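(* Let $\Gamma$ and $\Lambda$ be two basic finite dimensional algebras with one-dimensional simple modules over a field $k$. Then $\Gamma$ is a generalized arrow removal of $\Lambda$ if and only if $\Lambda$ occurs (up to isomorphism of $k$-algebras) as a split extension $\Gamma\ltimes_\theta M$ of $\Gamma$ by a removable multiplicative bimodule $(M,\theta)$.
   Context: A bound quiver algebra $kQ/I$ consists of a field $k$, a finite quiver $Q$ and an admissible ideal $I$ of $kQ$ (every path occurring in an element of $I$ has length at least $2$, and $I$ contains all paths of length $N$ for some $N>1$). For a set $A$ of arrows (possibly empty), $\langle A+I\rangle$ is the ideal of $kQ/I$ generated by the cosets of the arrows in $A$. Every $z\in kQ$ is uniquely $z=z_A+z_{\mathrm{not}A}$, where $z_A$ is a linear combination of paths passing through at least one arrow of $A$ and $z_{\mathrm{not}A}$ one of paths avoiding all arrows of $A$; $A$ is pre-removable if $z_A,z_{\mathrm{not}A}\in I$ for all $z\in I$. A pre-removable set $A$ is two-sided removable if $\langle A+I\rangle$ has finite projective dimension as a left and as a right $kQ/I$-module; only left removable if $\langle A+I\rangle^2=0$ and $\langle A+I\rangle$ has finite projective dimension as a right but not as a left module; removable if it is two-sided or only left removable. $\Gamma$ is a generalized arrow removal of $\Lambda$ if there are a bound quiver algebra $kQ_\Lambda/I_\Lambda\cong\Lambda$ and a removable set of arrows $A$ in it with $\Gamma\cong(kQ_\Lambda/I_\Lambda)/\langle A+I_\Lambda\rangle$. A multiplicative bimodule for $\Gamma$ is a pair $(M,\theta)$ with $M$ a non-zero $\Gamma$-bimodule ($k$ acting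 centrally, $\dim_kM<\infty$) and $\theta:M\otimes_\Gamma M\to M$ an associative $\Gamma$-bimodule homomorphism ($\theta(\theta\otimes1_M)=\theta(1_M\otimes\theta)$). The split extension $E=\Gamma\ltimes_\theta M$ is $\Gamma\oplus M$ with multiplication $(\gamma_1,m_1)(\gamma_2,m_2)=(\gamma_1\gamma_2,\gamma_1m_2+m_1\gamma_2+\theta(m_1\otimes m_2))$, and $\widetilde M=0\oplus M$ is an ideal of $E$. $(M,\theta)$ is nilpotent if $\theta^N=0$ for some $N\ge1$, where $\theta^0=\mathrm{id}_M$, $\theta^r=\theta\circ(\theta^{r-1}\otimes1_M)$ (equivalently, $\widetilde M$ is a nilpotent ideal of $E$). A nilpotent $(M,\theta)$ is two-sided removable if the projective dimensions $\mathrm{pd}\,\widetilde M_E$ (right) and $\mathrm{pd}\,{}_E\widetilde M$ (left) are both finite; only left removable if $\mathrm{pd}\,\widetilde M_E<\infty$, $\mathrm{pd}\,{}_E\widetilde M=\infty$ and $\theta=0$; removable if it is two-sided or only left removable.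
   Formalization: The zero module is taken to have projective dimension minus infinity, not counted as finite, so the empty set A is never removable; otherwise Γ = Λ with A empty would be a counterexample since M must be non-zero. Finite dimensional (bi)modules are taken up to isomorphism inside k^n. *)

theory Defs
  imports "HOL-Algebra.Algebra" "HOL-Library.Extended_Real" "Graph_Theory.Graph_Theory"
begin

section \<open>Finite dimensional algebras\<close>

text \<open>
  An associative unital algebra is carried by the record \<open>module\<close>, whose ring fields hold the
  multiplication of the algebra and whose field \<open>smult\<close> holds the action of the scalars.
\<close>

locale k_algebra = field K + module K A + A?: ring A
  for K :: "('k, 'x) ring_scheme" (structure) and A :: "('k, 'a, 'y) module_scheme" (structure) +
  assumes smult_mult_left:
      "\<lbrakk>c \<in> carrier K; x \<in> carrier A; y \<in> carrier A\<rbrakk>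
        \<Longrightarrow> (c \<odot>\<^bsub>A\<^esub> x) \<otimes>\<^bsub>A\<^esub> y = c \<odot>\<^bsub>A\<^esub> (x \<otimes>\<^bsub>A\<^esub> y)"
    and smult_mult_right:
      "\<lbrakk>c \<in> carrier K; x \<in> carrier A; y \<in> carrier A\<rbrakk>
        \<Longrightarrow> x \<otimes>\<^bsub>A\<^esub> (c \<odot>\<^bsub>A\<^esub> y) = c \<odot>\<^bsub>A\<^esub> (x \<otimes>\<^bsub>A\<^esub> y)"

definition fin_dim :: "('k, 'x) ring_scheme \<Rightarrow> ('k, 'v, 'y) module_scheme \<Rightarrow> bool" where
  "fin_dim K V \<longleftrightarrow> (\<exists>S \<subseteq> carrier V. finite S \<and>
     (\<forall>x \<in> carrier V. \<exists>c \<in> S \<rightarrow> carrier K. x = (\<Oplus>\<^bsub>V\<^esub>s\<in>S. c s \<odot>\<^bsub>V\<^esub> s)))"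

locale fin_dim_algebra = k_algebra +
  assumes fin_dim: "fin_dim K A"

definition alg_isomorphic ::
  "('k, 'x) ring_scheme \<Rightarrow> ('k, 'a, 'y) module_scheme \<Rightarrow> ('k, 'b, 'z) module_scheme \<Rightarrow> bool" where
  "alg_isomorphic K A B \<longleftrightarrow> (\<exists>h \<in> ring_iso A B.
     \<forall>c \<in> carrier K. \<forall>x \<in> carrier A. h (c \<odot>\<^bsub>A\<^esub> x) = c \<odot>\<^bsub>B\<^esub> h x)"

definition op_alg :: "('k, 'a, 'y) module_scheme \<Rightarrow> ('k, 'a, 'y) module_scheme" where
  "op_alg A = A\<lparr>monoid.mult := \<lambda>x y. y \<otimes>\<^bsub>A\<^esub> x\<rparr>"

definition quot_alg :: "('k, 'a, 'y) module_scheme \<Rightarrow> 'a set \<Rightarrow> ('k, 'a set) module" where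
  "quot_alg A I = \<lparr>carrier = carrier (A Quot I), monoid.mult = monoid.mult (A Quot I),
     one = one (A Quot I), ring.zero = ring.zero (A Quot I), add = add (A Quot I),
     smult = (\<lambda>c Z. \<Union>x\<in>Z. I +>\<^bsub>A\<^esub> (c \<odot>\<^bsub>A\<^esub> x))\<rparr>"


section \<open>Modules over noncommutative rings\<close>

text \<open>
  The library's locale \<open>module\<close> is restricted to commutative rings. The ring fields \<open>mult\<close> and
  \<open>one\<close> of a record that is used as a module carry no meaning. A right module over \<open>A\<close> is a left
  module over \<open>op_alg A\<close>.
\<close>

locale lmodule = R?: ring R + M?: abelian_group M
  for R :: "('r, 'x) ring_scheme" (structure) and M :: "('r, 'm, 'y) module_scheme" (structure) +
  assumes smult_closed: "\<lbrakk>a \<in> carrier R; x \<in> carrier M\<rbrakk> \<Longrightarrow> a \<odot>\<^bsub>M\<^esub> x \<in> carrier M"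
    and smult_l_distr: "\<lbrakk>a \<in> carrier R; b \<in> carrier R; x \<in> carrier M\<rbrakk>
          \<Longrightarrow> (a \<oplus>\<^bsub>R\<^esub> b) \<odot>\<^bsub>M\<^esub> x = a \<odot>\<^bsub>M\<^esub> x \<oplus>\<^bsub>M\<^esub> b \<odot>\<^bsub>M\<^esub> x"
    and smult_r_distr: "\<lbrakk>a \<in> carrier R; x \<in> carrier M; y \<in> carrier M\<rbrakk>
          \<Longrightarrow> a \<odot>\<^bsub>M\<^esub> (x \<oplus>\<^bsub>M\<^esub> y) = a \<odot>\<^bsub>M\<^esub> x \<oplus>\<^bsub>M\<^esub> a \<odot>\<^bsub>M\<^esub> y"
    and smult_assoc: "\<lbrakk>a \<in> carrier R; b \<in> carrier R; x \<in> carrier M\<rbrakk>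
          \<Longrightarrow> (a \<otimes>\<^bsub>R\<^esub> b) \<odot>\<^bsub>M\<^esub> x = a \<odot>\<^bsub>M\<^esub> (b \<odot>\<^bsub>M\<^esub> x)"
    and smult_one: "x \<in> carrier M \<Longrightarrow> \<one>\<^bsub>R\<^esub> \<odot>\<^bsub>M\<^esub> x = x"

definition lmod_hom :: "('r, 'x) ring_scheme \<Rightarrow> ('r, 'm, 'y) module_scheme
    \<Rightarrow> ('r, 'n, 'z) module_scheme \<Rightarrow> ('m \<Rightarrow> 'n) set" where
  "lmod_hom R M N = {f. f \<in> carrier M \<rightarrow> carrier N \<and>
     (\<forall>x \<in> carrier M. \<forall>y \<in> carrier M. f (x \<oplus>\<^bsub>M\<^esub> y) = f x \<oplus>\<^bsub>N\<^esub> f y) \<and>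
     (\<forall>r \<in> carrier R. \<forall>x \<in> carrier M. f (r \<odot>\<^bsub>M\<^esub> x) = r \<odot>\<^bsub>N\<^esub> f x)}"

definition lmod_isomorphic :: "('r, 'x) ring_scheme \<Rightarrow> ('r, 'm, 'y) module_scheme
    \<Rightarrow> ('r, 'n, 'z) module_scheme \<Rightarrow> bool" where
  "lmod_isomorphic R M N \<longleftrightarrow> (\<exists>f \<in> lmod_hom R M N. bij_betw f (carrier M) (carrier N))"

definition left_ideal_module :: "('r, 'x) ring_scheme \<Rightarrow> 'r set \<Rightarrow> ('r, 'r) module" where
  "left_ideal_module R J = \<lparr>carrier = J, monoid.mult = monoid.mult R, one = one R,
     ring.zero = ring.zero R, add = add R, smult = monoid.mult R\<rparr>"

definition k_space :: "('k, 'a, 'y) module_scheme \<Rightarrow> ('a, 'm, 'z) module_scheme \<Rightarrow> ('k, 'm) module"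
  where
  "k_space A M = \<lparr>carrier = carrier M, monoid.mult = monoid.mult M, one = one M,
     ring.zero = ring.zero M, add = add M,
     smult = (\<lambda>c m. (c \<odot>\<^bsub>A\<^esub> \<one>\<^bsub>A\<^esub>) \<odot>\<^bsub>M\<^esub> m)\<rparr>"

definition simple_module :: "('r, 'x) ring_scheme \<Rightarrow> ('r, 'm, 'y) module_scheme \<Rightarrow> bool" where
  "simple_module R S \<longleftrightarrow> lmodule R S \<and> carrier S \<noteq> {\<zero>\<^bsub>S\<^esub>} \<and>
     (\<forall>N. additive_subgroup N S \<and> (\<forall>r \<in> carrier R. \<forall>x \<in> N. r \<odot>\<^bsub>S\<^esub> x \<in> N)
        \<longrightarrow> N = {\<zero>\<^bsub>S\<^esub>} \<or> N = carrier S)"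

definition one_dim :: "('k, 'x) ring_scheme \<Rightarrow> ('k, 'v, 'y) module_scheme \<Rightarrow> bool" where
  "one_dim K V \<longleftrightarrow> (\<exists>s \<in> carrier V. s \<noteq> \<zero>\<^bsub>V\<^esub> \<and> (\<forall>x \<in> carrier V. \<exists>c \<in> carrier K. x = c \<odot>\<^bsub>V\<^esub> s))"

text \<open>
  Finite dimensional modules over a \<open>K\<close>-algebra are represented, up to isomorphism, on subsets of
  the type \<open>nat \<Rightarrow> 'k\<close>, which contains a copy of every \<open>K\<^sup>n\<close>. Every simple module over a finite
  dimensional algebra is finite dimensional, so the following quantifier reaches all of them.
\<close>

definition one_dim_simples :: "('k, 'x) ring_scheme \<Rightarrow> ('k, 'a, 'y) module_scheme \<Rightarrow> bool" where
  "one_dim_simples K A \<longleftrightarrow>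
     (\<forall>S :: ('a, nat \<Rightarrow> 'k) module. simple_module A S \<longrightarrow> one_dim K (k_space A S))"

definition idempotent :: "('r, 'x) ring_scheme \<Rightarrow> 'r \<Rightarrow> bool" where
  "idempotent R e \<longleftrightarrow> e \<in> carrier R \<and> e \<otimes>\<^bsub>R\<^esub> e = e"

definition primitive_idempotent :: "('r, 'x) ring_scheme \<Rightarrow> 'r \<Rightarrow> bool" where
  "primitive_idempotent R e \<longleftrightarrow> idempotent R e \<and> e \<noteq> \<zero>\<^bsub>R\<^esub> \<and>
     \<not> (\<exists>f g. idempotent R f \<and> idempotent R g \<and> f \<noteq> \<zero>\<^bsub>R\<^esub> \<and> g \<noteq> \<zero>\<^bsub>R\<^esub> \<and>
          f \<otimes>\<^bsub>R\<^esub> g = \<zero>\<^bsub>R\<^esub> \<and> g \<otimes>\<^bsub>R\<^esub> f = \<zero>\<^bsub>R\<^esub> \<and> e = f \<oplus>\<^bsub>R\<^esub> g)"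

text \<open>
  An algebra is basic if the indecomposable direct summands of its regular module are pairwise
  non-isomorphic.
\<close>

definition basic :: "('r, 'x) ring_scheme \<Rightarrow> bool" where
  "basic R \<longleftrightarrow> (\<exists>E. finite E \<and> (\<forall>e \<in> E. primitive_idempotent R e) \<and>
     (\<forall>e \<in> E. \<forall>f \<in> E. e \<noteq> f \<longrightarrow> e \<otimes>\<^bsub>R\<^esub> f = \<zero>\<^bsub>R\<^esub>) \<and> (\<Oplus>\<^bsub>R\<^esub>e\<in>E. e) = \<one>\<^bsub>R\<^esub> \<and>
     (\<forall>e \<in> E. \<forall>f \<in> E. e \<noteq> f \<longrightarrow>
        \<not> lmod_isomorphic R (left_ideal_module R {x \<otimes>\<^bsub>R\<^esub> e | x. x \<in> carrier R})
                           (left_ideal_module R {x \<otimes>\<^bsub>R\<^esub> f | x. x \<in> carrier R})))"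


section \<open>Projective dimension\<close>

definition free_module :: "('r, 'x) ring_scheme \<Rightarrow> 'i set \<Rightarrow> ('r, 'i \<Rightarrow> 'r) module" where
  "free_module R Z = \<lparr>carrier = {f. (\<forall>i \<in> Z. f i \<in> carrier R) \<and> (\<forall>i. i \<notin> Z \<longrightarrow> f i = \<zero>\<^bsub>R\<^esub>) \<and>
                                   finite {i. f i \<noteq> \<zero>\<^bsub>R\<^esub>}},
     monoid.mult = undefined, one = undefined, ring.zero = (\<lambda>i. \<zero>\<^bsub>R\<^esub>),
     add = (\<lambda>f g i. f i \<oplus>\<^bsub>R\<^esub> g i),
     smult = (\<lambda>r f i. r \<otimes>\<^bsub>R\<^esub> f i)\<rparr>"

text \<open>
  Projective means: direct summand of a free module. It is no restriction to take the basis of the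
  free module inside the type of elements of \<open>P\<close>, as \<open>P\<close> is the image of the free module on its
  own carrier.
\<close>

definition projective :: "('r, 'x) ring_scheme \<Rightarrow> ('r, 'p, 'y) module_scheme \<Rightarrow> bool" where
  "projective R P \<longleftrightarrow> lmodule R P \<and> (\<exists>(Z :: 'p set) i p. i \<in> lmod_hom R P (free_module R Z) \<and>
     p \<in> lmod_hom R (free_module R Z) P \<and> (\<forall>x \<in> carrier P. p (i x) = x))"

definition projective_resolution :: "('r, 'x) ring_scheme \<Rightarrow> ('r, 'm, 'y) module_scheme
    \<Rightarrow> (nat \<Rightarrow> ('r, 'p) module) \<Rightarrow> (nat \<Rightarrow> 'p \<Rightarrow> 'p) \<Rightarrow> ('p \<Rightarrow> 'm) \<Rightarrow> bool" where
  "projective_resolution R M P d \<epsilon> \<longleftrightarrow>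
     (\<forall>i. projective R (P i)) \<and>
     (\<forall>i. d i \<in> lmod_hom R (P (Suc i)) (P i)) \<and> \<epsilon> \<in> lmod_hom R (P 0) M \<and>
     \<epsilon> ` carrier (P 0) = carrier M \<and>
     d 0 ` carrier (P 1) = {x \<in> carrier (P 0). \<epsilon> x = \<zero>\<^bsub>M\<^esub>} \<and>
     (\<forall>i. d (Suc i) ` carrier (P (Suc (Suc i))) = {x \<in> carrier (P (Suc i)). d i x = \<zero>\<^bsub>P i\<^esub>})"

text \<open>
  Projective dimension of a finite dimensional module over a finite dimensional algebra: the
  infimum of the lengths of its projective resolutions. Such a module has a projective resolution
  of minimal length by finite dimensional modules, and these live in the type \<open>nat \<Rightarrow> 'k\<close>. The
  length \<open>n\<close> ranges over the integers, so that the zero module, and no other one, has projective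
  dimension \<open>-\<infinity>\<close>; in particular its projective dimension does not count as finite.
\<close>

definition proj_dim :: "('k, 'a, 'y) module_scheme \<Rightarrow> ('a, 'm, 'z) module_scheme \<Rightarrow> ereal" where
  "proj_dim A M = Inf {ereal (of_int n) | n :: int.
     \<exists>(P :: nat \<Rightarrow> ('a, nat \<Rightarrow> 'k) module) d \<epsilon>. projective_resolution A M P d \<epsilon> \<and>
       (\<forall>i. n < int i \<longrightarrow> carrier (P i) = {\<zero>\<^bsub>P i\<^esub>})}"

definition left_pd :: "('k, 'a, 'y) module_scheme \<Rightarrow> 'a set \<Rightarrow> ereal" where
  "left_pd A J = proj_dim A (left_ideal_module A J)"

definition right_pd :: "('k, 'a, 'y) module_scheme \<Rightarrow> 'a set \<Rightarrow> ereal" where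
  "right_pd A J = proj_dim (op_alg A) (left_ideal_module (op_alg A) J)"

abbreviation pd_finite :: "ereal \<Rightarrow> bool" where
  "pd_finite x \<equiv> \<bar>x\<bar> \<noteq> \<infinity>"


section \<open>Bound quiver algebras and generalized arrow removal\<close>

text \<open>
  A path is a pair of its start vertex and its list of arrows; the path at \<open>u\<close> with the empty list
  is the trivial path at \<open>u\<close>. The product of two paths is the first one followed by the second one.
  (The opposite convention amounts to replacing the quiver by the opposite quiver.)
\<close>

definition paths :: "('v, 'e) pre_digraph \<Rightarrow> ('v \<times> 'e list) set" where
  "paths Q = {(u, p). \<exists>v. pre_digraph.awalk Q u p v}"

definition path_algebra ::
  "('k, 'x) ring_scheme \<Rightarrow> ('v, 'e) pre_digraph \<Rightarrow> ('k, 'v \<times> 'e list \<Rightarrow> 'k) module" where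
  "path_algebra K Q = \<lparr>
     carrier = {z. (\<forall>w. z w \<in> carrier K) \<and> (\<forall>w. w \<notin> paths Q \<longrightarrow> z w = \<zero>\<^bsub>K\<^esub>) \<and>
                   finite {w. z w \<noteq> \<zero>\<^bsub>K\<^esub>}},
     monoid.mult = (\<lambda>y z (u, p). \<Oplus>\<^bsub>K\<^esub>i\<in>{..length p}.
               y (u, take i p) \<otimes>\<^bsub>K\<^esub> z (last (pre_digraph.awalk_verts Q u (take i p)), drop i p)),
     one = (\<lambda>(u, p). if u \<in> verts Q \<and> p = [] then \<one>\<^bsub>K\<^esub> else \<zero>\<^bsub>K\<^esub>),
     ring.zero = (\<lambda>w. \<zero>\<^bsub>K\<^esub>),
     add = (\<lambda>y z w. y w \<oplus>\<^bsub>K\<^esub> z w),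
     smult = (\<lambda>c z w. c \<otimes>\<^bsub>K\<^esub> z w)\<rparr>"

definition path_elem :: "('k, 'x) ring_scheme \<Rightarrow> 'v \<times> 'e list \<Rightarrow> ('v \<times> 'e list \<Rightarrow> 'k)" where
  "path_elem K w = (\<lambda>w'. if w' = w then \<one>\<^bsub>K\<^esub> else \<zero>\<^bsub>K\<^esub>)"

definition admissible ::
  "('k, 'x) ring_scheme \<Rightarrow> ('v, 'e) pre_digraph \<Rightarrow> ('v \<times> 'e list \<Rightarrow> 'k) set \<Rightarrow> bool" where
  "admissible K Q I \<longleftrightarrow> ideal I (path_algebra K Q) \<and>
     (\<forall>z \<in> I. \<forall>w. z w \<noteq> \<zero>\<^bsub>K\<^esub> \<longrightarrow> 2 \<le> length (snd w)) \<and>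
     (\<exists>N>1. \<forall>w \<in> paths Q. length (snd w) = N \<longrightarrow> path_elem K w \<in> I)"

definition bound_quiver ::
  "('k, 'x) ring_scheme \<Rightarrow> ('v, 'e) pre_digraph \<Rightarrow> ('v \<times> 'e list \<Rightarrow> 'k) set \<Rightarrow> bool" where
  "bound_quiver K Q I \<longleftrightarrow> field K \<and> fin_digraph Q \<and> admissible K Q I"

abbreviation bq_algebra :: "('k, 'x) ring_scheme \<Rightarrow> ('v, 'e) pre_digraph
    \<Rightarrow> ('v \<times> 'e list \<Rightarrow> 'k) set \<Rightarrow> ('k, ('v \<times> 'e list \<Rightarrow> 'k) set) module" where
  "bq_algebra K Q I \<equiv> quot_alg (path_algebra K Q) I"

definition arrow_ideal :: "('k, 'x) ring_scheme \<Rightarrow> ('v, 'e) pre_digraph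
    \<Rightarrow> ('v \<times> 'e list \<Rightarrow> 'k) set \<Rightarrow> 'e set \<Rightarrow> ('v \<times> 'e list \<Rightarrow> 'k) set set" where
  "arrow_ideal K Q I A = Idl\<^bsub>bq_algebra K Q I\<^esub>
     ((\<lambda>a. I +>\<^bsub>path_algebra K Q\<^esub> path_elem K (tail Q a, [a])) ` A)"

definition part_through :: "('k, 'x) ring_scheme \<Rightarrow> 'e set \<Rightarrow> ('v \<times> 'e list \<Rightarrow> 'k)
    \<Rightarrow> ('v \<times> 'e list \<Rightarrow> 'k)" where
  "part_through K A z = (\<lambda>w. if set (snd w) \<inter> A \<noteq> {} then z w else \<zero>\<^bsub>K\<^esub>)"

definition part_avoiding :: "('k, 'x) ring_scheme \<Rightarrow> 'e set \<Rightarrow> ('v \<times> 'e list \<Rightarrow> 'k)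
    \<Rightarrow> ('v \<times> 'e list \<Rightarrow> 'k)" where
  "part_avoiding K A z = (\<lambda>w. if set (snd w) \<inter> A = {} then z w else \<zero>\<^bsub>K\<^esub>)"

definition pre_removable :: "('k, 'x) ring_scheme \<Rightarrow> ('v, 'e) pre_digraph
    \<Rightarrow> ('v \<times> 'e list \<Rightarrow> 'k) set \<Rightarrow> 'e set \<Rightarrow> bool" where
  "pre_removable K Q I A \<longleftrightarrow> A \<subseteq> arcs Q \<and>
     (\<forall>z \<in> I. part_through K A z \<in> I \<and> part_avoiding K A z \<in> I)"

definition two_sided_removable_arrows :: "('k, 'x) ring_scheme \<Rightarrow> ('v, 'e) pre_digraph
    \<Rightarrow> ('v \<times> 'e list \<Rightarrow> 'k) set \<Rightarrow> 'e set \<Rightarrow> bool" where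
  "two_sided_removable_arrows K Q I A \<longleftrightarrow> pre_removable K Q I A \<and>
     pd_finite (left_pd (bq_algebra K Q I) (arrow_ideal K Q I A)) \<and>
     pd_finite (right_pd (bq_algebra K Q I) (arrow_ideal K Q I A))"

definition only_left_removable_arrows :: "('k, 'x) ring_scheme \<Rightarrow> ('v, 'e) pre_digraph
    \<Rightarrow> ('v \<times> 'e list \<Rightarrow> 'k) set \<Rightarrow> 'e set \<Rightarrow> bool" where
  "only_left_removable_arrows K Q I A \<longleftrightarrow> pre_removable K Q I A \<and>
     arrow_ideal K Q I A \<cdot>\<^bsub>bq_algebra K Q I\<^esub> arrow_ideal K Q I A = {\<zero>\<^bsub>bq_algebra K Q I\<^esub>} \<and>
     pd_finite (right_pd (bq_algebra K Q I) (arrow_ideal K Q I A)) \<and>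
     \<not> pd_finite (left_pd (bq_algebra K Q I) (arrow_ideal K Q I A))"

definition removable_arrows :: "('k, 'x) ring_scheme \<Rightarrow> ('v, 'e) pre_digraph
    \<Rightarrow> ('v \<times> 'e list \<Rightarrow> 'k) set \<Rightarrow> 'e set \<Rightarrow> bool" where
  "removable_arrows K Q I A \<longleftrightarrow>
     two_sided_removable_arrows K Q I A \<or> only_left_removable_arrows K Q I A"

text \<open>
  \<open>G\<close> is a generalized arrow removal of \<open>L\<close>. Every finite quiver is isomorphic to one whose
  vertices and arrows are natural numbers.
\<close>

definition generalized_arrow_removal :: "('k, 'x) ring_scheme \<Rightarrow> ('k, 'a, 'y) module_scheme
    \<Rightarrow> ('k, 'b, 'z) module_scheme \<Rightarrow> bool" where
  "generalized_arrow_removal K G L \<longleftrightarrow>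
     (\<exists>(Q :: (nat, nat) pre_digraph) I A. bound_quiver K Q I \<and>
        alg_isomorphic K (bq_algebra K Q I) L \<and> removable_arrows K Q I A \<and>
        alg_isomorphic K G (quot_alg (bq_algebra K Q I) (arrow_ideal K Q I A)))"


section \<open>Bimodules and tensor products\<close>

record ('r, 'm) bimodule = "('r, 'm) module" +
  rsmult :: "['m, 'r] \<Rightarrow> 'm"  (infixl \<open>\<triangleleft>\<index>\<close> 70)

definition right_module :: "('r, 'm, 'y) bimodule_scheme \<Rightarrow> ('r, 'm) module" where
  "right_module M = \<lparr>carrier = carrier M, monoid.mult = monoid.mult M, one = one M,
     ring.zero = ring.zero M, add = add M,
     smult = (\<lambda>r m. m \<triangleleft>\<^bsub>M\<^esub> r)\<rparr>"

locale algebra_bimodule = k_algebra K A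
  for K :: "('k, 'x) ring_scheme" (structure) and A :: "('k, 'a, 'y) module_scheme" (structure)
    and M :: "('a, 'm, 'z) bimodule_scheme" (structure) +
  assumes left_module: "lmodule A M"
    and right_module: "lmodule (op_alg A) (right_module M)"
    and actions_commute: "\<lbrakk>a \<in> carrier A; b \<in> carrier A; m \<in> carrier M\<rbrakk>
          \<Longrightarrow> (a \<odot>\<^bsub>M\<^esub> m) \<triangleleft>\<^bsub>M\<^esub> b = a \<odot>\<^bsub>M\<^esub> (m \<triangleleft>\<^bsub>M\<^esub> b)"
    and central: "\<lbrakk>c \<in> carrier K; m \<in> carrier M\<rbrakk>
          \<Longrightarrow> (c \<odot>\<^bsub>A\<^esub> \<one>\<^bsub>A\<^esub>) \<odot>\<^bsub>M\<^esub> m = m \<triangleleft>\<^bsub>M\<^esub> (c \<odot>\<^bsub>A\<^esub> \<one>\<^bsub>A\<^esub>)"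

definition bimodule_hom :: "('r, 'x) ring_scheme \<Rightarrow> ('r, 'm, 'y) bimodule_scheme
    \<Rightarrow> ('r, 'n, 'z) bimodule_scheme \<Rightarrow> ('m \<Rightarrow> 'n) set" where
  "bimodule_hom R M N = {f \<in> lmod_hom R M N.
     \<forall>x \<in> carrier M. \<forall>r \<in> carrier R. f (x \<triangleleft>\<^bsub>M\<^esub> r) = f x \<triangleleft>\<^bsub>N\<^esub> r}"

text \<open>
  The tensor product over \<open>R\<close> of \<open>M\<close> and \<open>N\<close> is the quotient of the free abelian group on
  the pairs \<open>(m, n)\<close> by the subgroup generated by the elements expressing biadditivity and
  \<open>R\<close>-balancedness.
\<close>

definition tensor_relations :: "('r, 'x) ring_scheme \<Rightarrow> ('r, 'm, 'y) bimodule_scheme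
    \<Rightarrow> ('r, 'n, 'z) bimodule_scheme \<Rightarrow> ('m \<times> 'n \<Rightarrow>\<^sub>0 int) set" where
  "tensor_relations R M N =
     {frag_of (m \<oplus>\<^bsub>M\<^esub> m', n) - frag_of (m, n) - frag_of (m', n) | m m' n.
        m \<in> carrier M \<and> m' \<in> carrier M \<and> n \<in> carrier N} \<union>
     {frag_of (m, n \<oplus>\<^bsub>N\<^esub> n') - frag_of (m, n) - frag_of (m, n') | m n n'.
        m \<in> carrier M \<and> n \<in> carrier N \<and> n' \<in> carrier N} \<union>
     {frag_of (m \<triangleleft>\<^bsub>M\<^esub> r, n) - frag_of (m, r \<odot>\<^bsub>N\<^esub> n) | m r n.
        m \<in> carrier M \<and> r \<in> carrier R \<and> n \<in> carrier N}"

definition tensor_kernel :: "('r, 'x) ring_scheme \<Rightarrow> ('r, 'm, 'y) bimodule_scheme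
    \<Rightarrow> ('r, 'n, 'z) bimodule_scheme \<Rightarrow> ('m \<times> 'n \<Rightarrow>\<^sub>0 int) set" where
  "tensor_kernel R M N =
     generate (free_Abelian_group (carrier M \<times> carrier N)) (tensor_relations R M N)"

definition tensor_class :: "('r, 'x) ring_scheme \<Rightarrow> ('r, 'm, 'y) bimodule_scheme
    \<Rightarrow> ('r, 'n, 'z) bimodule_scheme \<Rightarrow> ('m \<times> 'n \<Rightarrow>\<^sub>0 int) \<Rightarrow> ('m \<times> 'n \<Rightarrow>\<^sub>0 int) set" where
  "tensor_class R M N x =
     tensor_kernel R M N #>\<^bsub>free_Abelian_group (carrier M \<times> carrier N)\<^esub> x"

definition tensor_elem :: "('r, 'x) ring_scheme \<Rightarrow> ('r, 'm, 'y) bimodule_scheme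
    \<Rightarrow> ('r, 'n, 'z) bimodule_scheme \<Rightarrow> 'm \<Rightarrow> 'n \<Rightarrow> ('m \<times> 'n \<Rightarrow>\<^sub>0 int) set" where
  "tensor_elem R M N m n = tensor_class R M N (frag_of (m, n))"

definition tensor_product :: "('r, 'x) ring_scheme \<Rightarrow> ('r, 'm, 'y) bimodule_scheme
    \<Rightarrow> ('r, 'n, 'z) bimodule_scheme \<Rightarrow> ('r, ('m \<times> 'n \<Rightarrow>\<^sub>0 int) set) bimodule" where
  "tensor_product R M N =
     (let T = free_Abelian_group (carrier M \<times> carrier N) Mod tensor_kernel R M N in
      \<lparr>carrier = carrier T, monoid.mult = undefined, one = undefined,
       ring.zero = one T, add = monoid.mult T,
       smult = (\<lambda>r Z. \<Union>x\<in>Z. tensor_class R M N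
                  (frag_extend (\<lambda>(m, n). frag_of (r \<odot>\<^bsub>M\<^esub> m, n)) x)),
       rsmult = (\<lambda>Z r. \<Union>x\<in>Z. tensor_class R M N
                  (frag_extend (\<lambda>(m, n). frag_of (m, n \<triangleleft>\<^bsub>N\<^esub> r)) x))\<rparr>)"


section \<open>Split extensions by multiplicative bimodules\<close>

text \<open>
  Associativity is expressed on the elementary tensors, which generate the triple tensor product.
\<close>

locale multiplicative_bimodule = algebra_bimodule K A M
  for K :: "('k, 'x) ring_scheme" (structure) and A :: "('k, 'a, 'y) module_scheme" (structure)
    and M :: "('a, 'm, 'z) bimodule_scheme" (structure) +
  fixes \<theta> :: "('m \<times> 'm \<Rightarrow>\<^sub>0 int) set \<Rightarrow> 'm"
  assumes nonzero: "carrier M \<noteq> {\<zero>\<^bsub>M\<^esub>}"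
    and fin_dim_M: "fin_dim K (k_space A M)"
    and theta_hom: "\<theta> \<in> bimodule_hom A (tensor_product A M M) M"
    and theta_assoc: "\<lbrakk>a \<in> carrier M; b \<in> carrier M; c \<in> carrier M\<rbrakk>
      \<Longrightarrow> \<theta> (tensor_elem A M M (\<theta> (tensor_elem A M M a b)) c)
          = \<theta> (tensor_elem A M M a (\<theta> (tensor_elem A M M b c)))"

text \<open>
  \<open>theta_power A M \<theta> r m\<close> is the value of the map \<open>\<theta>\<^sup>r\<close> on the elementary tensor of
  \<open>m 0, \<dots>, m r\<close>. These elementary tensors generate the \<open>(r+1)\<close>-fold tensor power of \<open>M\<close>, so
  that \<open>\<theta>\<^sup>r = 0\<close> means that all the values are zero.
\<close>

primrec theta_power :: "('r, 'x) ring_scheme \<Rightarrow> ('r, 'm, 'y) bimodule_scheme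
    \<Rightarrow> (('m \<times> 'm \<Rightarrow>\<^sub>0 int) set \<Rightarrow> 'm) \<Rightarrow> nat \<Rightarrow> (nat \<Rightarrow> 'm) \<Rightarrow> 'm" where
  "theta_power A M \<theta> 0 m = m 0"
| "theta_power A M \<theta> (Suc r) m = \<theta> (tensor_elem A M M (theta_power A M \<theta> r m) (m (Suc r)))"

definition nilpotent_theta :: "('r, 'x) ring_scheme \<Rightarrow> ('r, 'm, 'y) bimodule_scheme
    \<Rightarrow> (('m \<times> 'm \<Rightarrow>\<^sub>0 int) set \<Rightarrow> 'm) \<Rightarrow> bool" where
  "nilpotent_theta A M \<theta> \<longleftrightarrow> (\<exists>N\<ge>1. \<forall>m. (\<forall>i\<le>N. m i \<in> carrier M) \<longrightarrow>
     theta_power A M \<theta> N m = \<zero>\<^bsub>M\<^esub>)"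

definition split_extension :: "('k, 'a, 'y) module_scheme \<Rightarrow> ('a, 'm, 'z) bimodule_scheme
    \<Rightarrow> (('m \<times> 'm \<Rightarrow>\<^sub>0 int) set \<Rightarrow> 'm) \<Rightarrow> ('k, 'a \<times> 'm) module" where
  "split_extension A M \<theta> = \<lparr>
     carrier = carrier A \<times> carrier M,
     monoid.mult = (\<lambda>(a, m) (b, n). (a \<otimes>\<^bsub>A\<^esub> b,
               a \<odot>\<^bsub>M\<^esub> n \<oplus>\<^bsub>M\<^esub> m \<triangleleft>\<^bsub>M\<^esub> b \<oplus>\<^bsub>M\<^esub> \<theta> (tensor_elem A M M m n))),
     one = (\<one>\<^bsub>A\<^esub>, \<zero>\<^bsub>M\<^esub>),
     ring.zero = (\<zero>\<^bsub>A\<^esub>, \<zero>\<^bsub>M\<^esub>),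
     add = (\<lambda>(a, m) (b, n). (a \<oplus>\<^bsub>A\<^esub> b, m \<oplus>\<^bsub>M\<^esub> n)),
     smult = (\<lambda>c (a, m). (c \<odot>\<^bsub>A\<^esub> a, (c \<odot>\<^bsub>A\<^esub> \<one>\<^bsub>A\<^esub>) \<odot>\<^bsub>M\<^esub> m))\<rparr>"

definition extension_ideal :: "('k, 'a, 'y) module_scheme \<Rightarrow> ('a, 'm, 'z) bimodule_scheme
    \<Rightarrow> ('a \<times> 'm) set" where
  "extension_ideal A M = {\<zero>\<^bsub>A\<^esub>} \<times> carrier M"

definition two_sided_removable_bimodule :: "('k, 'x) ring_scheme \<Rightarrow> ('k, 'a, 'y) module_scheme
    \<Rightarrow> ('a, 'm, 'z) bimodule_scheme \<Rightarrow> (('m \<times> 'm \<Rightarrow>\<^sub>0 int) set \<Rightarrow> 'm) \<Rightarrow> bool" where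
  "two_sided_removable_bimodule K A M \<theta> \<longleftrightarrow>
     multiplicative_bimodule K A M \<theta> \<and> nilpotent_theta A M \<theta> \<and>
     pd_finite (right_pd (split_extension A M \<theta>) (extension_ideal A M)) \<and>
     pd_finite (left_pd (split_extension A M \<theta>) (extension_ideal A M))"

definition only_left_removable_bimodule :: "('k, 'x) ring_scheme \<Rightarrow> ('k, 'a, 'y) module_scheme
    \<Rightarrow> ('a, 'm, 'z) bimodule_scheme \<Rightarrow> (('m \<times> 'm \<Rightarrow>\<^sub>0 int) set \<Rightarrow> 'm) \<Rightarrow> bool" where
  "only_left_removable_bimodule K A M \<theta> \<longleftrightarrow>
     multiplicative_bimodule K A M \<theta> \<and> nilpotent_theta A M \<theta> \<and>
     pd_finite (right_pd (split_extension A M \<theta>) (extension_ideal A M)) \<and>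
     left_pd (split_extension A M \<theta>) (extension_ideal A M) = \<infinity> \<and>
     (\<forall>t \<in> carrier (tensor_product A M M). \<theta> t = \<zero>\<^bsub>M\<^esub>)"

definition removable_bimodule :: "('k, 'x) ring_scheme \<Rightarrow> ('k, 'a, 'y) module_scheme
    \<Rightarrow> ('a, 'm, 'z) bimodule_scheme \<Rightarrow> (('m \<times> 'm \<Rightarrow>\<^sub>0 int) set \<Rightarrow> 'm) \<Rightarrow> bool" where
  "removable_bimodule K A M \<theta> \<longleftrightarrow>
     two_sided_removable_bimodule K A M \<theta> \<or> only_left_removable_bimodule K A M \<theta>"

text \<open>
  Every finite dimensional bimodule over a \<open>K\<close>-algebra is isomorphic to one with carrier in the
  type \<open>nat \<Rightarrow> 'k\<close>, so an existential statement about such bimodules may be restricted to this type.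
\<close>

end

(*
  Both conditions say that the algebra is a direct sum of a subalgebra isomorphic to \<Gamma> and a
  nilpotent ideal N that has the required projective dimensions and, in the one-sided case, square
  zero. Finite projective dimension forces N to be non-zero, as the zero module has projective
  dimension minus infinity. Given a pre-removable set A of arrows, the residue classes of
  combinations of paths avoiding A form such a subalgebra, with N = <A + I>, and N becomes the
  bimodule M.

  Conversely, let \<Lambda> = \<sigma>(\<Gamma>) + N be such a decomposition. One-dimensional simple modules and
  basicness provide orthogonal primitive idempotents in \<Gamma>, one for each character, which remain
  complete in \<Lambda> because N is nilpotent. Gabriel's theorem is then applied with arrows adapted
  to the decomposition: modulo the square of the radical, choose a basis of the radical that is
  represented partly by elements of \<sigma>(\<Gamma>) and partly by elements of N. The latter arrows form A;
  evaluation of paths maps the paths through A into N and the others into \<sigma>(\<Gamma>), so the kernel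
  is compatible with the splitting of kQ, and <A + I> corresponds to N.
*)

theory Submission
  imports Defs
begin

section \<open>Subspaces of finite dimensional algebras\<close>

text \<open>The middle term of the equivalence is a statement about \<Lambda> alone,
  \<open>nilpotent_splitting\<close> with \<open>removable_ideal\<close>; it involves neither
  quivers nor tensor products and moves along algebra isomorphisms. Three obstacles shape the rest.
  Simple modules and resolutions are quantified over the type \<open>nat \<Rightarrow> 'k\<close>,
  so quotients A/L and the ideal N are encoded there by coordinate vectors, while resolutions pass
  between isomorphic rings with unchanged underlying sets. Dimension enters only through a bounded
  function \<open>sdim\<close>, strictly monotone on subspaces; its extrema give maximal left
  ideals, stable powers, Fitting idempotents and finite generating sets. Finally, arrows must be
  homogeneous both for the Peirce decomposition and for \<Lambda> = \<sigma>(\<Gamma>) + N. This is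
  possible because the idempotents lie in \<sigma>(\<Gamma>), so multiplying by them preserves both
  summands. Homogeneous generators of least cardinality are then independent modulo the square of
  the radical, which keeps combinations of arrows out of the kernel.\<close>

context k_algebra
begin

lemmas K_simprules = cring.cring_simprules[OF is_cring]

lemmas K_m_assoc = monoid.m_assoc[OF ring.axioms(2)[OF cring.axioms(1)[OF is_cring]]]

lemmas K_abelian_monoid =
  abelian_group.axioms(1)[OF ring.axioms(1)[OF cring.axioms(1)[OF is_cring]]]
lemmas K_finsum_cong = abelian_monoid.finsum_cong'[OF K_abelian_monoid]
  and K_finsum_singleton = abelian_monoid.finsum_singleton[OF K_abelian_monoid]

definition subspace :: "'a set \<Rightarrow> bool" where
  "subspace U \<longleftrightarrow> U \<subseteq> carrier A \<and> \<zero>\<^bsub>A\<^esub> \<in> U \<and> (\<forall>x\<in>U. \<forall>y\<in>U. x \<oplus>\<^bsub>A\<^esub> y \<in> U) \<and>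
     (\<forall>c\<in>carrier K. \<forall>x\<in>U. c \<odot>\<^bsub>A\<^esub> x \<in> U)"

lemma subspaceI:
  assumes "U \<subseteq> carrier A" "\<zero>\<^bsub>A\<^esub> \<in> U" "\<And>x y. x \<in> U \<Longrightarrow> y \<in> U \<Longrightarrow> x \<oplus>\<^bsub>A\<^esub> y \<in> U"
    "\<And>c x. c \<in> carrier K \<Longrightarrow> x \<in> U \<Longrightarrow> c \<odot>\<^bsub>A\<^esub> x \<in> U"
  shows "subspace U"
  using assms by (simp add: subspace_def)

lemma subspace_carr: "subspace U \<Longrightarrow> x \<in> U \<Longrightarrow> x \<in> carrier A"
  and subspace_zero: "subspace U \<Longrightarrow> \<zero>\<^bsub>A\<^esub> \<in> U"
  and subspace_add: "subspace U \<Longrightarrow> x \<in> U \<Longrightarrow> y \<in> U \<Longrightarrow> x \<oplus>\<^bsub>A\<^esub> y \<in> U"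
  and subspace_smult: "subspace U \<Longrightarrow> c \<in> carrier K \<Longrightarrow> x \<in> U \<Longrightarrow> c \<odot>\<^bsub>A\<^esub> x \<in> U"
  by (auto simp: subspace_def)

lemma smult_neg_one: "x \<in> carrier A \<Longrightarrow> (\<ominus> \<one>) \<odot>\<^bsub>A\<^esub> x = \<ominus>\<^bsub>A\<^esub> x"
  using smult_l_minus[of \<one> x] by simp

lemma subspace_neg: "subspace U \<Longrightarrow> x \<in> U \<Longrightarrow> \<ominus>\<^bsub>A\<^esub> x \<in> U"
  using subspace_smult[of U "\<ominus> \<one>" x] subspace_carr[of U x] smult_neg_one by auto

lemma subspace_minus: "subspace U \<Longrightarrow> x \<in> U \<Longrightarrow> y \<in> U \<Longrightarrow> x \<ominus>\<^bsub>A\<^esub> y \<in> U"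
  unfolding a_minus_def by (intro subspace_add subspace_neg)

lemma subspace_carrier: "subspace (carrier A)"
  by (rule subspaceI) auto

lemma subspace_Int: "subspace U \<Longrightarrow> subspace V \<Longrightarrow> subspace (U \<inter> V)"
  unfolding subspace_def by auto

lemma subspace_finsum:
  assumes "subspace U" "finite S" "\<And>s. s \<in> S \<Longrightarrow> f s \<in> U"
  shows "(\<Oplus>\<^bsub>A\<^esub>s\<in>S. f s) \<in> U"
  using assms(2,3)
proof (induction S rule: finite_induct)
  case empty
  then show ?case using assms(1) by (simp add: subspace_zero)
next
  case (insert s S)
  have "f \<in> S \<rightarrow> carrier A" "f s \<in> carrier A" using insert assms(1) subspace_carr by auto
  then show ?case using insert assms(1) by (simp add: subspace_add)
qed

lemma scalar_mult_eq:
  assumes "c \<in> carrier K" "x \<in> carrier A"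
  shows "(c \<odot>\<^bsub>A\<^esub> \<one>\<^bsub>A\<^esub>) \<otimes>\<^bsub>A\<^esub> x = c \<odot>\<^bsub>A\<^esub> x" "x \<otimes>\<^bsub>A\<^esub> (c \<odot>\<^bsub>A\<^esub> \<one>\<^bsub>A\<^esub>) = c \<odot>\<^bsub>A\<^esub> x"
  using assms by (simp_all add: smult_mult_left smult_mult_right)

text \<open>A scalar c acts as left multiplication by c times the unit, so closure under the algebra
  already gives closure under scalars.\<close>

lemma left_ideal_subspace:
  assumes "U \<subseteq> carrier A" "\<zero>\<^bsub>A\<^esub> \<in> U" "\<And>x y. x \<in> U \<Longrightarrow> y \<in> U \<Longrightarrow> x \<oplus>\<^bsub>A\<^esub> y \<in> U"
    "\<And>a x. a \<in> carrier A \<Longrightarrow> x \<in> U \<Longrightarrow> a \<otimes>\<^bsub>A\<^esub> x \<in> U"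
  shows "subspace U"
proof (rule subspaceI)
  fix c x assume "c \<in> carrier K" "x \<in> U"
  then show "c \<odot>\<^bsub>A\<^esub> x \<in> U"
    using assms(1) assms(4)[of "c \<odot>\<^bsub>A\<^esub> \<one>\<^bsub>A\<^esub>" x] scalar_mult_eq(1)[of c x] by auto
qed (use assms in auto)

lemma ideal_subspace: "ideal N A \<Longrightarrow> subspace N"
  by (rule left_ideal_subspace)
     (auto simp: ideal.Icarr ideal.I_l_closed additive_subgroup.zero_closed
       additive_subgroup.a_closed ideal.axioms(1))

section \<open>A measure on subspaces in place of the dimension\<close>

primrec list_span :: "'a list \<Rightarrow> 'a set" where
  "list_span [] = {\<zero>\<^bsub>A\<^esub>}"
| "list_span (s # ss) = {c \<odot>\<^bsub>A\<^esub> s \<oplus>\<^bsub>A\<^esub> v | c v. c \<in> carrier K \<and> v \<in> list_span ss}"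

lemma smult_add_regroup:
  assumes "c \<in> carrier K" "d \<in> carrier K" "s \<in> carrier A" "v \<in> carrier A" "w \<in> carrier A"
  shows "(c \<odot>\<^bsub>A\<^esub> s \<oplus>\<^bsub>A\<^esub> v) \<oplus>\<^bsub>A\<^esub> (d \<odot>\<^bsub>A\<^esub> s \<oplus>\<^bsub>A\<^esub> w) = (c \<oplus> d) \<odot>\<^bsub>A\<^esub> s \<oplus>\<^bsub>A\<^esub> (v \<oplus>\<^bsub>A\<^esub> w)"
  using assms by (simp add: smult_l_distr M.a_ac)

lemma subspace_list_span: "set ss \<subseteq> carrier A \<Longrightarrow> subspace (list_span ss)"
proof (induction ss)
  case Nil
  show ?case by (rule subspaceI) (auto simp: smult_r_null)
next
  case (Cons s ss)
  then have V: "subspace (list_span ss)" and s: "s \<in> carrier A" by auto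
  note Vc = subspace_carr[OF V]
  show ?case
  proof (rule subspaceI)
    show "list_span (s # ss) \<subseteq> carrier A" using s Vc by auto
    show "\<zero>\<^bsub>A\<^esub> \<in> list_span (s # ss)"
      using s subspace_zero[OF V] by (auto intro!: exI[of _ \<zero>] exI[of _ "\<zero>\<^bsub>A\<^esub>"] simp: smult_l_null)
  next
    fix x y assume "x \<in> list_span (s # ss)" "y \<in> list_span (s # ss)"
    then obtain c v d w where *: "c \<in> carrier K" "v \<in> list_span ss" "x = c \<odot>\<^bsub>A\<^esub> s \<oplus>\<^bsub>A\<^esub> v"
      "d \<in> carrier K" "w \<in> list_span ss" "y = d \<odot>\<^bsub>A\<^esub> s \<oplus>\<^bsub>A\<^esub> w" by auto
    have "x \<oplus>\<^bsub>A\<^esub> y = (c \<oplus> d) \<odot>\<^bsub>A\<^esub> s \<oplus>\<^bsub>A\<^esub> (v \<oplus>\<^bsub>A\<^esub> w)"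
      using * s Vc by (simp add: smult_add_regroup)
    then show "x \<oplus>\<^bsub>A\<^esub> y \<in> list_span (s # ss)"
      using * subspace_add[OF V, of v w] by auto
  next
    fix c x assume c: "c \<in> carrier K" and "x \<in> list_span (s # ss)"
    then obtain d w where *: "d \<in> carrier K" "w \<in> list_span ss" "x = d \<odot>\<^bsub>A\<^esub> s \<oplus>\<^bsub>A\<^esub> w" by auto
    have "c \<odot>\<^bsub>A\<^esub> x = (c \<otimes> d) \<odot>\<^bsub>A\<^esub> s \<oplus>\<^bsub>A\<^esub> (c \<odot>\<^bsub>A\<^esub> w)"
      using * s c Vc by (simp add: smult_r_distr smult_assoc1)
    then show "c \<odot>\<^bsub>A\<^esub> x \<in> list_span (s # ss)"
      using * c subspace_smult[OF V c] by auto
  qed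
qed

lemma finsum_in_list_span:
  assumes "distinct ss" "set ss \<subseteq> carrier A" "c \<in> set ss \<rightarrow> carrier K"
  shows "(\<Oplus>\<^bsub>A\<^esub>s\<in>set ss. c s \<odot>\<^bsub>A\<^esub> s) \<in> list_span ss"
  using assms
proof (induction ss)
  case (Cons s ss)
  have "(\<Oplus>\<^bsub>A\<^esub>t\<in>insert s (set ss). c t \<odot>\<^bsub>A\<^esub> t)
      = c s \<odot>\<^bsub>A\<^esub> s \<oplus>\<^bsub>A\<^esub> (\<Oplus>\<^bsub>A\<^esub>t\<in>set ss. c t \<odot>\<^bsub>A\<^esub> t)"
    using Cons.prems by (intro M.finsum_insert) auto
  then show ?case using Cons by auto
qed simp

text \<open>The spanning vectors are added one at a time: a new vector s contributes 1 unless U lies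
  in the span W of the tail, and the rest is measured on the intersection of U with W. For U inside
  the span this is the dimension of U, and dependent vectors in the list do no harm.\<close>

lemma strict_measure_list_span:
  assumes "set ss \<subseteq> carrier A"
  shows "\<exists>d :: 'a set \<Rightarrow> nat. (\<forall>U. d U \<le> length ss) \<and>
    (\<forall>U V. subspace U \<and> subspace V \<and> U \<subset> V \<and> V \<subseteq> list_span ss \<longrightarrow> d U < d V)"
  using assms
proof (induction ss)
  case Nil
  show ?case by (rule exI[of _ "\<lambda>_. 0"]) (auto dest: subspace_zero)
next
  case (Cons s ss)
  let ?W = "list_span ss"
  from Cons have s: "s \<in> carrier A" and W: "subspace ?W" by (auto intro: subspace_list_span)
  have "set ss \<subseteq> carrier A" using Cons.prems by simp
  from Cons.IH[OF this] obtain d :: "'a set \<Rightarrow> nat" where d: "\<And>U. d U \<le> length ss"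
    "\<And>U V. subspace U \<Longrightarrow> subspace V \<Longrightarrow> U \<subset> V \<Longrightarrow> V \<subseteq> ?W \<Longrightarrow> d U < d V" by meson
  let ?d = "\<lambda>U. d (U \<inter> ?W) + (if U \<subseteq> ?W then 0 else 1)"
  have "?d U < ?d V" if U: "subspace U" and V: "subspace V" and UV: "U \<subset> V"
    and VW: "V \<subseteq> list_span (s # ss)" for U V
  proof (cases "U \<inter> ?W = V \<inter> ?W")
    case False
    then have "d (U \<inter> ?W) < d (V \<inter> ?W)"
      using UV by (intro d(2) subspace_Int U V W) auto
    then show ?thesis using UV by auto
  next
    case True
    have nV: "\<not> V \<subseteq> ?W" using True UV by auto
    \<comment> \<open>Otherwise some u in U has a non-zero coefficient a at s. Subtracting a
      multiple of u from any x in V removes the coefficient of x at s, and the result lies in V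
      \<inter> W = U \<inter> W, where W is the span of the tail. So x is in U, against U \<subset>
      V.\<close>
    have "U \<subseteq> ?W"
    proof (rule ccontr)
      assume "\<not> U \<subseteq> ?W"
      then obtain u where u: "u \<in> U" "u \<notin> ?W" by auto
      moreover have "u \<in> list_span (s # ss)" using u(1) UV VW by blast
      ultimately obtain a v where a: "a \<in> carrier K" "v \<in> ?W" "u = a \<odot>\<^bsub>A\<^esub> s \<oplus>\<^bsub>A\<^esub> v"
        by auto
      have vc: "v \<in> carrier A" using subspace_carr[OF W] a by auto
      have "a \<noteq> \<zero>" using u a vc s by (auto simp: smult_l_null)
      then have ai: "inv a \<in> carrier K" "inv a \<otimes> a = \<one>" using a field_Units by auto
      have "V \<subseteq> U"
      proof
        fix x assume x: "x \<in> V"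
        then obtain b w where b: "b \<in> carrier K" "w \<in> ?W" "x = b \<odot>\<^bsub>A\<^esub> s \<oplus>\<^bsub>A\<^esub> w"
          using VW by auto
        let ?c = "\<ominus> (b \<otimes> inv a)"
        have wc: "w \<in> carrier A" using subspace_carr[OF W] b by auto
        have cc: "?c \<in> carrier K" "?c \<otimes> a = \<ominus> b"
          using ai a(1) b(1) K_m_assoc[of b "inv a" a] cring.cring_simprules(27)[OF is_cring]
          by (simp_all add: ring.ring_simprules[OF cring.axioms(1)[OF is_cring]])
        have uc: "?c \<odot>\<^bsub>A\<^esub> u = (\<ominus> b) \<odot>\<^bsub>A\<^esub> s \<oplus>\<^bsub>A\<^esub> ?c \<odot>\<^bsub>A\<^esub> v"
          using a s vc cc smult_assoc1[of ?c a s] by (simp add: smult_r_distr)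
        have "x \<oplus>\<^bsub>A\<^esub> ?c \<odot>\<^bsub>A\<^esub> u = (b \<oplus> \<ominus> b) \<odot>\<^bsub>A\<^esub> s \<oplus>\<^bsub>A\<^esub> (w \<oplus>\<^bsub>A\<^esub> ?c \<odot>\<^bsub>A\<^esub> v)"
          unfolding uc b(3) using b(1) s wc vc cc(1) by (intro smult_add_regroup) auto
        also have "\<dots> = w \<oplus>\<^bsub>A\<^esub> ?c \<odot>\<^bsub>A\<^esub> v"
          using b(1) s wc vc cc(1) by (simp add: K_simprules smult_l_null)
        also have "\<dots> \<in> ?W" using a b cc W by (intro subspace_add subspace_smult)
        finally have "x \<oplus>\<^bsub>A\<^esub> ?c \<odot>\<^bsub>A\<^esub> u \<in> V \<inter> ?W"
          using x u UV cc by (auto intro!: subspace_add[OF V] subspace_smult[OF V])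
        then have "x \<oplus>\<^bsub>A\<^esub> ?c \<odot>\<^bsub>A\<^esub> u \<in> U" using True by auto
        then have "(x \<oplus>\<^bsub>A\<^esub> ?c \<odot>\<^bsub>A\<^esub> u) \<ominus>\<^bsub>A\<^esub> ?c \<odot>\<^bsub>A\<^esub> u \<in> U"
          using u cc by (intro subspace_minus subspace_smult U)
        moreover have "(x \<oplus>\<^bsub>A\<^esub> y) \<ominus>\<^bsub>A\<^esub> y = x" if "y \<in> carrier A" for y
          using that subspace_carr[OF V x] by (simp add: a_minus_def M.a_assoc M.r_neg)
        ultimately show "x \<in> U" using cc u subspace_carr[OF U] by simp
      qed
      then show False using UV by auto
    qed
    then show ?thesis using True nV by auto
  qed
  moreover have "?d U \<le> length (s # ss)" for U using d(1)[of "U \<inter> ?W"] by auto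
  ultimately show ?case by (intro exI[of _ ?d]) blast
qed

end

context fin_dim_algebra
begin

lemma ex_strict_measure:
  "\<exists>(d :: 'c set \<Rightarrow> nat) n. (\<forall>U. d U \<le> n) \<and> (\<forall>U V. subspace U \<and> subspace V \<and> U \<subset> V \<longrightarrow> d U < d V)"
proof -
  obtain S where S: "S \<subseteq> carrier A" "finite S"
    "\<And>x. x \<in> carrier A \<Longrightarrow> \<exists>c \<in> S \<rightarrow> carrier K. x = (\<Oplus>\<^bsub>A\<^esub>s\<in>S. c s \<odot>\<^bsub>A\<^esub> s)"
    using fin_dim unfolding fin_dim_def by blast
  obtain ss where ss: "distinct ss" "set ss = S" using finite_distinct_list[OF S(2)] by auto
  have "carrier A \<subseteq> list_span ss"
  proof
    fix x assume "x \<in> carrier A"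
    then obtain c where "c \<in> S \<rightarrow> carrier K" "x = (\<Oplus>\<^bsub>A\<^esub>s\<in>S. c s \<odot>\<^bsub>A\<^esub> s)" using S(3) by blast
    then show "x \<in> list_span ss" using finsum_in_list_span[of ss c] ss S(1) by auto
  qed
  then have "V \<subseteq> list_span ss" if "subspace V" for V
    using that subspace_carr by blast
  then show ?thesis using strict_measure_list_span[of ss] ss S(1) by meson
qed

text \<open>Any function with the two properties would do, since the arguments below only compare
  values and take extrema. The bound holds on all sets, so a maximum can be taken over any non-empty
  family.\<close>

definition sdim :: "'c set \<Rightarrow> nat" where
  "sdim = (SOME d. \<exists>n. (\<forall>U. d U \<le> n) \<and> (\<forall>U V. subspace U \<and> subspace V \<and> U \<subset> V \<longrightarrow> d U < d V))"

lemma sdim_bounded: "\<exists>n. \<forall>U. sdim U \<le> n"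
  and sdim_strict: "subspace U \<Longrightarrow> subspace V \<Longrightarrow> U \<subset> V \<Longrightarrow> sdim U < sdim V"
  using someI_ex[OF ex_strict_measure, folded sdim_def] by blast+

lemma sdim_antimono_eq: "subspace U \<Longrightarrow> subspace V \<Longrightarrow> U \<subseteq> V \<Longrightarrow> sdim V \<le> sdim U \<Longrightarrow> U = V"
  using sdim_strict[of U V] by auto

lemma ex_max_sdim:
  assumes "P x" shows "\<exists>x. P x \<and> (\<forall>y. P y \<longrightarrow> sdim (f y) \<le> sdim (f x))"
proof -
  obtain n where "\<And>U. sdim U \<le> n" using sdim_bounded by auto
  then have "\<forall>y. P y \<longrightarrow> sdim (f y) < Suc n" using le_imp_less_Suc by blast
  then show ?thesis using ex_has_greatest_nat[of P x "\<lambda>y. sdim (f y)" "Suc n"] assms by auto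
qed

text \<open>Coefficients with respect to a finite spanning set are chosen for each element and
  numbered by natural numbers; they determine the element, whatever the choice. This places copies
  of quotients and of ideals of A in the type over which the definitions quantify.\<close>

lemma ex_inj_nat_fun: "\<exists>h :: 'c \<Rightarrow> nat \<Rightarrow> 'a. inj_on h (carrier A)"
proof -
  obtain S where S: "finite S"
    "\<And>x. x \<in> carrier A \<Longrightarrow> \<exists>c \<in> S \<rightarrow> carrier K. x = (\<Oplus>\<^bsub>A\<^esub>s\<in>S. c s \<odot>\<^bsub>A\<^esub> s)"
    and SA: "S \<subseteq> carrier A"
    using fin_dim unfolding fin_dim_def by blast
  then obtain c where c: "\<And>x. x \<in> carrier A \<Longrightarrow> c x \<in> S \<rightarrow> carrier K \<and> x = (\<Oplus>\<^bsub>A\<^esub>s\<in>S. c x s \<odot>\<^bsub>A\<^esub> s)"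
    by metis
  obtain b :: "'c \<Rightarrow> nat" where b: "inj_on b S" using finite_imp_inj_to_nat_seg[OF S(1)] by auto
  let ?h = "\<lambda>x i. c x (inv_into S b i)"
  have "inj_on ?h (carrier A)"
  proof (rule inj_onI)
    fix x y assume xy: "x \<in> carrier A" "y \<in> carrier A" "?h x = ?h y"
    have "c x s = c y s" if "s \<in> S" for s
      using fun_cong[OF xy(3), of "b s"] inv_into_f_f[OF b that] by simp
    then have "(\<Oplus>\<^bsub>A\<^esub>s\<in>S. c x s \<odot>\<^bsub>A\<^esub> s) = (\<Oplus>\<^bsub>A\<^esub>s\<in>S. c y s \<odot>\<^bsub>A\<^esub> s)"
      using c[OF xy(2)] SA by (intro M.finsum_cong') auto
    then show "x = y" using c[OF xy(1)] c[OF xy(2)] by simp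
  qed
  then show ?thesis by blast
qed

end

section \<open>Characters and the radical\<close>

context fin_dim_algebra
begin

lemma minus_self: "x \<in> carrier A \<Longrightarrow> x \<ominus>\<^bsub>A\<^esub> x = \<zero>\<^bsub>A\<^esub>"
  by algebra

definition left_ideal :: "'c set \<Rightarrow> bool" where
  "left_ideal L \<longleftrightarrow> subspace L \<and> (\<forall>a\<in>carrier A. \<forall>x\<in>L. a \<otimes>\<^bsub>A\<^esub> x \<in> L)"

lemma left_idealI:
  assumes "L \<subseteq> carrier A" "\<zero>\<^bsub>A\<^esub> \<in> L" "\<And>x y. x \<in> L \<Longrightarrow> y \<in> L \<Longrightarrow> x \<oplus>\<^bsub>A\<^esub> y \<in> L"
    "\<And>a x. a \<in> carrier A \<Longrightarrow> x \<in> L \<Longrightarrow> a \<otimes>\<^bsub>A\<^esub> x \<in> L"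
  shows "left_ideal L"
  unfolding left_ideal_def using left_ideal_subspace[OF assms] assms(4) by auto

lemma left_ideal_principal:
  assumes a: "a \<in> carrier A" shows "left_ideal {x \<otimes>\<^bsub>A\<^esub> a | x. x \<in> carrier A}"
proof (rule left_idealI)
  show "\<zero>\<^bsub>A\<^esub> \<in> {x \<otimes>\<^bsub>A\<^esub> a | x. x \<in> carrier A}" using a by (auto intro!: exI[of _ "\<zero>\<^bsub>A\<^esub>"])
next
  fix x y assume "x \<in> {x \<otimes>\<^bsub>A\<^esub> a | x. x \<in> carrier A}" "y \<in> {x \<otimes>\<^bsub>A\<^esub> a | x. x \<in> carrier A}"
  then show "x \<oplus>\<^bsub>A\<^esub> y \<in> {x \<otimes>\<^bsub>A\<^esub> a | x. x \<in> carrier A}"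
    using a by (auto simp: A.l_distr[symmetric])
next
  fix b x assume "b \<in> carrier A" "x \<in> {x \<otimes>\<^bsub>A\<^esub> a | x. x \<in> carrier A}"
  then show "b \<otimes>\<^bsub>A\<^esub> x \<in> {x \<otimes>\<^bsub>A\<^esub> a | x. x \<in> carrier A}"
    using a by (auto simp: A.m_assoc[symmetric])
qed (use a in auto)

definition max_left_ideal :: "'c set \<Rightarrow> bool" where
  "max_left_ideal L \<longleftrightarrow> left_ideal L \<and> \<one>\<^bsub>A\<^esub> \<notin> L \<and>
     (\<forall>L'. left_ideal L' \<and> L \<subseteq> L' \<and> \<one>\<^bsub>A\<^esub> \<notin> L' \<longrightarrow> L' = L)"

lemma ex_max_left_ideal:
  assumes "left_ideal L\<^sub>0" "\<one>\<^bsub>A\<^esub> \<notin> L\<^sub>0"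
  obtains L where "max_left_ideal L" "L\<^sub>0 \<subseteq> L"
proof -
  let ?P = "\<lambda>L. left_ideal L \<and> L\<^sub>0 \<subseteq> L \<and> \<one>\<^bsub>A\<^esub> \<notin> L"
  have "\<exists>L. ?P L \<and> (\<forall>L'. ?P L' \<longrightarrow> sdim L' \<le> sdim L)"
    using ex_max_sdim[of ?P L\<^sub>0 "\<lambda>L. L"] assms by auto
  then obtain L where L: "?P L" "\<And>L'. ?P L' \<Longrightarrow> sdim L' \<le> sdim L" by blast
  have "L' = L" if "left_ideal L' \<and> L \<subseteq> L' \<and> \<one>\<^bsub>A\<^esub> \<notin> L'" for L'
  proof -
    have "?P L'" using that L(1) by auto
    then have "sdim L' \<le> sdim L" by (rule L(2))
    then show ?thesis using that L(1) sdim_antimono_eq[of L L'] by (auto simp: left_ideal_def)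
  qed
  then show ?thesis using that L(1) unfolding max_left_ideal_def by blast
qed

text \<open>The simple module \<open>A/L\<close> is realised inside the type \<open>nat \<Rightarrow> 'a\<close>.\<close>

lemma scalar_mod_max_left_ideal:
  assumes simp: "one_dim_simples K A" and L: "max_left_ideal L" and x: "x \<in> carrier A"
  shows "\<exists>c\<in>carrier K. x \<ominus>\<^bsub>A\<^esub> c \<odot>\<^bsub>A\<^esub> \<one>\<^bsub>A\<^esub> \<in> L"
proof -
  from L have sL: "subspace L" and mL: "\<And>a x. a \<in> carrier A \<Longrightarrow> x \<in> L \<Longrightarrow> a \<otimes>\<^bsub>A\<^esub> x \<in> L"
    and oL: "\<one>\<^bsub>A\<^esub> \<notin> L" by (auto simp: max_left_ideal_def left_ideal_def)
  obtain h :: "'c \<Rightarrow> nat \<Rightarrow> 'a" where h: "inj_on h (carrier A)" using ex_inj_nat_fun by blast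
  \<comment> \<open>One representative is fixed for each coset of L, and the coset is encoded by the
    coordinate vector of that representative.\<close>
  define rep where "rep x = (SOME y. y \<in> carrier A \<and> x \<ominus>\<^bsub>A\<^esub> y \<in> L)" for x
  define \<phi> where "\<phi> x = h (rep x)" for x
  have rep: "rep x \<in> carrier A \<and> x \<ominus>\<^bsub>A\<^esub> rep x \<in> L" if "x \<in> carrier A" for x
  proof -
    have "\<exists>y. y \<in> carrier A \<and> x \<ominus>\<^bsub>A\<^esub> y \<in> L"
      using that subspace_zero[OF sL] by (auto simp: minus_self intro!: exI[of _ x])
    then show ?thesis unfolding rep_def by (rule someI_ex)
  qed
  have diff1: "x \<ominus>\<^bsub>A\<^esub> z \<in> L" if "x \<ominus>\<^bsub>A\<^esub> y \<in> L" "y \<ominus>\<^bsub>A\<^esub> z \<in> L" "x \<in> carrier A" "y \<in> carrier A" "z \<in> carrier A" for x y z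
  proof -
    have "x \<ominus>\<^bsub>A\<^esub> z = (x \<ominus>\<^bsub>A\<^esub> y) \<oplus>\<^bsub>A\<^esub> (y \<ominus>\<^bsub>A\<^esub> z)" using that(3-) by algebra
    then show ?thesis using subspace_add[OF sL that(1,2)] by simp
  qed
  have diff2: "y \<ominus>\<^bsub>A\<^esub> x \<in> L" if "x \<ominus>\<^bsub>A\<^esub> y \<in> L" "x \<in> carrier A" "y \<in> carrier A" for x y
  proof -
    have "y \<ominus>\<^bsub>A\<^esub> x = \<ominus>\<^bsub>A\<^esub> (x \<ominus>\<^bsub>A\<^esub> y)" using that(2-) by algebra
    then show ?thesis using subspace_neg[OF sL that(1)] by simp
  qed
  have \<phi>: "\<phi> x = \<phi> y \<longleftrightarrow> x \<ominus>\<^bsub>A\<^esub> y \<in> L" if xy: "x \<in> carrier A" "y \<in> carrier A" for x y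
  proof
    assume "\<phi> x = \<phi> y"
    then have "rep x = rep y" using inj_onD[OF h _ conjunct1[OF rep] conjunct1[OF rep]] xy by (simp add: \<phi>_def)
    then show "x \<ominus>\<^bsub>A\<^esub> y \<in> L" using diff1[of x "rep x" y] diff2[of y "rep y"] rep[OF xy(1)] rep[OF xy(2)] xy by simp
  next
    assume "x \<ominus>\<^bsub>A\<^esub> y \<in> L"
    \<comment> \<open>The choice in \<open>rep\<close> depends on x only through this predicate on
      z, so congruent elements receive the same representative.\<close>
    then have "(z \<in> carrier A \<and> x \<ominus>\<^bsub>A\<^esub> z \<in> L) \<longleftrightarrow> (z \<in> carrier A \<and> y \<ominus>\<^bsub>A\<^esub> z \<in> L)" for z
      using diff1[of x y z] diff1[of y x z] diff2[of x y] xy by blast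
    then show "\<phi> x = \<phi> y" by (simp add: \<phi>_def rep_def)
  qed
  define g where "g = inv_into (carrier A) \<phi>"
  define S :: "('c, nat \<Rightarrow> 'a) module" where "S = \<lparr>carrier = \<phi> ` carrier A, monoid.mult = undefined, one = undefined,
     ring.zero = \<phi> \<zero>\<^bsub>A\<^esub>, add = (\<lambda>u v. \<phi> (g u \<oplus>\<^bsub>A\<^esub> g v)), smult = (\<lambda>a u. \<phi> (a \<otimes>\<^bsub>A\<^esub> g u))\<rparr>"
  have g: "g (\<phi> x) \<in> carrier A \<and> g (\<phi> x) \<ominus>\<^bsub>A\<^esub> x \<in> L" if "x \<in> carrier A" for x
    using \<phi>[of "g (\<phi> x)" x] that unfolding g_def by (auto simp: inv_into_into f_inv_into_f)
  have cS: "carrier S = \<phi> ` carrier A" and zS: "\<zero>\<^bsub>S\<^esub> = \<phi> \<zero>\<^bsub>A\<^esub>" by (simp_all add: S_def)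
  have aS: "\<phi> x \<oplus>\<^bsub>S\<^esub> \<phi> y = \<phi> (x \<oplus>\<^bsub>A\<^esub> y)" if xy: "x \<in> carrier A" "y \<in> carrier A" for x y
  proof -
    have "(g (\<phi> x) \<oplus>\<^bsub>A\<^esub> g (\<phi> y)) \<ominus>\<^bsub>A\<^esub> (x \<oplus>\<^bsub>A\<^esub> y) = (g (\<phi> x) \<ominus>\<^bsub>A\<^esub> x) \<oplus>\<^bsub>A\<^esub> (g (\<phi> y) \<ominus>\<^bsub>A\<^esub> y)"
      using g[OF xy(1)] g[OF xy(2)] xy by algebra
    then show ?thesis using g[OF xy(1)] g[OF xy(2)] xy subspace_add[OF sL] by (simp add: S_def \<phi>)
  qed
  have mS: "a \<odot>\<^bsub>S\<^esub> \<phi> x = \<phi> (a \<otimes>\<^bsub>A\<^esub> x)" if xy: "a \<in> carrier A" "x \<in> carrier A" for a x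
  proof -
    have "(a \<otimes>\<^bsub>A\<^esub> g (\<phi> x)) \<ominus>\<^bsub>A\<^esub> (a \<otimes>\<^bsub>A\<^esub> x) = a \<otimes>\<^bsub>A\<^esub> (g (\<phi> x) \<ominus>\<^bsub>A\<^esub> x)"
      using g[OF xy(2)] xy by (simp add: a_minus_def A.r_distr A.r_minus)
    then show ?thesis using g[OF xy(2)] xy mL by (simp add: S_def \<phi>)
  qed
  have "abelian_group S"
  proof (rule abelian_groupI)
    fix u assume "u \<in> carrier S"
    then obtain x where "x \<in> carrier A" "u = \<phi> x" by (auto simp: cS)
    then show "\<exists>y\<in>carrier S. y \<oplus>\<^bsub>S\<^esub> u = \<zero>\<^bsub>S\<^esub>"
      by (auto simp: cS zS aS M.l_neg intro!: bexI[of _ "\<ominus>\<^bsub>A\<^esub> x"])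
  qed (auto simp: cS zS aS M.a_ac)
  then have lm: "lmodule A S"
    by (intro lmodule.intro lmodule_axioms.intro A.ring_axioms)
       (auto simp: cS aS mS A.l_distr A.r_distr A.m_assoc)
  have "simple_module A S"
    unfolding simple_module_def
  proof (intro conjI allI impI lm)
    have "\<phi> \<one>\<^bsub>A\<^esub> \<noteq> \<phi> \<zero>\<^bsub>A\<^esub>" using oL by (simp add: \<phi> a_minus_def)
    then show "carrier S \<noteq> {\<zero>\<^bsub>S\<^esub>}" by (auto simp: cS zS)
  next
    fix N assume N: "additive_subgroup N S \<and> (\<forall>r\<in>carrier A. \<forall>x\<in>N. r \<odot>\<^bsub>S\<^esub> x \<in> N)"
    then have Ns: "N \<subseteq> carrier S" "\<zero>\<^bsub>S\<^esub> \<in> N" and Na: "\<And>u v. u \<in> N \<Longrightarrow> v \<in> N \<Longrightarrow> u \<oplus>\<^bsub>S\<^esub> v \<in> N"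
      by (auto simp: additive_subgroup.a_subset additive_subgroup.zero_closed additive_subgroup.a_closed)
    \<comment> \<open>A submodule is pulled back to a left ideal containing L, to which the
      maximality of L applies.\<close>
    let ?N = "{x \<in> carrier A. \<phi> x \<in> N}"
    have lN: "left_ideal ?N"
      by (rule left_idealI) (use Ns Na N in \<open>auto simp: zS aS[symmetric] mS[symmetric]\<close>)
    have LN: "L \<subseteq> ?N"
    proof
      fix x assume x: "x \<in> L"
      then have "x \<in> carrier A" using sL subspace_carr by auto
      moreover then have "\<phi> x = \<phi> \<zero>\<^bsub>A\<^esub>" using x by (simp add: \<phi> a_minus_def)
      ultimately show "x \<in> ?N" using Ns zS by simp
    qed
    show "N = {\<zero>\<^bsub>S\<^esub>} \<or> N = carrier S"
    proof (cases "\<one>\<^bsub>A\<^esub> \<in> ?N")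
      case True
      have "\<phi> x \<in> N" if "x \<in> carrier A" for x
      proof -
        have "x \<odot>\<^bsub>S\<^esub> \<phi> \<one>\<^bsub>A\<^esub> \<in> N" using N True that by blast
        then show ?thesis using mS[of x "\<one>\<^bsub>A\<^esub>"] that by simp
      qed
      then show ?thesis using Ns by (auto simp: cS)
    next
      case False
      then have "?N = L" using L lN LN unfolding max_left_ideal_def by blast
      then have "N = {\<zero>\<^bsub>S\<^esub>}" using Ns by (auto simp: cS zS \<phi> a_minus_def)
      then show ?thesis by simp
    qed
  qed
  then have "one_dim K (k_space A S)" using simp by (simp add: one_dim_simples_def)
  then obtain t where t: "t \<in> carrier S"
    "\<forall>u\<in>carrier S. \<exists>c\<in>carrier K. u = (c \<odot>\<^bsub>A\<^esub> \<one>\<^bsub>A\<^esub>) \<odot>\<^bsub>S\<^esub> t"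
    unfolding one_dim_def k_space_def by simp blast
  then obtain s where s: "s \<in> carrier A" "t = \<phi> s" unfolding cS by blast
  have gen: "\<exists>c\<in>carrier K. \<phi> y = \<phi> (c \<odot>\<^bsub>A\<^esub> s)" if y: "y \<in> carrier A" for y
  proof -
    have "\<phi> y \<in> carrier S" using y cS by simp
    then obtain c where c: "c \<in> carrier K" "\<phi> y = (c \<odot>\<^bsub>A\<^esub> \<one>\<^bsub>A\<^esub>) \<odot>\<^bsub>S\<^esub> \<phi> s" using t(2) s(2) by blast
    then have "\<phi> y = \<phi> (c \<odot>\<^bsub>A\<^esub> s)" using s(1) mS[of "c \<odot>\<^bsub>A\<^esub> \<one>\<^bsub>A\<^esub>" s] by (simp add: scalar_mult_eq)
    then show ?thesis using c by blast
  qed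
  \<comment> \<open>The generator s of A/L need not be the class of the unit. Since the unit is not
    in L, its coefficient \<open>c0\<close> is invertible, so x is congruent to the scalar
    \<open>c1\<close> divided by \<open>c0\<close>.\<close>
  obtain c0 where c0: "c0 \<in> carrier K" "\<phi> \<one>\<^bsub>A\<^esub> = \<phi> (c0 \<odot>\<^bsub>A\<^esub> s)" using gen[OF A.one_closed] by blast
  obtain c1 where c1: "c1 \<in> carrier K" "\<phi> x = \<phi> (c1 \<odot>\<^bsub>A\<^esub> s)" using gen[OF x] by blast
  have "c0 \<noteq> \<zero>" using c0 oL s(1) by (auto simp: smult_l_null \<phi> a_minus_def)
  then have ci: "inv c0 \<in> carrier K" "inv c0 \<otimes> c0 = \<one>" using c0 field_Units by auto
  have "c1 \<otimes> inv c0 \<otimes> c0 = c1" using ci c0(1) c1(1) K_m_assoc[of c1 "inv c0" c0] by (simp add: K_simprules)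
  then obtain d where d: "d \<in> carrier K" "d \<otimes> c0 = c1"
    using ci c1(1) by (intro that[of "c1 \<otimes> inv c0"]) (auto simp: K_simprules)
  have cs: "c1 \<odot>\<^bsub>A\<^esub> s = d \<odot>\<^bsub>A\<^esub> (c0 \<odot>\<^bsub>A\<^esub> s)" using d c0(1) s(1) smult_assoc1[of d c0 s] by simp
  have "d \<odot>\<^bsub>A\<^esub> \<one>\<^bsub>A\<^esub> \<ominus>\<^bsub>A\<^esub> c1 \<odot>\<^bsub>A\<^esub> s = d \<odot>\<^bsub>A\<^esub> (\<one>\<^bsub>A\<^esub> \<ominus>\<^bsub>A\<^esub> c0 \<odot>\<^bsub>A\<^esub> s)"
    unfolding cs using d(1) c0(1) s(1) by (simp add: a_minus_def smult_r_distr smult_r_minus)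
  also have "\<dots> \<in> L" using c0 s(1) d by (intro subspace_smult sL) (auto simp: \<phi>)
  finally have "c1 \<odot>\<^bsub>A\<^esub> s \<ominus>\<^bsub>A\<^esub> d \<odot>\<^bsub>A\<^esub> \<one>\<^bsub>A\<^esub> \<in> L"
    using c1(1) d(1) s(1) by - (rule diff2, auto)
  then have "x \<ominus>\<^bsub>A\<^esub> d \<odot>\<^bsub>A\<^esub> \<one>\<^bsub>A\<^esub> \<in> L"
    using c1 x d(1) s(1) by - (rule diff1[of x "c1 \<odot>\<^bsub>A\<^esub> s"], auto simp: \<phi>)
  then show ?thesis using d by auto
qed

end

section \<open>Characters: algebra homomorphisms to the ground field\<close>

context k_algebra begin

definition character :: "('a \<Rightarrow> 'k) \<Rightarrow> bool" where
  "character \<psi> \<longleftrightarrow> \<psi> \<in> ring_hom A K \<and> (\<forall>c\<in>carrier K. \<forall>x\<in>carrier A. \<psi> (c \<odot>\<^bsub>A\<^esub> x) = c \<otimes> \<psi> x)"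

lemma character_closed: "character \<psi> \<Longrightarrow> x \<in> carrier A \<Longrightarrow> \<psi> x \<in> carrier K"
  and character_add: "character \<psi> \<Longrightarrow> x \<in> carrier A \<Longrightarrow> y \<in> carrier A \<Longrightarrow> \<psi> (x \<oplus>\<^bsub>A\<^esub> y) = \<psi> x \<oplus> \<psi> y"
  and character_mult: "character \<psi> \<Longrightarrow> x \<in> carrier A \<Longrightarrow> y \<in> carrier A \<Longrightarrow> \<psi> (x \<otimes>\<^bsub>A\<^esub> y) = \<psi> x \<otimes> \<psi> y"
  and character_one: "character \<psi> \<Longrightarrow> \<psi> \<one>\<^bsub>A\<^esub> = \<one>"
  and character_smult: "character \<psi> \<Longrightarrow> c \<in> carrier K \<Longrightarrow> x \<in> carrier A \<Longrightarrow> \<psi> (c \<odot>\<^bsub>A\<^esub> x) = c \<otimes> \<psi> x"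
  by (auto simp: character_def ring_hom_closed ring_hom_add ring_hom_mult ring_hom_one)

lemma character_zero: "character \<psi> \<Longrightarrow> \<psi> \<zero>\<^bsub>A\<^esub> = \<zero>"
  using character_smult[of \<psi> \<zero> "\<zero>\<^bsub>A\<^esub>"] character_closed[of \<psi> "\<zero>\<^bsub>A\<^esub>"]
  by (simp add: smult_r_null K_simprules)

lemma character_minus:
  assumes "character \<psi>" "x \<in> carrier A" "y \<in> carrier A"
  shows "\<psi> (x \<ominus>\<^bsub>A\<^esub> y) = \<psi> x \<ominus> \<psi> y"
proof -
  have "\<psi> (\<ominus>\<^bsub>A\<^esub> y) = \<ominus> \<psi> y"
    using character_smult[OF assms(1), of "\<ominus> \<one>" y] assms character_closed[OF assms(1,3)]
    by (simp add: smult_neg_one K_simprules)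
  then show ?thesis using assms by (simp add: a_minus_def character_add)
qed

end

context fin_dim_algebra begin

text \<open>Enlarge the left ideal to a maximal one, L. Every x is congruent modulo L to a unique
  scalar, and this scalar is the value of the character at x.\<close>

lemma ex_character:
  assumes simp: "one_dim_simples K A" and "left_ideal L\<^sub>0" "\<one>\<^bsub>A\<^esub> \<notin> L\<^sub>0"
  obtains \<psi> where "character \<psi>" "\<And>x. x \<in> L\<^sub>0 \<Longrightarrow> \<psi> x = \<zero>"
proof -
  obtain L where L: "max_left_ideal L" "L\<^sub>0 \<subseteq> L" using ex_max_left_ideal assms by metis
  then have sL: "subspace L" and mL: "\<And>a x. a \<in> carrier A \<Longrightarrow> x \<in> L \<Longrightarrow> a \<otimes>\<^bsub>A\<^esub> x \<in> L"
    and oL: "\<one>\<^bsub>A\<^esub> \<notin> L" by (auto simp: max_left_ideal_def left_ideal_def)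
  obtain \<psi> where \<psi>: "\<And>x. x \<in> carrier A \<Longrightarrow> \<psi> x \<in> carrier K \<and> x \<ominus>\<^bsub>A\<^esub> \<psi> x \<odot>\<^bsub>A\<^esub> \<one>\<^bsub>A\<^esub> \<in> L"
    using scalar_mod_max_left_ideal[OF simp L(1)] by metis
  have scal: "c = \<zero>" if "c \<in> carrier K" "c \<odot>\<^bsub>A\<^esub> \<one>\<^bsub>A\<^esub> \<in> L" for c
  proof (rule ccontr)
    assume "c \<noteq> \<zero>"
    then have ci: "inv c \<in> carrier K" "inv c \<otimes> c = \<one>" using that field_Units by auto
    then have "inv c \<odot>\<^bsub>A\<^esub> (c \<odot>\<^bsub>A\<^esub> \<one>\<^bsub>A\<^esub>) \<in> L" using subspace_smult[OF sL] that by auto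
    then show False using ci that oL smult_assoc1[of "inv c" c "\<one>\<^bsub>A\<^esub>"] by simp
  qed
  have uniq: "\<psi> x = c" if "x \<in> carrier A" "c \<in> carrier K" "x \<ominus>\<^bsub>A\<^esub> c \<odot>\<^bsub>A\<^esub> \<one>\<^bsub>A\<^esub> \<in> L" for x c
  proof -
    have "(\<psi> x \<ominus> c) \<odot>\<^bsub>A\<^esub> \<one>\<^bsub>A\<^esub> = (x \<ominus>\<^bsub>A\<^esub> c \<odot>\<^bsub>A\<^esub> \<one>\<^bsub>A\<^esub>) \<ominus>\<^bsub>A\<^esub> (x \<ominus>\<^bsub>A\<^esub> \<psi> x \<odot>\<^bsub>A\<^esub> \<one>\<^bsub>A\<^esub>)"
    proof -
      have "(p \<oplus>\<^bsub>A\<^esub> \<ominus>\<^bsub>A\<^esub> q) = (x \<ominus>\<^bsub>A\<^esub> q) \<ominus>\<^bsub>A\<^esub> (x \<ominus>\<^bsub>A\<^esub> p)"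
        if "p \<in> carrier A" "q \<in> carrier A" for p q using that \<open>x \<in> carrier A\<close> by algebra
      then show ?thesis using that \<psi>[of x]
        by (simp add: a_minus_def[of K] smult_l_distr smult_l_minus)
    qed
    also have "\<dots> \<in> L" using that \<psi>[of x] by (auto intro: subspace_minus[OF sL])
    finally have "\<psi> x \<ominus> c = \<zero>" using scal[of "\<psi> x \<ominus> c"] that \<psi>[of x] by (simp add: K_simprules)
    then show ?thesis using that \<psi>[of x] by (simp add: r_right_minus_eq)
  qed
  have "character \<psi>"
    unfolding character_def
  proof (intro conjI ballI ring_hom_memI)
    show "\<psi> x \<in> carrier K" if "x \<in> carrier A" for x using \<psi> that by auto
  next
    fix x y assume xy: "x \<in> carrier A" "y \<in> carrier A"
    note px = \<psi>[OF xy(1)] and py = \<psi>[OF xy(2)]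
    \<comment> \<open>The identity writes x y - \<psi>(x) \<psi>(y) as a left multiple plus a scalar
      multiple of elements of L, so multiplicativity follows although L is only known to be a left
      ideal.\<close>
    have "(x \<otimes>\<^bsub>A\<^esub> y) \<ominus>\<^bsub>A\<^esub> (\<psi> x \<otimes> \<psi> y) \<odot>\<^bsub>A\<^esub> \<one>\<^bsub>A\<^esub>
      = x \<otimes>\<^bsub>A\<^esub> (y \<ominus>\<^bsub>A\<^esub> \<psi> y \<odot>\<^bsub>A\<^esub> \<one>\<^bsub>A\<^esub>) \<oplus>\<^bsub>A\<^esub> \<psi> y \<odot>\<^bsub>A\<^esub> (x \<ominus>\<^bsub>A\<^esub> \<psi> x \<odot>\<^bsub>A\<^esub> \<one>\<^bsub>A\<^esub>)"
    proof -
      have *: "(p \<ominus>\<^bsub>A\<^esub> r) = (p \<oplus>\<^bsub>A\<^esub> \<ominus>\<^bsub>A\<^esub> q) \<oplus>\<^bsub>A\<^esub> (q \<oplus>\<^bsub>A\<^esub> \<ominus>\<^bsub>A\<^esub> r)"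
        if "p \<in> carrier A" "q \<in> carrier A" "r \<in> carrier A" for p q r using that by algebra
      have "(\<psi> x \<otimes> \<psi> y) \<odot>\<^bsub>A\<^esub> \<one>\<^bsub>A\<^esub> = \<psi> y \<odot>\<^bsub>A\<^esub> (\<psi> x \<odot>\<^bsub>A\<^esub> \<one>\<^bsub>A\<^esub>)"
        using px py smult_assoc1[of "\<psi> y" "\<psi> x" "\<one>\<^bsub>A\<^esub>"] by (simp add: K_simprules)
      then show ?thesis
        using px py xy *[of "x \<otimes>\<^bsub>A\<^esub> y" "\<psi> y \<odot>\<^bsub>A\<^esub> x" "\<psi> y \<odot>\<^bsub>A\<^esub> (\<psi> x \<odot>\<^bsub>A\<^esub> \<one>\<^bsub>A\<^esub>)"]
        by (simp add: a_minus_def[of A] A.r_distr A.r_minus smult_r_distr smult_r_minus smult_mult_right)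
    qed
    also have "\<dots> \<in> L" using px py xy by (intro subspace_add subspace_smult mL sL) auto
    finally show "\<psi> (x \<otimes>\<^bsub>A\<^esub> y) = \<psi> x \<otimes> \<psi> y" using px py xy by (intro uniq) (auto simp: K_simprules)
    have "(x \<oplus>\<^bsub>A\<^esub> y) \<ominus>\<^bsub>A\<^esub> (\<psi> x \<oplus> \<psi> y) \<odot>\<^bsub>A\<^esub> \<one>\<^bsub>A\<^esub>
      = (x \<ominus>\<^bsub>A\<^esub> \<psi> x \<odot>\<^bsub>A\<^esub> \<one>\<^bsub>A\<^esub>) \<oplus>\<^bsub>A\<^esub> (y \<ominus>\<^bsub>A\<^esub> \<psi> y \<odot>\<^bsub>A\<^esub> \<one>\<^bsub>A\<^esub>)"
    proof -
      have "(x \<oplus>\<^bsub>A\<^esub> y) \<ominus>\<^bsub>A\<^esub> (p \<oplus>\<^bsub>A\<^esub> q) = (x \<ominus>\<^bsub>A\<^esub> p) \<oplus>\<^bsub>A\<^esub> (y \<ominus>\<^bsub>A\<^esub> q)"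
        if "p \<in> carrier A" "q \<in> carrier A" for p q using that xy by algebra
      then show ?thesis using px py by (simp add: smult_l_distr)
    qed
    also have "\<dots> \<in> L" using px py xy by (intro subspace_add sL) auto
    finally show "\<psi> (x \<oplus>\<^bsub>A\<^esub> y) = \<psi> x \<oplus> \<psi> y" using px py xy by (intro uniq) (auto simp: K_simprules)
  next
    show "\<psi> \<one>\<^bsub>A\<^esub> = \<one>" using subspace_zero[OF sL] by (intro uniq) (auto simp: minus_self)
  next
    fix c x assume cx: "c \<in> carrier K" "x \<in> carrier A"
    note px = \<psi>[OF cx(2)]
    have "c \<odot>\<^bsub>A\<^esub> x \<ominus>\<^bsub>A\<^esub> (c \<otimes> \<psi> x) \<odot>\<^bsub>A\<^esub> \<one>\<^bsub>A\<^esub> = c \<odot>\<^bsub>A\<^esub> (x \<ominus>\<^bsub>A\<^esub> \<psi> x \<odot>\<^bsub>A\<^esub> \<one>\<^bsub>A\<^esub>)"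
      using px cx by (simp add: a_minus_def[of A] smult_r_distr smult_r_minus smult_assoc1)
    also have "\<dots> \<in> L" using px cx by (intro subspace_smult sL) auto
    finally show "\<psi> (c \<odot>\<^bsub>A\<^esub> x) = c \<otimes> \<psi> x" using px cx by (intro uniq) (auto simp: K_simprules)
  qed
  moreover have "\<psi> x = \<zero>" if "x \<in> L\<^sub>0" for x
    using uniq[of x \<zero>] that L(2) subspace_carr[OF sL, of x] by (auto simp: smult_l_null a_minus_def)
  ultimately show ?thesis using that by blast
qed

end

section \<open>Products and powers of ideals\<close>

context k_algebra begin

definition mprod :: "'a list \<Rightarrow> 'a" where
  "mprod xs = foldr (\<lambda>x y. x \<otimes>\<^bsub>A\<^esub> y) xs \<one>\<^bsub>A\<^esub>"

lemma mprod_Nil [simp]: "mprod [] = \<one>\<^bsub>A\<^esub>"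
  and mprod_Cons [simp]: "mprod (x # xs) = x \<otimes>\<^bsub>A\<^esub> mprod xs"
  by (simp_all add: mprod_def)

lemma mprod_closed [simp]: "set xs \<subseteq> carrier A \<Longrightarrow> mprod xs \<in> carrier A"
  by (induction xs) auto

lemma mprod_append:
  "set xs \<subseteq> carrier A \<Longrightarrow> set ys \<subseteq> carrier A \<Longrightarrow> mprod (xs @ ys) = mprod xs \<otimes>\<^bsub>A\<^esub> mprod ys"
  by (induction xs) (auto simp: A.m_assoc)

text \<open>For an ideal J and n > 0 this is the usual n-th power. For n = 0 only the empty product
  occurs, which gives the scalar multiples of the unit and not the whole algebra; hence the side
  condition \<open>0 < n\<close> in later lemmas.\<close>

inductive_set pw :: "'a set \<Rightarrow> nat \<Rightarrow> 'a set" for J :: "'a set" and n :: nat where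
  pw_zero: "\<zero>\<^bsub>A\<^esub> \<in> pw J n"
| pw_prod: "set xs \<subseteq> J \<Longrightarrow> length xs = n \<Longrightarrow> mprod xs \<in> pw J n"
| pw_add: "x \<in> pw J n \<Longrightarrow> y \<in> pw J n \<Longrightarrow> x \<oplus>\<^bsub>A\<^esub> y \<in> pw J n"
| pw_smult: "c \<in> carrier K \<Longrightarrow> x \<in> pw J n \<Longrightarrow> c \<odot>\<^bsub>A\<^esub> x \<in> pw J n"

context
  fixes J
  assumes J: "J \<subseteq> carrier A"
begin

lemma pw_carr: "x \<in> pw J n \<Longrightarrow> x \<in> carrier A"
  by (induction rule: pw.induct) (use J in \<open>auto intro!: mprod_closed\<close>)

lemma pw_subspace: "subspace (pw J n)"
  by (rule subspaceI) (auto intro: pw_carr pw_zero pw_add pw_smult)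

lemma pw_subset_subspace:
  assumes U: "subspace U" and P: "\<And>xs. set xs \<subseteq> J \<Longrightarrow> length xs = n \<Longrightarrow> mprod xs \<in> U"
  shows "pw J n \<subseteq> U"
proof
  fix x assume "x \<in> pw J n"
  then show "x \<in> U"
    by (induction rule: pw.induct) (auto intro: P subspace_zero[OF U] subspace_add[OF U] subspace_smult[OF U])
qed

lemma pw_mult:
  assumes "x \<in> pw J m" "y \<in> pw J n"
  shows "x \<otimes>\<^bsub>A\<^esub> y \<in> pw J (m + n)"
  using assms(1)
proof (induction rule: pw.induct)
  case pw_zero
  then show ?case using pw_carr[OF assms(2)] by (simp add: pw.pw_zero)
next
  case (pw_prod xs)
  from assms(2) show ?case
  proof (induction rule: pw.induct)
    case (pw_prod ys)
    then show ?case
      using \<open>set xs \<subseteq> J\<close> \<open>length xs = m\<close> J pw.pw_prod[of "xs @ ys" J "m + n"]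
      by (auto simp: mprod_append)
  next
    case (pw_add y z)
    moreover have "mprod xs \<in> carrier A" using \<open>set xs \<subseteq> J\<close> J by (auto intro!: mprod_closed)
    ultimately show ?case using pw.pw_add pw_carr by (simp add: A.r_distr)
  next
    case (pw_smult c y)
    moreover have "mprod xs \<in> carrier A" using \<open>set xs \<subseteq> J\<close> J by (auto intro!: mprod_closed)
    ultimately show ?case using pw.pw_smult pw_carr by (simp add: smult_mult_right)
  next
    case pw_zero
    moreover have "mprod xs \<in> carrier A" using \<open>set xs \<subseteq> J\<close> J by (auto intro!: mprod_closed)
    ultimately show ?case using pw.pw_zero by simp
  qed
next
  case (pw_add x y)
  then show ?case using pw.pw_add pw_carr[OF assms(2)] pw_carr by (simp add: A.l_distr)
next
  case (pw_smult c x)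
  then show ?case using pw.pw_smult pw_carr[OF assms(2)] pw_carr by (simp add: smult_mult_left)
qed

lemma pw_one: "x \<in> J \<Longrightarrow> x \<in> pw J 1"
  using pw_prod[of "[x]" J 1] J by auto

text \<open>A product of m + n factors splits after m factors, so annihilation in two stages becomes
  annihilation by the larger power. Nakayama's argument uses this with a stable power, where both
  powers coincide.\<close>

lemma pw_double_annihilate:
  assumes z: "z \<in> pw J (m + n)" and x: "x \<in> carrier A"
    and ann: "\<And>a b. a \<in> pw J m \<Longrightarrow> b \<in> pw J n \<Longrightarrow> a \<otimes>\<^bsub>A\<^esub> (b \<otimes>\<^bsub>A\<^esub> x) = \<zero>\<^bsub>A\<^esub>"
  shows "z \<otimes>\<^bsub>A\<^esub> x = \<zero>\<^bsub>A\<^esub>"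
  using z
proof (induction rule: pw.induct)
  case (pw_prod xs)
  let ?a = "mprod (take m xs)" and ?b = "mprod (drop m xs)"
  have *: "set (take m xs) \<subseteq> J" "set (drop m xs) \<subseteq> J"
    using pw_prod set_take_subset set_drop_subset by fastforce+
  then have "?a \<in> pw J m" "?b \<in> pw J n" using pw_prod by (auto intro!: pw.pw_prod)
  moreover have "mprod xs = ?a \<otimes>\<^bsub>A\<^esub> ?b"
    using mprod_append[of "take m xs" "drop m xs"] * J by auto
  ultimately show ?case using ann[of ?a ?b] pw_carr x by (simp add: A.m_assoc)
qed (use x pw_carr in \<open>auto simp: A.l_distr smult_mult_left smult_r_null\<close>)

end

context
  fixes J
  assumes J: "ideal J A"
begin

lemma ideal_subset_carrier: "J \<subseteq> carrier A"
  using ideal_subspace[OF J] by (simp add: subspace_def)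

lemma pw_1_ideal: "pw J 1 = J"
proof
  show "pw J 1 \<subseteq> J"
  proof (rule pw_subset_subspace[OF ideal_subset_carrier ideal_subspace[OF J]])
    fix xs assume "set xs \<subseteq> J" "length xs = 1"
    then obtain x where "xs = [x]" "x \<in> J" by (auto simp: length_Suc_conv)
    then show "mprod xs \<in> J" using ideal_subset_carrier by auto
  qed
qed (rule subsetI, rule pw_one[OF ideal_subset_carrier])

lemma pw_l_closed:
  assumes "x \<in> pw J n" "0 < n" "a \<in> carrier A"
  shows "a \<otimes>\<^bsub>A\<^esub> x \<in> pw J n"
  using assms(1)
proof (induction rule: pw.induct)
  case (pw_prod xs)
  then obtain y ys where xs: "xs = y # ys" using assms(2) by (cases xs) auto
  then have "set ((a \<otimes>\<^bsub>A\<^esub> y) # ys) \<subseteq> J" using pw_prod assms(3) ideal.I_l_closed[OF J] by auto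
  moreover have "a \<otimes>\<^bsub>A\<^esub> mprod xs = mprod ((a \<otimes>\<^bsub>A\<^esub> y) # ys)"
  proof -
    have "set ys \<subseteq> carrier A" "y \<in> carrier A"
      using xs pw_prod ideal_subset_carrier by auto
    then show ?thesis using assms(3) by (simp add: xs A.m_assoc)
  qed
  ultimately show ?case using pw.pw_prod[of "(a \<otimes>\<^bsub>A\<^esub> y) # ys" J n] xs pw_prod by simp
qed (use assms(3) pw_carr[OF ideal_subset_carrier] in
      \<open>auto simp: A.r_distr smult_mult_right intro: pw.intros\<close>)

text \<open>The surplus factors at the front are absorbed into the remaining product, since J is an
  ideal. This needs a remaining factor, hence n > 0.\<close>

lemma pw_antimono:
  assumes "0 < n" "n \<le> m" shows "pw J m \<subseteq> pw J n"
proof (rule pw_subset_subspace[OF ideal_subset_carrier pw_subspace[OF ideal_subset_carrier]])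
  fix xs assume xs: "set xs \<subseteq> J" "length xs = m"
  have "set (take (m - n) xs) \<subseteq> J" "set (drop (m - n) xs) \<subseteq> J"
    using xs set_take_subset[of "m - n" xs] set_drop_subset[of "m - n" xs] by auto
  then have *: "set (take (m - n) xs) \<subseteq> carrier A" "set (drop (m - n) xs) \<subseteq> carrier A"
    "mprod (drop (m - n) xs) \<in> pw J n"
    using ideal_subset_carrier assms xs by (auto intro!: pw.pw_prod)
  then have "mprod (take (m - n) xs) \<otimes>\<^bsub>A\<^esub> mprod (drop (m - n) xs) \<in> pw J n"
    using assms by (intro pw_l_closed mprod_closed) auto
  then show "mprod xs \<in> pw J n" using mprod_append[OF *(1,2)] by simp
qed

end

end

section \<open>Nilpotent ideals, Fitting idempotents and primitive idempotents\<close>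

context fin_dim_algebra begin

text \<open>Nakayama's argument: a minimal left ideal not annihilated by the stable power of \<open>J\<close> cannot exist.\<close>

lemma nilpotent_if_quasi_regular:
  assumes J: "ideal J A"
    and qr: "\<And>n. n \<in> J \<Longrightarrow> \<exists>y\<in>carrier A. y \<otimes>\<^bsub>A\<^esub> (\<one>\<^bsub>A\<^esub> \<ominus>\<^bsub>A\<^esub> n) = \<one>\<^bsub>A\<^esub>"
  shows "\<exists>m>0. pw J m = {\<zero>\<^bsub>A\<^esub>}"
proof -
  note Jc = ideal_subset_carrier[OF J]
  \<comment> \<open>A positive power of least measure is stable: the power with exponent m + m is
    contained in it and cannot be smaller.\<close>
  have "\<exists>m. 0 < m \<and> (\<forall>k. 0 < k \<longrightarrow> sdim (pw J m) \<le> sdim (pw J k))"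
    using ex_has_least_nat[of "\<lambda>m. 0 < m" 1 "\<lambda>m. sdim (pw J m)"] by auto
  then obtain m where m: "0 < m" "\<And>k. 0 < k \<Longrightarrow> sdim (pw J m) \<le> sdim (pw J k)" by auto
  define N where "N = pw J m"
  have sN: "subspace N" unfolding N_def by (rule pw_subspace[OF Jc])
  have N2: "pw J (m + m) = N"
    unfolding N_def using m by (intro sdim_antimono_eq pw_subspace[OF Jc] pw_antimono[OF J]) auto
  have NJ: "N \<subseteq> J" using pw_antimono[OF J, of 1 m] m(1) pw_1_ideal[OF J] by (simp add: N_def)
  have "N = {\<zero>\<^bsub>A\<^esub>}"
  proof (rule ccontr)
    assume "N \<noteq> {\<zero>\<^bsub>A\<^esub>}"
    then obtain n1 where n1: "n1 \<in> N" "n1 \<noteq> \<zero>\<^bsub>A\<^esub>" using subspace_zero[OF sN] by auto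
    let ?P = "\<lambda>L. left_ideal L \<and> (\<exists>n\<in>N. \<exists>x\<in>L. n \<otimes>\<^bsub>A\<^esub> x \<noteq> \<zero>\<^bsub>A\<^esub>)"
    have "?P (carrier A)"
    proof
      show "left_ideal (carrier A)" by (simp add: left_ideal_def subspace_carrier)
      have "n1 \<otimes>\<^bsub>A\<^esub> \<one>\<^bsub>A\<^esub> \<noteq> \<zero>\<^bsub>A\<^esub>" using n1 subspace_carr[OF sN] by simp
      then show "\<exists>n\<in>N. \<exists>x\<in>carrier A. n \<otimes>\<^bsub>A\<^esub> x \<noteq> \<zero>\<^bsub>A\<^esub>" using n1(1) by blast
    qed
    then obtain L where L: "?P L" "\<And>L'. ?P L' \<Longrightarrow> sdim L \<le> sdim L'"
      using ex_has_least_nat[of ?P "carrier A" sdim] by blast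
    then obtain n0 x0 where n0: "n0 \<in> N" "x0 \<in> L" "n0 \<otimes>\<^bsub>A\<^esub> x0 \<noteq> \<zero>\<^bsub>A\<^esub>" by blast
    have sL: "subspace L" using L by (simp add: left_ideal_def)
    have x0: "x0 \<in> carrier A" using subspace_carr[OF sL] n0 by simp
    \<comment> \<open>N x0 is a left ideal inside L which N does not annihilate, because N is equal
      to the doubled power. By minimality it is all of L, so x0 = n x0 for some n in N; as 1 - n has
      a left inverse, x0 = 0.\<close>
    let ?L = "{n \<otimes>\<^bsub>A\<^esub> x0 | n. n \<in> N}"
    have lL: "left_ideal ?L"
    proof (rule left_idealI)
      show "?L \<subseteq> carrier A" using x0 subspace_carr[OF sN] by auto
      show "\<zero>\<^bsub>A\<^esub> \<in> ?L" using subspace_zero[OF sN] x0 by (auto intro!: exI[of _ "\<zero>\<^bsub>A\<^esub>"])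
    next
      fix u v assume "u \<in> ?L" "v \<in> ?L"
      then obtain a b where "a \<in> N" "b \<in> N" "u = a \<otimes>\<^bsub>A\<^esub> x0" "v = b \<otimes>\<^bsub>A\<^esub> x0" by auto
      then show "u \<oplus>\<^bsub>A\<^esub> v \<in> ?L"
        using x0 subspace_carr[OF sN] subspace_add[OF sN, of a b]
        by (auto simp: A.l_distr intro!: exI[of _ "a \<oplus>\<^bsub>A\<^esub> b"])
    next
      fix a u assume "a \<in> carrier A" "u \<in> ?L"
      then obtain b where "b \<in> N" "u = b \<otimes>\<^bsub>A\<^esub> x0" by auto
      then show "a \<otimes>\<^bsub>A\<^esub> u \<in> ?L"
        using x0 subspace_carr[OF sN] \<open>a \<in> carrier A\<close> pw_l_closed[OF J, of b m a] m(1)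
        by (auto simp: A.m_assoc N_def intro!: exI[of _ "a \<otimes>\<^bsub>A\<^esub> b"])
    qed
    have LL: "?L \<subseteq> L" using L(1) n0(2) subspace_carr[OF sN] by (auto simp: left_ideal_def)
    have "\<exists>n\<in>N. \<exists>x\<in>?L. n \<otimes>\<^bsub>A\<^esub> x \<noteq> \<zero>\<^bsub>A\<^esub>"
    proof (rule ccontr)
      assume "\<not> (\<exists>n\<in>N. \<exists>x\<in>?L. n \<otimes>\<^bsub>A\<^esub> x \<noteq> \<zero>\<^bsub>A\<^esub>)"
      then have "a \<otimes>\<^bsub>A\<^esub> (b \<otimes>\<^bsub>A\<^esub> x0) = \<zero>\<^bsub>A\<^esub>" if "a \<in> pw J m" "b \<in> pw J m" for a b
        using that by (auto simp: N_def)
      moreover have "n0 \<in> pw J (m + m)" using n0 N2 by simp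
      ultimately show False using pw_double_annihilate[OF Jc _ x0] n0(3) by blast
    qed
    then have "sdim L \<le> sdim ?L" using lL by (intro L(2)) blast
    then have "?L = L" using lL sL LL by (intro sdim_antimono_eq) (auto simp: left_ideal_def)
    then obtain n where n: "n \<in> N" "x0 = n \<otimes>\<^bsub>A\<^esub> x0" using n0(2) by blast
    then obtain y where y: "y \<in> carrier A" "y \<otimes>\<^bsub>A\<^esub> (\<one>\<^bsub>A\<^esub> \<ominus>\<^bsub>A\<^esub> n) = \<one>\<^bsub>A\<^esub>" using qr NJ by blast
    have nc: "n \<in> carrier A" using n subspace_carr[OF sN] by simp
    have "(\<one>\<^bsub>A\<^esub> \<ominus>\<^bsub>A\<^esub> n) \<otimes>\<^bsub>A\<^esub> x0 = x0 \<ominus>\<^bsub>A\<^esub> n \<otimes>\<^bsub>A\<^esub> x0" using nc x0 by algebra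
    also have "\<dots> = \<zero>\<^bsub>A\<^esub>" using n(2) x0 minus_self by simp
    finally have "y \<otimes>\<^bsub>A\<^esub> ((\<one>\<^bsub>A\<^esub> \<ominus>\<^bsub>A\<^esub> n) \<otimes>\<^bsub>A\<^esub> x0) = \<zero>\<^bsub>A\<^esub>" using y by simp
    then have "x0 = \<zero>\<^bsub>A\<^esub>" using A.m_assoc[of y "\<one>\<^bsub>A\<^esub> \<ominus>\<^bsub>A\<^esub> n" x0] y nc x0 by simp
    then show False using n0 subspace_carr[OF sN] by simp
  qed
  then show ?thesis using m N_def by auto
qed

text \<open>Fitting's lemma: once the right ideal x^l A and the left ideal A x^l are stable, a = x^l
  satisfies a = a a y = z a a. Then a y = z a, and this element is an idempotent fixing a under
  multiplication from the right.\<close>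

lemma fitting_idempotent:
  assumes x: "x \<in> carrier A"
  obtains l g y z where "0 < l" "y \<in> carrier A" "z \<in> carrier A"
    "g = (x [^]\<^bsub>A\<^esub> (l::nat)) \<otimes>\<^bsub>A\<^esub> y" "g = z \<otimes>\<^bsub>A\<^esub> (x [^]\<^bsub>A\<^esub> l)" "g \<otimes>\<^bsub>A\<^esub> g = g"
    "(x [^]\<^bsub>A\<^esub> l) \<otimes>\<^bsub>A\<^esub> g = x [^]\<^bsub>A\<^esub> l"
proof -
  let ?R = "\<lambda>a. {a \<otimes>\<^bsub>A\<^esub> y | y. y \<in> carrier A}" and ?L = "\<lambda>a. {y \<otimes>\<^bsub>A\<^esub> a | y. y \<in> carrier A}"
  \<comment> \<open>Minimising the sum of both measures makes the right and the left ideal stable at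
    the same exponent.\<close>
  let ?f = "\<lambda>l::nat. sdim (?R (x [^]\<^bsub>A\<^esub> l)) + sdim (?L (x [^]\<^bsub>A\<^esub> l))"
  have "\<exists>m. 0 < m \<and> (\<forall>k. 0 < k \<longrightarrow> ?f m \<le> ?f k)"
    using ex_has_least_nat[of "\<lambda>m. 0 < m" 1 ?f] by auto
  then obtain l where l: "0 < l" "\<And>k. 0 < k \<Longrightarrow> ?f l \<le> ?f k" by blast
  define a where "a = x [^]\<^bsub>A\<^esub> l"
  have a: "a \<in> carrier A" using x by (simp add: a_def)
  have aa: "x [^]\<^bsub>A\<^esub> (l + l) = a \<otimes>\<^bsub>A\<^esub> a" using x by (simp add: a_def A.nat_pow_mult)
  have sL: "subspace (?L b)" if "b \<in> carrier A" for b
    using left_ideal_principal[OF that] by (simp add: left_ideal_def)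
  have sR: "subspace (?R b)" if b: "b \<in> carrier A" for b
  proof (rule subspaceI)
    show "?R b \<subseteq> carrier A" using b by auto
    show "\<zero>\<^bsub>A\<^esub> \<in> ?R b" using b by (auto intro!: exI[of _ "\<zero>\<^bsub>A\<^esub>"])
    show "u \<oplus>\<^bsub>A\<^esub> v \<in> ?R b" if uv: "u \<in> ?R b" "v \<in> ?R b" for u v
    proof -
      obtain p q where "p \<in> carrier A" "q \<in> carrier A" "u = b \<otimes>\<^bsub>A\<^esub> p" "v = b \<otimes>\<^bsub>A\<^esub> q" using uv by auto
      then show ?thesis using b by (auto intro!: exI[of _ "p \<oplus>\<^bsub>A\<^esub> q"] simp: A.r_distr)
    qed
    show "c \<odot>\<^bsub>A\<^esub> u \<in> ?R b" if cu: "c \<in> carrier K" "u \<in> ?R b" for c u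
    proof -
      obtain p where "p \<in> carrier A" "u = b \<otimes>\<^bsub>A\<^esub> p" using cu by auto
      then show ?thesis using b cu by (auto intro!: exI[of _ "c \<odot>\<^bsub>A\<^esub> p"] simp: smult_mult_right)
    qed
  qed
  have subR: "?R (a \<otimes>\<^bsub>A\<^esub> a) \<subseteq> ?R a" and subL: "?L (a \<otimes>\<^bsub>A\<^esub> a) \<subseteq> ?L a"
    using a by (auto simp: A.m_assoc) (metis A.m_assoc A.m_closed)
  have aac: "a \<otimes>\<^bsub>A\<^esub> a \<in> carrier A" using a by simp
  have "sdim (?R (a \<otimes>\<^bsub>A\<^esub> a)) \<le> sdim (?R a)" "sdim (?L (a \<otimes>\<^bsub>A\<^esub> a)) \<le> sdim (?L a)"
    using sdim_strict[OF sR[OF aac] sR[OF a]] sdim_strict[OF sL[OF aac] sL[OF a]] subR subL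
    by (metis (no_types, lifting) less_imp_le order_refl psubsetI)+
  moreover have "?f l \<le> ?f (l + l)" using l(1) by (intro l(2)) simp
  ultimately have le: "sdim (?R a) \<le> sdim (?R (a \<otimes>\<^bsub>A\<^esub> a))" "sdim (?L a) \<le> sdim (?L (a \<otimes>\<^bsub>A\<^esub> a))"
    unfolding aa a_def[symmetric] by linarith+
  have "?R (a \<otimes>\<^bsub>A\<^esub> a) = ?R a" "?L (a \<otimes>\<^bsub>A\<^esub> a) = ?L a"
    using sdim_antimono_eq[OF sR[OF aac] sR[OF a] subR le(1)] sdim_antimono_eq[OF sL[OF aac] sL[OF a] subL le(2)] by auto
  moreover have "a \<in> ?R a" "a \<in> ?L a" using a by (auto intro!: exI[of _ "\<one>\<^bsub>A\<^esub>"])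
  ultimately have "a \<in> ?R (a \<otimes>\<^bsub>A\<^esub> a)" "a \<in> ?L (a \<otimes>\<^bsub>A\<^esub> a)" by auto
  then obtain y z where yz: "y \<in> carrier A" "z \<in> carrier A" "a = a \<otimes>\<^bsub>A\<^esub> a \<otimes>\<^bsub>A\<^esub> y" "a = z \<otimes>\<^bsub>A\<^esub> (a \<otimes>\<^bsub>A\<^esub> a)"
    by blast
  define g where "g = a \<otimes>\<^bsub>A\<^esub> y"
  have gz: "g = z \<otimes>\<^bsub>A\<^esub> a"
  proof -
    have "z \<otimes>\<^bsub>A\<^esub> a = z \<otimes>\<^bsub>A\<^esub> (a \<otimes>\<^bsub>A\<^esub> a \<otimes>\<^bsub>A\<^esub> y)" using yz(3) by simp
    also have "\<dots> = (z \<otimes>\<^bsub>A\<^esub> (a \<otimes>\<^bsub>A\<^esub> a)) \<otimes>\<^bsub>A\<^esub> y" using a yz(1,2) by (simp add: A.m_assoc)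
    also have "\<dots> = g" using yz(4) g_def by simp
    finally show ?thesis by simp
  qed
  have ag: "a \<otimes>\<^bsub>A\<^esub> g = a" using yz(3) a yz(1) by (simp add: g_def A.m_assoc)
  have "g \<otimes>\<^bsub>A\<^esub> g = z \<otimes>\<^bsub>A\<^esub> (a \<otimes>\<^bsub>A\<^esub> g)"
    using gz a yz(1,2) A.m_assoc[of z a g] g_def by (metis A.m_closed)
  then have "g \<otimes>\<^bsub>A\<^esub> g = g" using ag gz by simp
  then show ?thesis using that[of l y z g] l(1) yz(1,2) g_def gz ag by (simp add: a_def)
qed

lemma character_pow:
  assumes "character \<psi>" "x \<in> carrier A" "\<psi> x = \<zero> \<or> \<psi> x = \<one>" "0 < (l::nat)"
  shows "\<psi> (x [^]\<^bsub>A\<^esub> l) = \<psi> x"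
  using assms(4)
proof (induction l rule: nat_induct_non_zero)
  case 1
  then show ?case using assms by simp
next
  case (Suc n)
  then show ?case using assms(1-3) by (auto simp: character_mult K_simprules)
qed

lemma character_idempotent:
  assumes "character \<psi>" "idempotent A g"
  shows "\<psi> g = \<zero> \<or> \<psi> g = \<one>"
proof -
  have g: "g \<in> carrier A" "\<psi> g \<otimes> \<psi> g = \<psi> g" using assms character_mult[of \<psi> g g] by (auto simp: idempotent_def)
  have pc: "\<psi> g \<in> carrier K" using character_closed[OF assms(1) g(1)] .
  show ?thesis
  proof (cases "\<psi> g = \<zero>")
    case False
    then have ci: "inv (\<psi> g) \<in> carrier K" "inv (\<psi> g) \<otimes> \<psi> g = \<one>" using pc field_Units by auto
    then have "\<psi> g = (inv (\<psi> g) \<otimes> \<psi> g) \<otimes> \<psi> g" using pc by (simp add: K_simprules)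
    also have "\<dots> = \<one>" using K_m_assoc[OF ci(1) pc pc] g(2) ci by simp
    finally show ?thesis by simp
  qed simp
qed

text \<open>If the values differed at u, there would be an idempotent g below e with \<psi>(g) = 1
  and \<chi>(g) = 0, and e = g + (e - g) would split e into two non-zero orthogonal
  idempotents.\<close>

lemma character_eq_at_primitive:
  assumes e: "primitive_idempotent A e" and \<psi>: "character \<psi>" "\<psi> e = \<one>" and \<chi>: "character \<chi>" "\<chi> e = \<one>"
    and u: "u \<in> carrier A"
  shows "\<psi> u = \<chi> u"
proof (rule ccontr)
  assume ne: "\<psi> u \<noteq> \<chi> u"
  have ec: "e \<in> carrier A" "e \<otimes>\<^bsub>A\<^esub> e = e" using e by (auto simp: primitive_idempotent_def idempotent_def)
  note pu = character_closed[OF \<psi>(1) u] and cu = character_closed[OF \<chi>(1) u]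
  let ?d = "\<psi> u \<ominus> \<chi> u"
  have "?d \<noteq> \<zero>" using ne pu cu by (simp add: r_right_minus_eq)
  then have di: "inv ?d \<in> carrier K" "inv ?d \<otimes> ?d = \<one>" using pu cu field_Units by (auto simp: K_simprules)
  \<comment> \<open>The element u is shifted and scaled so that \<psi> takes the value 1 and \<chi>
    the value 0.\<close>
  define v where "v = inv ?d \<odot>\<^bsub>A\<^esub> (u \<ominus>\<^bsub>A\<^esub> \<chi> u \<odot>\<^bsub>A\<^esub> \<one>\<^bsub>A\<^esub>)"
  have vc: "v \<in> carrier A" using u di cu by (simp add: v_def)
  have "\<psi> v = \<one>" "\<chi> v = \<zero>"
    using \<psi>(1) \<chi>(1) u cu pu di
    by (simp_all add: v_def character_smult character_minus character_one)
       (simp_all add: K_simprules)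
  \<comment> \<open>Passing to e v e keeps both values and moves into the corner e A e, so that the
    Fitting idempotent g satisfies e g = g = g e.\<close>
  define x where "x = e \<otimes>\<^bsub>A\<^esub> v \<otimes>\<^bsub>A\<^esub> e"
  have xc: "x \<in> carrier A" using ec vc by (simp add: x_def)
  have px: "\<psi> x = \<one>" "\<chi> x = \<zero>"
    using \<open>\<psi> v = \<one>\<close> \<open>\<chi> v = \<zero>\<close> \<psi> \<chi> ec vc by (simp_all add: x_def character_mult K_simprules)
  have ex: "e \<otimes>\<^bsub>A\<^esub> x = x" "x \<otimes>\<^bsub>A\<^esub> e = x"
    using ec vc A.m_assoc[of e e "v \<otimes>\<^bsub>A\<^esub> e"] by (simp_all add: x_def A.m_assoc)
  obtain l g y z where g: "0 < l" "y \<in> carrier A" "z \<in> carrier A" "g = (x [^]\<^bsub>A\<^esub> (l::nat)) \<otimes>\<^bsub>A\<^esub> y"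
    "g = z \<otimes>\<^bsub>A\<^esub> (x [^]\<^bsub>A\<^esub> l)" "g \<otimes>\<^bsub>A\<^esub> g = g" "(x [^]\<^bsub>A\<^esub> l) \<otimes>\<^bsub>A\<^esub> g = x [^]\<^bsub>A\<^esub> l"
    by (rule fitting_idempotent[OF xc])
  define a where "a = x [^]\<^bsub>A\<^esub> l"
  have ac: "a \<in> carrier A" using xc by (simp add: a_def)
  have gc: "g \<in> carrier A" using g(2,4) xc by simp
  have ea: "e \<otimes>\<^bsub>A\<^esub> a = a"
  proof -
    obtain k where "l = Suc k" using g(1) by (cases l) auto
    then have "a = x \<otimes>\<^bsub>A\<^esub> x [^]\<^bsub>A\<^esub> k" using xc A.nat_pow_Suc2 by (simp add: a_def)
    then show ?thesis using ex(1) ec xc A.m_assoc[of e x "x [^]\<^bsub>A\<^esub> k"] by simp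
  qed
  have ae: "a \<otimes>\<^bsub>A\<^esub> e = a"
  proof -
    obtain k where "l = Suc k" using g(1) by (cases l) auto
    then have "a = x [^]\<^bsub>A\<^esub> k \<otimes>\<^bsub>A\<^esub> x" by (simp add: a_def)
    then show ?thesis using ex(2) ec xc A.m_assoc[of "x [^]\<^bsub>A\<^esub> k" x e] by simp
  qed
  have eg: "e \<otimes>\<^bsub>A\<^esub> g = g" "g \<otimes>\<^bsub>A\<^esub> e = g"
    using ea ae ec ac g(2-5) A.m_assoc[of e a y] A.m_assoc[of z a e] by (simp_all add: a_def)
  have pa: "\<psi> a = \<one>" "\<chi> a = \<zero>"
    using character_pow[OF \<psi>(1) xc _ g(1)] character_pow[OF \<chi>(1) xc _ g(1)] px by (auto simp: a_def)
  \<comment> \<open>The value of \<psi> comes from a g = a, the value of \<chi> from g = a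
    y.\<close>
  have pg: "\<psi> g = \<one>"
    using character_mult[OF \<psi>(1) ac gc] g(7) pa character_closed[OF \<psi>(1) gc] by (simp add: a_def K_simprules)
  have cg: "\<chi> g = \<zero>"
    using character_mult[OF \<chi>(1) ac g(2)] g(4) pa character_closed[OF \<chi>(1) g(2)] by (simp add: a_def K_simprules)
  let ?h = "e \<ominus>\<^bsub>A\<^esub> g"
  have gh: "g \<otimes>\<^bsub>A\<^esub> ?h = \<zero>\<^bsub>A\<^esub>" "?h \<otimes>\<^bsub>A\<^esub> g = \<zero>\<^bsub>A\<^esub>" "?h \<otimes>\<^bsub>A\<^esub> ?h = ?h"
  proof -
    show 1: "g \<otimes>\<^bsub>A\<^esub> ?h = \<zero>\<^bsub>A\<^esub>"
      using eg(2) g(6) gc ec(1) by (simp add: a_minus_def A.r_distr A.r_minus M.r_neg)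
    show "?h \<otimes>\<^bsub>A\<^esub> g = \<zero>\<^bsub>A\<^esub>"
      using eg(1) g(6) gc ec(1) by (simp add: a_minus_def A.l_distr A.l_minus M.r_neg)
    have "?h \<otimes>\<^bsub>A\<^esub> ?h = e \<otimes>\<^bsub>A\<^esub> ?h \<ominus>\<^bsub>A\<^esub> g \<otimes>\<^bsub>A\<^esub> ?h" using gc ec(1) by (simp add: a_minus_def A.l_distr A.l_minus)
    also have "e \<otimes>\<^bsub>A\<^esub> ?h = ?h" using eg(1) ec gc by (simp add: a_minus_def A.r_distr A.r_minus)
    finally show "?h \<otimes>\<^bsub>A\<^esub> ?h = ?h" using 1 ec gc by (simp add: a_minus_def[of A _ "\<zero>\<^bsub>A\<^esub>"])
  qed
  have "e = g \<oplus>\<^bsub>A\<^esub> ?h" using ec(1) gc by algebra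
  moreover have "idempotent A g" "idempotent A ?h" using gc ec g(6) gh by (auto simp: idempotent_def)
  moreover have "g \<noteq> \<zero>\<^bsub>A\<^esub>" using pg character_zero[OF \<psi>(1)] by auto
  moreover have "?h \<noteq> \<zero>\<^bsub>A\<^esub>"
  proof
    assume "?h = \<zero>\<^bsub>A\<^esub>"
    then have "\<chi> ?h = \<zero>" using character_zero[OF \<chi>(1)] by simp
    then show False using character_minus[OF \<chi>(1) ec(1) gc] \<chi>(2) cg by (simp add: K_simprules a_minus_def)
  qed
  ultimately show False using e gh unfolding primitive_idempotent_def by blast
qed

text \<open>A character that vanishes on A (1 - e) takes the value 1 at e. This left ideal is
  proper, since 1 = x (1 - e) would give e = x (1 - e) e = 0.\<close>

lemma ex_character_at_idempotent:
  assumes simp: "one_dim_simples K A" and e: "idempotent A e" "e \<noteq> \<zero>\<^bsub>A\<^esub>"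
  obtains \<chi> where "character \<chi>" "\<chi> e = \<one>"
proof -
  have ec: "e \<in> carrier A" "e \<otimes>\<^bsub>A\<^esub> e = e" using e by (auto simp: idempotent_def)
  let ?f = "\<one>\<^bsub>A\<^esub> \<ominus>\<^bsub>A\<^esub> e"
  let ?L = "{x \<otimes>\<^bsub>A\<^esub> ?f | x. x \<in> carrier A}"
  have fe: "?f \<otimes>\<^bsub>A\<^esub> e = \<zero>\<^bsub>A\<^esub>" using ec by (simp add: a_minus_def A.l_distr A.l_minus M.r_neg)
  have "\<one>\<^bsub>A\<^esub> \<notin> ?L"
  proof
    assume "\<one>\<^bsub>A\<^esub> \<in> ?L"
    then obtain x where x: "x \<in> carrier A" "\<one>\<^bsub>A\<^esub> = x \<otimes>\<^bsub>A\<^esub> ?f" by auto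
    have "e = \<one>\<^bsub>A\<^esub> \<otimes>\<^bsub>A\<^esub> e" using ec by simp
    also have "\<dots> = x \<otimes>\<^bsub>A\<^esub> (?f \<otimes>\<^bsub>A\<^esub> e)" using x ec A.m_assoc[of x ?f e] by simp
    also have "\<dots> = \<zero>\<^bsub>A\<^esub>" using fe x by simp
    finally show False using e by simp
  qed
  then obtain \<chi> where \<chi>: "character \<chi>" "\<And>x. x \<in> ?L \<Longrightarrow> \<chi> x = \<zero>"
    using ex_character[OF simp left_ideal_principal, of ?f] ec by auto
  have "?f \<in> ?L" using ec by (auto intro!: exI[of _ "\<one>\<^bsub>A\<^esub>"])
  then have "\<one> \<ominus> \<chi> e = \<zero>" using \<chi> character_minus[OF \<chi>(1) _ ec(1), of "\<one>\<^bsub>A\<^esub>"] by (simp add: character_one)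
  then have "\<chi> e = \<one>" using character_closed[OF \<chi>(1) ec(1)] by (simp add: r_right_minus_eq)
  then show ?thesis using that \<chi>(1) by blast
qed

text \<open>For the characters constructed below this ideal is nilpotent and plays the part of the
  radical.\<close>

definition joint_kernel :: "nat \<Rightarrow> (nat \<Rightarrow> 'c \<Rightarrow> 'a) \<Rightarrow> 'c set" where
  "joint_kernel n \<chi> = {x \<in> carrier A. \<forall>i<n. \<chi> i x = \<zero>}"

lemma joint_kernel_ideal:
  assumes \<chi>: "\<And>i. i < n \<Longrightarrow> character (\<chi> i)"
  shows "ideal (joint_kernel n \<chi>) A"
proof (rule idealI)
  show "subgroup (joint_kernel n \<chi>) (add_monoid A)"
  proof (rule subgroup.intro)
    fix x assume x: "x \<in> joint_kernel n \<chi>"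
    then have "\<ominus>\<^bsub>A\<^esub> x \<in> joint_kernel n \<chi>"
      using \<chi> character_smult[OF \<chi>, of _ "\<ominus> \<one>" x] by (auto simp: joint_kernel_def smult_neg_one K_simprules)
    then show "inv\<^bsub>add_monoid A\<^esub> x \<in> joint_kernel n \<chi>" by (simp add: a_inv_def)
  qed (use \<chi> in \<open>auto simp: joint_kernel_def character_add character_zero K_simprules\<close>)
qed (use \<chi> A.ring_axioms in \<open>auto simp: joint_kernel_def character_mult character_closed K_simprules\<close>)

text \<open>The idempotents come from \<open>basic\<close>, and each of them has a character.
  Nilpotency rests on quasi-regularity: if 1 - r had no left inverse, some character \<psi> would
  satisfy \<psi>(r) = 1. But \<psi> takes the value 1 at some e i, because these sum to the unit; so
  it agrees with \<chi> i everywhere and vanishes at r.\<close>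

theorem idempotents_and_characters:
  assumes simp: "one_dim_simples K A" and "basic A"
  obtains n :: nat and e \<chi> where
    "\<And>i. i < n \<Longrightarrow> e i \<in> carrier A"
    "\<And>i j. i < n \<Longrightarrow> j < n \<Longrightarrow> e i \<otimes>\<^bsub>A\<^esub> e j = (if i = j then e i else \<zero>\<^bsub>A\<^esub>)"
    "(\<Oplus>\<^bsub>A\<^esub>i\<in>{..<n}. e i) = \<one>\<^bsub>A\<^esub>"
    "\<And>i. i < n \<Longrightarrow> character (\<chi> i)"
    "\<And>i j. i < n \<Longrightarrow> j < n \<Longrightarrow> \<chi> i (e j) = (if i = j then \<one> else \<zero>)"
    "\<exists>m>0. pw (joint_kernel n \<chi>) m = {\<zero>\<^bsub>A\<^esub>}"
proof -
  obtain E where E: "finite E" "\<forall>e \<in> E. primitive_idempotent A e"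
     "\<forall>e \<in> E. \<forall>f \<in> E. e \<noteq> f \<longrightarrow> e \<otimes>\<^bsub>A\<^esub> f = \<zero>\<^bsub>A\<^esub>" "(\<Oplus>\<^bsub>A\<^esub>e\<in>E. e) = \<one>\<^bsub>A\<^esub>"
    using assms(2) unfolding basic_def by blast
  define n where "n = card E"
  obtain e where e: "bij_betw e {..<n} E"
    using ex_bij_betw_nat_finite[OF E(1)] unfolding n_def atLeast0LessThan by blast
  have eE: "e i \<in> E" if "i < n" for i using e that by (auto simp: bij_betw_def)
  have prim: "primitive_idempotent A (e i)" if "i < n" for i using E(2) eE that by auto
  have ec: "e i \<in> carrier A" "e i \<otimes>\<^bsub>A\<^esub> e i = e i" "idempotent A (e i)" "e i \<noteq> \<zero>\<^bsub>A\<^esub>" if "i < n" for i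
    using prim[OF that] by (auto simp: primitive_idempotent_def idempotent_def)
  have orth: "e i \<otimes>\<^bsub>A\<^esub> e j = (if i = j then e i else \<zero>\<^bsub>A\<^esub>)" if "i < n" "j < n" for i j
  proof (cases "i = j")
    case False
    then have "e i \<noteq> e j" using e that by (auto simp: bij_betw_def inj_on_def)
    then show ?thesis using E(3) eE[OF that(1)] eE[OF that(2)] False by simp
  qed (use ec(2) that in simp)
  have sum: "(\<Oplus>\<^bsub>A\<^esub>i\<in>{..<n}. e i) = \<one>\<^bsub>A\<^esub>"
  proof -
    have "(\<Oplus>\<^bsub>A\<^esub>f\<in>e ` {..<n}. f) = (\<Oplus>\<^bsub>A\<^esub>i\<in>{..<n}. e i)"
      using e ec(1) by (intro M.finsum_reindex) (auto simp: bij_betw_def)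
    then show ?thesis using E(4) e by (simp add: bij_betw_def)
  qed
  have "\<forall>i. \<exists>\<chi>. i < n \<longrightarrow> character \<chi> \<and> \<chi> (e i) = \<one>"
    using ex_character_at_idempotent[OF simp ec(3,4)] by metis
  then obtain \<chi> where \<chi>: "\<And>i. i < n \<Longrightarrow> character (\<chi> i)" "\<And>i. i < n \<Longrightarrow> \<chi> i (e i) = \<one>" by metis
  have \<chi>e: "\<chi> i (e j) = (if i = j then \<one> else \<zero>)" if ij: "i < n" "j < n" for i j
  proof (cases "i = j")
    case False
    then have "\<chi> i (e i) \<otimes> \<chi> i (e j) = \<zero>"
      using character_mult[OF \<chi>(1)[OF ij(1)] ec(1)[OF ij(1)] ec(1)[OF ij(2)]] orth[OF ij] character_zero[OF \<chi>(1)[OF ij(1)]] by simp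
    then show ?thesis using False \<chi>(2)[OF ij(1)] character_closed[OF \<chi>(1)[OF ij(1)] ec(1)[OF ij(2)]] by (simp add: K_simprules)
  qed (use \<chi>(2) ij in auto)
  let ?J = "joint_kernel n \<chi>"
  have "\<exists>y\<in>carrier A. y \<otimes>\<^bsub>A\<^esub> (\<one>\<^bsub>A\<^esub> \<ominus>\<^bsub>A\<^esub> r) = \<one>\<^bsub>A\<^esub>" if r: "r \<in> ?J" for r
  proof (rule ccontr)
    assume no: "\<not> (\<exists>y\<in>carrier A. y \<otimes>\<^bsub>A\<^esub> (\<one>\<^bsub>A\<^esub> \<ominus>\<^bsub>A\<^esub> r) = \<one>\<^bsub>A\<^esub>)"
    have rc: "r \<in> carrier A" using r by (simp add: joint_kernel_def)
    let ?L = "{x \<otimes>\<^bsub>A\<^esub> (\<one>\<^bsub>A\<^esub> \<ominus>\<^bsub>A\<^esub> r) | x. x \<in> carrier A}"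
    have "\<one>\<^bsub>A\<^esub> \<notin> ?L" using no by auto
    then obtain \<psi> where \<psi>: "character \<psi>" "\<And>x. x \<in> ?L \<Longrightarrow> \<psi> x = \<zero>"
      using ex_character[OF simp left_ideal_principal, of "\<one>\<^bsub>A\<^esub> \<ominus>\<^bsub>A\<^esub> r"] rc by auto
    have "\<one>\<^bsub>A\<^esub> \<ominus>\<^bsub>A\<^esub> r \<in> ?L" using rc by (auto intro!: exI[of _ "\<one>\<^bsub>A\<^esub>"])
    then have "\<one> \<ominus> \<psi> r = \<zero>" using \<psi> character_minus[OF \<psi>(1) _ rc, of "\<one>\<^bsub>A\<^esub>"] by (simp add: character_one)
    then have pr: "\<psi> r = \<one>" using character_closed[OF \<psi>(1) rc] by (simp add: r_right_minus_eq)
    have "\<exists>i<n. \<psi> (e i) \<noteq> \<zero>"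
    proof (rule ccontr)
      assume "\<not> (\<exists>i<n. \<psi> (e i) \<noteq> \<zero>)"
      moreover have "subspace {x \<in> carrier A. \<psi> x = \<zero>}"
        by (rule subspaceI) (use \<psi>(1) in \<open>auto simp: character_add character_zero character_smult K_simprules\<close>)
      ultimately have "(\<Oplus>\<^bsub>A\<^esub>i\<in>{..<n}. e i) \<in> {x \<in> carrier A. \<psi> x = \<zero>}"
        using ec(1) by (intro subspace_finsum) auto
      then show False using sum character_one[OF \<psi>(1)] by simp
    qed
    then obtain i where i: "i < n" "\<psi> (e i) = \<one>" using character_idempotent[OF \<psi>(1) ec(3)] by blast
    have "\<psi> r = \<chi> i r"
      using character_eq_at_primitive[OF prim[OF i(1)] \<psi>(1) i(2) \<chi>[OF i(1)] rc] .
    then show False using pr r i(1) by (simp add: joint_kernel_def)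
  qed
  then have "\<exists>m>0. pw ?J m = {\<zero>\<^bsub>A\<^esub>}"
    using nilpotent_if_quasi_regular[OF joint_kernel_ideal[of n \<chi>]] \<chi>(1) by blast
  then show ?thesis using that[of n e \<chi>] ec(1) orth sum \<chi>(1) \<chi>e by blast
qed

end

section \<open>Invariance of the projective dimension\<close>

text \<open>Group axioms have to pass between records that share the additive structure but differ
  in other fields, such as a bimodule, its right module and its underlying vector space.\<close>

lemma abelian_group_cong:
  fixes M :: "('a, 'x) ring_scheme" and N :: "('a, 'y) ring_scheme"
  assumes "abelian_group M" "carrier N = carrier M" "add N = add M" "ring.zero N = ring.zero M"
  shows "abelian_group N"
proof -
  interpret abelian_group M by fact
  show ?thesis
  proof (rule abelian_groupI)
    fix x assume "x \<in> carrier N"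
    then show "\<exists>y\<in>carrier N. y \<oplus>\<^bsub>N\<^esub> x = \<zero>\<^bsub>N\<^esub>"
      using assms(2-) l_neg by (auto intro!: bexI[of _ "\<ominus>\<^bsub>M\<^esub> x"])
  qed (use assms(2-) a_ac in auto)
qed

lemma ring_cong:
  fixes M :: "('a, 'x) ring_scheme" and N :: "('a, 'y) ring_scheme"
  assumes "ring M" "carrier N = carrier M" "add N = add M" "ring.zero N = ring.zero M"
    "monoid.mult N = monoid.mult M" "one N = one M"
  shows "ring N"
proof -
  interpret ring M by fact
  show ?thesis
  proof (rule ringI)
    show "abelian_group N" using assms by (intro abelian_group_cong[OF abelian_group_axioms]) auto
    show "Group.monoid N" by (rule monoidI) (use assms(2-) m_assoc in auto)
  qed (use assms(2-) l_distr r_distr in auto)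
qed

section \<open>Transport of projective resolutions along ring isomorphisms\<close>

definition restrict_scalars :: "('s \<Rightarrow> 'r) \<Rightarrow> ('r, 'm, 'y) module_scheme \<Rightarrow> ('s, 'm) module" where
  "restrict_scalars g P = \<lparr>carrier = carrier P, monoid.mult = monoid.mult P, one = one P,
     ring.zero = ring.zero P, add = add P, smult = (\<lambda>r x. g r \<odot>\<^bsub>P\<^esub> x)\<rparr>"

lemma restrict_scalars_simps [simp]:
  "carrier (restrict_scalars g P) = carrier P" "ring.zero (restrict_scalars g P) = ring.zero P"
  "add (restrict_scalars g P) = add P" "smult (restrict_scalars g P) r x = g r \<odot>\<^bsub>P\<^esub> x"
  by (simp_all add: restrict_scalars_def)

lemma lmodule_restrict_scalars:
  assumes "lmodule R P" "ring S" "g \<in> ring_hom S R"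
  shows "lmodule S (restrict_scalars g P)"
proof -
  interpret lmodule R P by fact
  have "abelian_group (restrict_scalars g P)"
    by (rule abelian_group_cong[OF M.abelian_group_axioms]) auto
  then show ?thesis
    using assms(2,3) smult_closed smult_l_distr smult_r_distr smult_assoc smult_one
    by (intro lmodule.intro lmodule_axioms.intro)
      (auto simp: ring_hom_closed ring_hom_add ring_hom_mult ring_hom_one)
qed

lemma lmod_hom_restrict_scalars:
  assumes "h \<in> lmod_hom R P Q" "g \<in> ring_hom S R"
  shows "h \<in> lmod_hom S (restrict_scalars g P) (restrict_scalars g Q)"
  using assms by (auto simp: lmod_hom_def ring_hom_closed)

lemma lmod_hom_add: "h \<in> lmod_hom R M N \<Longrightarrow> x \<in> carrier M \<Longrightarrow> y \<in> carrier M \<Longrightarrow> h (x \<oplus>\<^bsub>M\<^esub> y) = h x \<oplus>\<^bsub>N\<^esub> h y"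
  and lmod_hom_smult: "h \<in> lmod_hom R M N \<Longrightarrow> r \<in> carrier R \<Longrightarrow> x \<in> carrier M \<Longrightarrow> h (r \<odot>\<^bsub>M\<^esub> x) = r \<odot>\<^bsub>N\<^esub> h x"
  by (auto simp: lmod_hom_def)

lemma free_module_simps [simp]:
  "carrier (free_module R Z) = {f. (\<forall>i \<in> Z. f i \<in> carrier R) \<and> (\<forall>i. i \<notin> Z \<longrightarrow> f i = \<zero>\<^bsub>R\<^esub>) \<and>
     finite {i. f i \<noteq> \<zero>\<^bsub>R\<^esub>}}"
  "u \<oplus>\<^bsub>free_module R Z\<^esub> v = (\<lambda>i. u i \<oplus>\<^bsub>R\<^esub> v i)"
  "r \<odot>\<^bsub>free_module R Z\<^esub> v = (\<lambda>i. r \<otimes>\<^bsub>R\<^esub> v i)"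
  by (simp_all add: free_module_def)

lemma free_module_map:
  assumes f: "f \<in> ring_hom R S" "ring R" "ring S" and u: "u \<in> carrier (free_module R Z)"
  shows "f \<circ> u \<in> carrier (free_module S Z)" and "u j \<in> carrier R"
proof -
  have f0: "f \<zero>\<^bsub>R\<^esub> = \<zero>\<^bsub>S\<^esub>" using f ring_hom_zero by blast
  show uc: "u j \<in> carrier R" for j
    using u ring.ring_simprules(2)[OF f(2)] by (cases "j \<in> Z") auto
  have "{i. f (u i) \<noteq> \<zero>\<^bsub>S\<^esub>} \<subseteq> {i. u i \<noteq> \<zero>\<^bsub>R\<^esub>}" using f0 by auto
  then have "finite {i. f (u i) \<noteq> \<zero>\<^bsub>S\<^esub>}" using u finite_subset by auto
  then show "f \<circ> u \<in> carrier (free_module S Z)" using f0 u uc f(1) by (auto simp: ring_hom_closed)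
qed

text \<open>The basis \<open>Z\<close> of the free module is kept, which is possible because it
  consists of elements of the unchanged carrier type; only the coefficients are moved by f and
  g.\<close>

lemma projective_restrict_scalars:
  fixes P :: "('r, 'p, 'y) module_scheme"
  assumes P: "projective R P" and S: "ring S" and f: "f \<in> ring_hom R S" and g: "g \<in> ring_hom S R"
    and gf: "\<And>x. x \<in> carrier R \<Longrightarrow> g (f x) = x" and fg: "\<And>y. y \<in> carrier S \<Longrightarrow> f (g y) = y"
  shows "projective S (restrict_scalars g P)"
proof -
  obtain Z :: "'p set" and i p where lm: "lmodule R P" and i: "i \<in> lmod_hom R P (free_module R Z)"
    and p: "p \<in> lmod_hom R (free_module R Z) P" and pi: "\<And>x. x \<in> carrier P \<Longrightarrow> p (i x) = x"
    using P unfolding projective_def by blast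
  have R: "ring R" using lm by (simp add: lmodule_def)
  have ic: "i x \<in> carrier (free_module R Z)" if "x \<in> carrier P" for x
    using i that by (auto simp: lmod_hom_def)
  note fi = free_module_map[OF f R S ic] and gi = free_module_map[OF g S R]
  have "(\<lambda>x. f \<circ> i x) \<in> lmod_hom S (restrict_scalars g P) (free_module S Z)"
    unfolding lmod_hom_def
  proof (intro CollectI conjI ballI funcsetI)
    show "f \<circ> i x \<in> carrier (free_module S Z)" if "x \<in> carrier (restrict_scalars g P)" for x
      using fi that by simp
  next
    fix x y assume "x \<in> carrier (restrict_scalars g P)" "y \<in> carrier (restrict_scalars g P)"
    then have xy: "x \<in> carrier P" "y \<in> carrier P" by auto
    then have "i (x \<oplus>\<^bsub>P\<^esub> y) = (\<lambda>j. i x j \<oplus>\<^bsub>R\<^esub> i y j)" using i by (auto simp: lmod_hom_def)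
    then show "f \<circ> i (x \<oplus>\<^bsub>restrict_scalars g P\<^esub> y) = (f \<circ> i x) \<oplus>\<^bsub>free_module S Z\<^esub> (f \<circ> i y)"
      using fi(2)[OF xy(1)] fi(2)[OF xy(2)] ring_hom_add[OF f] by auto
  next
    fix r x assume "r \<in> carrier S" "x \<in> carrier (restrict_scalars g P)"
    then have rx: "r \<in> carrier S" "x \<in> carrier P" "g r \<in> carrier R" using ring_hom_closed[OF g] by auto
    then have "i (g r \<odot>\<^bsub>P\<^esub> x) = (\<lambda>j. g r \<otimes>\<^bsub>R\<^esub> i x j)" using i by (auto simp: lmod_hom_def)
    then show "f \<circ> i (r \<odot>\<^bsub>restrict_scalars g P\<^esub> x) = r \<odot>\<^bsub>free_module S Z\<^esub> (f \<circ> i x)"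
      using fi(2)[OF rx(2)] ring_hom_mult[OF f] rx fg by auto
  qed
  moreover have "(\<lambda>u. p (g \<circ> u)) \<in> lmod_hom S (free_module S Z) (restrict_scalars g P)"
    unfolding lmod_hom_def
  proof (intro CollectI conjI ballI funcsetI)
    show "p (g \<circ> u) \<in> carrier (restrict_scalars g P)" if "u \<in> carrier (free_module S Z)" for u
      using gi(1)[OF that] p by (auto simp: lmod_hom_def)
  next
    fix u v assume uv: "u \<in> carrier (free_module S Z)" "v \<in> carrier (free_module S Z)"
    have "g \<circ> (u \<oplus>\<^bsub>free_module S Z\<^esub> v) = (g \<circ> u) \<oplus>\<^bsub>free_module R Z\<^esub> (g \<circ> v)"
      using gi(2)[OF uv(1)] gi(2)[OF uv(2)] ring_hom_add[OF g] by auto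
    then show "p (g \<circ> (u \<oplus>\<^bsub>free_module S Z\<^esub> v)) = p (g \<circ> u) \<oplus>\<^bsub>restrict_scalars g P\<^esub> p (g \<circ> v)"
      using lmod_hom_add[OF p gi(1)[OF uv(1)] gi(1)[OF uv(2)]] by (simp del: free_module_simps)
  next
    fix r u assume ru: "r \<in> carrier S" "u \<in> carrier (free_module S Z)"
    have "g \<circ> (r \<odot>\<^bsub>free_module S Z\<^esub> u) = g r \<odot>\<^bsub>free_module R Z\<^esub> (g \<circ> u)"
      using gi(2)[OF ru(2)] ring_hom_mult[OF g] ru by auto
    then show "p (g \<circ> (r \<odot>\<^bsub>free_module S Z\<^esub> u)) = r \<odot>\<^bsub>restrict_scalars g P\<^esub> p (g \<circ> u)"
      using lmod_hom_smult[OF p ring_hom_closed[OF g ru(1)] gi(1)[OF ru(2)]] by (simp del: free_module_simps)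
  qed
  moreover have "p (g \<circ> (f \<circ> i x)) = x" if "x \<in> carrier (restrict_scalars g P)" for x
  proof -
    have xP: "x \<in> carrier P" using that by simp
    have "g \<circ> (f \<circ> i x) = i x" using gf fi(2)[OF xP] by auto
    then show ?thesis using pi[OF xP] by simp
  qed
  ultimately show ?thesis
    unfolding projective_def
    by (intro conjI lmodule_restrict_scalars[OF lm S g] exI[of _ Z]
        exI[of _ "\<lambda>x. f \<circ> i x"] exI[of _ "\<lambda>u. p (g \<circ> u)"]) auto
qed

text \<open>Modules and differentials are the same on underlying sets, so exactness has to be
  reconsidered only at the augmentation, which is composed with f because J lies in the ring itself.
  The resolution also stays in its type.\<close>

lemma projective_resolution_restrict_scalars:
  assumes res: "projective_resolution R (left_ideal_module R J) P d \<epsilon>" and J: "J \<subseteq> carrier R"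
    and S: "ring S" and R: "ring R" and f: "f \<in> ring_hom R S" and g: "g \<in> ring_hom S R"
    and gf: "\<And>x. x \<in> carrier R \<Longrightarrow> g (f x) = x" and fg: "\<And>y. y \<in> carrier S \<Longrightarrow> f (g y) = y"
  shows "projective_resolution S (left_ideal_module S (f ` J))
    (\<lambda>i. restrict_scalars g (P i)) d (f \<circ> \<epsilon>)"
proof -
  have \<epsilon>: "\<epsilon> \<in> lmod_hom R (P 0) (left_ideal_module R J)"
    and im: "\<epsilon> ` carrier (P 0) = J"
    and ker: "d 0 ` carrier (P 1) = {x \<in> carrier (P 0). \<epsilon> x = \<zero>\<^bsub>R\<^esub>}"
    using res by (auto simp: projective_resolution_def left_ideal_module_def)
  have \<epsilon>c: "\<epsilon> x \<in> J" if "x \<in> carrier (P 0)" for x using im that by blast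
  have \<epsilon>': "f \<circ> \<epsilon> \<in> lmod_hom S (restrict_scalars g (P 0)) (left_ideal_module S (f ` J))"
    unfolding lmod_hom_def
  proof (intro CollectI conjI ballI funcsetI)
    show "(f \<circ> \<epsilon>) x \<in> carrier (left_ideal_module S (f ` J))" if "x \<in> carrier (restrict_scalars g (P 0))" for x
      using \<epsilon>c that by (auto simp: left_ideal_module_def)
  next
    fix x y assume xy: "x \<in> carrier (restrict_scalars g (P 0))" "y \<in> carrier (restrict_scalars g (P 0))"
    then have "\<epsilon> (x \<oplus>\<^bsub>P 0\<^esub> y) = \<epsilon> x \<oplus>\<^bsub>R\<^esub> \<epsilon> y" using \<epsilon> by (simp add: lmod_hom_def left_ideal_module_def)
    moreover have "\<epsilon> x \<in> carrier R" "\<epsilon> y \<in> carrier R" using \<epsilon>c J xy by auto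
    ultimately show "(f \<circ> \<epsilon>) (x \<oplus>\<^bsub>restrict_scalars g (P 0)\<^esub> y)
        = (f \<circ> \<epsilon>) x \<oplus>\<^bsub>left_ideal_module S (f ` J)\<^esub> (f \<circ> \<epsilon>) y"
      using ring_hom_add[OF f] by (simp add: left_ideal_module_def)
  next
    fix r x assume rx: "r \<in> carrier S" "x \<in> carrier (restrict_scalars g (P 0))"
    then have gr: "g r \<in> carrier R" using ring_hom_closed[OF g] by simp
    then have "\<epsilon> (g r \<odot>\<^bsub>P 0\<^esub> x) = g r \<otimes>\<^bsub>R\<^esub> \<epsilon> x" using \<epsilon> rx by (simp add: lmod_hom_def left_ideal_module_def)
    moreover have "\<epsilon> x \<in> carrier R" using \<epsilon>c J rx by auto
    ultimately show "(f \<circ> \<epsilon>) (r \<odot>\<^bsub>restrict_scalars g (P 0)\<^esub> x)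
        = r \<odot>\<^bsub>left_ideal_module S (f ` J)\<^esub> (f \<circ> \<epsilon>) x"
      using ring_hom_mult[OF f] gr rx fg by (simp add: left_ideal_module_def)
  qed
  have f0: "f y = \<zero>\<^bsub>S\<^esub> \<longleftrightarrow> y = \<zero>\<^bsub>R\<^esub>" if "y \<in> carrier R" for y
    using gf[OF that] gf[OF ring.ring_simprules(2)[OF R]] ring_hom_zero[OF f R S] by metis
  have "(f \<circ> \<epsilon>) x = \<zero>\<^bsub>left_ideal_module S (f ` J)\<^esub> \<longleftrightarrow> \<epsilon> x = \<zero>\<^bsub>R\<^esub>" if "x \<in> carrier (P 0)" for x
    using f0[of "\<epsilon> x"] \<epsilon>c[OF that] J by (auto simp: left_ideal_module_def)
  then have ker': "d 0 ` carrier (P 1) = {x \<in> carrier (P 0). (f \<circ> \<epsilon>) x = \<zero>\<^bsub>left_ideal_module S (f ` J)\<^esub>}"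
    using ker by auto
  have "projective S (restrict_scalars g (P i))" for i
    using res by (intro projective_restrict_scalars[OF _ S f g gf fg]) (auto simp: projective_resolution_def)
  moreover have "d i \<in> lmod_hom S (restrict_scalars g (P (Suc i))) (restrict_scalars g (P i))" for i
    using res by (intro lmod_hom_restrict_scalars[OF _ g]) (auto simp: projective_resolution_def)
  moreover have "(f \<circ> \<epsilon>) ` carrier (P 0) = carrier (left_ideal_module S (f ` J))"
    using im by (auto simp: left_ideal_module_def)
  ultimately show ?thesis
    using res \<epsilon>' ker' by (simp add: projective_resolution_def)
qed

text \<open>A resolution over one ring becomes one of the same length over the other, so both infima
  are taken over the same set. The two directions differ only by exchanging f and its
  inverse.\<close>

lemma proj_dim_ring_iso:
  fixes R :: "('k, 'a, 'y) module_scheme" and S :: "('k, 'b, 'z) module_scheme"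
  assumes R: "ring R" and S: "ring S" and f: "f \<in> ring_iso R S" and J: "J \<subseteq> carrier R"
  shows "proj_dim S (left_ideal_module S (f ` J)) = proj_dim R (left_ideal_module R J)"
proof -
  define g where "g = inv_into (carrier R) f"
  have b: "bij_betw f (carrier R) (carrier S)" and fh: "f \<in> ring_hom R S"
    using f by (auto simp: ring_iso_def)
  have gh: "g \<in> ring_hom S R"
    using ring_iso_set_sym[OF R f] unfolding g_def by (auto simp: ring_iso_def)
  have gf: "g (f x) = x" if "x \<in> carrier R" for x
    using b that by (simp add: g_def bij_betw_inv_into_left)
  have fg: "f (g y) = y" if "y \<in> carrier S" for y
    using b that by (simp add: g_def bij_betw_inv_into_right)
  have fJ: "f ` J \<subseteq> carrier S" using J fh by (auto simp: ring_hom_closed)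
  have gfJ: "g ` f ` J = J" using gf J by (force simp: image_iff)
  have "(\<exists>(P :: nat \<Rightarrow> ('a, nat \<Rightarrow> 'k) module) d \<epsilon>. projective_resolution R (left_ideal_module R J) P d \<epsilon> \<and>
       (\<forall>i. n < int i \<longrightarrow> carrier (P i) = {\<zero>\<^bsub>P i\<^esub>})) \<longleftrightarrow>
     (\<exists>(P :: nat \<Rightarrow> ('b, nat \<Rightarrow> 'k) module) d \<epsilon>. projective_resolution S (left_ideal_module S (f ` J)) P d \<epsilon> \<and>
       (\<forall>i. n < int i \<longrightarrow> carrier (P i) = {\<zero>\<^bsub>P i\<^esub>}))" (is "?A \<longleftrightarrow> ?B") for n :: int
  proof
    assume ?A
    then obtain P :: "nat \<Rightarrow> ('a, nat \<Rightarrow> 'k) module" and d \<epsilon> where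
      P: "projective_resolution R (left_ideal_module R J) P d \<epsilon>"
         "\<forall>i. n < int i \<longrightarrow> carrier (P i) = {\<zero>\<^bsub>P i\<^esub>}" by auto
    show ?B
      using projective_resolution_restrict_scalars[OF P(1) J S R fh gh gf fg] P(2)
      by (intro exI[of _ "\<lambda>i. restrict_scalars g (P i)"] exI[of _ d] exI[of _ "f \<circ> \<epsilon>"]) simp
  next
    assume ?B
    then obtain P :: "nat \<Rightarrow> ('b, nat \<Rightarrow> 'k) module" and d \<epsilon> where
      P: "projective_resolution S (left_ideal_module S (f ` J)) P d \<epsilon>"
         "\<forall>i. n < int i \<longrightarrow> carrier (P i) = {\<zero>\<^bsub>P i\<^esub>}" by auto
    show ?A
      using projective_resolution_restrict_scalars[OF P(1) fJ R S gh fh fg gf] P(2) gfJ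
      by (intro exI[of _ "\<lambda>i. restrict_scalars f (P i)"] exI[of _ d] exI[of _ "g \<circ> \<epsilon>"]) simp
  qed
  then show ?thesis unfolding proj_dim_def by presburger
qed

lemma ring_op_alg: assumes "ring R" shows "ring (op_alg R)"
proof -
  interpret ring R by fact
  show ?thesis
  proof (rule ringI)
    show "abelian_group (op_alg R)"
      by (rule abelian_group_cong[OF abelian_group_axioms]) (auto simp: op_alg_def)
    show "Group.monoid (op_alg R)" by (rule monoidI) (auto simp: op_alg_def m_assoc)
  qed (auto simp: op_alg_def l_distr r_distr)
qed

lemma ring_iso_op_alg: "f \<in> ring_iso R S \<Longrightarrow> f \<in> ring_iso (op_alg R) (op_alg S)"
  by (auto simp: ring_iso_def ring_hom_def op_alg_def)

lemma left_pd_ring_iso: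
  fixes R :: "('k, 'a, 'y) module_scheme" and S :: "('k, 'b, 'z) module_scheme"
  assumes "ring R" "ring S" "f \<in> ring_iso R S" "J \<subseteq> carrier R"
  shows "left_pd S (f ` J) = left_pd R J"
  using proj_dim_ring_iso[OF assms] by (simp add: left_pd_def)

lemma right_pd_ring_iso:
  fixes R :: "('k, 'a, 'y) module_scheme" and S :: "('k, 'b, 'z) module_scheme"
  assumes "ring R" "ring S" "f \<in> ring_iso R S" "J \<subseteq> carrier R"
  shows "right_pd S (f ` J) = right_pd R J"
  using proj_dim_ring_iso[OF ring_op_alg[OF assms(1)] ring_op_alg[OF assms(2)] ring_iso_op_alg[OF assms(3)]] assms(4)
  by (simp add: right_pd_def op_alg_def)

text \<open>The zero resolution meets the length condition for every integer n, negative ones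
  included, so the infimum is below every real number. Hence a finite projective dimension excludes
  the zero ideal.\<close>

lemma proj_dim_zero_module:
  fixes R :: "('k, 'a, 'y) module_scheme"
  assumes R: "ring R"
  shows "proj_dim R (left_ideal_module R {\<zero>\<^bsub>R\<^esub>}) = -\<infinity>"
proof -
  interpret ring R by fact
  define Z :: "('a, nat \<Rightarrow> 'k) module" where
    "Z = \<lparr>carrier = {undefined}, monoid.mult = undefined, one = undefined, ring.zero = undefined,
      add = (\<lambda>x y. undefined), smult = (\<lambda>r x. undefined)\<rparr>"
  have "abelian_group Z" by (rule abelian_groupI) (auto simp: Z_def)
  then have lm: "lmodule R Z"
    by (intro lmodule.intro lmodule_axioms.intro ring_axioms) (auto simp: Z_def)
  have "projective R Z"
    unfolding projective_def
  \<comment> \<open>The zero module is free on the empty basis.\<close>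
  proof (intro conjI lm exI[of _ "{}"] exI[of _ "\<lambda>x i. \<zero>\<^bsub>R\<^esub>"] exI[of _ "\<lambda>x. undefined"])
  qed (auto simp: lmod_hom_def Z_def)
  then have "projective_resolution R (left_ideal_module R {\<zero>\<^bsub>R\<^esub>}) (\<lambda>i. Z) (\<lambda>i x. x) (\<lambda>x. \<zero>\<^bsub>R\<^esub>)"
    by (auto simp: projective_resolution_def Z_def lmod_hom_def left_ideal_module_def)
  then have "ereal (of_int n) \<in> {ereal (of_int n) | n :: int.
     \<exists>(P :: nat \<Rightarrow> ('a, nat \<Rightarrow> 'k) module) d \<epsilon>. projective_resolution R (left_ideal_module R {\<zero>\<^bsub>R\<^esub>}) P d \<epsilon> \<and>
       (\<forall>i. n < int i \<longrightarrow> carrier (P i) = {\<zero>\<^bsub>P i\<^esub>})}" for n :: int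
    by (intro CollectI exI[of _ n] conjI refl exI[of _ "\<lambda>i. Z"] exI[of _ "\<lambda>i x. x"] exI[of _ "\<lambda>x. \<zero>\<^bsub>R\<^esub>"]) (auto simp: Z_def)
  then have le: "proj_dim R (left_ideal_module R {\<zero>\<^bsub>R\<^esub>}) \<le> ereal (of_int n)" for n
    unfolding proj_dim_def by (rule Inf_lower)
  show ?thesis
  proof (rule ereal_bot)
    fix B :: real
    have "ereal (of_int \<lfloor>B\<rfloor>) \<le> ereal B" by simp
    then show "proj_dim R (left_ideal_module R {\<zero>\<^bsub>R\<^esub>}) \<le> ereal B" using le order_trans by blast
  qed
qed

text \<open>A bound n < 0 would make P 0 trivial, and then its image J would be trivial too. So for
  a non-zero ideal a dimension that is not finite is \<infinity>.\<close>

lemma proj_dim_not_minus_infinity: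
  fixes R :: "('k, 'a, 'y) module_scheme"
  assumes "J \<noteq> {\<zero>\<^bsub>R\<^esub>}" "\<zero>\<^bsub>R\<^esub> \<in> J"
  shows "proj_dim R (left_ideal_module R J) \<noteq> -\<infinity>"
proof -
  have "0 \<le> ereal (of_int n)" if res: "projective_resolution R (left_ideal_module R J) P d \<epsilon>"
    and z: "\<forall>i. n < int i \<longrightarrow> carrier (P i) = {\<zero>\<^bsub>P i\<^esub>}" for n :: int and P :: "nat \<Rightarrow> ('a, nat \<Rightarrow> 'k) module" and d \<epsilon>
  proof (rule ccontr)
    assume "\<not> 0 \<le> ereal (of_int n)"
    then have P0: "carrier (P 0) = {\<zero>\<^bsub>P 0\<^esub>}" using z by auto
    moreover have im: "\<epsilon> ` carrier (P 0) = J"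
      using res by (simp add: projective_resolution_def left_ideal_module_def)
    ultimately show False using assms by auto
  qed
  then have "0 \<le> proj_dim R (left_ideal_module R J)"
    unfolding proj_dim_def by (intro Inf_greatest) auto
  then show ?thesis by auto
qed

lemma right_pd_zero: "ring R \<Longrightarrow> right_pd R {\<zero>\<^bsub>R\<^esub>} = -\<infinity>"
  using proj_dim_zero_module[OF ring_op_alg] by (simp add: right_pd_def op_alg_def)

lemma left_pd_not_minus_infinity: "J \<noteq> {\<zero>\<^bsub>R\<^esub>} \<Longrightarrow> \<zero>\<^bsub>R\<^esub> \<in> J \<Longrightarrow> left_pd R J \<noteq> -\<infinity>"
  using proj_dim_not_minus_infinity by (simp add: left_pd_def)

section \<open>Quotient algebras\<close>

lemma quot_alg_simps [simp]:
  "carrier (quot_alg A I) = carrier (A Quot I)" "monoid.mult (quot_alg A I) = monoid.mult (A Quot I)"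
  "one (quot_alg A I) = one (A Quot I)" "ring.zero (quot_alg A I) = ring.zero (A Quot I)"
  "add (quot_alg A I) = add (A Quot I)"
  by (simp_all add: quot_alg_def)

context k_algebra begin

context
  fixes I
  assumes I: "ideal I A"
begin

lemma ring_quot_alg: "ring (quot_alg A I)"
  by (rule ring_cong[OF ideal.quotient_is_ring[OF I]]) auto

lemma quot_hom: "(\<lambda>x. I +>\<^bsub>A\<^esub> x) \<in> ring_hom A (quot_alg A I)"
  using ideal.rcos_ring_hom[OF I] by (simp add: ring_hom_def)

lemma quot_carrier: "carrier (quot_alg A I) = (\<lambda>x. I +>\<^bsub>A\<^esub> x) ` carrier A"
  by (auto simp: FactRing_def A_RCOSETS_def RCOSETS_def a_r_coset_def)

lemma quot_eq_iff:
  assumes "x \<in> carrier A" "y \<in> carrier A"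
  shows "I +>\<^bsub>A\<^esub> x = I +>\<^bsub>A\<^esub> y \<longleftrightarrow> x \<ominus>\<^bsub>A\<^esub> y \<in> I"
  using A.quotient_eq_iff_same_a_r_cos[OF I assms] by auto

text \<open>\<open>quot_alg\<close> takes the union over all representatives of a coset; since I is
  a subspace they all give the same coset, and the union collapses.\<close>

lemma quot_smult:
  assumes c: "c \<in> carrier K" and x: "x \<in> carrier A"
  shows "c \<odot>\<^bsub>quot_alg A I\<^esub> (I +>\<^bsub>A\<^esub> x) = I +>\<^bsub>A\<^esub> (c \<odot>\<^bsub>A\<^esub> x)"
proof -
  note sI = ideal_subspace[OF I]
  have "I +>\<^bsub>A\<^esub> (c \<odot>\<^bsub>A\<^esub> y) = I +>\<^bsub>A\<^esub> (c \<odot>\<^bsub>A\<^esub> x)" if y: "y \<in> I +>\<^bsub>A\<^esub> x" for y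
  proof -
    obtain i where i: "i \<in> I" "y = i \<oplus>\<^bsub>A\<^esub> x" using y by (auto simp: a_r_coset_def r_coset_def)
    have ic: "i \<in> carrier A" using i subspace_carr[OF sI] by simp
    have "p \<oplus>\<^bsub>A\<^esub> q \<ominus>\<^bsub>A\<^esub> q = p" if "p \<in> carrier A" "q \<in> carrier A" for p q using that by algebra
    then have "c \<odot>\<^bsub>A\<^esub> y \<ominus>\<^bsub>A\<^esub> c \<odot>\<^bsub>A\<^esub> x = c \<odot>\<^bsub>A\<^esub> i" using c x i ic by (simp add: smult_r_distr)
    also have "\<dots> \<in> I" using subspace_smult[OF sI c] i by simp
    finally show ?thesis using quot_eq_iff[of "c \<odot>\<^bsub>A\<^esub> y" "c \<odot>\<^bsub>A\<^esub> x"] c x i ic by simp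
  qed
  moreover have "x \<in> I +>\<^bsub>A\<^esub> x"
    using subspace_zero[OF sI] M.l_zero[OF x] unfolding a_r_coset_def r_coset_def by force
  ultimately have "(\<Union>y\<in>I +>\<^bsub>A\<^esub> x. I +>\<^bsub>A\<^esub> (c \<odot>\<^bsub>A\<^esub> y)) = I +>\<^bsub>A\<^esub> (c \<odot>\<^bsub>A\<^esub> x)" by blast
  then show ?thesis by (simp add: quot_alg_def)
qed

text \<open>The homomorphism theorem, with its isomorphism checked to be linear. In the converse
  direction it is applied both to kQ/I and to the quotient of kQ/I by the arrow ideal.\<close>

lemma quot_alg_lift:
  assumes C: "ring C" and h: "h \<in> ring_hom A C" "h ` carrier A = carrier C"
    and hl: "\<And>c x. c \<in> carrier K \<Longrightarrow> x \<in> carrier A \<Longrightarrow> h (c \<odot>\<^bsub>A\<^esub> x) = c \<odot>\<^bsub>C\<^esub> h x"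
    and ker: "I = {x \<in> carrier A. h x = \<zero>\<^bsub>C\<^esub>}"
  obtains \<phi> where "\<phi> \<in> ring_iso (quot_alg A I) C" "\<And>x. x \<in> carrier A \<Longrightarrow> \<phi> (I +>\<^bsub>A\<^esub> x) = h x"
    "\<And>c Z. c \<in> carrier K \<Longrightarrow> Z \<in> carrier (quot_alg A I) \<Longrightarrow> \<phi> (c \<odot>\<^bsub>quot_alg A I\<^esub> Z) = c \<odot>\<^bsub>C\<^esub> \<phi> Z"
proof -
  interpret h: ring_hom_ring A C h
    by (rule ring_hom_ringI2) (use A.ring_axioms C h in auto)
  have k: "a_kernel A C h = I" unfolding a_kernel_def' ker by simp
  let ?F = "\<lambda>Y. the_elem (h ` Y)"
  have "?F \<in> ring_iso (A Quot I) C"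
    using h.FactRing_iso_set[OF h(2)] k by simp
  then have iso: "?F \<in> ring_iso (quot_alg A I) C" by (simp add: ring_iso_def ring_hom_def)
  have \<phi>: "?F (I +>\<^bsub>A\<^esub> x) = h x" if "x \<in> carrier A" for x
    using h.the_elem_simp[OF that] k by simp
  have "?F (c \<odot>\<^bsub>quot_alg A I\<^esub> Z) = c \<odot>\<^bsub>C\<^esub> ?F Z" if cZ: "c \<in> carrier K" "Z \<in> carrier (quot_alg A I)" for c Z
  proof -
    obtain x where "x \<in> carrier A" "Z = I +>\<^bsub>A\<^esub> x" using cZ(2) unfolding quot_carrier by auto
    then show ?thesis using quot_smult[OF cZ(1)] \<phi> hl cZ(1) by simp
  qed
  then show ?thesis using that[OF iso \<phi>] by blast
qed

end

end

section \<open>Path algebras\<close>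

locale quiver_algebra = field K + fin_digraph Q
  for K :: "('k, 'x) ring_scheme" (structure) and Q :: "('v, 'e) pre_digraph"
begin

abbreviation kQ where "kQ \<equiv> path_algebra K Q"

lemma awlast_append: "awlast u (p @ q) = awlast (awlast u p) q"
  by (induction p arbitrary: u) auto

lemma paths_iff: "(u, p) \<in> paths Q \<longleftrightarrow> awalk u p (awlast u p)"
  by (auto simp: paths_def awalk_def awlast_if_cas)

lemma paths_append: "(u, p @ q) \<in> paths Q \<longleftrightarrow> (u, p) \<in> paths Q \<and> (awlast u p, q) \<in> paths Q"
  unfolding paths_iff awlast_append by (rule awalk_append_iff)

lemma paths_Nil: "(u, []) \<in> paths Q \<longleftrightarrow> u \<in> verts Q"
  by (simp add: paths_iff awalk_def)

lemma paths_arc: "a \<in> arcs Q \<Longrightarrow> (tail Q a, [a]) \<in> paths Q"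
  by (simp add: paths_iff awalk_def)

lemma paths_verts: "(u, p) \<in> paths Q \<Longrightarrow> u \<in> verts Q" "(u, p) \<in> paths Q \<Longrightarrow> awlast u p \<in> verts Q"
  by (auto simp: paths_iff awalk_def)
     (metis awalk_def awlast_in_verts)

lemma paths_arcs: "(u, p) \<in> paths Q \<Longrightarrow> set p \<subseteq> arcs Q"
  by (simp add: paths_iff awalk_def)

lemma paths_Cons: "(u, a # p) \<in> paths Q \<longleftrightarrow> a \<in> arcs Q \<and> tail Q a = u \<and> (head Q a, p) \<in> paths Q"
  by (auto simp: paths_iff awalk_def)

lemma kQ_simps [simp]:
  "\<zero>\<^bsub>kQ\<^esub> = (\<lambda>w. \<zero>)" "y \<oplus>\<^bsub>kQ\<^esub> z = (\<lambda>w. y w \<oplus> z w)" "c \<odot>\<^bsub>kQ\<^esub> z = (\<lambda>w. c \<otimes> z w)"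
  by (simp_all add: path_algebra_def)

lemma kQ_mult: "(y \<otimes>\<^bsub>kQ\<^esub> z) (u, p) =
   (\<Oplus>i\<in>{..length p}. y (u, take i p) \<otimes> z (awlast u (take i p), drop i p))"
  by (simp add: path_algebra_def)

lemma kQ_one: "\<one>\<^bsub>kQ\<^esub> (u, p) = (if u \<in> verts Q \<and> p = [] then \<one> else \<zero>)"
  by (simp add: path_algebra_def)

lemma kQ_carrier: "z \<in> carrier kQ \<longleftrightarrow>
    (\<forall>w. z w \<in> carrier K) \<and> (\<forall>w. w \<notin> paths Q \<longrightarrow> z w = \<zero>) \<and> finite {w. z w \<noteq> \<zero>}"
  by (simp add: path_algebra_def)

lemma kQ_closed [simp]: "z \<in> carrier kQ \<Longrightarrow> z w \<in> carrier K"
  and kQ_outside: "z \<in> carrier kQ \<Longrightarrow> w \<notin> paths Q \<Longrightarrow> z w = \<zero>"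
  and kQ_finite: "z \<in> carrier kQ \<Longrightarrow> finite {w. z w \<noteq> \<zero>}"
  unfolding kQ_carrier by blast+

lemma kQ_carrier_subset:
  assumes "finite F" "F \<subseteq> paths Q" "\<And>w. z w \<in> carrier K" "\<And>w. w \<notin> F \<Longrightarrow> z w = \<zero>"
  shows "z \<in> carrier kQ"
proof -
  have "{w. z w \<noteq> \<zero>} \<subseteq> F" using assms(4) by blast
  then show ?thesis using assms finite_subset unfolding kQ_carrier by blast
qed

lemma finsum_eq_zeroI:
  assumes "\<And>i. i \<in> S \<Longrightarrow> f i = \<zero>" shows "(\<Oplus>i\<in>S. f i) = \<zero>"
proof -
  have "(\<Oplus>i\<in>S. f i) = (\<Oplus>i\<in>S. \<zero>)" by (rule finsum_cong') (use assms in auto)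
  then show ?thesis by simp
qed

lemma kQ_add_closed:
  assumes "y \<in> carrier kQ" "z \<in> carrier kQ" shows "y \<oplus>\<^bsub>kQ\<^esub> z \<in> carrier kQ"
proof (rule kQ_carrier_subset)
  show "finite ({w. y w \<noteq> \<zero>} \<union> {w. z w \<noteq> \<zero>})" using kQ_finite assms by simp
  show "{w. y w \<noteq> \<zero>} \<union> {w. z w \<noteq> \<zero>} \<subseteq> paths Q" using kQ_outside assms by blast
qed (use assms in auto)

lemma kQ_smult_closed:
  assumes "c \<in> carrier K" "z \<in> carrier kQ" shows "c \<odot>\<^bsub>kQ\<^esub> z \<in> carrier kQ"
proof (rule kQ_carrier_subset)
  show "finite {w. z w \<noteq> \<zero>}" using kQ_finite assms by simp
  show "{w. z w \<noteq> \<zero>} \<subseteq> paths Q" using kQ_outside assms by blast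
qed (use assms in auto)

lemma kQ_zero_closed: "(\<lambda>w. \<zero>) \<in> carrier kQ"
  by (simp add: kQ_carrier)

lemma kQ_term_closed:
  "y \<in> carrier kQ \<Longrightarrow> z \<in> carrier kQ \<Longrightarrow>
   (\<lambda>i. y (u, take i p) \<otimes> z (awlast u (take i p), drop i p)) \<in> S \<rightarrow> carrier K"
  by auto

lemma kQ_mult_closed:
  assumes y: "y \<in> carrier kQ" and z: "z \<in> carrier kQ" shows "y \<otimes>\<^bsub>kQ\<^esub> z \<in> carrier kQ"
proof (rule kQ_carrier_subset)
  let ?F = "(\<lambda>((u, p), (v, q)). (u, p @ q)) ` ({w. y w \<noteq> \<zero>} \<times> {w. z w \<noteq> \<zero>}) \<inter> paths Q"
  show "finite ?F" using kQ_finite assms by auto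
  show "?F \<subseteq> paths Q" by auto
  show "(y \<otimes>\<^bsub>kQ\<^esub> z) w \<in> carrier K" for w
    by (cases w) (use kQ_term_closed[OF y z] in \<open>auto simp: kQ_mult intro!: finsum_closed\<close>)
  show "(y \<otimes>\<^bsub>kQ\<^esub> z) w = \<zero>" if w: "w \<notin> ?F" for w
  proof (cases w)
    case (Pair u p)
    have "y (u, take i p) \<otimes> z (awlast u (take i p), drop i p) = \<zero>" for i
    proof (rule ccontr)
      assume ne: "y (u, take i p) \<otimes> z (awlast u (take i p), drop i p) \<noteq> \<zero>"
      then have ne': "y (u, take i p) \<noteq> \<zero>" "z (awlast u (take i p), drop i p) \<noteq> \<zero>"
        using y z by auto
      then have "(u, take i p) \<in> paths Q" "(awlast u (take i p), drop i p) \<in> paths Q"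
        using kQ_outside y z by blast+
      then have "(u, p) \<in> paths Q" using paths_append[of u "take i p" "drop i p"] by simp
      moreover have "(u, p) \<in> (\<lambda>((u, p), (v, q)). (u, p @ q)) ` ({w. y w \<noteq> \<zero>} \<times> {w. z w \<noteq> \<zero>})"
        using ne' by (intro image_eqI[of _ _ "((u, take i p), (awlast u (take i p), drop i p))"]) auto
      ultimately show False using w Pair by blast
    qed
    then show ?thesis using Pair by (simp add: kQ_mult finsum_eq_zeroI)
  qed
qed

lemma path_elem_closed [simp]: "w \<in> paths Q \<Longrightarrow> path_elem K w \<in> carrier kQ"
  by (rule kQ_carrier_subset[of "{w}"]) (auto simp: path_elem_def)

lemma kQ_one_closed: "\<one>\<^bsub>kQ\<^esub> \<in> carrier kQ"
proof (rule kQ_carrier_subset[of "(\<lambda>u. (u, [])) ` verts Q"])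
  fix w :: "'v \<times> 'e list"
  show "\<one>\<^bsub>kQ\<^esub> w \<in> carrier K" by (cases w) (simp add: kQ_one)
  show "\<one>\<^bsub>kQ\<^esub> w = \<zero>" if "w \<notin> (\<lambda>u. (u, [])) ` verts Q" using that by (cases w) (auto simp: kQ_one)
qed (auto simp: paths_Nil)

text \<open>Induction on a finite set containing the support; it reduces identities that are
  additive in z to scalar multiples of single paths.\<close>

lemma kQ_induct [consumes 1, case_names zero base add]:
  assumes "z \<in> carrier kQ" and zero: "P (\<lambda>w. \<zero>)"
    and base: "\<And>c w. c \<in> carrier K \<Longrightarrow> w \<in> paths Q \<Longrightarrow> P (c \<odot>\<^bsub>kQ\<^esub> path_elem K w)"
    and add: "\<And>x y. x \<in> carrier kQ \<Longrightarrow> y \<in> carrier kQ \<Longrightarrow> P x \<Longrightarrow> P y \<Longrightarrow> P (x \<oplus>\<^bsub>kQ\<^esub> y)"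
  shows "P z"
proof -
  have "P z" if "finite F" "z \<in> carrier kQ" "\<And>w. w \<notin> F \<Longrightarrow> z w = \<zero>" for F z
    using that
  proof (induction F arbitrary: z rule: finite_induct)
    case empty
    then have "z = (\<lambda>w. \<zero>)" by auto
    then show ?case using zero by simp
  next
    case (insert w F)
    show ?case
    proof (cases "w \<in> paths Q")
      case True
      let ?y = "z(w := \<zero>)"
      have yc: "?y \<in> carrier kQ"
      proof (rule kQ_carrier_subset)
        show "finite {v. z v \<noteq> \<zero>}" using kQ_finite insert.prems(1) .
        show "{v. z v \<noteq> \<zero>} \<subseteq> paths Q" using kQ_outside insert.prems(1) by blast
      qed (use insert.prems(1) in auto)
      have "P ?y" using insert.prems(2) by (intro insert.IH yc) auto
      moreover have "P (z w \<odot>\<^bsub>kQ\<^esub> path_elem K w)" using insert.prems True by (intro base) auto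
      moreover have "z w \<odot>\<^bsub>kQ\<^esub> path_elem K w \<in> carrier kQ"
        using insert.prems True by (intro kQ_smult_closed) auto
      ultimately have "P (z w \<odot>\<^bsub>kQ\<^esub> path_elem K w \<oplus>\<^bsub>kQ\<^esub> ?y)" using yc by (intro add)
      moreover have "z w \<odot>\<^bsub>kQ\<^esub> path_elem K w \<oplus>\<^bsub>kQ\<^esub> ?y = z"
        using insert.prems by (auto simp: path_elem_def)
      ultimately show ?thesis by simp
    next
      case False
      then have "z v = \<zero>" if "v \<notin> F" for v
        using insert.prems that kQ_outside by (cases "v = w") auto
      then show ?thesis using insert by blast
    qed
  qed
  from this[OF kQ_finite[OF assms(1)] assms(1)] show ?thesis by blast
qed

lemma kQ_distrib:
  assumes "x \<in> carrier kQ" "y \<in> carrier kQ" "z \<in> carrier kQ"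
  shows "(x \<oplus>\<^bsub>kQ\<^esub> y) \<otimes>\<^bsub>kQ\<^esub> z = x \<otimes>\<^bsub>kQ\<^esub> z \<oplus>\<^bsub>kQ\<^esub> y \<otimes>\<^bsub>kQ\<^esub> z"
    and "z \<otimes>\<^bsub>kQ\<^esub> (x \<oplus>\<^bsub>kQ\<^esub> y) = z \<otimes>\<^bsub>kQ\<^esub> x \<oplus>\<^bsub>kQ\<^esub> z \<otimes>\<^bsub>kQ\<^esub> y"
proof -
  show "(x \<oplus>\<^bsub>kQ\<^esub> y) \<otimes>\<^bsub>kQ\<^esub> z = x \<otimes>\<^bsub>kQ\<^esub> z \<oplus>\<^bsub>kQ\<^esub> y \<otimes>\<^bsub>kQ\<^esub> z"
  proof (rule ext)
    fix w :: "'v \<times> 'e list"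
    obtain u p where w: "w = (u, p)" by (cases w)
    let ?f = "\<lambda>y i. y (u, take i p) \<otimes> z (awlast u (take i p), drop i p)"
    have "((x \<oplus>\<^bsub>kQ\<^esub> y) \<otimes>\<^bsub>kQ\<^esub> z) (u, p) = (\<Oplus>i\<in>{..length p}. ?f x i \<oplus> ?f y i)"
      unfolding kQ_mult using assms by (intro finsum_cong') (auto simp: l_distr)
    also have "\<dots> = (\<Oplus>i\<in>{..length p}. ?f x i) \<oplus> (\<Oplus>i\<in>{..length p}. ?f y i)"
      using assms by (intro finsum_addf kQ_term_closed)
    finally show "((x \<oplus>\<^bsub>kQ\<^esub> y) \<otimes>\<^bsub>kQ\<^esub> z) w = (x \<otimes>\<^bsub>kQ\<^esub> z \<oplus>\<^bsub>kQ\<^esub> y \<otimes>\<^bsub>kQ\<^esub> z) w"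
      using w by (simp add: kQ_mult)
  qed
  show "z \<otimes>\<^bsub>kQ\<^esub> (x \<oplus>\<^bsub>kQ\<^esub> y) = z \<otimes>\<^bsub>kQ\<^esub> x \<oplus>\<^bsub>kQ\<^esub> z \<otimes>\<^bsub>kQ\<^esub> y"
  proof (rule ext)
    fix w :: "'v \<times> 'e list"
    obtain u p where w: "w = (u, p)" by (cases w)
    let ?f = "\<lambda>y i. z (u, take i p) \<otimes> y (awlast u (take i p), drop i p)"
    have "(z \<otimes>\<^bsub>kQ\<^esub> (x \<oplus>\<^bsub>kQ\<^esub> y)) (u, p) = (\<Oplus>i\<in>{..length p}. ?f x i \<oplus> ?f y i)"
      unfolding kQ_mult using assms by (intro finsum_cong') (auto simp: r_distr)
    also have "\<dots> = (\<Oplus>i\<in>{..length p}. ?f x i) \<oplus> (\<Oplus>i\<in>{..length p}. ?f y i)"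
      using assms by (intro finsum_addf kQ_term_closed)
    finally show "(z \<otimes>\<^bsub>kQ\<^esub> (x \<oplus>\<^bsub>kQ\<^esub> y)) w = (z \<otimes>\<^bsub>kQ\<^esub> x \<oplus>\<^bsub>kQ\<^esub> z \<otimes>\<^bsub>kQ\<^esub> y) w"
      using w by (simp add: kQ_mult)
  qed
qed

lemma kQ_smult_mult:
  assumes "c \<in> carrier K" "y \<in> carrier kQ" "z \<in> carrier kQ"
  shows "(c \<odot>\<^bsub>kQ\<^esub> y) \<otimes>\<^bsub>kQ\<^esub> z = c \<odot>\<^bsub>kQ\<^esub> (y \<otimes>\<^bsub>kQ\<^esub> z)"
    and "y \<otimes>\<^bsub>kQ\<^esub> (c \<odot>\<^bsub>kQ\<^esub> z) = c \<odot>\<^bsub>kQ\<^esub> (y \<otimes>\<^bsub>kQ\<^esub> z)"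
  using assms
  by (auto intro!: ext finsum_cong' simp: kQ_mult kQ_term_closed finsum_rdistr m_assoc m_lcomm)

text \<open>Of all the ways to split a list, only the cut after \<open>length p\<close> entries can
  produce p and q, so the convolution has at most one non-zero term, the constant c of the
  proof.\<close>

lemma path_elem_mult:
  assumes "(u, p) \<in> paths Q" "(v, q) \<in> paths Q"
  shows "path_elem K (u, p) \<otimes>\<^bsub>kQ\<^esub> path_elem K (v, q) =
    (if awlast u p = v then path_elem K (u, p @ q) else (\<lambda>w. \<zero>))"
proof (rule ext)
  fix w :: "'v \<times> 'e list"
  obtain u' r where w: "w = (u', r)" by (cases w)
  define c where "c = (if u' = u \<and> r = p @ q \<and> awlast u p = v then \<one> else \<zero>)"
  have cc: "c \<in> carrier K" by (simp add: c_def)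
  have "path_elem K (u, p) (u', take i r) \<otimes> path_elem K (v, q) (awlast u' (take i r), drop i r)
      = (if length p = i then c else \<zero>)" if "i \<le> length r" for i
  proof (cases "take i r = p \<and> drop i r = q")
    case True
    then have "length p = i" using that by auto
    moreover have "r = p @ q" using True append_take_drop_id[of i r] by simp
    ultimately have "length p = i" "r = p @ q" by auto
    then show ?thesis using True by (auto simp: path_elem_def c_def)
  next
    case False
    then have "\<not> (length p = i \<and> r = p @ q)" by auto
    then show ?thesis using False by (auto simp: path_elem_def c_def)
  qed
  then have "(path_elem K (u, p) \<otimes>\<^bsub>kQ\<^esub> path_elem K (v, q)) (u', r)
      = (\<Oplus>i\<in>{..length r}. if length p = i then c else \<zero>)"
    unfolding kQ_mult using cc by (intro finsum_cong') auto
  also have "\<dots> = c"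
  proof (cases "length p \<le> length r")
    case True
    then show ?thesis using finsum_singleton[of "length p" "{..length r}" "\<lambda>_. c"] cc by auto
  next
    case False
    then have "c = \<zero>" by (auto simp: c_def)
    then show ?thesis by (simp add: finsum_eq_zeroI)
  qed
  finally show "(path_elem K (u, p) \<otimes>\<^bsub>kQ\<^esub> path_elem K (v, q)) w =
    (if awlast u p = v then path_elem K (u, p @ q) else (\<lambda>w. \<zero>)) w"
    by (auto simp: w path_elem_def c_def)
qed

lemma kQ_mult_zero:
  assumes "z \<in> carrier kQ"
  shows "(\<lambda>w. \<zero>) \<otimes>\<^bsub>kQ\<^esub> z = (\<lambda>w. \<zero>)" "z \<otimes>\<^bsub>kQ\<^esub> (\<lambda>w. \<zero>) = (\<lambda>w. \<zero>)"
  using assms by (auto intro!: ext finsum_eq_zeroI simp: kQ_mult)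

lemma path_elem_assoc:
  assumes "a \<in> paths Q" "b \<in> paths Q" "c \<in> paths Q"
  shows "path_elem K a \<otimes>\<^bsub>kQ\<^esub> path_elem K b \<otimes>\<^bsub>kQ\<^esub> path_elem K c
       = path_elem K a \<otimes>\<^bsub>kQ\<^esub> (path_elem K b \<otimes>\<^bsub>kQ\<^esub> path_elem K c)"
proof -
  obtain u p v q w r where "a = (u, p)" "b = (v, q)" "c = (w, r)" by (metis surj_pair)
  then show ?thesis using assms
    by (simp add: path_elem_mult kQ_mult_zero paths_append awlast_append)
qed

text \<open>Both sides are linear in each factor. Inductions on z, on y and on x reduce the identity
  to three paths, where it is associativity of concatenation.\<close>

lemma kQ_assoc:
  assumes x: "x \<in> carrier kQ" and y: "y \<in> carrier kQ" and z: "z \<in> carrier kQ"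
  shows "x \<otimes>\<^bsub>kQ\<^esub> y \<otimes>\<^bsub>kQ\<^esub> z = x \<otimes>\<^bsub>kQ\<^esub> (y \<otimes>\<^bsub>kQ\<^esub> z)"
proof -
  note cl = kQ_mult_closed kQ_smult_closed kQ_add_closed path_elem_closed
  note [simp del] = kQ_simps
  have 1: "path_elem K a \<otimes>\<^bsub>kQ\<^esub> path_elem K b \<otimes>\<^bsub>kQ\<^esub> z = path_elem K a \<otimes>\<^bsub>kQ\<^esub> (path_elem K b \<otimes>\<^bsub>kQ\<^esub> z)"
    if ab: "a \<in> paths Q" "b \<in> paths Q" for a b
    using z
  proof (induction rule: kQ_induct)
    case zero
    then show ?case using ab by (simp add: kQ_mult_zero cl)
  next
    case (base c w)
    then show ?case using ab by (simp add: kQ_smult_mult cl path_elem_assoc)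
  next
    case (add s t)
    then show ?case using ab by (simp add: kQ_distrib cl)
  qed
  have 2: "path_elem K a \<otimes>\<^bsub>kQ\<^esub> y \<otimes>\<^bsub>kQ\<^esub> z = path_elem K a \<otimes>\<^bsub>kQ\<^esub> (y \<otimes>\<^bsub>kQ\<^esub> z)"
    if a: "a \<in> paths Q" for a
    using y
  proof (induction rule: kQ_induct)
    case zero
    then show ?case using a z by (simp add: kQ_mult_zero cl)
  next
    case (base c w)
    then show ?case using a z by (simp add: kQ_smult_mult cl 1)
  next
    case (add s t)
    then show ?case using a z by (simp add: kQ_distrib cl)
  qed
  show ?thesis
    using x
  proof (induction rule: kQ_induct)
    case zero
    then show ?case using y z by (simp add: kQ_mult_zero cl)
  next
    case (base c w)
    then show ?case using y z by (simp add: kQ_smult_mult cl 2)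
  next
    case (add s t)
    then show ?case using y z by (simp add: kQ_distrib cl)
  qed
qed

lemma kQ_one_mult:
  assumes z: "z \<in> carrier kQ"
  shows "\<one>\<^bsub>kQ\<^esub> \<otimes>\<^bsub>kQ\<^esub> z = z" "z \<otimes>\<^bsub>kQ\<^esub> \<one>\<^bsub>kQ\<^esub> = z"
proof -
  show "\<one>\<^bsub>kQ\<^esub> \<otimes>\<^bsub>kQ\<^esub> z = z"
  proof (rule ext)
    fix w :: "'v \<times> 'e list"
    obtain u p where w: "w = (u, p)" by (cases w)
    have "(\<one>\<^bsub>kQ\<^esub> \<otimes>\<^bsub>kQ\<^esub> z) (u, p) = (\<Oplus>i\<in>{..length p}. if 0 = i then z (u, p) else \<zero>)"
      unfolding kQ_mult
    proof -
      \<comment> \<open>The unit is zero at a trivial path outside the vertex set; the term for i =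
        0 is still right there because z vanishes as well.\<close>
      have "z (u, p) = \<zero>" if "u \<notin> verts Q" using that kQ_outside[OF z] paths_verts(1) by blast
      then show "(\<Oplus>i\<in>{..length p}. \<one>\<^bsub>kQ\<^esub> (u, take i p) \<otimes> z (awlast u (take i p), drop i p))
        = (\<Oplus>i\<in>{..length p}. if 0 = i then z (u, p) else \<zero>)"
        using z by (intro finsum_cong') (auto simp: kQ_one)
    qed
    also have "\<dots> = z (u, p)" using finsum_singleton[of 0 "{..length p}" "\<lambda>_. z (u, p)"] z by auto
    finally show "(\<one>\<^bsub>kQ\<^esub> \<otimes>\<^bsub>kQ\<^esub> z) w = z w" using w by simp
  qed
  show "z \<otimes>\<^bsub>kQ\<^esub> \<one>\<^bsub>kQ\<^esub> = z"
  proof (rule ext)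
    fix w :: "'v \<times> 'e list"
    obtain u p where w: "w = (u, p)" by (cases w)
    have "(z \<otimes>\<^bsub>kQ\<^esub> \<one>\<^bsub>kQ\<^esub>) (u, p) = (\<Oplus>i\<in>{..length p}. if length p = i then z (u, p) else \<zero>)"
      unfolding kQ_mult
    proof -
      have "z (u, p) = \<zero>" if "awlast u p \<notin> verts Q" using that kQ_outside[OF z] paths_verts(2) by blast
      then show "(\<Oplus>i\<in>{..length p}. z (u, take i p) \<otimes> \<one>\<^bsub>kQ\<^esub> (awlast u (take i p), drop i p))
        = (\<Oplus>i\<in>{..length p}. if length p = i then z (u, p) else \<zero>)"
        using z by (intro finsum_cong') (auto simp: kQ_one)
    qed
    also have "\<dots> = z (u, p)" using finsum_singleton[of "length p" "{..length p}" "\<lambda>_. z (u, p)"] z by auto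
    finally show "(z \<otimes>\<^bsub>kQ\<^esub> \<one>\<^bsub>kQ\<^esub>) w = z w" using w by simp
  qed
qed

lemma kQ_abelian_group: "abelian_group kQ"
proof (rule abelian_groupI)
  fix x assume "x \<in> carrier kQ"
  moreover from this have "(\<ominus> \<one>) \<odot>\<^bsub>kQ\<^esub> x \<in> carrier kQ" by (intro kQ_smult_closed) auto
  ultimately show "\<exists>y\<in>carrier kQ. y \<oplus>\<^bsub>kQ\<^esub> x = \<zero>\<^bsub>kQ\<^esub>"
    by (intro bexI[of _ "(\<ominus> \<one>) \<odot>\<^bsub>kQ\<^esub> x"]) (auto simp: l_minus l_neg)
qed (use kQ_add_closed kQ_zero_closed in \<open>auto simp: a_assoc intro!: a_comm\<close>)

sublocale kQ: k_algebra K kQ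
proof -
  have ring: "ring kQ"
  proof (rule ringI[OF kQ_abelian_group])
    show "Group.monoid kQ"
      by (rule monoidI) (auto simp: kQ_mult_closed kQ_one_closed kQ_assoc kQ_one_mult simp del: kQ_simps)
  qed (auto simp: kQ_distrib simp del: kQ_simps)
  have mod: "module K kQ"
    by (rule module.intro[OF is_cring kQ_abelian_group])
       (unfold_locales, auto simp: kQ_smult_closed[unfolded kQ_simps] l_distr r_distr m_assoc)
  show "k_algebra K kQ"
    by (intro k_algebra.intro field_axioms mod ring k_algebra_axioms.intro)
       (auto simp: kQ_smult_mult simp del: kQ_simps)
qed

section \<open>Paths through and paths avoiding a set of arrows\<close>

lemma part_avoiding_closed: "z \<in> carrier kQ \<Longrightarrow> part_avoiding K A z \<in> carrier kQ"
  and part_through_closed: "z \<in> carrier kQ \<Longrightarrow> part_through K A z \<in> carrier kQ"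
  by (rule kQ_carrier_subset[of "{w. z w \<noteq> \<zero>}"],
      auto simp: part_avoiding_def part_through_def kQ_finite intro: ccontr[OF kQ_outside[THEN notE[rotated]]])+

lemma part_sum: "z \<in> carrier kQ \<Longrightarrow> part_through K A z \<oplus>\<^bsub>kQ\<^esub> part_avoiding K A z = z"
  by (auto simp: part_through_def part_avoiding_def)

text \<open>A path avoids A if and only if both pieces of each of its splittings do. So discarding
  the paths through A is an algebra endomorphism, the retraction of kQ onto the path algebra of the
  quiver without A.\<close>

lemma part_avoiding_mult:
  assumes y: "y \<in> carrier kQ" and z: "z \<in> carrier kQ"
  shows "part_avoiding K A (y \<otimes>\<^bsub>kQ\<^esub> z) = part_avoiding K A y \<otimes>\<^bsub>kQ\<^esub> part_avoiding K A z"
proof (rule ext)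
  fix w :: "'v \<times> 'e list"
  obtain u p where w: "w = (u, p)" by (cases w)
  have s: "set p = set (take i p) \<union> set (drop i p)" for i by (metis append_take_drop_id set_append)
  show "part_avoiding K A (y \<otimes>\<^bsub>kQ\<^esub> z) w = (part_avoiding K A y \<otimes>\<^bsub>kQ\<^esub> part_avoiding K A z) w"
  proof (cases "set p \<inter> A = {}")
    case True
    then have "set (take i p) \<inter> A = {}" "set (drop i p) \<inter> A = {}" for i using s[of i] by auto
    then show ?thesis using True w by (simp add: part_avoiding_def kQ_mult)
  next
    case False
    then have "set (take i p) \<inter> A \<noteq> {} \<or> set (drop i p) \<inter> A \<noteq> {}" for i using s[of i] by auto
    then have "part_avoiding K A y (u, take i p) \<otimes> part_avoiding K A z (awlast u (take i p), drop i p) = \<zero>" for i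
      using y z by (fastforce simp: part_avoiding_def)
    then show ?thesis using False w by (simp add: part_avoiding_def kQ_mult finsum_eq_zeroI)
  qed
qed

lemma part_avoiding_add:
  "part_avoiding K A (y \<oplus>\<^bsub>kQ\<^esub> z) = part_avoiding K A y \<oplus>\<^bsub>kQ\<^esub> part_avoiding K A z"
  by (auto simp: part_avoiding_def)

lemma part_avoiding_smult:
  "c \<in> carrier K \<Longrightarrow> part_avoiding K A (c \<odot>\<^bsub>kQ\<^esub> z) = c \<odot>\<^bsub>kQ\<^esub> part_avoiding K A z"
  by (auto simp: part_avoiding_def)

lemma part_avoiding_one: "part_avoiding K A \<one>\<^bsub>kQ\<^esub> = \<one>\<^bsub>kQ\<^esub>"
  by (auto simp: part_avoiding_def kQ_one)

end

section \<open>Splittings by a nilpotent ideal\<close>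

text \<open>The product is \<open>mprod\<close> unfolded, so that the notion depends on the ring
  alone.\<close>

definition nilpotent_set :: "('a, 'x) ring_scheme \<Rightarrow> 'a set \<Rightarrow> bool" where
  "nilpotent_set R N \<longleftrightarrow> (\<exists>m>0. \<forall>xs. set xs \<subseteq> N \<and> length xs = m \<longrightarrow>
     foldr (\<lambda>x y. x \<otimes>\<^bsub>R\<^esub> y) xs \<one>\<^bsub>R\<^esub> = \<zero>\<^bsub>R\<^esub>)"

text \<open>An internal form of \<Lambda> = \<sigma>(\<Gamma>) \<oplus> N with N a nilpotent ideal.
  The last condition yields both that \<sigma> is injective and that its image meets N only in
  zero.\<close>

definition nilpotent_splitting :: "('k, 'x) ring_scheme \<Rightarrow> ('k, 'a, 'y) module_scheme
    \<Rightarrow> ('k, 'b, 'z) module_scheme \<Rightarrow> ('a \<Rightarrow> 'b) \<Rightarrow> 'b set \<Rightarrow> bool" where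
  "nilpotent_splitting K G L \<sigma> N \<longleftrightarrow> \<sigma> \<in> ring_hom G L \<and>
     (\<forall>c\<in>carrier K. \<forall>x\<in>carrier G. \<sigma> (c \<odot>\<^bsub>G\<^esub> x) = c \<odot>\<^bsub>L\<^esub> \<sigma> x) \<and> ideal N L \<and> nilpotent_set L N \<and>
     (\<forall>x\<in>carrier L. \<exists>g\<in>carrier G. \<exists>n\<in>N. x = \<sigma> g \<oplus>\<^bsub>L\<^esub> n) \<and>
     (\<forall>g\<in>carrier G. \<sigma> g \<in> N \<longrightarrow> g = \<zero>\<^bsub>G\<^esub>)"

text \<open>The common homological condition on \<langle>A + I\<rangle> and on 0 \<oplus> M. The
  second alternative is the only left removable case, with square zero expressed by
  elements.\<close>

definition removable_ideal :: "('k, 'a, 'y) module_scheme \<Rightarrow> 'a set \<Rightarrow> bool" where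
  "removable_ideal R N \<longleftrightarrow> pd_finite (right_pd R N) \<and>
     (pd_finite (left_pd R N) \<or> (\<forall>x\<in>N. \<forall>y\<in>N. x \<otimes>\<^bsub>R\<^esub> y = \<zero>\<^bsub>R\<^esub>) \<and> left_pd R N = \<infinity>)"

lemma removable_ideal_iso:
  fixes R :: "('k, 'a, 'y) module_scheme" and S :: "('k, 'b, 'z) module_scheme"
  assumes R: "ring R" and S: "ring S" and f: "f \<in> ring_iso R S" and N: "N \<subseteq> carrier R"
  shows "removable_ideal S (f ` N) \<longleftrightarrow> removable_ideal R N"
proof -
  have fh: "f \<in> ring_hom R S" and inj: "inj_on f (carrier R)"
    using f by (auto simp: ring_iso_def bij_betw_def)
  have "f x \<otimes>\<^bsub>S\<^esub> f y = \<zero>\<^bsub>S\<^esub> \<longleftrightarrow> x \<otimes>\<^bsub>R\<^esub> y = \<zero>\<^bsub>R\<^esub>" if "x \<in> N" "y \<in> N" for x y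
  proof -
    have xy: "x \<in> carrier R" "y \<in> carrier R" using that N by auto
    then have "x \<otimes>\<^bsub>R\<^esub> y \<in> carrier R" "\<zero>\<^bsub>R\<^esub> \<in> carrier R"
      using R by (auto simp: ring.ring_simprules)
    then show ?thesis
      using inj_onD[OF inj, of "x \<otimes>\<^bsub>R\<^esub> y" "\<zero>\<^bsub>R\<^esub>"] ring_hom_mult[OF fh xy] ring_hom_zero[OF fh R S] by auto
  qed
  then have "(\<forall>x\<in>f ` N. \<forall>y\<in>f ` N. x \<otimes>\<^bsub>S\<^esub> y = \<zero>\<^bsub>S\<^esub>) \<longleftrightarrow> (\<forall>x\<in>N. \<forall>y\<in>N. x \<otimes>\<^bsub>R\<^esub> y = \<zero>\<^bsub>R\<^esub>)"
    by simp
  then show ?thesis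
    unfolding removable_ideal_def left_pd_ring_iso[OF assms] right_pd_ring_iso[OF assms] by simp
qed

lemma ring_iso_inverse:
  assumes "ring R" "f \<in> ring_iso R S"
  obtains g where "g \<in> ring_iso S R" "\<And>x. x \<in> carrier R \<Longrightarrow> g (f x) = x"
    "\<And>y. y \<in> carrier S \<Longrightarrow> f (g y) = y"
proof
  show "inv_into (carrier R) f \<in> ring_iso S R" by (rule ring_iso_set_sym[OF assms])
  have "bij_betw f (carrier R) (carrier S)" using assms(2) by (simp add: ring_iso_def)
  then show "\<And>x. x \<in> carrier R \<Longrightarrow> inv_into (carrier R) f (f x) = x"
    "\<And>y. y \<in> carrier S \<Longrightarrow> f (inv_into (carrier R) f y) = y"
    by (auto simp: bij_betw_inv_into_left bij_betw_inv_into_right)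
qed

lemma surj_image_ideal:
  assumes R: "ring R" and S: "ring S" and h: "h \<in> ring_hom R S" "h ` carrier R = carrier S" and J: "ideal J R"
  shows "ideal (h ` J) S"
proof -
  interpret R: ring R by fact
  interpret S: ring S by fact
  interpret J: ideal J R by fact
  interpret h: ring_hom_ring R S h by (rule ring_hom_ringI2) (use assms in auto)
  show ?thesis
  proof (rule idealI[OF S])
    show "subgroup (h ` J) (add_monoid S)"
      by (rule group_hom.subgroup_img_is_subgroup[OF h.a_group_hom J.a_subgroup])
  next
    fix a x assume ax: "a \<in> h ` J" "x \<in> carrier S"
    obtain b where b: "b \<in> J" "a = h b" using ax(1) by blast
    obtain y where y: "y \<in> carrier R" "x = h y" using ax(2) h(2) by blast
    have "x \<otimes>\<^bsub>S\<^esub> a = h (y \<otimes>\<^bsub>R\<^esub> b)" "a \<otimes>\<^bsub>S\<^esub> x = h (b \<otimes>\<^bsub>R\<^esub> y)" using b y by (simp_all add: J.Icarr)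
    moreover have "h (y \<otimes>\<^bsub>R\<^esub> b) \<in> h ` J" "h (b \<otimes>\<^bsub>R\<^esub> y) \<in> h ` J"
      using b y J.I_l_closed J.I_r_closed by blast+
    ultimately show "x \<otimes>\<^bsub>S\<^esub> a \<in> h ` J" "a \<otimes>\<^bsub>S\<^esub> x \<in> h ` J" by metis+
  qed
qed

text \<open>Applied to coset maps it makes \<open>quot_alg\<close> an algebra over the field, since
  all laws can be checked on representatives.\<close>

lemma k_algebra_surj_image:
  assumes A: "k_algebra K A" and B: "ring B" and h: "h \<in> ring_hom A B" "h ` carrier A = carrier B"
    and hl: "\<And>c x. c \<in> carrier K \<Longrightarrow> x \<in> carrier A \<Longrightarrow> h (c \<odot>\<^bsub>A\<^esub> x) = c \<odot>\<^bsub>B\<^esub> h x"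
  shows "k_algebra K B"
proof -
  interpret A: k_algebra K A by fact
  interpret h: ring_hom_ring A B h by (rule ring_hom_ringI2[OF A.A.ring_axioms B h(1)])
  have ex: "\<exists>x\<in>carrier A. y = h x" if "y \<in> carrier B" for y using h(2) that by blast
  have "module K B"
  proof (rule module.intro[OF A.is_cring h.S.abelian_group_axioms], unfold_locales)
    fix c d x y assume *: "c \<in> carrier K" "d \<in> carrier K" "x \<in> carrier B" "y \<in> carrier B"
    obtain a b where ab: "a \<in> carrier A" "x = h a" "b \<in> carrier A" "y = h b"
      using ex *(3,4) by blast
    show "c \<odot>\<^bsub>B\<^esub> x \<in> carrier B" using ab * by (simp add: hl[symmetric])
    show "(c \<oplus>\<^bsub>K\<^esub> d) \<odot>\<^bsub>B\<^esub> x = c \<odot>\<^bsub>B\<^esub> x \<oplus>\<^bsub>B\<^esub> d \<odot>\<^bsub>B\<^esub> x"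
      using ab * by (simp add: hl[symmetric] A.K_simprules A.smult_l_distr)
    show "c \<odot>\<^bsub>B\<^esub> (x \<oplus>\<^bsub>B\<^esub> y) = c \<odot>\<^bsub>B\<^esub> x \<oplus>\<^bsub>B\<^esub> c \<odot>\<^bsub>B\<^esub> y"
      using ab * hl[of c "a \<oplus>\<^bsub>A\<^esub> b"] by (simp add: hl A.smult_r_distr)
    show "(c \<otimes>\<^bsub>K\<^esub> d) \<odot>\<^bsub>B\<^esub> x = c \<odot>\<^bsub>B\<^esub> (d \<odot>\<^bsub>B\<^esub> x)"
      using ab * by (simp add: hl[symmetric] A.K_simprules A.smult_assoc1)
  next
    show "x \<in> carrier B \<Longrightarrow> \<one>\<^bsub>K\<^esub> \<odot>\<^bsub>B\<^esub> x = x" for x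
      using ex[of x] by (auto simp: hl[symmetric] A.K_simprules)
  qed
  then show ?thesis
  proof (intro k_algebra.intro A.field_axioms B k_algebra_axioms.intro)
    fix c x y assume *: "c \<in> carrier K" "x \<in> carrier B" "y \<in> carrier B"
    obtain a b where ab: "a \<in> carrier A" "x = h a" "b \<in> carrier A" "y = h b"
      using ex *(2,3) by blast
    show "(c \<odot>\<^bsub>B\<^esub> x) \<otimes>\<^bsub>B\<^esub> y = c \<odot>\<^bsub>B\<^esub> (x \<otimes>\<^bsub>B\<^esub> y)"
      using ab * hl[of c "a \<otimes>\<^bsub>A\<^esub> b"] hl[of c a] A.smult_mult_left[of c a b]
        h.hom_mult[of "c \<odot>\<^bsub>A\<^esub> a" b] by simp
    show "x \<otimes>\<^bsub>B\<^esub> (c \<odot>\<^bsub>B\<^esub> y) = c \<odot>\<^bsub>B\<^esub> (x \<otimes>\<^bsub>B\<^esub> y)"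
      using ab * hl[of c "a \<otimes>\<^bsub>A\<^esub> b"] hl[of c b] A.smult_mult_right[of c a b]
        h.hom_mult[of a "c \<odot>\<^bsub>A\<^esub> b"] by simp
  qed
qed

text \<open>The value at y is r of a chosen preimage; two preimages differ by an element of the
  kernel of q, so the choice does not matter. This is how a map on \<Gamma> is obtained from one on
  kQ.\<close>

lemma surj_hom_factor:
  assumes R: "ring R" and S: "ring S" and T: "ring T"
    and q: "q \<in> ring_hom R S" "q ` carrier R = carrier S" and r: "r \<in> ring_hom R T"
    and ker: "\<And>x. x \<in> carrier R \<Longrightarrow> q x = \<zero>\<^bsub>S\<^esub> \<Longrightarrow> r x = \<zero>\<^bsub>T\<^esub>"
  obtains \<sigma> where "\<sigma> \<in> ring_hom S T" "\<And>x. x \<in> carrier R \<Longrightarrow> \<sigma> (q x) = r x"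
proof -
  interpret q: ring_hom_ring R S q by (rule ring_hom_ringI2) (use assms in auto)
  interpret r: ring_hom_ring R T r by (rule ring_hom_ringI2) (use assms in auto)
  define \<sigma> where "\<sigma> y = r (SOME x. x \<in> carrier R \<and> q x = y)" for y
  have *: "\<sigma> (q x) = r x" if x: "x \<in> carrier R" for x
  proof -
    define x' where "x' = (SOME x'. x' \<in> carrier R \<and> q x' = q x)"
    have "\<exists>x'. x' \<in> carrier R \<and> q x' = q x" using x by auto
    then have x': "x' \<in> carrier R" "q x' = q x" unfolding x'_def by (metis (mono_tags, lifting) someI_ex)+
    have "q (x' \<ominus>\<^bsub>R\<^esub> x) = \<zero>\<^bsub>S\<^esub>" using x x' by (simp add: a_minus_def q.S.r_neg)
    then have "r (x' \<ominus>\<^bsub>R\<^esub> x) = \<zero>\<^bsub>T\<^esub>" using x x' by (intro ker) auto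
    then have "r x' \<ominus>\<^bsub>T\<^esub> r x = \<zero>\<^bsub>T\<^esub>" using x x' by (simp add: a_minus_def)
    then have "r x' = r x" using x x' by (simp add: r.S.r_right_minus_eq)
    then show ?thesis by (simp add: \<sigma>_def x'_def)
  qed
  have "\<sigma> \<in> ring_hom S T"
  proof (rule ring_hom_memI)
    fix x assume "x \<in> carrier S"
    then obtain a where a: "a \<in> carrier R" "x = q a" using q(2) by auto
    then show "\<sigma> x \<in> carrier T" by (simp add: *)
  next
    fix x y assume "x \<in> carrier S" "y \<in> carrier S"
    then obtain a b where a: "a \<in> carrier R" "x = q a" "b \<in> carrier R" "y = q b" using q(2) by blast
    show "\<sigma> (x \<otimes>\<^bsub>S\<^esub> y) = \<sigma> x \<otimes>\<^bsub>T\<^esub> \<sigma> y" using a *[of "a \<otimes>\<^bsub>R\<^esub> b"] by (simp add: *)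
    show "\<sigma> (x \<oplus>\<^bsub>S\<^esub> y) = \<sigma> x \<oplus>\<^bsub>T\<^esub> \<sigma> y" using a *[of "a \<oplus>\<^bsub>R\<^esub> b"] by (simp add: *)
  next
    show "\<sigma> \<one>\<^bsub>S\<^esub> = \<one>\<^bsub>T\<^esub>" using *[of "\<one>\<^bsub>R\<^esub>"] by simp
  qed
  then show ?thesis using that * by blast
qed

section \<open>Ideals generated by arrows\<close>

lemma ideal_prod_zero_iff:
  assumes "ring R" "ideal N R"
  shows "N \<cdot>\<^bsub>R\<^esub> N = {\<zero>\<^bsub>R\<^esub>} \<longleftrightarrow> (\<forall>x\<in>N. \<forall>y\<in>N. x \<otimes>\<^bsub>R\<^esub> y = \<zero>\<^bsub>R\<^esub>)"
proof
  interpret ring R by fact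
  interpret N: ideal N R by fact
  assume *: "\<forall>x\<in>N. \<forall>y\<in>N. x \<otimes>\<^bsub>R\<^esub> y = \<zero>\<^bsub>R\<^esub>"
  have "z = \<zero>\<^bsub>R\<^esub>" if "z \<in> N \<cdot>\<^bsub>R\<^esub> N" for z
    using that
  proof (induction rule: ideal_prod.induct)
    case (prod i j)
    then show ?case using *[rule_format, of i j] by simp
  next
    case (sum s t)
    then show ?case by simp
  qed
  moreover have "\<zero>\<^bsub>R\<^esub> \<in> N \<cdot>\<^bsub>R\<^esub> N"
    using ideal_prod.prod[OF N.zero_closed N.zero_closed, of R] by simp
  ultimately show "N \<cdot>\<^bsub>R\<^esub> N = {\<zero>\<^bsub>R\<^esub>}" by blast
next
  assume *: "N \<cdot>\<^bsub>R\<^esub> N = {\<zero>\<^bsub>R\<^esub>}"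
  show "\<forall>x\<in>N. \<forall>y\<in>N. x \<otimes>\<^bsub>R\<^esub> y = \<zero>\<^bsub>R\<^esub>"
  proof (intro ballI)
    fix x y assume "x \<in> N" "y \<in> N"
    then have "x \<otimes>\<^bsub>R\<^esub> y \<in> N \<cdot>\<^bsub>R\<^esub> N" by (rule ideal_prod.prod)
    then show "x \<otimes>\<^bsub>R\<^esub> y = \<zero>\<^bsub>R\<^esub>" using * by simp
  qed
qed

text \<open>For arrows the left dimension is required not to be finite, in
  \<open>removable_ideal\<close> to be \<infinity>. These agree because a finite right dimension
  forces the ideal to be non-zero, which excludes -\<infinity> on the left.\<close>

lemma removable_arrows_iff:
  assumes R: "ring (bq_algebra K Q I)" and N: "ideal (arrow_ideal K Q I A) (bq_algebra K Q I)"
  shows "removable_arrows K Q I A \<longleftrightarrow>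
    pre_removable K Q I A \<and> removable_ideal (bq_algebra K Q I) (arrow_ideal K Q I A)"
proof -
  let ?B = "bq_algebra K Q I" and ?a = "arrow_ideal K Q I A"
  have "\<not> pd_finite (left_pd ?B ?a) \<longleftrightarrow> left_pd ?B ?a = \<infinity>" if "pd_finite (right_pd ?B ?a)"
  proof -
    have "?a \<noteq> {\<zero>\<^bsub>?B\<^esub>}" using that right_pd_zero[OF R] by auto
    moreover have "\<zero>\<^bsub>?B\<^esub> \<in> ?a" using N additive_subgroup.zero_closed ideal.axioms(1) by blast
    ultimately have "left_pd ?B ?a \<noteq> -\<infinity>" by (rule left_pd_not_minus_infinity)
    then show ?thesis by (cases "left_pd ?B ?a") auto
  qed
  then show ?thesis
    unfolding removable_arrows_def two_sided_removable_arrows_def only_left_removable_arrows_def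
      removable_ideal_def ideal_prod_zero_iff[OF R N] by (cases "pd_finite (right_pd ?B ?a)") auto
qed

context quiver_algebra begin

lemma path_elem_through:
  assumes p: "(u, p) \<in> paths Q" and a: "a \<in> set p"
  obtains x y where "x \<in> carrier kQ" "y \<in> carrier kQ"
    "path_elem K (u, p) = x \<otimes>\<^bsub>kQ\<^esub> (path_elem K (tail Q a, [a]) \<otimes>\<^bsub>kQ\<^esub> y)"
proof -
  obtain p1 p2 where s: "p = p1 @ a # p2" using a by (auto simp: in_set_conv_decomp)
  then have pp: "(u, p1) \<in> paths Q" "a \<in> arcs Q" "awlast u p1 = tail Q a" "(head Q a, p2) \<in> paths Q"
    using p by (auto simp: paths_append paths_Cons)
  have "path_elem K (tail Q a, [a]) \<otimes>\<^bsub>kQ\<^esub> path_elem K (head Q a, p2) = path_elem K (tail Q a, a # p2)"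
    using pp paths_arc by (simp add: path_elem_mult)
  moreover have "path_elem K (u, p1) \<otimes>\<^bsub>kQ\<^esub> path_elem K (tail Q a, a # p2) = path_elem K (u, p)"
    using pp s by (subst path_elem_mult) (auto simp: paths_Cons)
  ultimately show ?thesis using that[of "path_elem K (u, p1)" "path_elem K (head Q a, p2)"] pp by simp
qed

lemma part_avoiding_ring_hom: "part_avoiding K A \<in> ring_hom kQ kQ"
  by (rule ring_hom_memI) (auto simp: part_avoiding_closed part_avoiding_mult part_avoiding_add
      part_avoiding_one simp del: kQ_simps)

lemma part_avoiding_idem: "part_avoiding K A (part_avoiding K A z) = part_avoiding K A z"
  and part_avoiding_through: "part_avoiding K A (part_through K A z) = (\<lambda>w. \<zero>)"
  by (auto simp: part_avoiding_def part_through_def)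

lemma part_through_minus:
  assumes z: "z \<in> carrier kQ"
  shows "z \<ominus>\<^bsub>kQ\<^esub> part_through K A z = part_avoiding K A z"
    and "z \<ominus>\<^bsub>kQ\<^esub> part_avoiding K A z = part_through K A z"
proof -
  have t: "part_through K A z \<in> carrier kQ" and a: "part_avoiding K A z \<in> carrier kQ"
    using z by (auto intro: part_through_closed part_avoiding_closed)
  have "(x \<oplus>\<^bsub>kQ\<^esub> y) \<ominus>\<^bsub>kQ\<^esub> x = y" "(x \<oplus>\<^bsub>kQ\<^esub> y) \<ominus>\<^bsub>kQ\<^esub> y = x"
    if "x \<in> carrier kQ" "y \<in> carrier kQ" for x y
    using that by (simp_all add: a_minus_def kQ.A.ring_simprules del: kQ_simps) (metis kQ.A.ring_simprules)+
  from this[OF t a] show "z \<ominus>\<^bsub>kQ\<^esub> part_through K A z = part_avoiding K A z"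
    "z \<ominus>\<^bsub>kQ\<^esub> part_avoiding K A z = part_through K A z"
    unfolding part_sum[OF z] by auto
qed

text \<open>A path meeting A factors as x a y with a in A, so its image lies in every ideal
  containing the images of these arrows. With h the coset map this gives, in both directions of the
  proof, the inclusion into the arrow ideal.\<close>

lemma through_in_arrow_ideal:
  fixes h :: "('v \<times> 'e list \<Rightarrow> 'k) \<Rightarrow> 'c"
  assumes R: "ring R" and h: "h \<in> ring_hom kQ R" and J: "ideal J R"
    and gen: "\<And>a. a \<in> A \<Longrightarrow> a \<in> arcs Q \<Longrightarrow> h (path_elem K (tail Q a, [a])) \<in> J"
    and z: "z \<in> carrier kQ"
  shows "h (part_through K A z) \<in> J"
  using z
proof (induction rule: kQ_induct)
  case zero
  have "h \<zero>\<^bsub>kQ\<^esub> = \<zero>\<^bsub>R\<^esub>" using ring_hom_zero[OF h kQ.A.ring_axioms R] .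
  then show ?case using J additive_subgroup.zero_closed ideal.axioms(1)
    by (fastforce simp: part_through_def)
next
  case (base c w)
  obtain u p where w: "w = (u, p)" by (cases w)
  show ?case
  proof (cases "set p \<inter> A = {}")
    case True
    then have "part_through K A (c \<odot>\<^bsub>kQ\<^esub> path_elem K w) = \<zero>\<^bsub>kQ\<^esub>"
      using base w by (auto simp: part_through_def path_elem_def)
    then show ?thesis using ring_hom_zero[OF h kQ.A.ring_axioms R] J additive_subgroup.zero_closed ideal.axioms(1)
      by metis
  next
    case False
    then obtain a where a: "a \<in> set p" "a \<in> A" by auto
    then have aQ: "a \<in> arcs Q" using paths_arcs base(2) w by auto
    obtain x y where xy: "x \<in> carrier kQ" "y \<in> carrier kQ"
      "path_elem K (u, p) = x \<otimes>\<^bsub>kQ\<^esub> (path_elem K (tail Q a, [a]) \<otimes>\<^bsub>kQ\<^esub> y)"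
      using path_elem_through[of u p a] base(2) a w by auto
    note pc = path_elem_closed[OF paths_arc[OF aQ]]
    have "part_through K A (c \<odot>\<^bsub>kQ\<^esub> path_elem K w) = c \<odot>\<^bsub>kQ\<^esub> path_elem K w"
      unfolding w by (rule ext) (use base False in \<open>simp add: part_through_def path_elem_def\<close>)
    also have "\<dots> = (c \<odot>\<^bsub>kQ\<^esub> x) \<otimes>\<^bsub>kQ\<^esub> (path_elem K (tail Q a, [a]) \<otimes>\<^bsub>kQ\<^esub> y)"
      using xy base(1) pc by (simp add: w kQ_smult_mult(1) kQ_mult_closed del: kQ_simps)
    finally have "h (part_through K A (c \<odot>\<^bsub>kQ\<^esub> path_elem K w))
      = h (c \<odot>\<^bsub>kQ\<^esub> x) \<otimes>\<^bsub>R\<^esub> (h (path_elem K (tail Q a, [a])) \<otimes>\<^bsub>R\<^esub> h y)"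
      using xy pc base(1) by (simp add: ring_hom_mult[OF h] kQ_mult_closed kQ_smult_closed del: kQ_simps)
    then show ?thesis
      using ideal.I_l_closed[OF J ideal.I_r_closed[OF J gen[OF a(2) aQ]]] ring_hom_closed[OF h] xy base(1)
      by (simp add: kQ_smult_closed del: kQ_simps)
  qed
next
  case (add x y)
  have "part_through K A (x \<oplus>\<^bsub>kQ\<^esub> y) = part_through K A x \<oplus>\<^bsub>kQ\<^esub> part_through K A y"
    by (auto simp: part_through_def)
  then have "h (part_through K A (x \<oplus>\<^bsub>kQ\<^esub> y)) = h (part_through K A x) \<oplus>\<^bsub>R\<^esub> h (part_through K A y)"
    using add ring_hom_add[OF h] by (simp add: part_through_closed del: kQ_simps)
  then show ?case using add additive_subgroup.a_closed[OF ideal.axioms(1)[OF J]] by metis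
qed

text \<open>The k-th power of the ideal of kQ generated by all arrows; admissibility places one of
  these powers inside I.\<close>

definition deep :: "nat \<Rightarrow> ('v \<times> 'e list \<Rightarrow> 'k) set" where
  "deep k = {z \<in> carrier kQ. \<forall>w. z w \<noteq> \<zero> \<longrightarrow> k \<le> length (snd w)}"

lemma deep_mult:
  assumes "y \<in> deep j" "z \<in> deep k" shows "y \<otimes>\<^bsub>kQ\<^esub> z \<in> deep (j + k)"
proof -
  have yz: "y \<in> carrier kQ" "z \<in> carrier kQ" using assms by (auto simp: deep_def)
  have "j + k \<le> length p" if ne: "(y \<otimes>\<^bsub>kQ\<^esub> z) (u, p) \<noteq> \<zero>" for u p
  proof -
    obtain i where i: "i \<le> length p" "y (u, take i p) \<otimes> z (awlast u (take i p), drop i p) \<noteq> \<zero>"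
    proof -
      have "\<exists>i\<in>{..length p}. y (u, take i p) \<otimes> z (awlast u (take i p), drop i p) \<noteq> \<zero>"
      proof (rule ccontr)
        assume "\<not> ?thesis"
        then have "(y \<otimes>\<^bsub>kQ\<^esub> z) (u, p) = \<zero>" unfolding kQ_mult by (intro finsum_eq_zeroI) blast
        then show False using ne by simp
      qed
      then show ?thesis using that by auto
    qed
    then have "y (u, take i p) \<noteq> \<zero>" "z (awlast u (take i p), drop i p) \<noteq> \<zero>" using yz by auto
    then have "j \<le> length (take i p)" "k \<le> length (drop i p)" using assms by (fastforce simp: deep_def)+
    then show ?thesis by auto
  qed
  then show ?thesis using kQ_mult_closed[OF yz] by (auto simp: deep_def)
qed

text \<open>A path of length at least N has an initial segment of length N, which lies in I.\<close>

lemma deep_subset_ideal: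
  assumes I: "ideal I kQ" and N: "\<And>w. w \<in> paths Q \<Longrightarrow> length (snd w) = N \<Longrightarrow> path_elem K w \<in> I"
  shows "deep N \<subseteq> I"
proof
  fix z assume z: "z \<in> deep N"
  \<comment> \<open>The induction is carried out for the truncation of z to paths of length at least
    N, because the summands into which the induction breaks an element need not be deep.\<close>
  let ?d = "\<lambda>z w. if N \<le> length (snd w) then z w else \<zero>"
  note sI = kQ.ideal_subspace[OF I]
  have "z \<in> carrier kQ" using z by (simp add: deep_def)
  then have "?d z \<in> I"
  proof (induction rule: kQ_induct)
    case zero
    then show ?case using kQ.subspace_zero[OF sI] by simp
  next
    case (base c w)
    show ?case
    proof (cases "N \<le> length (snd w)")
      case True
      obtain u p where w: "w = (u, p)" by (cases w)
      have pp: "(u, take N p) \<in> paths Q" "(awlast u (take N p), drop N p) \<in> paths Q"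
        using base(2) w paths_append[of u "take N p" "drop N p"] by auto
      have "path_elem K (u, take N p) \<in> I" using N[OF pp(1)] True w by simp
      then have "path_elem K (u, take N p) \<otimes>\<^bsub>kQ\<^esub> path_elem K (awlast u (take N p), drop N p) \<in> I"
        using ideal.I_r_closed[OF I] pp by simp
      then have "path_elem K w \<in> I" using pp w by (simp add: path_elem_mult)
      moreover have "?d (c \<odot>\<^bsub>kQ\<^esub> path_elem K w) = c \<odot>\<^bsub>kQ\<^esub> path_elem K w"
        by (rule ext) (use True base in \<open>simp add: path_elem_def\<close>)
      ultimately show ?thesis using kQ.subspace_smult[OF sI base(1)] by metis
    next
      case False
      then have "?d (c \<odot>\<^bsub>kQ\<^esub> path_elem K w) = (\<lambda>w. \<zero>)"
        by (intro ext) (use base in \<open>simp add: path_elem_def\<close>)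
      then show ?thesis using kQ.subspace_zero[OF sI] by simp
    qed
  next
    case (add x y)
    have "?d (x \<oplus>\<^bsub>kQ\<^esub> y) = ?d x \<oplus>\<^bsub>kQ\<^esub> ?d y" by auto
    then show ?case using kQ.subspace_add[OF sI add(3,4)] by metis
  qed
  moreover have "?d z = z"
  proof
    fix w
    have "z w = \<zero> \<or> N \<le> length (snd w)" using z unfolding deep_def by blast
    then show "?d z w = z w" by auto
  qed
  ultimately show "z \<in> I" by simp
qed

end

text \<open>The section \<sigma> sends the class of z in \<Gamma> to the class of
  \<open>part_avoiding K A z\<close> in \<Lambda>. By pre-removability the retraction preserves I,
  so an element of kQ vanishes in \<Gamma> precisely if its avoiding part lies in I, and \<sigma> is
  well defined.\<close>

lemma generalized_arrow_removal_imp_splitting: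
  fixes K :: "('k, 'x) ring_scheme" and \<Gamma> :: "('k, 'a, 'y) module_scheme" and \<Lambda> :: "('k, 'b, 'z) module_scheme"
  assumes \<Gamma>: "k_algebra K \<Gamma>" and \<Lambda>: "k_algebra K \<Lambda>" and gar: "generalized_arrow_removal K \<Gamma> \<Lambda>"
  shows "\<exists>\<sigma> N. nilpotent_splitting K \<Gamma> \<Lambda> \<sigma> N \<and> removable_ideal \<Lambda> N"
proof -
  interpret L: k_algebra K \<Lambda> by fact
  interpret G: k_algebra K \<Gamma> by fact
  obtain Q :: "(nat, nat) pre_digraph" and I A where bq: "bound_quiver K Q I"
    and iso\<Lambda>: "alg_isomorphic K (bq_algebra K Q I) \<Lambda>" and rem: "removable_arrows K Q I A"
    and iso\<Gamma>: "alg_isomorphic K \<Gamma> (quot_alg (bq_algebra K Q I) (arrow_ideal K Q I A))"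
    using gar unfolding generalized_arrow_removal_def by blast
  interpret quiver_algebra K Q
    using bq by (auto simp: bound_quiver_def quiver_algebra_def)
  let ?B = "bq_algebra K Q I" and ?a = "arrow_ideal K Q I A"
  have I: "ideal I kQ" using bq by (simp add: bound_quiver_def admissible_def)
  note sI = kQ.ideal_subspace[OF I]
  obtain N\<^sub>0 where N0: "0 < N\<^sub>0" "\<And>w. w \<in> paths Q \<Longrightarrow> length (snd w) = N\<^sub>0 \<Longrightarrow> path_elem K w \<in> I"
    using bq unfolding bound_quiver_def admissible_def by (metis One_nat_def Suc_lessD)
  note ringB = kQ.ring_quot_alg[OF I] and qhom = kQ.quot_hom[OF I]
  interpret B: ring ?B by (rule ringB)
  obtain \<psi> where \<psi>: "\<psi> \<in> ring_iso ?B \<Lambda>"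
    and \<psi>l: "\<And>c x. c \<in> carrier K \<Longrightarrow> x \<in> carrier ?B \<Longrightarrow> \<psi> (c \<odot>\<^bsub>?B\<^esub> x) = c \<odot>\<^bsub>\<Lambda>\<^esub> \<psi> x"
    using iso\<Lambda> unfolding alg_isomorphic_def by blast
  have \<psi>h: "\<psi> \<in> ring_hom ?B \<Lambda>" and \<psi>b: "bij_betw \<psi> (carrier ?B) (carrier \<Lambda>)"
    using \<psi> by (auto simp: ring_iso_def)
  define q where "q z = I +>\<^bsub>kQ\<^esub> z" for z
  have qh: "q \<in> ring_hom kQ ?B" and qs: "q ` carrier kQ = carrier ?B"
    using qhom kQ.quot_carrier[OF I] by (auto simp: q_def[abs_def])
  have q_eq: "q x = q y \<longleftrightarrow> x \<ominus>\<^bsub>kQ\<^esub> y \<in> I" if "x \<in> carrier kQ" "y \<in> carrier kQ" for x y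
    unfolding q_def by (rule kQ.quot_eq_iff[OF I that])
  have q_smult: "q (c \<odot>\<^bsub>kQ\<^esub> x) = c \<odot>\<^bsub>?B\<^esub> q x" if "c \<in> carrier K" "x \<in> carrier kQ" for c x
    unfolding q_def using kQ.quot_smult[OF I that] by simp
  let ?av = "part_avoiding K A" and ?th = "part_through K A"
  have avc: "?av z \<in> carrier kQ" and thc: "?th z \<in> carrier kQ" if "z \<in> carrier kQ" for z
    using that by (auto intro: part_avoiding_closed part_through_closed)
  note avh = part_avoiding_ring_hom[of A]
  have pre: "?th z \<in> I" "?av z \<in> I" if "z \<in> I" for z
    using rem that unfolding removable_arrows_def two_sided_removable_arrows_def
      only_left_removable_arrows_def pre_removable_def by blast+
  have AQ: "A \<subseteq> arcs Q"
    using rem unfolding removable_arrows_def two_sided_removable_arrows_def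
      only_left_removable_arrows_def pre_removable_def by blast
  \<comment> \<open>Z will be the preimage of the arrow ideal under q. As the kernel of the
    retraction followed by q it is visibly an ideal.\<close>
  define Z where "Z = {z \<in> carrier kQ. ?av z \<in> I}"
  have avmin: "?av (x \<ominus>\<^bsub>kQ\<^esub> y) = ?av x \<ominus>\<^bsub>kQ\<^esub> ?av y" if "x \<in> carrier kQ" "y \<in> carrier kQ" for x y
  proof -
    interpret ring_hom_ring kQ kQ ?av
      by (rule ring_hom_ringI2[OF kQ.A.ring_axioms kQ.A.ring_axioms avh])
    show ?thesis using that by (simp add: a_minus_def del: kQ_simps)
  qed
  have Zid: "ideal Z kQ"
  proof -
    interpret r: ring_hom_ring kQ ?B "q \<circ> ?av"
      by (rule ring_hom_ringI2[OF kQ.A.ring_axioms ringB]) (rule ring_hom_trans[OF avh qh])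
    have "q x = \<zero>\<^bsub>?B\<^esub> \<longleftrightarrow> x \<in> I" if "x \<in> carrier kQ" for x
      using q_eq[OF that kQ.M.zero_closed] ring_hom_zero[OF qh kQ.A.ring_axioms ringB] that
      by (simp add: a_minus_def del: kQ_simps)
    then have "Z = a_kernel kQ ?B (q \<circ> ?av)" using avc by (auto simp: Z_def a_kernel_def' simp del: kQ_simps)
    then show ?thesis using r.kernel_is_ideal by simp
  qed
  have qZ: "ideal (q ` Z) ?B" by (rule surj_image_ideal[OF kQ.A.ring_axioms ringB qh qs Zid])
  have gens: "(\<lambda>a. I +>\<^bsub>kQ\<^esub> path_elem K (tail Q a, [a])) ` A \<subseteq> q ` Z"
  proof
    fix x assume "x \<in> (\<lambda>a. I +>\<^bsub>kQ\<^esub> path_elem K (tail Q a, [a])) ` A"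
    then obtain a where a: "a \<in> A" "x = q (path_elem K (tail Q a, [a]))" by (auto simp: q_def)
    have "?av (path_elem K (tail Q a, [a])) = \<zero>\<^bsub>kQ\<^esub>" using a by (auto simp: part_avoiding_def path_elem_def)
    then have "path_elem K (tail Q a, [a]) \<in> Z"
      using a AQ paths_arc[of a] kQ.subspace_zero[OF sI] by (auto simp: Z_def simp del: kQ_simps)
    then show "x \<in> q ` Z" using a by blast
  qed
  have gensB: "(\<lambda>a. I +>\<^bsub>kQ\<^esub> path_elem K (tail Q a, [a])) ` A \<subseteq> carrier ?B"
    using gens ideal.Icarr[OF qZ] by blast
  have aid: "ideal ?a ?B" unfolding arrow_ideal_def by (rule B.genideal_ideal[OF gensB])
  \<comment> \<open>One inclusion is minimality of the generated ideal. For the other, an element of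
    Z is congruent modulo I to its part through A, which consists of multiples of arrows in
    A.\<close>
  have aZ: "?a = q ` Z"
  proof
    show "?a \<subseteq> q ` Z" unfolding arrow_ideal_def by (rule B.genideal_minimal[OF qZ gens])
    show "q ` Z \<subseteq> ?a"
    proof
      fix x assume "x \<in> q ` Z"
      then obtain z where z: "z \<in> carrier kQ" "?av z \<in> I" "x = q z" by (auto simp: Z_def)
      have "q (?th z) \<in> ?a"
      proof (rule through_in_arrow_ideal[OF ringB qh aid _ z(1)])
        show "q (path_elem K (tail Q a, [a])) \<in> ?a" if "a \<in> A" for a
          using B.genideal_self[OF gensB] that unfolding arrow_ideal_def q_def by blast
      qed
      moreover have "q z = q (?th z)"
        using q_eq[OF z(1) thc[OF z(1)]] part_through_minus(1)[OF z(1)] z(2) by simp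
      ultimately show "x \<in> ?a" using z(3) by simp
    qed
  qed
  \<comment> \<open>Both algebras are presented as quotients of kQ, \<Lambda> by p and \<Gamma> by g
    below; \<sigma> will be the map for which \<sigma> after g equals p after the
    retraction.\<close>
  define p where "p z = \<psi> (q z)" for z
  have ph: "p \<in> ring_hom kQ \<Lambda>" using ring_hom_trans[OF qh \<psi>h] by (simp add: p_def[abs_def] comp_def)
  have ps: "p ` carrier kQ = carrier \<Lambda>"
    using qs \<psi>b unfolding p_def[abs_def] bij_betw_def by (metis image_image)
  have p_smult: "p (c \<odot>\<^bsub>kQ\<^esub> x) = c \<odot>\<^bsub>\<Lambda>\<^esub> p x" if "c \<in> carrier K" "x \<in> carrier kQ" for c x
    using q_smult[OF that] \<psi>l[OF that(1)] qs that(2) by (auto simp: p_def)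
  have p_eq: "p x = p y \<longleftrightarrow> x \<ominus>\<^bsub>kQ\<^esub> y \<in> I" if "x \<in> carrier kQ" "y \<in> carrier kQ" for x y
  proof -
    have "q x \<in> carrier ?B" "q y \<in> carrier ?B" using qs that by blast+
    then have "p x = p y \<longleftrightarrow> q x = q y"
      unfolding p_def by (rule inj_on_eq_iff[OF bij_betw_imp_inj_on[OF \<psi>b]])
    then show ?thesis using q_eq[OF that] by simp
  qed
  interpret p: ring_hom_ring kQ \<Lambda> p by (rule ring_hom_ringI2[OF kQ.A.ring_axioms L.A.ring_axioms ph])
  obtain \<alpha> where \<alpha>: "\<alpha> \<in> ring_iso \<Gamma> (quot_alg ?B ?a)"
    and \<alpha>l: "\<And>c x. c \<in> carrier K \<Longrightarrow> x \<in> carrier \<Gamma> \<Longrightarrow> \<alpha> (c \<odot>\<^bsub>\<Gamma>\<^esub> x) = c \<odot>\<^bsub>quot_alg ?B ?a\<^esub> \<alpha> x"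
    using iso\<Gamma> unfolding alg_isomorphic_def by blast
  obtain \<beta> where \<beta>: "\<beta> \<in> ring_iso (quot_alg ?B ?a) \<Gamma>" "\<And>x. x \<in> carrier \<Gamma> \<Longrightarrow> \<beta> (\<alpha> x) = x"
    "\<And>y. y \<in> carrier (quot_alg ?B ?a) \<Longrightarrow> \<alpha> (\<beta> y) = y"
    using ring_iso_inverse[OF G.A.ring_axioms \<alpha>] by blast
  interpret kB: k_algebra K ?B
    by (rule k_algebra_surj_image[OF kQ.k_algebra_axioms ringB qh qs]) (rule q_smult)
  note rh = kB.quot_hom[OF aid] and rs = kB.quot_carrier[OF aid] and ringC = kB.ring_quot_alg[OF aid]
  define g where "g z = \<beta> (?a +>\<^bsub>?B\<^esub> q z)" for z
  have \<beta>h: "\<beta> \<in> ring_hom (quot_alg ?B ?a) \<Gamma>" and \<beta>b: "bij_betw \<beta> (carrier (quot_alg ?B ?a)) (carrier \<Gamma>)"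
    using \<beta> by (auto simp: ring_iso_def)
  have gh: "g \<in> ring_hom kQ \<Gamma>"
    using ring_hom_trans[OF ring_hom_trans[OF qh rh] \<beta>h] by (simp add: g_def[abs_def] comp_def)
  have gs: "g ` carrier kQ = carrier \<Gamma>"
  proof -
    have "g ` carrier kQ = \<beta> ` (\<lambda>x. ?a +>\<^bsub>?B\<^esub> x) ` q ` carrier kQ"
      by (simp add: g_def[abs_def] image_image)
    then show ?thesis unfolding qs rs[symmetric] using bij_betw_imp_surj_on[OF \<beta>b] by simp
  qed
  interpret g: ring_hom_ring kQ \<Gamma> g by (rule ring_hom_ringI2[OF kQ.A.ring_axioms G.A.ring_axioms gh])
  have g0: "g z = \<zero>\<^bsub>\<Gamma>\<^esub> \<longleftrightarrow> ?av z \<in> I" if z: "z \<in> carrier kQ" for z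
  proof -
    have qz: "q z \<in> carrier ?B" using qs z by blast
    have "g z = g \<zero>\<^bsub>kQ\<^esub> \<longleftrightarrow> ?a +>\<^bsub>?B\<^esub> q z = ?a +>\<^bsub>?B\<^esub> q \<zero>\<^bsub>kQ\<^esub>"
    proof -
      have "q \<zero>\<^bsub>kQ\<^esub> \<in> carrier ?B" using qs kQ.M.zero_closed by blast
      then have "?a +>\<^bsub>?B\<^esub> q z \<in> carrier (quot_alg ?B ?a)" "?a +>\<^bsub>?B\<^esub> q \<zero>\<^bsub>kQ\<^esub> \<in> carrier (quot_alg ?B ?a)"
        unfolding rs using qz by blast+
      then show ?thesis unfolding g_def by (rule inj_on_eq_iff[OF bij_betw_imp_inj_on[OF \<beta>b]])
    qed
    also have "\<dots> \<longleftrightarrow> q z \<in> ?a"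
      using kB.quot_eq_iff[OF aid qz, of "\<zero>\<^bsub>?B\<^esub>"] qz ring_hom_zero[OF qh kQ.A.ring_axioms ringB]
      by (simp add: a_minus_def del: quot_alg_simps kQ_simps)
    also have "\<dots> \<longleftrightarrow> ?av z \<in> I"
    proof
      assume "q z \<in> ?a"
      then obtain y where y: "y \<in> carrier kQ" "?av y \<in> I" "q z = q y" by (auto simp: aZ Z_def)
      \<comment> \<open>Pre-removability enters here: z - y lies in I, hence so does its avoiding
        part, which is the difference of the avoiding parts of z and y.\<close>
      then have "z \<ominus>\<^bsub>kQ\<^esub> y \<in> I" using q_eq z by simp
      then have "?av z \<ominus>\<^bsub>kQ\<^esub> ?av y \<in> I" using pre(2) avmin z y by metis
      then have "(?av z \<ominus>\<^bsub>kQ\<^esub> ?av y) \<oplus>\<^bsub>kQ\<^esub> ?av y \<in> I" using y kQ.subspace_add[OF sI] by blast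
      moreover have "(a \<ominus>\<^bsub>kQ\<^esub> b) \<oplus>\<^bsub>kQ\<^esub> b = a" if "a \<in> carrier kQ" "b \<in> carrier kQ" for a b
        using that by (simp add: a_minus_def kQ.M.a_assoc kQ.M.l_neg del: kQ_simps)
      ultimately show "?av z \<in> I" using avc z y by metis
    qed (use z in \<open>auto simp: aZ Z_def\<close>)
    finally show ?thesis using g.hom_zero by (simp del: kQ_simps)
  qed
  have g_smult: "g (c \<odot>\<^bsub>kQ\<^esub> x) = c \<odot>\<^bsub>\<Gamma>\<^esub> g x" if cx: "c \<in> carrier K" "x \<in> carrier kQ" for c x
  proof -
    let ?u = "?a +>\<^bsub>?B\<^esub> q x"
    have qx: "q x \<in> carrier ?B" using qs cx by blast
    then have uc: "?u \<in> carrier (quot_alg ?B ?a)" using rs by blast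
    then have gx: "g x \<in> carrier \<Gamma>" "\<alpha> (g x) = ?u"
      using \<beta>(3) ring_hom_closed[OF \<beta>h] by (auto simp: g_def[of x] simp del: kQ_simps quot_alg_simps)
    have "g (c \<odot>\<^bsub>kQ\<^esub> x) = \<beta> (c \<odot>\<^bsub>quot_alg ?B ?a\<^esub> ?u)"
      unfolding g_def q_smult[OF cx] kB.quot_smult[OF aid cx(1) qx] by simp
    also have "\<dots> = \<beta> (\<alpha> (c \<odot>\<^bsub>\<Gamma>\<^esub> g x))" using \<alpha>l[OF cx(1) gx(1)] gx(2) by simp
    also have "\<dots> = c \<odot>\<^bsub>\<Gamma>\<^esub> g x" using \<beta>(2) gx(1) cx(1) by simp
    finally show ?thesis .
  qed
  have pav: "(\<lambda>z. p (?av z)) \<in> ring_hom kQ \<Lambda>"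
    using ring_hom_trans[OF avh ph] by (simp add: comp_def)
  have "p (?av z) = \<zero>\<^bsub>\<Lambda>\<^esub>" if "z \<in> carrier kQ" "g z = \<zero>\<^bsub>\<Gamma>\<^esub>" for z
  proof -
    have "?av z \<ominus>\<^bsub>kQ\<^esub> \<zero>\<^bsub>kQ\<^esub> \<in> I" using g0 that avc by (simp add: a_minus_def del: kQ_simps)
    then have "p (?av z) = p \<zero>\<^bsub>kQ\<^esub>" using p_eq[OF avc kQ.M.zero_closed] that by simp
    then show ?thesis using p.hom_zero by simp
  qed
  then obtain \<sigma> where \<sigma>: "\<sigma> \<in> ring_hom \<Gamma> \<Lambda>" "\<And>z. z \<in> carrier kQ \<Longrightarrow> \<sigma> (g z) = p (?av z)"
    using surj_hom_factor[OF kQ.A.ring_axioms G.A.ring_axioms L.A.ring_axioms gh gs pav] by blast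
  define N where "N = p ` Z"
  have N_eq: "N = \<psi> ` ?a" unfolding N_def aZ p_def[abs_def] by (simp add: image_image)
  have "nilpotent_splitting K \<Gamma> \<Lambda> \<sigma> N"
    unfolding nilpotent_splitting_def
  proof (intro conjI ballI impI \<sigma>(1))
    show "\<sigma> (c \<odot>\<^bsub>\<Gamma>\<^esub> x) = c \<odot>\<^bsub>\<Lambda>\<^esub> \<sigma> x" if cx: "c \<in> carrier K" "x \<in> carrier \<Gamma>" for c x
    proof -
      obtain z where z: "z \<in> carrier kQ" "x = g z" using gs cx(2) by blast
      have "\<sigma> (c \<odot>\<^bsub>\<Gamma>\<^esub> x) = p (?av (c \<odot>\<^bsub>kQ\<^esub> z))"
        using \<sigma>(2)[OF kQ_smult_closed[OF cx(1) z(1)]] g_smult[OF cx(1) z(1)] z(2) by simp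
      also have "\<dots> = c \<odot>\<^bsub>\<Lambda>\<^esub> \<sigma> x"
        using part_avoiding_smult[OF cx(1)] p_smult[OF cx(1) avc[OF z(1)]] \<sigma>(2)[OF z(1)] z(2) by simp
      finally show ?thesis .
    qed
    show "ideal N \<Lambda>"
      unfolding N_def by (rule surj_image_ideal[OF kQ.A.ring_axioms L.A.ring_axioms ph ps Zid])
    \<comment> \<open>Each element of N is the image of a combination of paths through A, which have
      positive length. A product of such elements therefore comes from paths at least as long as the
      number of factors, and all paths of length \<open>N\<^sub>0\<close> or more lie in I.\<close>
    have prod: "\<exists>z \<in> deep (length xs). L.mprod xs = p z" if "set xs \<subseteq> N" for xs
      using that
    proof (induction xs)
      case Nil
      then show ?case using p.hom_one kQ_one_closed
        by (auto simp: deep_def simp del: kQ_simps intro!: bexI[of _ "\<one>\<^bsub>kQ\<^esub>"])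
    next
      case (Cons x xs)
      then obtain z where z: "z \<in> deep (length xs)" "L.mprod xs = p z" by auto
      obtain y where y: "y \<in> carrier kQ" "?av y \<in> I" "x = p y" using Cons.prems by (auto simp: N_def Z_def)
      have "p y = p (?th y)"
        using p_eq[OF y(1) thc[OF y(1)]] part_through_minus(1)[OF y(1)] y(2) by simp
      moreover have "?th y \<in> deep 1"
        using thc[OF y(1)] by (auto simp: deep_def part_through_def Suc_le_eq)
      moreover have "z \<in> carrier kQ" using z by (simp add: deep_def)
      ultimately have "?th y \<otimes>\<^bsub>kQ\<^esub> z \<in> deep (length (x # xs))" "L.mprod (x # xs) = p (?th y \<otimes>\<^bsub>kQ\<^esub> z)"
        using z y thc[OF y(1)] deep_mult[of "?th y" 1 z "length xs"] by auto
      then show ?case by blast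
    qed
    have "L.mprod xs = \<zero>\<^bsub>\<Lambda>\<^esub>" if xs: "set xs \<subseteq> N" "length xs = N\<^sub>0" for xs
    proof -
      obtain z where z: "z \<in> deep N\<^sub>0" "L.mprod xs = p z" using prod[OF xs(1)] xs(2) by auto
      then have "z \<in> I" "z \<in> carrier kQ" using deep_subset_ideal[OF I N0(2)] by (auto simp: deep_def)
      then have "p z = p \<zero>\<^bsub>kQ\<^esub>" using p_eq[OF _ kQ.M.zero_closed] by (simp add: a_minus_def del: kQ_simps)
      then show ?thesis using z p.hom_zero by simp
    qed
    then show "nilpotent_set \<Lambda> N" using N0(1) unfolding nilpotent_set_def L.mprod_def by blast
  next
    fix x assume "x \<in> carrier \<Lambda>"
    then obtain z where z: "z \<in> carrier kQ" "x = p z" using ps by blast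
    have "x = p (?th z \<oplus>\<^bsub>kQ\<^esub> ?av z)" unfolding part_sum[OF z(1)] by (rule z(2))
    also have "\<dots> = p (?av z) \<oplus>\<^bsub>\<Lambda>\<^esub> p (?th z)"
      using thc[OF z(1)] avc[OF z(1)] by (simp add: L.M.a_comm del: kQ_simps)
    finally have "x = \<sigma> (g z) \<oplus>\<^bsub>\<Lambda>\<^esub> p (?th z)" using \<sigma>(2) z(1) by simp
    moreover have "?th z \<in> Z"
      using thc[OF z(1)] kQ.subspace_zero[OF sI] by (simp add: Z_def part_avoiding_through)
    moreover have "g z \<in> carrier \<Gamma>" using z(1) by (simp del: kQ_simps)
    ultimately show "\<exists>g\<in>carrier \<Gamma>. \<exists>n\<in>N. x = \<sigma> g \<oplus>\<^bsub>\<Lambda>\<^esub> n" unfolding N_def by blast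
  next
    fix x assume x: "x \<in> carrier \<Gamma>" "\<sigma> x \<in> N"
    obtain z where z: "z \<in> carrier kQ" "x = g z" using gs x(1) by blast
    obtain y where y: "y \<in> carrier kQ" "?av y \<in> I" "p (?av z) = p y"
      using x(2) \<sigma>(2)[OF z(1)] z(2) by (auto simp: N_def Z_def)
    have "?av z \<ominus>\<^bsub>kQ\<^esub> y \<in> I" using p_eq[OF avc[OF z(1)] y(1)] y(3) by simp
    \<comment> \<open>Applying the idempotent retraction replaces y by its avoiding part, and that
      lies in I.\<close>
    then have "?av z \<ominus>\<^bsub>kQ\<^esub> ?av y \<in> I"
      using pre(2) avmin[OF avc[OF z(1)] y(1)] part_avoiding_idem by metis
    then have "(?av z \<ominus>\<^bsub>kQ\<^esub> ?av y) \<oplus>\<^bsub>kQ\<^esub> ?av y \<in> I" using y kQ.subspace_add[OF sI] by blast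
    moreover have "(a \<ominus>\<^bsub>kQ\<^esub> b) \<oplus>\<^bsub>kQ\<^esub> b = a" if "a \<in> carrier kQ" "b \<in> carrier kQ" for a b
      using that by (simp add: a_minus_def kQ.M.a_assoc kQ.M.l_neg del: kQ_simps)
    ultimately have "?av z \<in> I" using avc z y by metis
    then show "x = \<zero>\<^bsub>\<Gamma>\<^esub>" using g0 z by simp
  qed
  moreover have "removable_ideal \<Lambda> N"
    unfolding N_eq using removable_ideal_iso[OF ringB L.A.ring_axioms \<psi>] ideal.Icarr[OF aid]
      removable_arrows_iff[OF ringB aid] rem by blast
  ultimately show ?thesis by blast
qed

section \<open>Representations of path algebras\<close>

text \<open>Data for an algebra homomorphism from kQ to A: a complete family of orthogonal
  idempotents for the vertices and, for each arrow, an element of the Peirce component given by its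
  ends. Tails act from the left because paths are multiplied in the order in which they are
  walked.\<close>

locale quiver_evaluation = quiver_algebra K Q + A: k_algebra K A
  for K :: "('k, 'x) ring_scheme" (structure) and Q :: "('v, 'e) pre_digraph"
    and A :: "('k, 'a, 'y) module_scheme" (structure) +
  fixes e :: "'v \<Rightarrow> 'a" and \<xi> :: "'e \<Rightarrow> 'a"
  assumes e_closed: "v \<in> verts Q \<Longrightarrow> e v \<in> carrier A"
    and e_mult: "u \<in> verts Q \<Longrightarrow> v \<in> verts Q \<Longrightarrow> e u \<otimes>\<^bsub>A\<^esub> e v = (if u = v then e u else \<zero>\<^bsub>A\<^esub>)"
    and e_sum: "(\<Oplus>\<^bsub>A\<^esub>v\<in>verts Q. e v) = \<one>\<^bsub>A\<^esub>"
    and arr_closed: "a \<in> arcs Q \<Longrightarrow> \<xi> a \<in> carrier A"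
    and arr_tail: "a \<in> arcs Q \<Longrightarrow> e (tail Q a) \<otimes>\<^bsub>A\<^esub> \<xi> a = \<xi> a"
    and arr_head: "a \<in> arcs Q \<Longrightarrow> \<xi> a \<otimes>\<^bsub>A\<^esub> e (head Q a) = \<xi> a"
begin

text \<open>The start idempotent matters for trivial paths; on other paths it is absorbed by the
  first arrow.\<close>

definition evp :: "'v \<times> 'e list \<Rightarrow> 'a" where
  "evp w = e (fst w) \<otimes>\<^bsub>A\<^esub> A.mprod (map \<xi> (snd w))"

definition ev :: "('v \<times> 'e list \<Rightarrow> 'k) \<Rightarrow> 'a" where
  "ev z = (\<Oplus>\<^bsub>A\<^esub>w\<in>{w. z w \<noteq> \<zero>}. z w \<odot>\<^bsub>A\<^esub> evp w)"

lemma arr_list_closed: "set p \<subseteq> arcs Q \<Longrightarrow> set (map \<xi> p) \<subseteq> carrier A"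
  using arr_closed by auto

lemma evp_closed [simp]: "w \<in> paths Q \<Longrightarrow> evp w \<in> carrier A"
  using paths_verts(1)[of "fst w" "snd w"] paths_arcs[of "fst w" "snd w"] e_closed arr_list_closed
  by (simp add: evp_def A.mprod_closed)

lemma evp_Nil: "u \<in> verts Q \<Longrightarrow> evp (u, []) = e u"
  by (simp add: evp_def e_closed)

lemma evp_Cons:
  assumes "(u, a # p) \<in> paths Q" shows "evp (u, a # p) = \<xi> a \<otimes>\<^bsub>A\<^esub> evp (head Q a, p)"
proof -
  have a: "a \<in> arcs Q" "tail Q a = u" "(head Q a, p) \<in> paths Q" using assms by (auto simp: paths_Cons)
  have c: "e u \<in> carrier A" "\<xi> a \<in> carrier A" "A.mprod (map \<xi> p) \<in> carrier A" "e (head Q a) \<in> carrier A"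
    using a e_closed arr_closed paths_verts(1)[OF assms] paths_verts(1)[OF a(3)] arr_list_closed[OF paths_arcs[OF a(3)]]
    by (auto simp: A.mprod_closed)
  have "evp (u, a # p) = (e u \<otimes>\<^bsub>A\<^esub> \<xi> a) \<otimes>\<^bsub>A\<^esub> A.mprod (map \<xi> p)" using c by (simp add: evp_def A.A.m_assoc)
  also have "\<dots> = (\<xi> a \<otimes>\<^bsub>A\<^esub> e (head Q a)) \<otimes>\<^bsub>A\<^esub> A.mprod (map \<xi> p)" using arr_tail[OF a(1)] arr_head[OF a(1)] a(2) by simp
  also have "\<dots> = \<xi> a \<otimes>\<^bsub>A\<^esub> evp (head Q a, p)" using c by (simp add: evp_def A.A.m_assoc)
  finally show ?thesis .
qed

lemma evp_end:
  assumes "(u, p) \<in> paths Q" shows "evp (u, p) \<otimes>\<^bsub>A\<^esub> e (awlast u p) = evp (u, p)"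
  using assms
proof (induction p arbitrary: u)
  case Nil
  then show ?case using e_mult by (simp add: paths_Nil evp_Nil)
next
  case (Cons a p)
  then have a: "a \<in> arcs Q" "tail Q a = u" "(head Q a, p) \<in> paths Q" by (auto simp: paths_Cons)
  have "evp (u, a # p) \<otimes>\<^bsub>A\<^esub> e (awlast u (a # p)) = \<xi> a \<otimes>\<^bsub>A\<^esub> (evp (head Q a, p) \<otimes>\<^bsub>A\<^esub> e (awlast (head Q a) p))"
    using a arr_closed e_closed paths_verts(2)[OF a(3)] by (simp add: evp_Cons[OF Cons.prems] A.A.m_assoc)
  then show ?case using Cons.IH[OF a(3)] evp_Cons[OF Cons.prems] by simp
qed

text \<open>The end idempotent of the first path and the start idempotent of the second can be
  inserted between the factors; orthogonality then kills the product of paths that do not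
  compose.\<close>

lemma evp_mult:
  assumes p: "(u, p) \<in> paths Q" and q: "(v, q) \<in> paths Q"
  shows "evp (u, p) \<otimes>\<^bsub>A\<^esub> evp (v, q) = (if awlast u p = v then evp (u, p @ q) else \<zero>\<^bsub>A\<^esub>)"
proof -
  have c: "e u \<in> carrier A" "e v \<in> carrier A" "e (awlast u p) \<in> carrier A"
    "A.mprod (map \<xi> p) \<in> carrier A" "A.mprod (map \<xi> q) \<in> carrier A"
    using e_closed paths_verts[OF p] paths_verts[OF q] arr_list_closed[OF paths_arcs[OF p]] arr_list_closed[OF paths_arcs[OF q]]
    by (auto simp: A.mprod_closed)
  note pc = evp_closed[OF p]
  have "evp (u, p) \<otimes>\<^bsub>A\<^esub> evp (v, q) = (evp (u, p) \<otimes>\<^bsub>A\<^esub> e (awlast u p)) \<otimes>\<^bsub>A\<^esub> (e v \<otimes>\<^bsub>A\<^esub> A.mprod (map \<xi> q))"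
    using evp_end[OF p] by (simp add: evp_def[of "(v, q)"])
  also have "\<dots> = evp (u, p) \<otimes>\<^bsub>A\<^esub> ((e (awlast u p) \<otimes>\<^bsub>A\<^esub> e v) \<otimes>\<^bsub>A\<^esub> A.mprod (map \<xi> q))"
    using c pc by (simp add: A.A.m_assoc)
  finally have *: "evp (u, p) \<otimes>\<^bsub>A\<^esub> evp (v, q)
      = evp (u, p) \<otimes>\<^bsub>A\<^esub> ((e (awlast u p) \<otimes>\<^bsub>A\<^esub> e v) \<otimes>\<^bsub>A\<^esub> A.mprod (map \<xi> q))" .
  show ?thesis
  proof (cases "awlast u p = v")
    case True
    have "evp (u, p) \<otimes>\<^bsub>A\<^esub> evp (v, q) = (evp (u, p) \<otimes>\<^bsub>A\<^esub> e v) \<otimes>\<^bsub>A\<^esub> A.mprod (map \<xi> q)"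
      using c pc by (simp add: evp_def[of "(v, q)"] A.A.m_assoc)
    also have "\<dots> = e u \<otimes>\<^bsub>A\<^esub> (A.mprod (map \<xi> p) \<otimes>\<^bsub>A\<^esub> A.mprod (map \<xi> q))"
      using evp_end[OF p] True c by (simp add: evp_def A.A.m_assoc)
    also have "\<dots> = evp (u, p @ q)"
      using A.mprod_append[OF arr_list_closed[OF paths_arcs[OF p]] arr_list_closed[OF paths_arcs[OF q]]] by (simp add: evp_def)
    finally show ?thesis using True by simp
  next
    case False
    then show ?thesis using * e_mult[OF paths_verts(2)[OF p] paths_verts(1)[OF q]] c pc by simp
  qed
qed

text \<open>\<open>ev\<close> sums over the exact support, which changes under addition; a larger
  common index set allows sums to be compared term by term.\<close>

lemma ev_superset:
  assumes z: "z \<in> carrier kQ" and F: "finite F" "F \<subseteq> paths Q" "\<And>w. w \<notin> F \<Longrightarrow> z w = \<zero>"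
  shows "ev z = (\<Oplus>\<^bsub>A\<^esub>w\<in>F. z w \<odot>\<^bsub>A\<^esub> evp w)"
  unfolding ev_def
  by (rule A.M.add.finprod_mono_neutral_cong_left) (use F z in \<open>auto simp: A.smult_l_null\<close>)

lemma ev_closed [simp]: assumes "z \<in> carrier kQ" shows "ev z \<in> carrier A"
proof -
  have "{w. z w \<noteq> \<zero>} \<subseteq> paths Q" using kQ_outside[OF assms] by blast
  then show ?thesis unfolding ev_def using assms by (intro A.M.finsum_closed) auto
qed

lemma ev_path_elem: assumes "w \<in> paths Q" shows "ev (path_elem K w) = evp w"
proof -
  have "ev (path_elem K w) = (\<Oplus>\<^bsub>A\<^esub>v\<in>{w}. path_elem K w v \<odot>\<^bsub>A\<^esub> evp v)"
    by (rule ev_superset[OF path_elem_closed[OF assms]]) (use assms in \<open>auto simp: path_elem_def\<close>)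
  also have "\<dots> = evp w" using assms by (simp add: path_elem_def)
  finally show ?thesis .
qed

lemma ev_add:
  assumes y: "y \<in> carrier kQ" and z: "z \<in> carrier kQ"
  shows "ev (y \<oplus>\<^bsub>kQ\<^esub> z) = ev y \<oplus>\<^bsub>A\<^esub> ev z"
proof -
  let ?F = "{w. y w \<noteq> \<zero>} \<union> {w. z w \<noteq> \<zero>}"
  have F: "finite ?F" "?F \<subseteq> paths Q" using kQ_finite[OF y] kQ_finite[OF z] kQ_outside[OF y] kQ_outside[OF z] by auto
  have "ev (y \<oplus>\<^bsub>kQ\<^esub> z) = (\<Oplus>\<^bsub>A\<^esub>w\<in>?F. (y \<oplus>\<^bsub>kQ\<^esub> z) w \<odot>\<^bsub>A\<^esub> evp w)"
    by (rule ev_superset[OF kQ_add_closed[OF y z] F]) simp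
  also have "\<dots> = (\<Oplus>\<^bsub>A\<^esub>w\<in>?F. y w \<odot>\<^bsub>A\<^esub> evp w \<oplus>\<^bsub>A\<^esub> z w \<odot>\<^bsub>A\<^esub> evp w)"
    using F(2) y z by (intro A.M.finsum_cong') (auto simp: A.smult_l_distr)
  also have "\<dots> = (\<Oplus>\<^bsub>A\<^esub>w\<in>?F. y w \<odot>\<^bsub>A\<^esub> evp w) \<oplus>\<^bsub>A\<^esub> (\<Oplus>\<^bsub>A\<^esub>w\<in>?F. z w \<odot>\<^bsub>A\<^esub> evp w)"
    using F(2) y z by (intro A.M.finsum_addf) auto
  also have "(\<Oplus>\<^bsub>A\<^esub>w\<in>?F. y w \<odot>\<^bsub>A\<^esub> evp w) = ev y" by (rule ev_superset[OF y F, symmetric]) simp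
  also have "(\<Oplus>\<^bsub>A\<^esub>w\<in>?F. z w \<odot>\<^bsub>A\<^esub> evp w) = ev z" by (rule ev_superset[OF z F, symmetric]) simp
  finally show ?thesis .
qed

lemma ev_zero: "ev (\<lambda>w. \<zero>) = \<zero>\<^bsub>A\<^esub>"
  by (simp add: ev_def)

lemma ev_smult:
  assumes c: "c \<in> carrier K" and z: "z \<in> carrier kQ"
  shows "ev (c \<odot>\<^bsub>kQ\<^esub> z) = c \<odot>\<^bsub>A\<^esub> ev z"
  using z
proof (induction rule: kQ_induct)
  case zero
  then show ?case using c by (simp add: ev_zero A.smult_r_null)
next
  case (base d w)
  have *: "ev (b \<odot>\<^bsub>kQ\<^esub> path_elem K w) = b \<odot>\<^bsub>A\<^esub> evp w" if b: "b \<in> carrier K" for b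
  proof -
    have "ev (b \<odot>\<^bsub>kQ\<^esub> path_elem K w) = (\<Oplus>\<^bsub>A\<^esub>v\<in>{w}. (b \<odot>\<^bsub>kQ\<^esub> path_elem K w) v \<odot>\<^bsub>A\<^esub> evp v)"
      by (rule ev_superset[OF kQ_smult_closed[OF b path_elem_closed[OF base(2)]]])
         (use base b in \<open>auto simp: path_elem_def\<close>)
    then show ?thesis using base b by (simp add: path_elem_def)
  qed
  have "c \<odot>\<^bsub>kQ\<^esub> (d \<odot>\<^bsub>kQ\<^esub> path_elem K w) = (c \<otimes> d) \<odot>\<^bsub>kQ\<^esub> path_elem K w"
    using c base kQ.smult_assoc1[of c d "path_elem K w"] by (simp del: kQ_simps)
  then show ?case using *[of "c \<otimes> d"] *[of d] base c by (simp add: A.smult_assoc1 del: kQ_simps)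
next
  case (add x y)
  then have "c \<odot>\<^bsub>kQ\<^esub> (x \<oplus>\<^bsub>kQ\<^esub> y) = c \<odot>\<^bsub>kQ\<^esub> x \<oplus>\<^bsub>kQ\<^esub> c \<odot>\<^bsub>kQ\<^esub> y"
    using c by (intro kQ.smult_r_distr)
  then show ?case using add c by (simp add: ev_add kQ_smult_closed A.smult_r_distr del: kQ_simps)
qed

text \<open>Both sides are bilinear, so two inductions reduce the claim to a pair of paths, that is,
  to \<open>evp_mult\<close>.\<close>

lemma ev_mult:
  assumes y: "y \<in> carrier kQ" and z: "z \<in> carrier kQ"
  shows "ev (y \<otimes>\<^bsub>kQ\<^esub> z) = ev y \<otimes>\<^bsub>A\<^esub> ev z"
proof -
  note cl = kQ_mult_closed kQ_smult_closed kQ_add_closed path_elem_closed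
  note [simp del] = kQ_simps
  have 1: "ev (path_elem K w \<otimes>\<^bsub>kQ\<^esub> z) = evp w \<otimes>\<^bsub>A\<^esub> ev z" if w: "w \<in> paths Q" for w
    using z
  proof (induction rule: kQ_induct)
    case zero
    then show ?case using w by (simp add: kQ_mult_zero ev_zero)
  next
    case (base c v)
    obtain u p u' q where "w = (u, p)" "v = (u', q)" by (metis surj_pair)
    then have "ev (path_elem K w \<otimes>\<^bsub>kQ\<^esub> path_elem K v) = evp w \<otimes>\<^bsub>A\<^esub> evp v"
      using w base by (simp add: path_elem_mult evp_mult ev_zero ev_path_elem paths_append)
    then show ?case
      using w base by (simp add: kQ_smult_mult cl ev_smult ev_path_elem A.smult_mult_right)
  next
    case (add s t)
    then show ?case using w by (simp add: kQ_distrib cl ev_add A.A.r_distr)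
  qed
  show ?thesis
    using y
  proof (induction rule: kQ_induct)
    case zero
    then show ?case using z by (simp add: kQ_mult_zero ev_zero)
  next
    case (base c w)
    then show ?case using z 1 by (simp add: kQ_smult_mult cl ev_smult ev_path_elem A.smult_mult_left)
  next
    case (add s t)
    then show ?case using z by (simp add: kQ_distrib cl ev_add A.A.l_distr)
  qed
qed

lemma ev_one: "ev \<one>\<^bsub>kQ\<^esub> = \<one>\<^bsub>A\<^esub>"
proof -
  let ?F = "(\<lambda>v. (v, [])) ` verts Q"
  have one: "\<one>\<^bsub>kQ\<^esub> w = (if w \<in> ?F then \<one> else \<zero>)" for w by (cases w) (auto simp: kQ_one)
  have "ev \<one>\<^bsub>kQ\<^esub> = (\<Oplus>\<^bsub>A\<^esub>w\<in>?F. \<one>\<^bsub>kQ\<^esub> w \<odot>\<^bsub>A\<^esub> evp w)"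
    by (rule ev_superset[OF kQ_one_closed]) (auto simp: paths_Nil one)
  also have "\<dots> = (\<Oplus>\<^bsub>A\<^esub>w\<in>?F. evp w)"
    by (rule A.M.finsum_cong') (auto simp: paths_Nil one)
  also have "\<dots> = (\<Oplus>\<^bsub>A\<^esub>v\<in>verts Q. evp (v, []))"
    by (rule A.M.finsum_reindex) (auto simp: paths_Nil inj_on_def)
  also have "\<dots> = (\<Oplus>\<^bsub>A\<^esub>v\<in>verts Q. e v)"
    by (rule A.M.finsum_cong') (auto simp: evp_Nil e_closed)
  finally show ?thesis using e_sum by simp
qed

lemma ev_ring_hom: "ev \<in> ring_hom kQ A"
  by (rule ring_hom_memI) (auto simp: ev_mult ev_add ev_one simp del: kQ_simps)

lemma ev_in_subspace:
  assumes U: "A.subspace U" and z: "z \<in> carrier kQ" and w: "\<And>w. w \<in> paths Q \<Longrightarrow> z w \<noteq> \<zero> \<Longrightarrow> evp w \<in> U"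
  shows "ev z \<in> U"
  unfolding ev_def
proof (rule A.subspace_finsum[OF U kQ_finite[OF z]])
  fix v assume v: "v \<in> {w. z w \<noteq> \<zero>}"
  then have "v \<in> paths Q" using kQ_outside[OF z] by blast
  then show "z v \<odot>\<^bsub>A\<^esub> evp v \<in> U" using v z w by (intro A.subspace_smult[OF U]) auto
qed

end

section \<open>Gabriel's theorem relative to a splitting\<close>

lemma (in k_algebra) character_finsum:
  assumes "character \<psi>" "finite S" "\<And>s. s \<in> S \<Longrightarrow> f s \<in> carrier A"
  shows "\<psi> (\<Oplus>\<^bsub>A\<^esub>s\<in>S. f s) = (\<Oplus>s\<in>S. \<psi> (f s))"
  using assms(2,3)
proof (induction S rule: finite_induct)
  case empty
  then show ?case using character_zero[OF assms(1)] by simp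
next
  case (insert s S)
  have "f \<in> S \<rightarrow> carrier A" "(\<lambda>s. \<psi> (f s)) \<in> S \<rightarrow> carrier K"
    using insert.prems character_closed[OF assms(1)] by auto
  then show ?case
    using insert character_add[OF assms(1)] character_closed[OF assms(1)] by simp
qed

text \<open>C stands for the image of \<Gamma>. Since the e i belong to C, multiplying by them on
  either side respects the decomposition into C and N. Containment of N in the joint kernel lets the
  radical inherit this decomposition.\<close>

locale elementary_splitting = fin_dim_algebra K A
  for K :: "('k, 'x) ring_scheme" (structure) and A :: "('k, 'a, 'y) module_scheme" (structure) +
  fixes n :: nat and e :: "nat \<Rightarrow> 'a" and \<chi> :: "nat \<Rightarrow> 'a \<Rightarrow> 'k" and C N :: "'a set"
  assumes e_closed: "i < n \<Longrightarrow> e i \<in> carrier A"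
    and e_mult: "i < n \<Longrightarrow> j < n \<Longrightarrow> e i \<otimes>\<^bsub>A\<^esub> e j = (if i = j then e i else \<zero>\<^bsub>A\<^esub>)"
    and e_sum: "(\<Oplus>\<^bsub>A\<^esub>i\<in>{..<n}. e i) = \<one>\<^bsub>A\<^esub>"
    and \<chi>: "i < n \<Longrightarrow> character (\<chi> i)"
    and \<chi>_e: "i < n \<Longrightarrow> j < n \<Longrightarrow> \<chi> i (e j) = (if i = j then \<one> else \<zero>)"
    and nilpotent: "\<exists>m>0. pw (joint_kernel n \<chi>) m = {\<zero>\<^bsub>A\<^esub>}"
    and C_subspace: "subspace C"
    and C_mult: "x \<in> C \<Longrightarrow> y \<in> C \<Longrightarrow> x \<otimes>\<^bsub>A\<^esub> y \<in> C"
    and e_C: "i < n \<Longrightarrow> e i \<in> C"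
    and N_ideal: "ideal N A"
    and N_J: "N \<subseteq> joint_kernel n \<chi>"
    and split: "x \<in> carrier A \<Longrightarrow> \<exists>c\<in>C. \<exists>y\<in>N. x = c \<oplus>\<^bsub>A\<^esub> y"
    and C_N: "x \<in> C \<Longrightarrow> x \<in> N \<Longrightarrow> x = \<zero>\<^bsub>A\<^esub>"
begin

abbreviation J where "J \<equiv> joint_kernel n \<chi>"

lemma J_ideal: "ideal J A"
  by (rule joint_kernel_ideal) (rule \<chi>)

lemmas J_subspace = ideal_subspace[OF J_ideal]
  and N_subspace = ideal_subspace[OF N_ideal]
  and J_carrier = ideal_subset_carrier[OF J_ideal]
  and J2_subspace = pw_subspace[OF ideal_subset_carrier[OF J_ideal]]

text \<open>The diagonal element D has the same character values as x, so x - D is killed by all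
  characters.\<close>

lemma diagonal_decomposition:
  assumes x: "x \<in> carrier A"
  shows "\<exists>r\<in>J. x = (\<Oplus>\<^bsub>A\<^esub>i\<in>{..<n}. \<chi> i x \<odot>\<^bsub>A\<^esub> e i) \<oplus>\<^bsub>A\<^esub> r"
proof -
  define D where "D = (\<Oplus>\<^bsub>A\<^esub>i\<in>{..<n}. \<chi> i x \<odot>\<^bsub>A\<^esub> e i)"
  have jx: "\<chi> i x \<in> carrier K" if "i < n" for i using character_closed[OF \<chi> x] that by simp
  have c: "\<chi> i x \<odot>\<^bsub>A\<^esub> e i \<in> carrier A" if "i < n" for i
    using that e_closed jx by simp
  have Dc: "D \<in> carrier A" unfolding D_def using c by (intro M.finsum_closed) auto
  have D: "\<chi> j D = \<chi> j x" if j: "j < n" for j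
  proof -
    have "\<chi> j D = (\<Oplus>i\<in>{..<n}. \<chi> j (\<chi> i x \<odot>\<^bsub>A\<^esub> e i))"
      unfolding D_def using c by (intro character_finsum[OF \<chi>[OF j]]) auto
    also have "\<dots> = (\<Oplus>i\<in>{..<n}. if j = i then \<chi> j x else \<zero>)"
      using j jx e_closed by (intro K_finsum_cong) (auto simp: character_smult[OF \<chi>[OF j]] \<chi>_e K_simprules)
    also have "\<dots> = \<chi> j x"
      using j jx[OF j] by (subst K_finsum_singleton[of j "{..<n}" "\<lambda>_. \<chi> j x"]) auto
    finally show ?thesis .
  qed
  have "\<chi> j (x \<ominus>\<^bsub>A\<^esub> D) = \<zero>" if j: "j < n" for j
    unfolding character_minus[OF \<chi>[OF j] x Dc] D[OF j]
    using jx[OF j] by (simp add: a_minus_def K_simprules)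
  then have "x \<ominus>\<^bsub>A\<^esub> D \<in> J" using x Dc by (simp add: joint_kernel_def)
  moreover have "x = D \<oplus>\<^bsub>A\<^esub> (x \<ominus>\<^bsub>A\<^esub> D)" using x Dc by algebra
  ultimately show ?thesis unfolding D_def by blast
qed

text \<open>The possible values of arrows: elements of the radical that are homogeneous both for the
  Peirce decomposition by the e i and for the sum of C and N.\<close>

definition H :: "'a set" where
  "H = {x \<in> J. (x \<in> C \<or> x \<in> N) \<and> (\<exists>i<n. \<exists>j<n. e i \<otimes>\<^bsub>A\<^esub> x = x \<and> x \<otimes>\<^bsub>A\<^esub> e j = x)}"

lemma one_C: "\<one>\<^bsub>A\<^esub> \<in> C"
  using subspace_finsum[OF C_subspace, of "{..<n}" e] e_C e_sum by simp

text \<open>The N-part of an element of J lies in J because N does, hence so does the C-part.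
  Multiplying each part by e i on the left and e j on the right stays in C or in N, and summing over
  all i and j restores it.\<close>

lemma J_spanned_by_H:
  assumes U: "subspace U" and HU: "H \<subseteq> U"
  shows "J \<subseteq> U"
proof
  fix x assume x: "x \<in> J"
  have *: "y \<in> U" if y: "y \<in> J" "y \<in> C \<or> y \<in> N" for y
  proof -
    have yc: "y \<in> carrier A" using y J_carrier by auto
    have "e i \<otimes>\<^bsub>A\<^esub> y \<otimes>\<^bsub>A\<^esub> e j \<in> H" if ij: "i < n" "j < n" for i j
    proof -
      have ec: "e i \<in> carrier A" "e j \<in> carrier A" using ij e_closed by auto
      have "e i \<otimes>\<^bsub>A\<^esub> y \<otimes>\<^bsub>A\<^esub> e j \<in> J"
        by (rule ideal.I_r_closed[OF J_ideal ideal.I_l_closed[OF J_ideal y(1) ec(1)] ec(2)])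
      moreover have "e i \<otimes>\<^bsub>A\<^esub> y \<otimes>\<^bsub>A\<^esub> e j \<in> C \<or> e i \<otimes>\<^bsub>A\<^esub> y \<otimes>\<^bsub>A\<^esub> e j \<in> N"
        using y(2)
      proof
        assume "y \<in> C"
        then show ?thesis using C_mult[OF C_mult[OF e_C[OF ij(1)]] e_C[OF ij(2)]] by simp
      next
        assume "y \<in> N"
        then show ?thesis
          using ideal.I_r_closed[OF N_ideal ideal.I_l_closed[OF N_ideal _ ec(1)] ec(2)] by simp
      qed
      moreover have "e i \<otimes>\<^bsub>A\<^esub> (e i \<otimes>\<^bsub>A\<^esub> y \<otimes>\<^bsub>A\<^esub> e j) = e i \<otimes>\<^bsub>A\<^esub> y \<otimes>\<^bsub>A\<^esub> e j"
        using ec yc e_mult[OF ij(1,1)] A.m_assoc[of "e i" "e i" "y \<otimes>\<^bsub>A\<^esub> e j"] by (simp add: A.m_assoc)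
      moreover have "(e i \<otimes>\<^bsub>A\<^esub> y \<otimes>\<^bsub>A\<^esub> e j) \<otimes>\<^bsub>A\<^esub> e j = e i \<otimes>\<^bsub>A\<^esub> y \<otimes>\<^bsub>A\<^esub> e j"
        using ec yc e_mult[OF ij(2,2)] by (simp add: A.m_assoc)
      ultimately show ?thesis using ij unfolding H_def by blast
    qed
    then have eye: "e i \<otimes>\<^bsub>A\<^esub> y \<otimes>\<^bsub>A\<^esub> e j \<in> U" if "i < n" "j < n" for i j using that HU by auto
    have "e i \<otimes>\<^bsub>A\<^esub> y \<in> U" if i: "i < n" for i
    proof -
      have "e i \<otimes>\<^bsub>A\<^esub> y = e i \<otimes>\<^bsub>A\<^esub> y \<otimes>\<^bsub>A\<^esub> (\<Oplus>\<^bsub>A\<^esub>j\<in>{..<n}. e j)" using i yc e_closed by (simp add: e_sum)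
      also have "\<dots> = (\<Oplus>\<^bsub>A\<^esub>j\<in>{..<n}. e i \<otimes>\<^bsub>A\<^esub> y \<otimes>\<^bsub>A\<^esub> e j)"
        using i yc e_closed by (intro A.finsum_rdistr) auto
      also have "\<dots> \<in> U" using eye i by (intro subspace_finsum[OF U]) auto
      finally show ?thesis .
    qed
    moreover have "y = (\<Oplus>\<^bsub>A\<^esub>i\<in>{..<n}. e i) \<otimes>\<^bsub>A\<^esub> y" using yc by (simp add: e_sum)
    moreover have "(\<Oplus>\<^bsub>A\<^esub>i\<in>{..<n}. e i) \<otimes>\<^bsub>A\<^esub> y = (\<Oplus>\<^bsub>A\<^esub>i\<in>{..<n}. e i \<otimes>\<^bsub>A\<^esub> y)"
      using yc e_closed by (intro A.finsum_ldistr) auto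
    ultimately show ?thesis using subspace_finsum[OF U, of "{..<n}" "\<lambda>i. e i \<otimes>\<^bsub>A\<^esub> y"] by simp
  qed
  obtain c y where cy: "c \<in> C" "y \<in> N" "x = c \<oplus>\<^bsub>A\<^esub> y" using split x J_carrier by blast
  have cc: "c \<in> carrier A" "y \<in> carrier A" using cy subspace_carr C_subspace N_subspace by auto
  have "x \<ominus>\<^bsub>A\<^esub> y \<in> J" using x cy N_J by (intro subspace_minus[OF J_subspace]) auto
  moreover have "x \<ominus>\<^bsub>A\<^esub> y = c" unfolding cy(3) using cc by algebra
  ultimately have "c \<in> U" "y \<in> U" using * cy N_J by auto
  then show "x \<in> U" using subspace_add[OF U] cy by simp
qed

section \<open>Generators of the radical modulo its square\<close>

definition lspan :: "'a set \<Rightarrow> 'a set" where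
  "lspan Y = \<Inter>{U. subspace U \<and> Y \<subseteq> U}"

lemma lspan_subspace: "Y \<subseteq> carrier A \<Longrightarrow> subspace (lspan Y)"
  unfolding lspan_def subspace_def by blast

lemma lspan_subset: "Y \<subseteq> lspan Y"
  and lspan_least: "subspace U \<Longrightarrow> Y \<subseteq> U \<Longrightarrow> lspan Y \<subseteq> U"
  unfolding lspan_def by blast+

text \<open>A finite W whose span has maximal measure already generates, since adding another h
  cannot enlarge the span. Among the finite generating sets one of least cardinality is then taken;
  it replaces a basis of J modulo its square.\<close>

lemma ex_minimal_generators:
  "\<exists>W. ((finite W \<and> W \<subseteq> H) \<and> H \<subseteq> lspan (W \<union> pw J 2)) \<and>
    (\<forall>Y. (finite Y \<and> Y \<subseteq> H) \<and> H \<subseteq> lspan (Y \<union> pw J 2) \<longrightarrow> card W \<le> card Y)"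
proof -
  let ?P = "\<lambda>W. finite W \<and> W \<subseteq> H"
  let ?f = "\<lambda>W. lspan (W \<union> pw J 2)"
  have carr: "W \<union> pw J 2 \<subseteq> carrier A" if "W \<subseteq> H" for W
    using that J_carrier subspace_carr[OF J2_subspace] by (auto simp: H_def)
  have "\<exists>W. ?P W \<and> (\<forall>Y. ?P Y \<longrightarrow> sdim (?f Y) \<le> sdim (?f W))"
    by (rule ex_max_sdim[of ?P "{}" ?f]) simp
  then obtain W where W: "?P W" "\<And>Y. ?P Y \<Longrightarrow> sdim (?f Y) \<le> sdim (?f W)" by blast
  have "H \<subseteq> ?f W"
  proof
    fix h assume h: "h \<in> H"
    have P: "?P (insert h W)" using W h by simp
    have sub: "subspace (?f W)" "subspace (?f (insert h W))"
      using carr W(1) P lspan_subspace by meson+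
    have "?f W \<subseteq> ?f (insert h W)" using lspan_subset[of "insert h W \<union> pw J 2"] by (intro lspan_least sub) auto
    then have "?f W = ?f (insert h W)" using sdim_antimono_eq[OF sub] W(2)[OF P] by simp
    then show "h \<in> ?f W" using lspan_subset[of "insert h W \<union> pw J 2"] by auto
  qed
  then have "?P W \<and> H \<subseteq> ?f W" using W(1) by blast
  then show ?thesis by (rule ex_has_least_nat)
qed

text \<open>A relation modulo J^2 with a non-zero coefficient at y would express y by the other
  generators modulo J^2, so y could be removed, against the least cardinality.\<close>

lemma minimal_generators_independent:
  assumes W: "finite W" "W \<subseteq> H" "H \<subseteq> lspan (W \<union> pw J 2)"
    and min: "\<And>Y. finite Y \<Longrightarrow> Y \<subseteq> H \<Longrightarrow> H \<subseteq> lspan (Y \<union> pw J 2) \<Longrightarrow> card W \<le> card Y"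
    and c: "\<And>x. x \<in> W \<Longrightarrow> c x \<in> carrier K" and sum: "(\<Oplus>\<^bsub>A\<^esub>x\<in>W. c x \<odot>\<^bsub>A\<^esub> x) \<in> pw J 2"
    and y: "y \<in> W"
  shows "c y = \<zero>"
proof (rule ccontr)
  assume ne: "c y \<noteq> \<zero>"
  let ?U = "lspan ((W - {y}) \<union> pw J 2)"
  have Wc: "W \<subseteq> carrier A" using W J_carrier by (auto simp: H_def)
  have Uc: "(W - {y}) \<union> pw J 2 \<subseteq> carrier A" using Wc subspace_carr[OF J2_subspace] by auto
  have U: "subspace ?U" using Uc by (rule lspan_subspace)
  have sub: "W - {y} \<subseteq> ?U" "pw J 2 \<subseteq> ?U" using lspan_subset[of "(W - {y}) \<union> pw J 2"] by auto
  let ?s = "\<Oplus>\<^bsub>A\<^esub>x\<in>W - {y}. c x \<odot>\<^bsub>A\<^esub> x"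
  have sU: "?s \<in> ?U"
    using W(1) sub(1) c by (intro subspace_finsum[OF U] subspace_smult[OF U]) auto
  have cy: "c y \<odot>\<^bsub>A\<^esub> y \<in> carrier A" using c y Wc by auto
  have sc: "?s \<in> carrier A" using subspace_carr[OF U sU] .
  have "(\<Oplus>\<^bsub>A\<^esub>x\<in>insert y (W - {y}). c x \<odot>\<^bsub>A\<^esub> x) = c y \<odot>\<^bsub>A\<^esub> y \<oplus>\<^bsub>A\<^esub> ?s"
    using W(1) c y Wc by (intro M.finsum_insert) auto
  then have "c y \<odot>\<^bsub>A\<^esub> y \<oplus>\<^bsub>A\<^esub> ?s \<in> ?U" using sum sub(2) y by (auto simp: insert_absorb)
  then have "(c y \<odot>\<^bsub>A\<^esub> y \<oplus>\<^bsub>A\<^esub> ?s) \<ominus>\<^bsub>A\<^esub> ?s \<in> ?U" using sU by (rule subspace_minus[OF U])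
  moreover have "(p \<oplus>\<^bsub>A\<^esub> q) \<ominus>\<^bsub>A\<^esub> q = p" if "p \<in> carrier A" "q \<in> carrier A" for p q
    using that by algebra
  then have "(c y \<odot>\<^bsub>A\<^esub> y \<oplus>\<^bsub>A\<^esub> ?s) \<ominus>\<^bsub>A\<^esub> ?s = c y \<odot>\<^bsub>A\<^esub> y" using cy sc by blast
  ultimately have cyU: "c y \<odot>\<^bsub>A\<^esub> y \<in> ?U" by simp
  have ci: "inv (c y) \<in> carrier K" "inv (c y) \<otimes> c y = \<one>" using c[OF y] ne field_Units by auto
  then have "inv (c y) \<odot>\<^bsub>A\<^esub> (c y \<odot>\<^bsub>A\<^esub> y) \<in> ?U" using subspace_smult[OF U _ cyU] by auto
  moreover have "inv (c y) \<odot>\<^bsub>A\<^esub> (c y \<odot>\<^bsub>A\<^esub> y) = y"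
    using ci c[OF y] y Wc smult_assoc1[of "inv (c y)" "c y" y] by auto
  ultimately have "y \<in> ?U" by simp
  then have "W \<union> pw J 2 \<subseteq> ?U" using sub by auto
  then have "H \<subseteq> ?U" using W(3) lspan_least[OF U] by blast
  then have "card W \<le> card (W - {y})" using W by (intro min) auto
  then show False using W(1) y by (metis card_Diff1_less not_less)
qed

text \<open>The quiver has the e i as vertices and the elements of W as arrows. The conclusions are
  stated for \<open>ev\<close>, whose kernel will be I: supports of length at least 2 and vanishing
  on long paths are admissibility, while the images in N and C of the two parts of z will give
  pre-removability.\<close>

theorem elementary_splitting_presentation:
  obtains Q :: "(nat, nat) pre_digraph" and ev B where
    "fin_digraph Q" "ev \<in> ring_hom (path_algebra K Q) A" "ev ` carrier (path_algebra K Q) = carrier A"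
    "\<And>c z. c \<in> carrier K \<Longrightarrow> z \<in> carrier (path_algebra K Q) \<Longrightarrow> ev (c \<odot>\<^bsub>path_algebra K Q\<^esub> z) = c \<odot>\<^bsub>A\<^esub> ev z"
    "\<And>z w. z \<in> carrier (path_algebra K Q) \<Longrightarrow> ev z = \<zero>\<^bsub>A\<^esub> \<Longrightarrow> z w \<noteq> \<zero> \<Longrightarrow> 2 \<le> length (snd w)"
    "\<exists>l>1. \<forall>w\<in>paths Q. length (snd w) = l \<longrightarrow> ev (path_elem K w) = \<zero>\<^bsub>A\<^esub>"
    "B \<subseteq> arcs Q" "\<And>z. z \<in> carrier (path_algebra K Q) \<Longrightarrow> ev (part_through K B z) \<in> N"
    "\<And>z. z \<in> carrier (path_algebra K Q) \<Longrightarrow> ev (part_avoiding K B z) \<in> C"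
proof -
  from ex_minimal_generators obtain W where W0: "((finite W \<and> W \<subseteq> H) \<and> H \<subseteq> lspan (W \<union> pw J 2)) \<and>
    (\<forall>Y. (finite Y \<and> Y \<subseteq> H) \<and> H \<subseteq> lspan (Y \<union> pw J 2) \<longrightarrow> card W \<le> card Y)" ..
  have W: "finite W" "W \<subseteq> H" "H \<subseteq> lspan (W \<union> pw J 2)"
    "\<And>Y. finite Y \<Longrightarrow> Y \<subseteq> H \<Longrightarrow> H \<subseteq> lspan (Y \<union> pw J 2) \<Longrightarrow> card W \<le> card Y"
    using W0 by simp_all
  define m where "m = card W"
  obtain b where b: "bij_betw b {..<m} W"
    using ex_bij_betw_nat_finite[OF W(1)] unfolding m_def atLeast0LessThan by blast
  have bW: "b a \<in> W" if "a < m" for a using b that by (auto simp: bij_betw_def)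
  have WH: "x \<in> J" "x \<in> C \<or> x \<in> N" "\<exists>i j. i < n \<and> j < n \<and> e i \<otimes>\<^bsub>A\<^esub> x = x \<and> x \<otimes>\<^bsub>A\<^esub> e j = x" if "x \<in> W" for x
    using W(2) that by (auto simp: H_def)
  \<comment> \<open>The indices that witness Peirce homogeneity become the source and the target of
    the arrow.\<close>
  then obtain s t where st: "\<And>x. x \<in> W \<Longrightarrow> s x < n" "\<And>x. x \<in> W \<Longrightarrow> t x < n"
    "\<And>x. x \<in> W \<Longrightarrow> e (s x) \<otimes>\<^bsub>A\<^esub> x = x" "\<And>x. x \<in> W \<Longrightarrow> x \<otimes>\<^bsub>A\<^esub> e (t x) = x"
    by metis
  define Q :: "(nat, nat) pre_digraph" where
    "Q = \<lparr>verts = {..<n}, arcs = {..<m}, tail = s \<circ> b, head = t \<circ> b\<rparr>"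
  have Qs: "verts Q = {..<n}" "arcs Q = {..<m}" "tail Q a = s (b a)" "head Q a = t (b a)" for a
    by (simp_all add: Q_def)
  have fdQ: "fin_digraph Q" by unfold_locales (auto simp: Qs st bW)
  interpret quiver_evaluation K Q A e b
  proof (intro quiver_evaluation.intro quiver_algebra.intro fdQ field_axioms k_algebra_axioms quiver_evaluation_axioms.intro)
    show "b a \<in> carrier A" if "a \<in> arcs Q" for a using WH(1)[OF bW] that J_carrier by (auto simp: Qs)
  qed (use e_closed e_mult e_sum st bW in \<open>auto simp: Qs\<close>)
  let ?th = "part_through K" and ?av = "part_avoiding K"
  have J_pw: "x \<in> J \<Longrightarrow> x \<in> pw J 1" for x by (rule pw_one[OF J_carrier])
  have evp_pw: "evp w \<in> pw J (length (snd w))" if w: "w \<in> paths Q" "0 < length (snd w)" for w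
  proof -
    have "set (snd w) \<subseteq> arcs Q" using paths_arcs[of "fst w" "snd w"] w by simp
    then have "set (map b (snd w)) \<subseteq> J" using WH(1)[OF bW] by (auto simp: Qs)
    then have "mprod (map b (snd w)) \<in> pw J (length (snd w))" by (intro pw_prod) auto
    then show ?thesis unfolding evp_def
      using w(2) paths_verts(1)[of "fst w" "snd w"] w(1) e_closed by (intro pw_l_closed[OF J_ideal]) (auto simp: Qs)
  qed
  have evp_J: "evp w \<in> J" if "w \<in> paths Q" "0 < length (snd w)" for w
    using evp_pw[OF that] pw_antimono[OF J_ideal, of 1 "length (snd w)"] pw_1_ideal[OF J_ideal] that(2) by auto
  \<comment> \<open>Arrows with value in N; by the definition of \<open>H\<close> all other arrows
    have their value in C.\<close>
  define B where "B = {a. a < m \<and> b a \<in> N}"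
  have evp_N: "evp (u, p) \<in> N" if p: "(u, p) \<in> paths Q" "set p \<inter> B \<noteq> {}" for u p
  proof -
    obtain a where a: "a \<in> set p" "a \<in> B" using p(2) by auto
    obtain x y where xy: "x \<in> carrier kQ" "y \<in> carrier kQ"
      "path_elem K (u, p) = x \<otimes>\<^bsub>kQ\<^esub> (path_elem K (tail Q a, [a]) \<otimes>\<^bsub>kQ\<^esub> y)"
      using path_elem_through[OF p(1) a(1)] by blast
    have aQ: "a \<in> arcs Q" using a by (auto simp: B_def Qs)
    have "ev (path_elem K (tail Q a, [a])) = b a"
      using ev_path_elem[OF paths_arc[OF aQ]] arr_tail[OF aQ] arr_closed[OF aQ] by (simp add: evp_def)
    then have "evp (u, p) = ev x \<otimes>\<^bsub>A\<^esub> (b a \<otimes>\<^bsub>A\<^esub> ev y)"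
      using xy paths_arc[OF aQ] ev_path_elem[OF p(1)] by (simp add: ev_mult kQ_mult_closed del: kQ_simps)
    then show ?thesis
      using a xy ideal.I_l_closed[OF N_ideal] ideal.I_r_closed[OF N_ideal] by (simp add: B_def)
  qed
  have mprod_C: "mprod xs \<in> C" if "set xs \<subseteq> C" for xs
    using that by (induction xs) (auto intro: C_mult one_C)
  have evp_C: "evp (u, p) \<in> C" if p: "(u, p) \<in> paths Q" "set p \<inter> B = {}" for u p
  proof -
    have "set (map b p) \<subseteq> C"
      using paths_arcs[OF p(1)] p(2) WH(2)[OF bW] by (auto simp: B_def Qs)
    then show ?thesis using mprod_C e_C paths_verts(1)[OF p(1)] by (auto simp: evp_def Qs intro!: C_mult)
  qed
  have thN: "ev (?th B z) \<in> N" if z: "z \<in> carrier kQ" for z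
  proof (rule ev_in_subspace[OF N_subspace part_through_closed[OF z]])
    fix w assume "w \<in> paths Q" "?th B z w \<noteq> \<zero>"
    then show "evp w \<in> N" using evp_N[of "fst w" "snd w"] by (auto simp: part_through_def split: if_splits)
  qed
  have avC: "ev (?av B z) \<in> C" if z: "z \<in> carrier kQ" for z
  proof (rule ev_in_subspace[OF C_subspace part_avoiding_closed[OF z]])
    fix w assume "w \<in> paths Q" "?av B z w \<noteq> \<zero>"
    then show "evp w \<in> C" using evp_C[of "fst w" "snd w"] by (auto simp: part_avoiding_def split: if_splits)
  qed
  \<comment> \<open>T is a subalgebra containing the e i and W. Since W generates J only modulo J^2,
    surjectivity is reached by successive approximation along the powers of J, which ends because J
    is nilpotent.\<close>
  define T where "T = ev ` carrier kQ"
  interpret evh: ring_hom_ring kQ A ev by (rule ring_hom_ringI2[OF kQ.A.ring_axioms A.ring_axioms ev_ring_hom])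
  have T_sub: "subspace T"
  proof (rule subspaceI)
    show "T \<subseteq> carrier A" by (auto simp: T_def)
    show "\<zero>\<^bsub>A\<^esub> \<in> T" unfolding T_def using ev_zero kQ_zero_closed by (metis image_eqI)
  next
    fix x y assume "x \<in> T" "y \<in> T"
    then obtain u v where uv: "u \<in> carrier kQ" "v \<in> carrier kQ" "x = ev u" "y = ev v" unfolding T_def by blast
    show "x \<oplus>\<^bsub>A\<^esub> y \<in> T"
      unfolding T_def uv ev_add[OF uv(1,2), symmetric] by (rule imageI[OF kQ_add_closed[OF uv(1,2)]])
  next
    fix c x assume c: "c \<in> carrier K" and "x \<in> T"
    then obtain u where u: "u \<in> carrier kQ" "x = ev u" unfolding T_def by blast
    show "c \<odot>\<^bsub>A\<^esub> x \<in> T"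
      unfolding T_def u(2) ev_smult[OF c u(1), symmetric] by (rule imageI[OF kQ_smult_closed[OF c u(1)]])
  qed
  have T_mult: "x \<otimes>\<^bsub>A\<^esub> y \<in> T" if "x \<in> T" "y \<in> T" for x y
  proof -
    obtain u where u: "u \<in> carrier kQ" "x = ev u" using \<open>x \<in> T\<close> unfolding T_def by blast
    obtain v where v: "v \<in> carrier kQ" "y = ev v" using \<open>y \<in> T\<close> unfolding T_def by blast
    note uv = u(1) v(1) u(2) v(2)
    show ?thesis
      unfolding T_def uv ev_mult[OF uv(1,2), symmetric] by (rule imageI[OF kQ_mult_closed[OF uv(1,2)]])
  qed
  have eT: "e i \<in> T" if i: "i < n" for i
  proof -
    have p: "(i, []) \<in> paths Q" using i by (simp add: paths_Nil Qs)
    have "e i = ev (path_elem K (i, []))" using ev_path_elem[OF p] evp_Nil[of i] i by (simp add: Qs)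
    then show ?thesis unfolding T_def using path_elem_closed[OF p] by (rule image_eqI)
  qed
  have WT: "W \<subseteq> T"
  proof
    fix x assume "x \<in> W"
    then obtain a where a: "a < m" "x = b a" using b by (auto simp: bij_betw_def)
    then have aQ: "a \<in> arcs Q" by (simp add: Qs)
    have "ev (path_elem K (tail Q a, [a])) = b a"
      using ev_path_elem[OF paths_arc[OF aQ]] arr_tail[OF aQ] arr_closed[OF aQ] by (simp add: evp_def)
    then show "x \<in> T" using a path_elem_closed[OF paths_arc[OF aQ]] unfolding T_def by (metis image_eqI)
  qed
  have approx: "\<forall>x\<in>J. \<exists>t\<in>T. \<exists>r\<in>pw J k. x = t \<oplus>\<^bsub>A\<^esub> r" if "0 < k" for k
    using that
  proof (induction k rule: nat_induct_non_zero)
    case 1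
    show ?case
    proof
      fix x assume x: "x \<in> J"
      then have "x = \<zero>\<^bsub>A\<^esub> \<oplus>\<^bsub>A\<^esub> x" using J_carrier by auto
      then show "\<exists>t\<in>T. \<exists>r\<in>pw J 1. x = t \<oplus>\<^bsub>A\<^esub> r" using subspace_zero[OF T_sub] J_pw[OF x] by blast
    qed
  next
    case (Suc k)
    \<comment> \<open>It suffices that T + J^(k+1) contains W and J^2, for then it contains H and
      hence J.\<close>
    let ?U = "{t \<oplus>\<^bsub>A\<^esub> r | t r. t \<in> T \<and> r \<in> pw J (Suc k)}"
    have pwS: "subspace (pw J l)" for l by (rule pw_subspace[OF J_carrier])
    have U: "subspace ?U"
    proof (rule subspaceI)
      show "?U \<subseteq> carrier A" using subspace_carr[OF T_sub] subspace_carr[OF pwS] by auto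
      show "\<zero>\<^bsub>A\<^esub> \<in> ?U" using subspace_zero[OF T_sub] subspace_zero[OF pwS] by force
    next
      fix x y assume "x \<in> ?U" "y \<in> ?U"
      then obtain t r t' r' where *: "t \<in> T" "r \<in> pw J (Suc k)" "x = t \<oplus>\<^bsub>A\<^esub> r"
        "t' \<in> T" "r' \<in> pw J (Suc k)" "y = t' \<oplus>\<^bsub>A\<^esub> r'" by blast
      then have "x \<oplus>\<^bsub>A\<^esub> y = (t \<oplus>\<^bsub>A\<^esub> t') \<oplus>\<^bsub>A\<^esub> (r \<oplus>\<^bsub>A\<^esub> r')"
        using subspace_carr[OF T_sub] subspace_carr[OF pwS] by (simp add: M.a_ac)
      then show "x \<oplus>\<^bsub>A\<^esub> y \<in> ?U" using * subspace_add[OF T_sub] subspace_add[OF pwS] by blast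
    next
      fix c x assume c: "c \<in> carrier K" and "x \<in> ?U"
      then obtain t r where *: "t \<in> T" "r \<in> pw J (Suc k)" "x = t \<oplus>\<^bsub>A\<^esub> r" by blast
      then have "c \<odot>\<^bsub>A\<^esub> x = c \<odot>\<^bsub>A\<^esub> t \<oplus>\<^bsub>A\<^esub> c \<odot>\<^bsub>A\<^esub> r"
        using c subspace_carr[OF T_sub] subspace_carr[OF pwS] by (simp add: smult_r_distr)
      then show "c \<odot>\<^bsub>A\<^esub> x \<in> ?U" using * c subspace_smult[OF T_sub] subspace_smult[OF pwS] by blast
    qed
    have TU: "T \<subseteq> ?U"
    proof
      fix x assume x: "x \<in> T"
      then have "x = x \<oplus>\<^bsub>A\<^esub> \<zero>\<^bsub>A\<^esub>" using subspace_carr[OF T_sub] by simp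
      then show "x \<in> ?U" using x subspace_zero[OF pwS] by blast
    qed
    have "pw J 2 \<subseteq> ?U"
    proof (rule pw_subset_subspace[OF J_carrier U])
      fix xs assume xs: "set xs \<subseteq> J" "length xs = 2"
      then obtain x y where xy: "xs = [x, y]" "x \<in> J" "y \<in> J"
        by (auto simp: numeral_2_eq_2 length_Suc_conv)
      obtain t1 r1 where 1: "t1 \<in> T" "r1 \<in> pw J k" "x = t1 \<oplus>\<^bsub>A\<^esub> r1" using Suc.IH xy(2) by blast
      obtain t2 r2 where 2: "t2 \<in> T" "r2 \<in> pw J k" "y = t2 \<oplus>\<^bsub>A\<^esub> r2" using Suc.IH xy(3) by blast
      have c: "t1 \<in> carrier A" "t2 \<in> carrier A" "r1 \<in> carrier A" "r2 \<in> carrier A" "y \<in> carrier A" "x \<in> carrier A"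
        using 1 2 xy subspace_carr[OF T_sub] subspace_carr[OF pwS] J_carrier by auto
      \<comment> \<open>As x and r1 lie in J, so does t1. In x y = t1 t2 + (t1 r2 + r1 y) the
        bracket therefore lies in J^(k+1), while t1 t2 lies in T.\<close>
      have "r1 \<in> J" using 1(2) pw_antimono[OF J_ideal, of 1 k] Suc.hyps pw_1_ideal[OF J_ideal] by auto
      then have "x \<ominus>\<^bsub>A\<^esub> r1 \<in> J" using xy(2) by (intro subspace_minus[OF J_subspace])
      moreover have "x \<ominus>\<^bsub>A\<^esub> r1 = t1" unfolding 1(3) using c by algebra
      ultimately have "t1 \<in> pw J 1" using J_pw by simp
      then have "t1 \<otimes>\<^bsub>A\<^esub> r2 \<in> pw J (Suc k)" using pw_mult[OF J_carrier _ 2(2), of t1 1] by simp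
      moreover have "r1 \<otimes>\<^bsub>A\<^esub> y \<in> pw J (Suc k)" using pw_mult[OF J_carrier 1(2) J_pw[OF xy(3)]] by simp
      ultimately have "t1 \<otimes>\<^bsub>A\<^esub> r2 \<oplus>\<^bsub>A\<^esub> r1 \<otimes>\<^bsub>A\<^esub> y \<in> pw J (Suc k)" by (rule subspace_add[OF pwS])
      moreover have "x \<otimes>\<^bsub>A\<^esub> y = t1 \<otimes>\<^bsub>A\<^esub> t2 \<oplus>\<^bsub>A\<^esub> (t1 \<otimes>\<^bsub>A\<^esub> r2 \<oplus>\<^bsub>A\<^esub> r1 \<otimes>\<^bsub>A\<^esub> y)"
      proof -
        have "x \<otimes>\<^bsub>A\<^esub> y = t1 \<otimes>\<^bsub>A\<^esub> y \<oplus>\<^bsub>A\<^esub> r1 \<otimes>\<^bsub>A\<^esub> y" using 1(3) c by (simp add: A.l_distr)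
        also have "t1 \<otimes>\<^bsub>A\<^esub> y = t1 \<otimes>\<^bsub>A\<^esub> t2 \<oplus>\<^bsub>A\<^esub> t1 \<otimes>\<^bsub>A\<^esub> r2" using 2(3) c by (simp add: A.r_distr)
        finally show ?thesis using c by (simp add: M.a_assoc)
      qed
      ultimately have "x \<otimes>\<^bsub>A\<^esub> y \<in> ?U" using T_mult[OF 1(1) 2(1)] by blast
      then show "mprod xs \<in> ?U" using xy c by simp
    qed
    then have "lspan (W \<union> pw J 2) \<subseteq> ?U" using WT TU by (intro lspan_least[OF U]) blast
    then have "J \<subseteq> ?U" using W(3) J_spanned_by_H[OF U] by blast
    then show ?case by blast
  qed
  obtain l where l: "0 < l" "pw J l = {\<zero>\<^bsub>A\<^esub>}" using nilpotent by blast
  have JT: "J \<subseteq> T"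
  proof
    fix x assume x: "x \<in> J"
    then obtain t r where "t \<in> T" "r \<in> pw J l" "x = t \<oplus>\<^bsub>A\<^esub> r" using approx[OF l(1)] by blast
    then show "x \<in> T" using l(2) subspace_carr[OF T_sub] by simp
  qed
  have surj: "ev ` carrier kQ = carrier A"
  proof
    show "carrier A \<subseteq> ev ` carrier kQ"
    proof
      fix x assume x: "x \<in> carrier A"
      obtain r where r: "r \<in> J" "x = (\<Oplus>\<^bsub>A\<^esub>i\<in>{..<n}. \<chi> i x \<odot>\<^bsub>A\<^esub> e i) \<oplus>\<^bsub>A\<^esub> r"
        using diagonal_decomposition[OF x] by blast
      have "(\<Oplus>\<^bsub>A\<^esub>i\<in>{..<n}. \<chi> i x \<odot>\<^bsub>A\<^esub> e i) \<in> T"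
        using eT character_closed[OF \<chi> x] by (intro subspace_finsum[OF T_sub] subspace_smult[OF T_sub]) auto
      then have "x \<in> T" using subspace_add[OF T_sub] r JT by (metis subsetD)
      then show "x \<in> ev ` carrier kQ" by (simp add: T_def)
    qed
  qed auto
  \<comment> \<open>Paths of positive length evaluate into J, so \<chi> i sees only the coefficient
    at the trivial path of vertex i.\<close>
  have \<chi>ev: "\<chi> i (ev z) = z (i, [])" if i: "i < n" and z: "z \<in> carrier kQ" for i z
    using z
  proof (induction rule: kQ_induct)
    case zero
    then show ?case using character_zero[OF \<chi>[OF i]] by (simp add: ev_zero)
  next
    case (base c w)
    obtain u p where w: "w = (u, p)" by (cases w)
    have "\<chi> i (evp w) = path_elem K w (i, [])"
    proof (cases "p = []")
      case True
      then have "u < n" using base(2) w by (simp add: paths_Nil Qs)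
      then show ?thesis using True w i evp_Nil[of u] \<chi>_e by (auto simp: path_elem_def Qs)
    next
      case False
      then have "evp w \<in> J" using evp_J base(2) w by simp
      then show ?thesis using False w i by (auto simp: joint_kernel_def path_elem_def)
    qed
    then show ?case using base i character_smult[OF \<chi>[OF i]]
      by (simp add: ev_smult[unfolded kQ_simps] ev_path_elem)
  next
    case (add x y)
    then show ?case using character_add[OF \<chi>[OF i]] by (simp add: ev_add[unfolded kQ_simps])
  qed
  \<comment> \<open>The characters exclude trivial paths from an element of the kernel. The rest is
    y + z', with y supported on arrows and z' on longer paths; then the value of y is minus that of
    z' and lies in J^2, so independence of W modulo J^2 makes the coefficients of y vanish.\<close>
  have supp: "2 \<le> length (snd w)" if z: "z \<in> carrier kQ" "ev z = \<zero>\<^bsub>A\<^esub>" and w: "z w \<noteq> \<zero>" for z w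
  proof (rule ccontr)
    assume short: "\<not> 2 \<le> length (snd w)"
    have wp: "w \<in> paths Q" using kQ_outside[OF z(1)] w by blast
    have len0: "z (u, []) = \<zero>" for u
    proof (cases "u < n")
      case True
      then show ?thesis using \<chi>ev[OF True z(1)] z(2) character_zero[OF \<chi>[OF True]] by simp
    next
      case False
      then show ?thesis using kQ_outside[OF z(1), of "(u, [])"] by (simp add: paths_Nil Qs)
    qed
    define y where "y v = (if length (snd v) = 1 then z v else \<zero>)" for v
    define z' where "z' v = (if 2 \<le> length (snd v) then z v else \<zero>)" for v
    have yc: "y \<in> carrier kQ" and zc: "z' \<in> carrier kQ"
    proof -
      have *: "finite {w. z w \<noteq> \<zero>}" "{w. z w \<noteq> \<zero>} \<subseteq> paths Q" using kQ_finite kQ_outside z(1) by blast+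
      show "y \<in> carrier kQ" by (rule kQ_carrier_subset[OF *]) (use z(1) in \<open>auto simp: y_def\<close>)
      show "z' \<in> carrier kQ" by (rule kQ_carrier_subset[OF *]) (use z(1) in \<open>auto simp: z'_def\<close>)
    qed
    have "z = y \<oplus>\<^bsub>kQ\<^esub> z'"
    proof
      fix v
      show "z v = (y \<oplus>\<^bsub>kQ\<^esub> z') v"
      proof (cases "length (snd v)")
        case 0
        then have "z v = \<zero>" using len0[of "fst v"] by (metis length_0_conv prod.collapse)
        then show ?thesis using 0 by (simp add: y_def z'_def)
      next
        case (Suc l)
        then show ?thesis using z(1) by (cases l) (simp_all add: y_def z'_def)
      qed
    qed
    then have sum0: "ev y \<oplus>\<^bsub>A\<^esub> ev z' = \<zero>\<^bsub>A\<^esub>" using ev_add[OF yc zc] z(2) by simp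
    have "ev z' \<in> pw J 2"
    proof (rule ev_in_subspace[OF J2_subspace zc])
      fix v assume v: "v \<in> paths Q" "z' v \<noteq> \<zero>"
      then have "2 \<le> length (snd v)" by (auto simp: z'_def split: if_splits)
      then show "evp v \<in> pw J 2"
        using evp_pw[OF v(1)] pw_antimono[OF J_ideal, of 2 "length (snd v)"] by (cases "snd v") auto
    qed
    then have "\<ominus>\<^bsub>A\<^esub> ev z' \<in> pw J 2" by (rule subspace_neg[OF J2_subspace])
    moreover have "ev y = \<ominus>\<^bsub>A\<^esub> ev z'" using sum0 yc zc by (metis M.minus_equality ev_closed)
    ultimately have y2: "ev y \<in> pw J 2" by simp
    \<comment> \<open>The sum over arrows is rewritten as a sum over elements of W, the form in
      which independence is stated; \<open>ar\<close> recovers an arrow from its value.\<close>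
    define ar where "ar x = inv_into {..<m} b x" for x
    have ar: "ar x < m" "b (ar x) = x" if "x \<in> W" for x
      using that b bij_betw_inv_into_right[OF b that] inv_into_into[of x b "{..<m}"]
      by (auto simp: ar_def bij_betw_def)
    have arb: "ar (b a) = a" if "a < m" for a
      using that bij_betw_inv_into_left[OF b, of a] by (simp add: ar_def)
    have bc: "b a \<in> carrier A" if "a < m" for a using WH(1)[OF bW[OF that]] J_carrier by blast
    let ?pa = "\<lambda>a. (s (b a), [a])"
    have pa: "?pa a \<in> paths Q" "evp (?pa a) = b a" if "a < m" for a
      using that paths_arc[of a] arr_tail[of a] arr_closed[of a] by (auto simp: Qs evp_def)
    have "ev y = (\<Oplus>\<^bsub>A\<^esub>v\<in>?pa ` {..<m}. y v \<odot>\<^bsub>A\<^esub> evp v)"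
    proof (rule ev_superset[OF yc])
      fix v assume v: "v \<notin> ?pa ` {..<m}"
      show "y v = \<zero>"
      proof (cases "length (snd v) = 1 \<and> v \<in> paths Q")
        case True
        then obtain a where a: "snd v = [a]" by (auto simp: length_Suc_conv)
        then have va: "v = (fst v, [a])" by (metis prod.collapse)
        then have "(fst v, [a]) \<in> paths Q" using True by metis
        then have "a < m" "fst v = s (b a)" by (auto simp: paths_Cons Qs)
        then show ?thesis using v va by auto
      next
        case False
        then show ?thesis using kQ_outside[OF z(1), of v] by (auto simp: y_def)
      qed
    qed (use pa in auto)
    also have "\<dots> = (\<Oplus>\<^bsub>A\<^esub>a\<in>{..<m}. y (?pa a) \<odot>\<^bsub>A\<^esub> evp (?pa a))"
      using pa yc bc by (intro M.finsum_reindex) (auto simp: inj_on_def)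
    also have "\<dots> = (\<Oplus>\<^bsub>A\<^esub>a\<in>{..<m}. y (?pa (ar (b a))) \<odot>\<^bsub>A\<^esub> b a)"
      using pa yc bc by (intro M.finsum_cong') (auto simp: arb)
    also have "\<dots> = (\<Oplus>\<^bsub>A\<^esub>x\<in>b ` {..<m}. y (?pa (ar x)) \<odot>\<^bsub>A\<^esub> x)"
      using b yc bc
      by (intro M.finsum_reindex[symmetric, of "\<lambda>x. y (?pa (ar x)) \<odot>\<^bsub>A\<^esub> x"]) (auto simp: bij_betw_def)
    finally have "(\<Oplus>\<^bsub>A\<^esub>x\<in>W. y (?pa (ar x)) \<odot>\<^bsub>A\<^esub> x) \<in> pw J 2"
      using y2 b by (simp add: bij_betw_def)
    then have c0: "y (?pa (ar x)) = \<zero>" if "x \<in> W" for x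
      using minimal_generators_independent[OF W, of "\<lambda>x. y (?pa (ar x))" x] that yc by auto
    have "length (snd w) \<noteq> 0" using len0[of "fst w"] w by (metis length_0_conv prod.collapse)
    then have l1: "length (snd w) = 1" using short by linarith
    then obtain a where a: "snd w = [a]" by (auto simp: length_Suc_conv)
    then have wa: "w = (fst w, [a])" by (metis prod.collapse)
    then have "(fst w, [a]) \<in> paths Q" using wp by metis
    then have "a < m" "fst w = s (b a)" by (auto simp: paths_Cons Qs)
    then have "y w = \<zero>" using c0[OF bW[of a]] arb[of a] wa by auto
    then show False using w l1 by (simp add: y_def)
  qed
  \<comment> \<open>The maximum with 2 serves the requirement that the exponent exceed 1.\<close>
  have long: "ev (path_elem K w) = \<zero>\<^bsub>A\<^esub>" if w: "w \<in> paths Q" "length (snd w) = max l 2" for w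
  proof -
    have "evp w \<in> pw J (max l 2)" using evp_pw[OF w(1)] w(2) by simp
    then have "evp w \<in> pw J l" using pw_antimono[OF J_ideal l(1), of "max l 2"] by auto
    then show ?thesis using l(2) ev_path_elem[OF w(1)] by simp
  qed
  have "\<exists>l>1. \<forall>w\<in>paths Q. length (snd w) = l \<longrightarrow> ev (path_elem K w) = \<zero>\<^bsub>A\<^esub>"
    by (rule exI[of _ "max l 2"]) (use long in auto)
  moreover have "B \<subseteq> arcs Q" by (auto simp: B_def Qs)
  ultimately show ?thesis
    using that[of Q ev B] fdQ ev_ring_hom surj ev_smult supp thN avC by blast
qed

end

section \<open>From a splitting to an arrow removal\<close>

lemma additive_map_finsum:
  assumes "abelian_monoid R" "abelian_monoid S" "f \<zero>\<^bsub>R\<^esub> = \<zero>\<^bsub>S\<^esub>"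
    and add: "\<And>x y. x \<in> carrier R \<Longrightarrow> y \<in> carrier R \<Longrightarrow> f (x \<oplus>\<^bsub>R\<^esub> y) = f x \<oplus>\<^bsub>S\<^esub> f y"
    and f: "\<And>x. x \<in> carrier R \<Longrightarrow> f x \<in> carrier S"
    and "finite I" "\<And>i. i \<in> I \<Longrightarrow> g i \<in> carrier R"
  shows "f (finsum R g I) = finsum S (\<lambda>i. f (g i)) I"
  using assms(6,7)
proof (induction I rule: finite_induct)
  case empty
  then show ?case using assms(1-3) by (simp add: abelian_monoid.finsum_empty)
next
  case (insert i I)
  interpret R: abelian_monoid R by fact
  interpret S: abelian_monoid S by fact
  have "g \<in> I \<rightarrow> carrier R" "(\<lambda>i. f (g i)) \<in> I \<rightarrow> carrier S" "g i \<in> carrier R" "f (g i) \<in> carrier S"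
    using insert.prems f by auto
  then show ?case using insert add by simp
qed

text \<open>The projection of \<sigma>(G) \<oplus> N onto the first summand, read in G. It is
  multiplicative because N is an ideal.\<close>

lemma splitting_projection:
  assumes G: "k_algebra K G" and L: "k_algebra K L" and sp: "nilpotent_splitting K G L \<sigma> N"
  obtains \<pi> where "\<pi> \<in> ring_hom L G"
    "\<And>g n. g \<in> carrier G \<Longrightarrow> n \<in> N \<Longrightarrow> \<pi> (\<sigma> g \<oplus>\<^bsub>L\<^esub> n) = g"
    "\<And>c x. c \<in> carrier K \<Longrightarrow> x \<in> carrier L \<Longrightarrow> \<pi> (c \<odot>\<^bsub>L\<^esub> x) = c \<odot>\<^bsub>G\<^esub> \<pi> x"
    "\<And>x. x \<in> carrier L \<Longrightarrow> \<exists>n\<in>N. x = \<sigma> (\<pi> x) \<oplus>\<^bsub>L\<^esub> n"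
    "\<And>x. x \<in> carrier L \<Longrightarrow> \<pi> x = \<zero>\<^bsub>G\<^esub> \<longleftrightarrow> x \<in> N"
proof -
  interpret G: k_algebra K G by fact
  interpret L: k_algebra K L by fact
  have \<sigma>: "\<sigma> \<in> ring_hom G L" and N: "ideal N L"
    and \<sigma>l: "\<And>c x. c \<in> carrier K \<Longrightarrow> x \<in> carrier G \<Longrightarrow> \<sigma> (c \<odot>\<^bsub>G\<^esub> x) = c \<odot>\<^bsub>L\<^esub> \<sigma> x"
    and ex: "\<And>x. x \<in> carrier L \<Longrightarrow> \<exists>g\<in>carrier G. \<exists>n\<in>N. x = \<sigma> g \<oplus>\<^bsub>L\<^esub> n"
    and inj: "\<And>g. g \<in> carrier G \<Longrightarrow> \<sigma> g \<in> N \<Longrightarrow> g = \<zero>\<^bsub>G\<^esub>"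
    using sp unfolding nilpotent_splitting_def by blast+
  interpret \<sigma>: ring_hom_ring G L \<sigma> by (rule ring_hom_ringI2[OF G.A.ring_axioms L.A.ring_axioms \<sigma>])
  note sN = L.ideal_subspace[OF N]
  have Nc: "n \<in> carrier L" if "n \<in> N" for n using L.subspace_carr[OF sN that] .
  have uniq: "g = g'" if *: "g \<in> carrier G" "g' \<in> carrier G" "n \<in> N" "n' \<in> N" "\<sigma> g \<oplus>\<^bsub>L\<^esub> n = \<sigma> g' \<oplus>\<^bsub>L\<^esub> n'" for g g' n n'
  proof -
    have alg: "a \<ominus>\<^bsub>L\<^esub> b = (a \<oplus>\<^bsub>L\<^esub> m) \<ominus>\<^bsub>L\<^esub> (b \<oplus>\<^bsub>L\<^esub> m') \<oplus>\<^bsub>L\<^esub> (m' \<ominus>\<^bsub>L\<^esub> m)"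
      if "a \<in> carrier L" "b \<in> carrier L" "m \<in> carrier L" "m' \<in> carrier L" for a b m m'
      using that by algebra
    have "\<sigma> (g \<ominus>\<^bsub>G\<^esub> g') = \<sigma> g \<ominus>\<^bsub>L\<^esub> \<sigma> g'" using * by (simp add: a_minus_def)
    also have "\<dots> = (\<sigma> g \<oplus>\<^bsub>L\<^esub> n) \<ominus>\<^bsub>L\<^esub> (\<sigma> g' \<oplus>\<^bsub>L\<^esub> n') \<oplus>\<^bsub>L\<^esub> (n' \<ominus>\<^bsub>L\<^esub> n)"
      using * Nc by (intro alg) auto
    also have "\<dots> = n' \<ominus>\<^bsub>L\<^esub> n" using * Nc by (simp add: a_minus_def L.M.r_neg)
    also have "\<dots> \<in> N" using * by (intro L.subspace_minus[OF sN])
    finally have "g \<ominus>\<^bsub>G\<^esub> g' = \<zero>\<^bsub>G\<^esub>" using * by (intro inj) auto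
    then show ?thesis using * by (simp add: G.A.r_right_minus_eq)
  qed
  define \<pi> where "\<pi> x = (SOME g. g \<in> carrier G \<and> (\<exists>n\<in>N. x = \<sigma> g \<oplus>\<^bsub>L\<^esub> n))" for x
  have \<pi>: "\<pi> x \<in> carrier G" "\<exists>n\<in>N. x = \<sigma> (\<pi> x) \<oplus>\<^bsub>L\<^esub> n" if "x \<in> carrier L" for x
  proof -
    have "\<exists>g. g \<in> carrier G \<and> (\<exists>n\<in>N. x = \<sigma> g \<oplus>\<^bsub>L\<^esub> n)" using ex[OF that] by blast
    then have "\<pi> x \<in> carrier G \<and> (\<exists>n\<in>N. x = \<sigma> (\<pi> x) \<oplus>\<^bsub>L\<^esub> n)" unfolding \<pi>_def by (rule someI_ex)
    then show "\<pi> x \<in> carrier G" "\<exists>n\<in>N. x = \<sigma> (\<pi> x) \<oplus>\<^bsub>L\<^esub> n" by auto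
  qed
  have \<pi>_eq: "\<pi> (\<sigma> g \<oplus>\<^bsub>L\<^esub> n) = g" if gn: "g \<in> carrier G" "n \<in> N" for g n
  proof -
    have "\<sigma> g \<oplus>\<^bsub>L\<^esub> n \<in> carrier L" using gn Nc by simp
    from \<pi>[OF this] obtain n' where "\<pi> (\<sigma> g \<oplus>\<^bsub>L\<^esub> n) \<in> carrier G" "n' \<in> N"
      "\<sigma> g \<oplus>\<^bsub>L\<^esub> n = \<sigma> (\<pi> (\<sigma> g \<oplus>\<^bsub>L\<^esub> n)) \<oplus>\<^bsub>L\<^esub> n'" by blast
    then show ?thesis using uniq gn by metis
  qed
  have decomp: "\<exists>g n. g \<in> carrier G \<and> n \<in> N \<and> n \<in> carrier L \<and> x = \<sigma> g \<oplus>\<^bsub>L\<^esub> n \<and> \<pi> x = g" if "x \<in> carrier L" for x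
    using \<pi>[OF that] Nc by blast
  have hom: "\<pi> \<in> ring_hom L G"
  proof (rule ring_hom_memI)
    show "\<pi> x \<in> carrier G" if "x \<in> carrier L" for x using \<pi>(1)[OF that] .
  next
    fix x y assume x: "x \<in> carrier L" and y: "y \<in> carrier L"
    obtain g n where g: "g \<in> carrier G" "n \<in> N" "n \<in> carrier L" "x = \<sigma> g \<oplus>\<^bsub>L\<^esub> n" "\<pi> x = g" using decomp[OF x] by blast
    obtain g' n' where g': "g' \<in> carrier G" "n' \<in> N" "n' \<in> carrier L" "y = \<sigma> g' \<oplus>\<^bsub>L\<^esub> n'" "\<pi> y = g'" using decomp[OF y] by blast
    have "x \<otimes>\<^bsub>L\<^esub> y = \<sigma> (g \<otimes>\<^bsub>G\<^esub> g') \<oplus>\<^bsub>L\<^esub> (\<sigma> g \<otimes>\<^bsub>L\<^esub> n' \<oplus>\<^bsub>L\<^esub> n \<otimes>\<^bsub>L\<^esub> y)"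
      unfolding g(4) using g(1-3) g'(1-3) y by (simp add: g'(4) L.A.l_distr L.A.r_distr L.M.a_ac)
    moreover have "\<sigma> g \<otimes>\<^bsub>L\<^esub> n' \<oplus>\<^bsub>L\<^esub> n \<otimes>\<^bsub>L\<^esub> y \<in> N"
      using g g' y ideal.I_l_closed[OF N] ideal.I_r_closed[OF N] by (intro L.subspace_add[OF sN]) auto
    ultimately show "\<pi> (x \<otimes>\<^bsub>L\<^esub> y) = \<pi> x \<otimes>\<^bsub>G\<^esub> \<pi> y"
      by (simp only: \<pi>_eq[OF G.A.m_closed[OF g(1) g'(1)]] g(5) g'(5))
    have "x \<oplus>\<^bsub>L\<^esub> y = \<sigma> (g \<oplus>\<^bsub>G\<^esub> g') \<oplus>\<^bsub>L\<^esub> (n \<oplus>\<^bsub>L\<^esub> n')"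
      unfolding g(4) g'(4) using g(1-3) g'(1-3) by (simp add: L.M.a_ac)
    moreover have "n \<oplus>\<^bsub>L\<^esub> n' \<in> N" using g g' by (intro L.subspace_add[OF sN])
    ultimately show "\<pi> (x \<oplus>\<^bsub>L\<^esub> y) = \<pi> x \<oplus>\<^bsub>G\<^esub> \<pi> y"
      by (simp only: \<pi>_eq[OF G.M.a_closed[OF g(1) g'(1)]] g(5) g'(5))
  next
    show "\<pi> \<one>\<^bsub>L\<^esub> = \<one>\<^bsub>G\<^esub>" using \<pi>_eq[OF G.A.one_closed L.subspace_zero[OF sN]] by simp
  qed
  show ?thesis
  proof (rule that[OF hom \<pi>_eq])
    fix c x assume c: "c \<in> carrier K" and x: "x \<in> carrier L"
    obtain g n where g: "g \<in> carrier G" "n \<in> N" "n \<in> carrier L" "x = \<sigma> g \<oplus>\<^bsub>L\<^esub> n" "\<pi> x = g" using decomp[OF x] by blast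
    have "c \<odot>\<^bsub>L\<^esub> x = \<sigma> (c \<odot>\<^bsub>G\<^esub> g) \<oplus>\<^bsub>L\<^esub> c \<odot>\<^bsub>L\<^esub> n" unfolding g(4) using c g(1,3) by (simp add: \<sigma>l L.smult_r_distr)
    moreover have "c \<odot>\<^bsub>L\<^esub> n \<in> N" using c g by (intro L.subspace_smult[OF sN])
    ultimately show "\<pi> (c \<odot>\<^bsub>L\<^esub> x) = c \<odot>\<^bsub>G\<^esub> \<pi> x" using \<pi>_eq c g(1,5) by simp
  next
    show "\<exists>n\<in>N. x = \<sigma> (\<pi> x) \<oplus>\<^bsub>L\<^esub> n" if "x \<in> carrier L" for x using \<pi>(2)[OF that] .
  next
    fix x assume x: "x \<in> carrier L"
    obtain n where n: "n \<in> N" "x = \<sigma> (\<pi> x) \<oplus>\<^bsub>L\<^esub> n" using \<pi>(2)[OF x] by blast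
    show "\<pi> x = \<zero>\<^bsub>G\<^esub> \<longleftrightarrow> x \<in> N"
    proof
      assume "\<pi> x = \<zero>\<^bsub>G\<^esub>"
      then show "x \<in> N" using n Nc by simp
    next
      assume xN: "x \<in> N"
      have "x = \<sigma> \<zero>\<^bsub>G\<^esub> \<oplus>\<^bsub>L\<^esub> x" using x by simp
      then show "\<pi> x = \<zero>\<^bsub>G\<^esub>" using \<pi>_eq[OF G.M.zero_closed xN] by simp
    qed
  qed auto
qed

text \<open>A product of m factors from J is killed by \<pi>, so it lies in N. A product with l
  times m factors is cut into l blocks of length m and becomes a product of l elements of N, which
  vanishes for an exponent l of N.\<close>

lemma nilpotent_joint_kernel:
  assumes G: "k_algebra K G" and L: "k_algebra K L" and \<pi>: "\<pi> \<in> ring_hom L G"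
    and ker: "\<And>x. x \<in> carrier L \<Longrightarrow> \<pi> x = \<zero>\<^bsub>G\<^esub> \<Longrightarrow> x \<in> N" and N: "N \<subseteq> carrier L" "nilpotent_set L N"
    and J: "J \<subseteq> carrier L" and nil: "0 < m" "\<And>xs. set xs \<subseteq> \<pi> ` J \<Longrightarrow> length xs = m \<Longrightarrow> k_algebra.mprod G xs = \<zero>\<^bsub>G\<^esub>"
  shows "\<exists>m>0. k_algebra.pw K L J m = {\<zero>\<^bsub>L\<^esub>}"
proof -
  interpret G: k_algebra K G by fact
  interpret L: k_algebra K L by fact
  interpret \<pi>: ring_hom_ring L G \<pi> by (rule ring_hom_ringI2[OF L.A.ring_axioms G.A.ring_axioms \<pi>])
  obtain l where l: "0 < l" "\<And>xs. set xs \<subseteq> N \<Longrightarrow> length xs = l \<Longrightarrow> L.mprod xs = \<zero>\<^bsub>L\<^esub>"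
    using N(2) unfolding nilpotent_set_def L.mprod_def by blast
  have \<pi>prod: "\<pi> (L.mprod xs) = G.mprod (map \<pi> xs)" if "set xs \<subseteq> carrier L" for xs
    using that by (induction xs) (auto simp: L.mprod_closed)
  have "\<exists>ys. set ys \<subseteq> N \<and> length ys = k \<and> L.mprod xs = L.mprod ys" if "set xs \<subseteq> J" "length xs = k * m" for k xs
    using that
  proof (induction k arbitrary: xs)
    case 0
    then show ?case by (intro exI[of _ "[]"]) simp
  next
    case (Suc k)
    have t: "set (take m xs) \<subseteq> J" "set (drop m xs) \<subseteq> J" "length (take m xs) = m" "length (drop m xs) = k * m"
      using Suc.prems set_take_subset[of m xs] set_drop_subset[of m xs] by auto
    obtain ys where ys: "set ys \<subseteq> N" "length ys = k" "L.mprod (drop m xs) = L.mprod ys"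
      using Suc.IH[OF t(2,4)] by blast
    have tc: "set (take m xs) \<subseteq> carrier L" "set (drop m xs) \<subseteq> carrier L" using t J by auto
    have "\<pi> (L.mprod (take m xs)) = \<zero>\<^bsub>G\<^esub>" using t(1,3) \<pi>prod[OF tc(1)] nil(2)[of "map \<pi> (take m xs)"] by auto
    then have "L.mprod (take m xs) \<in> N" using tc(1) by (intro ker L.mprod_closed) auto
    moreover have "L.mprod xs = L.mprod (take m xs) \<otimes>\<^bsub>L\<^esub> L.mprod (drop m xs)"
      using L.mprod_append[OF tc] by simp
    ultimately show ?case using ys by (intro exI[of _ "L.mprod (take m xs) # ys"]) auto
  qed
  from this[of _ l] have "L.pw J (l * m) \<subseteq> {\<zero>\<^bsub>L\<^esub>}"
    by (intro L.pw_subset_subspace[OF J]) (use l(2) in \<open>fastforce intro!: L.subspaceI simp: L.smult_r_null\<close>)+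
  moreover have "\<zero>\<^bsub>L\<^esub> \<in> L.pw J (l * m)" by (rule L.pw_zero)
  ultimately show ?thesis using l(1) nil(1) by (intro exI[of _ "l * m"]) auto
qed

text \<open>Idempotents are pushed forward by \<sigma> and characters pulled back along \<pi>; since
  \<pi> after \<sigma> is the identity, the values of characters at idempotents are unchanged. For
  the resulting presentation I is the kernel of the evaluation, and B is the removable set.\<close>

lemma splitting_imp_generalized_arrow_removal:
  fixes K :: "('k, 'x) ring_scheme" and \<Gamma> :: "('k, 'a, 'y) module_scheme" and \<Lambda> :: "('k, 'b, 'z) module_scheme"
  assumes \<Gamma>: "fin_dim_algebra K \<Gamma>" "basic \<Gamma>" "one_dim_simples K \<Gamma>" and \<Lambda>: "fin_dim_algebra K \<Lambda>"
    and sp: "nilpotent_splitting K \<Gamma> \<Lambda> \<sigma> N" and rem: "removable_ideal \<Lambda> N"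
  shows "generalized_arrow_removal K \<Gamma> \<Lambda>"
proof -
  interpret G: fin_dim_algebra K \<Gamma> by fact
  interpret L: fin_dim_algebra K \<Lambda> by fact
  have \<sigma>: "\<sigma> \<in> ring_hom \<Gamma> \<Lambda>" and N: "ideal N \<Lambda>" and nilN: "nilpotent_set \<Lambda> N"
    and \<sigma>l: "\<And>c x. c \<in> carrier K \<Longrightarrow> x \<in> carrier \<Gamma> \<Longrightarrow> \<sigma> (c \<odot>\<^bsub>\<Gamma>\<^esub> x) = c \<odot>\<^bsub>\<Lambda>\<^esub> \<sigma> x"
    and ex: "\<And>x. x \<in> carrier \<Lambda> \<Longrightarrow> \<exists>g\<in>carrier \<Gamma>. \<exists>n\<in>N. x = \<sigma> g \<oplus>\<^bsub>\<Lambda>\<^esub> n"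
    and inj: "\<And>g. g \<in> carrier \<Gamma> \<Longrightarrow> \<sigma> g \<in> N \<Longrightarrow> g = \<zero>\<^bsub>\<Gamma>\<^esub>"
    using sp unfolding nilpotent_splitting_def by blast+
  interpret \<sigma>: ring_hom_ring \<Gamma> \<Lambda> \<sigma> by (rule ring_hom_ringI2[OF G.A.ring_axioms L.A.ring_axioms \<sigma>])
  note sN = L.ideal_subspace[OF N]
  have Nc: "N \<subseteq> carrier \<Lambda>" using sN by (simp add: L.subspace_def)
  obtain \<pi> where \<pi>: "\<pi> \<in> ring_hom \<Lambda> \<Gamma>"
    and \<pi>_eq: "\<And>g n. g \<in> carrier \<Gamma> \<Longrightarrow> n \<in> N \<Longrightarrow> \<pi> (\<sigma> g \<oplus>\<^bsub>\<Lambda>\<^esub> n) = g"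
    and \<pi>l: "\<And>c x. c \<in> carrier K \<Longrightarrow> x \<in> carrier \<Lambda> \<Longrightarrow> \<pi> (c \<odot>\<^bsub>\<Lambda>\<^esub> x) = c \<odot>\<^bsub>\<Gamma>\<^esub> \<pi> x"
    and \<pi>0: "\<And>x. x \<in> carrier \<Lambda> \<Longrightarrow> \<pi> x = \<zero>\<^bsub>\<Gamma>\<^esub> \<longleftrightarrow> x \<in> N"
    using splitting_projection[OF G.k_algebra_axioms L.k_algebra_axioms sp] by metis
  interpret \<pi>: ring_hom_ring \<Lambda> \<Gamma> \<pi> by (rule ring_hom_ringI2[OF L.A.ring_axioms G.A.ring_axioms \<pi>])
  have \<pi>\<sigma>: "\<pi> (\<sigma> g) = g" if "g \<in> carrier \<Gamma>" for g
    using \<pi>_eq[OF that L.subspace_zero[OF sN]] that by simp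
  obtain n :: nat and e \<chi> where ec: "\<And>i. i < n \<Longrightarrow> e i \<in> carrier \<Gamma>"
    and em: "\<And>i j. i < n \<Longrightarrow> j < n \<Longrightarrow> e i \<otimes>\<^bsub>\<Gamma>\<^esub> e j = (if i = j then e i else \<zero>\<^bsub>\<Gamma>\<^esub>)"
    and es: "(\<Oplus>\<^bsub>\<Gamma>\<^esub>i\<in>{..<n}. e i) = \<one>\<^bsub>\<Gamma>\<^esub>"
    and \<chi>: "\<And>i. i < n \<Longrightarrow> G.character (\<chi> i)"
    and \<chi>e: "\<And>i j. i < n \<Longrightarrow> j < n \<Longrightarrow> \<chi> i (e j) = (if i = j then \<one>\<^bsub>K\<^esub> else \<zero>\<^bsub>K\<^esub>)"
    and nil: "\<exists>m>0. G.pw (G.joint_kernel n \<chi>) m = {\<zero>\<^bsub>\<Gamma>\<^esub>}"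
    by (fact G.idempotents_and_characters[OF \<Gamma>(3,2)])
  define e' where "e' i = \<sigma> (e i)" for i
  define \<chi>' where "\<chi>' i x = \<chi> i (\<pi> x)" for i x
  have \<chi>': "L.character (\<chi>' i)" if i: "i < n" for i
    unfolding L.character_def
  proof (intro conjI ballI)
    have "\<chi> i \<in> ring_hom \<Gamma> K" using \<chi>[OF i] by (simp add: G.character_def)
    from ring_hom_trans[OF \<pi> this] show "\<chi>' i \<in> ring_hom \<Lambda> K" by (simp add: \<chi>'_def[abs_def] comp_def)
    show "\<chi>' i (c \<odot>\<^bsub>\<Lambda>\<^esub> x) = c \<otimes>\<^bsub>K\<^esub> \<chi>' i x" if "c \<in> carrier K" "x \<in> carrier \<Lambda>" for c x
      using that \<pi>l G.character_smult[OF \<chi>[OF i]] by (simp add: \<chi>'_def)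
  qed
  have Jim: "\<pi> ` L.joint_kernel n \<chi>' \<subseteq> G.joint_kernel n \<chi>"
    by (auto simp: L.joint_kernel_def G.joint_kernel_def \<chi>'_def)
  have nil': "\<exists>m>0. L.pw (L.joint_kernel n \<chi>') m = {\<zero>\<^bsub>\<Lambda>\<^esub>}"
  proof -
    obtain m where m: "0 < m" "G.pw (G.joint_kernel n \<chi>) m = {\<zero>\<^bsub>\<Gamma>\<^esub>}" using nil by blast
    have "G.mprod xs = \<zero>\<^bsub>\<Gamma>\<^esub>" if "set xs \<subseteq> \<pi> ` L.joint_kernel n \<chi>'" "length xs = m" for xs
      using G.pw_prod[of xs "G.joint_kernel n \<chi>" m] that Jim m(2) by auto
    then show ?thesis
      using nilpotent_joint_kernel[OF G.k_algebra_axioms L.k_algebra_axioms \<pi> _ Nc nilN _ m(1)] \<pi>0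
      by (simp add: L.joint_kernel_def subset_iff)
  qed
  interpret S: elementary_splitting K \<Lambda> n e' \<chi>' "\<sigma> ` carrier \<Gamma>" N
  proof (intro elementary_splitting.intro elementary_splitting_axioms.intro \<Lambda>)
    show "e' i \<in> carrier \<Lambda>" if "i < n" for i using ec that by (simp add: e'_def)
    show "e' i \<otimes>\<^bsub>\<Lambda>\<^esub> e' j = (if i = j then e' i else \<zero>\<^bsub>\<Lambda>\<^esub>)" if "i < n" "j < n" for i j
    proof -
      have "e' i \<otimes>\<^bsub>\<Lambda>\<^esub> e' j = \<sigma> (e i \<otimes>\<^bsub>\<Gamma>\<^esub> e j)" using ec that by (simp add: e'_def)
      then show ?thesis using em[OF that] by (simp add: e'_def)
    qed
    show "(\<Oplus>\<^bsub>\<Lambda>\<^esub>i\<in>{..<n}. e' i) = \<one>\<^bsub>\<Lambda>\<^esub>"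
    proof -
      have "\<sigma> (\<Oplus>\<^bsub>\<Gamma>\<^esub>i\<in>{..<n}. e i) = (\<Oplus>\<^bsub>\<Lambda>\<^esub>i\<in>{..<n}. \<sigma> (e i))"
        by (rule additive_map_finsum[OF G.M.abelian_monoid_axioms L.M.abelian_monoid_axioms]) (auto simp: ec)
      then show ?thesis by (simp add: e'_def es)
    qed
    show "L.character (\<chi>' i)" if "i < n" for i using \<chi>'[OF that] .
    show "\<chi>' i (e' j) = (if i = j then \<one>\<^bsub>K\<^esub> else \<zero>\<^bsub>K\<^esub>)" if "i < n" "j < n" for i j
      using \<chi>e[OF that] ec that by (simp add: \<chi>'_def e'_def \<pi>\<sigma>)
    show "\<exists>m>0. L.pw (L.joint_kernel n \<chi>') m = {\<zero>\<^bsub>\<Lambda>\<^esub>}" by (rule nil')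
    show "L.subspace (\<sigma> ` carrier \<Gamma>)"
    proof (rule L.subspaceI)
      show "\<zero>\<^bsub>\<Lambda>\<^esub> \<in> \<sigma> ` carrier \<Gamma>" using \<sigma>.hom_zero G.M.zero_closed by (metis imageI)
      fix x y assume "x \<in> \<sigma> ` carrier \<Gamma>" "y \<in> \<sigma> ` carrier \<Gamma>"
      then obtain a b where ab: "a \<in> carrier \<Gamma>" "b \<in> carrier \<Gamma>" "x = \<sigma> a" "y = \<sigma> b" by blast
      have "x \<oplus>\<^bsub>\<Lambda>\<^esub> y = \<sigma> (a \<oplus>\<^bsub>\<Gamma>\<^esub> b)" using ab by simp
      then show "x \<oplus>\<^bsub>\<Lambda>\<^esub> y \<in> \<sigma> ` carrier \<Gamma>" using G.M.a_closed[OF ab(1,2)] by (rule image_eqI)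
    next
      fix c x assume c: "c \<in> carrier K" and "x \<in> \<sigma> ` carrier \<Gamma>"
      then obtain a where a: "a \<in> carrier \<Gamma>" "x = \<sigma> a" by blast
      show "c \<odot>\<^bsub>\<Lambda>\<^esub> x \<in> \<sigma> ` carrier \<Gamma>"
        unfolding a(2) \<sigma>l[OF c a(1), symmetric] by (rule imageI[OF G.smult_closed[OF c a(1)]])
    qed auto
    show "x \<otimes>\<^bsub>\<Lambda>\<^esub> y \<in> \<sigma> ` carrier \<Gamma>" if "x \<in> \<sigma> ` carrier \<Gamma>" "y \<in> \<sigma> ` carrier \<Gamma>" for x y
    proof -
      obtain a b where ab: "a \<in> carrier \<Gamma>" "b \<in> carrier \<Gamma>" "x = \<sigma> a" "y = \<sigma> b" using \<open>x \<in> _\<close> \<open>y \<in> _\<close> by blast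
      have "x \<otimes>\<^bsub>\<Lambda>\<^esub> y = \<sigma> (a \<otimes>\<^bsub>\<Gamma>\<^esub> b)" using ab by simp
      then show ?thesis using G.A.m_closed[OF ab(1,2)] by (rule image_eqI)
    qed
    show "e' i \<in> \<sigma> ` carrier \<Gamma>" if "i < n" for i using ec that by (simp add: e'_def)
    show "ideal N \<Lambda>" by (rule N)
    show "N \<subseteq> L.joint_kernel n \<chi>'"
    proof
      fix x assume x: "x \<in> N"
      then have "\<pi> x = \<zero>\<^bsub>\<Gamma>\<^esub>" using \<pi>0 Nc by blast
      then show "x \<in> L.joint_kernel n \<chi>'"
        using x Nc G.character_zero[OF \<chi>] by (auto simp: L.joint_kernel_def \<chi>'_def)
    qed
    show "\<exists>c\<in>\<sigma> ` carrier \<Gamma>. \<exists>y\<in>N. x = c \<oplus>\<^bsub>\<Lambda>\<^esub> y" if "x \<in> carrier \<Lambda>" for x using ex[OF that] by blast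
    show "x = \<zero>\<^bsub>\<Lambda>\<^esub>" if x: "x \<in> \<sigma> ` carrier \<Gamma>" "x \<in> N" for x
    proof -
      obtain g where "g \<in> carrier \<Gamma>" "x = \<sigma> g" using x(1) by blast
      then show ?thesis using inj[of g] x(2) by simp
    qed
  qed
  obtain Q :: "(nat, nat) pre_digraph" and ev B where Q: "fin_digraph Q"
    and ev: "ev \<in> ring_hom (path_algebra K Q) \<Lambda>" and surj: "ev ` carrier (path_algebra K Q) = carrier \<Lambda>"
    and evl: "\<And>c z. c \<in> carrier K \<Longrightarrow> z \<in> carrier (path_algebra K Q) \<Longrightarrow> ev (c \<odot>\<^bsub>path_algebra K Q\<^esub> z) = c \<odot>\<^bsub>\<Lambda>\<^esub> ev z"
    and supp: "\<And>z w. z \<in> carrier (path_algebra K Q) \<Longrightarrow> ev z = \<zero>\<^bsub>\<Lambda>\<^esub> \<Longrightarrow> z w \<noteq> \<zero>\<^bsub>K\<^esub> \<Longrightarrow> 2 \<le> length (snd w)"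
    and long: "\<exists>l>1. \<forall>w\<in>paths Q. length (snd w) = l \<longrightarrow> ev (path_elem K w) = \<zero>\<^bsub>\<Lambda>\<^esub>"
    and B: "B \<subseteq> arcs Q" and thN: "\<And>z. z \<in> carrier (path_algebra K Q) \<Longrightarrow> ev (part_through K B z) \<in> N"
    and avC: "\<And>z. z \<in> carrier (path_algebra K Q) \<Longrightarrow> ev (part_avoiding K B z) \<in> \<sigma> ` carrier \<Gamma>"
    by (fact S.elementary_splitting_presentation)
  interpret quiver_algebra K Q by (intro quiver_algebra.intro Q G.field_axioms)
  interpret ev: ring_hom_ring kQ \<Lambda> ev by (rule ring_hom_ringI2[OF kQ.A.ring_axioms L.A.ring_axioms ev])
  define I where "I = {z \<in> carrier kQ. ev z = \<zero>\<^bsub>\<Lambda>\<^esub>}"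
  have I: "ideal I kQ" using ev.kernel_is_ideal unfolding I_def a_kernel_def' .
  have bq: "bound_quiver K Q I"
    unfolding bound_quiver_def admissible_def
  proof (intro conjI ballI allI impI G.field_axioms Q I)
    show "2 \<le> length (snd w)" if "z \<in> I" "z w \<noteq> \<zero>\<^bsub>K\<^esub>" for z w
      using supp[of z w] that by (simp add: I_def)
    show "\<exists>N>1. \<forall>w\<in>paths Q. length (snd w) = N \<longrightarrow> path_elem K w \<in> I"
    proof -
      obtain l where "1 < l" "\<forall>w\<in>paths Q. length (snd w) = l \<longrightarrow> ev (path_elem K w) = \<zero>\<^bsub>\<Lambda>\<^esub>" using long by blast
      then show ?thesis by (intro exI[of _ l]) (simp add: I_def)
    qed
  qed
  let ?B = "bq_algebra K Q I" and ?a = "arrow_ideal K Q I B"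
  obtain \<phi> where \<phi>: "\<phi> \<in> ring_iso ?B \<Lambda>" "\<And>x. x \<in> carrier kQ \<Longrightarrow> \<phi> (I +>\<^bsub>kQ\<^esub> x) = ev x"
    "\<And>c Z. c \<in> carrier K \<Longrightarrow> Z \<in> carrier ?B \<Longrightarrow> \<phi> (c \<odot>\<^bsub>?B\<^esub> Z) = c \<odot>\<^bsub>\<Lambda>\<^esub> \<phi> Z"
  proof (rule kQ.quot_alg_lift[OF I L.A.ring_axioms ev surj evl I_def])
    fix \<phi> assume *: "\<phi> \<in> ring_iso ?B \<Lambda>" "\<And>x. x \<in> carrier kQ \<Longrightarrow> \<phi> (I +>\<^bsub>kQ\<^esub> x) = ev x"
      "\<And>c Z. c \<in> carrier K \<Longrightarrow> Z \<in> carrier ?B \<Longrightarrow> \<phi> (c \<odot>\<^bsub>?B\<^esub> Z) = c \<odot>\<^bsub>\<Lambda>\<^esub> \<phi> Z"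
    show thesis by (rule that[OF *])
  qed
  have \<phi>h: "\<phi> \<in> ring_hom ?B \<Lambda>" and \<phi>b: "bij_betw \<phi> (carrier ?B) (carrier \<Lambda>)"
    using \<phi>(1) by (auto simp: ring_iso_def)
  note ringB = kQ.ring_quot_alg[OF I] and qh = kQ.quot_hom[OF I] and qs = kQ.quot_carrier[OF I]
  interpret \<phi>: ring_hom_ring ?B \<Lambda> \<phi> by (rule ring_hom_ringI2[OF ringB L.A.ring_axioms \<phi>h])
  have ev_sum: "ev z = ev (part_through K B z) \<oplus>\<^bsub>\<Lambda>\<^esub> ev (part_avoiding K B z)" if z: "z \<in> carrier kQ" for z
    using ev.hom_add[OF part_through_closed[OF z, of B] part_avoiding_closed[OF z, of B]] unfolding part_sum[OF z, of B] .
  \<comment> \<open>The value of the avoiding part is a difference of two elements of N and also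
    lies in the image of \<sigma>, so it vanishes. This yields pre-removability and shows that
    elements evaluating into N are represented by paths through B.\<close>
  have av0: "ev (part_avoiding K B z) = \<zero>\<^bsub>\<Lambda>\<^esub>" if z: "z \<in> carrier kQ" "ev z \<in> N" for z
  proof -
    let ?t = "ev (part_through K B z)" and ?v = "ev (part_avoiding K B z)"
    have c: "?t \<in> carrier \<Lambda>" "?v \<in> carrier \<Lambda>"
      using z part_through_closed part_avoiding_closed by (auto simp del: kQ_simps)
    have "ev z \<ominus>\<^bsub>\<Lambda>\<^esub> ?t \<in> N" using z(2) thN[OF z(1)] by (rule L.subspace_minus[OF sN])
    moreover have "(p \<oplus>\<^bsub>\<Lambda>\<^esub> q) \<ominus>\<^bsub>\<Lambda>\<^esub> p = q" if "p \<in> carrier \<Lambda>" "q \<in> carrier \<Lambda>" for p q using that by algebra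
    ultimately have "?v \<in> N" using ev_sum[OF z(1)] c by metis
    then show ?thesis using avC[OF z(1)] S.C_N by blast
  qed
  have pre: "pre_removable K Q I B"
    unfolding pre_removable_def
  proof (intro conjI ballI B)
    fix z assume "z \<in> I"
    then have z: "z \<in> carrier kQ" "ev z = \<zero>\<^bsub>\<Lambda>\<^esub>" by (auto simp: I_def)
    have v0: "ev (part_avoiding K B z) = \<zero>\<^bsub>\<Lambda>\<^esub>" using av0[OF z(1)] z(2) L.subspace_zero[OF sN] by simp
    then have "ev (part_through K B z) = \<zero>\<^bsub>\<Lambda>\<^esub>"
      using ev_sum[OF z(1)] z(2) thN[OF z(1)] Nc by auto
    then show "part_through K B z \<in> I" "part_avoiding K B z \<in> I"
      using v0 z(1) part_through_closed part_avoiding_closed by (auto simp: I_def)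
  qed
  \<comment> \<open>V is the preimage of N in kQ/I; it is to be identified with the ideal generated
    by the arrows of B.\<close>
  define V where "V = {Z \<in> carrier ?B. \<phi> Z \<in> N}"
  have V: "ideal V ?B" unfolding V_def by (rule \<phi>.ideal_vimage[OF N])
  have gens: "(\<lambda>a. I +>\<^bsub>kQ\<^esub> path_elem K (tail Q a, [a])) ` B \<subseteq> V"
  proof (rule image_subsetI)
    fix a assume a: "a \<in> B"
    have p: "path_elem K (tail Q a, [a]) \<in> carrier kQ" using a B paths_arc by auto
    have "part_through K B (path_elem K (tail Q a, [a])) = path_elem K (tail Q a, [a])"
      by (rule ext) (use a in \<open>auto simp: part_through_def path_elem_def\<close>)
    then have "ev (path_elem K (tail Q a, [a])) \<in> N" using thN[OF p] by simp
    moreover have "I +>\<^bsub>kQ\<^esub> path_elem K (tail Q a, [a]) \<in> carrier ?B" unfolding qs using p by (rule imageI)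
    ultimately show "I +>\<^bsub>kQ\<^esub> path_elem K (tail Q a, [a]) \<in> V" using \<phi>(2)[OF p] by (simp add: V_def)
  qed
  have gensB: "(\<lambda>a. I +>\<^bsub>kQ\<^esub> path_elem K (tail Q a, [a])) ` B \<subseteq> carrier ?B" using gens by (auto simp: V_def)
  have aid: "ideal ?a ?B" unfolding arrow_ideal_def by (rule \<phi>.R.genideal_ideal[OF gensB])
  have aV: "?a = V"
  proof
    show "?a \<subseteq> V" unfolding arrow_ideal_def by (rule \<phi>.R.genideal_minimal[OF V gens])
    show "V \<subseteq> ?a"
    proof
      fix Z assume Z: "Z \<in> V"
      then obtain z where z: "z \<in> carrier kQ" "Z = I +>\<^bsub>kQ\<^esub> z" using qs by (auto simp: V_def simp del: quot_alg_simps)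
      have evz: "ev z \<in> N" using Z \<phi>(2)[OF z(1)] z(2) by (simp add: V_def)
      have "I +>\<^bsub>kQ\<^esub> part_through K B z \<in> ?a"
      proof (rule through_in_arrow_ideal[OF ringB qh aid _ z(1)])
        show "I +>\<^bsub>kQ\<^esub> path_elem K (tail Q a, [a]) \<in> ?a" if "a \<in> B" for a
          using \<phi>.R.genideal_self[OF gensB] that unfolding arrow_ideal_def by blast
      qed
      moreover have "I +>\<^bsub>kQ\<^esub> z = I +>\<^bsub>kQ\<^esub> part_through K B z"
        using kQ.quot_eq_iff[OF I z(1) part_through_closed[OF z(1)]] part_through_minus(1)[OF z(1)]
          av0[OF z(1) evz] part_avoiding_closed[OF z(1)] by (simp add: I_def)
      ultimately show "Z \<in> ?a" using z(2) by simp
    qed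
  qed
  have \<phi>a: "\<phi> ` ?a = N"
  proof
    show "\<phi> ` ?a \<subseteq> N" unfolding aV V_def by auto
    show "N \<subseteq> \<phi> ` ?a"
    proof
      fix x assume x: "x \<in> N"
      then have "x \<in> \<phi> ` carrier ?B" using Nc bij_betw_imp_surj_on[OF \<phi>b] by blast
      then obtain Z where "Z \<in> carrier ?B" "x = \<phi> Z" ..
      then show "x \<in> \<phi> ` ?a" unfolding aV V_def using x by (intro image_eqI[of _ _ Z]) auto
    qed
  qed
  have "removable_ideal ?B ?a"
    using removable_ideal_iso[OF ringB L.A.ring_axioms \<phi>(1), of ?a] ideal.Icarr[OF aid] rem unfolding \<phi>a by blast
  then have remA: "removable_arrows K Q I B" using removable_arrows_iff[OF ringB aid] pre by blast
  have "alg_isomorphic K \<Gamma> (quot_alg ?B ?a)"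
  proof -
    interpret kB: k_algebra K ?B
      by (rule k_algebra_surj_image[OF kQ.k_algebra_axioms ringB qh]) (use qs kQ.quot_smult[OF I] in auto)
    \<comment> \<open>The isomorphism with \<Lambda> followed by the projection \<pi> has the arrow
      ideal as its kernel, so the quotient is \<Gamma>.\<close>
    have h: "\<pi> \<circ> \<phi> \<in> ring_hom ?B \<Gamma>" by (rule ring_hom_trans[OF \<phi>h \<pi>])
    have hs: "(\<pi> \<circ> \<phi>) ` carrier ?B = carrier \<Gamma>"
    proof
      show "carrier \<Gamma> \<subseteq> (\<pi> \<circ> \<phi>) ` carrier ?B"
      proof
        fix g assume g: "g \<in> carrier \<Gamma>"
        then obtain Z where "Z \<in> carrier ?B" "\<sigma> g = \<phi> Z"
          using \<phi>b \<sigma>.hom_closed[OF g] unfolding bij_betw_def by blast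
        then show "g \<in> (\<pi> \<circ> \<phi>) ` carrier ?B" using \<pi>\<sigma>[OF g] by (intro image_eqI[of _ _ Z]) simp_all
      qed
    qed (use ring_hom_closed[OF h] in blast)
    have hl: "(\<pi> \<circ> \<phi>) (c \<odot>\<^bsub>?B\<^esub> Z) = c \<odot>\<^bsub>\<Gamma>\<^esub> (\<pi> \<circ> \<phi>) Z" if "c \<in> carrier K" "Z \<in> carrier ?B" for c Z
      using \<phi>(3)[OF that] \<pi>l[OF that(1)] \<phi>.hom_closed[OF that(2)] by simp
    have ker: "?a = {Z \<in> carrier ?B. (\<pi> \<circ> \<phi>) Z = \<zero>\<^bsub>\<Gamma>\<^esub>}"
      unfolding aV V_def using \<pi>0[OF \<phi>.hom_closed] by auto
    obtain \<beta> where \<beta>: "\<beta> \<in> ring_iso (quot_alg ?B ?a) \<Gamma>"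
      "\<And>c Z. c \<in> carrier K \<Longrightarrow> Z \<in> carrier (quot_alg ?B ?a) \<Longrightarrow> \<beta> (c \<odot>\<^bsub>quot_alg ?B ?a\<^esub> Z) = c \<odot>\<^bsub>\<Gamma>\<^esub> \<beta> Z"
    proof (rule kB.quot_alg_lift[OF aid G.A.ring_axioms h hs hl ker])
      fix \<beta> assume *: "\<beta> \<in> ring_iso (quot_alg ?B ?a) \<Gamma>"
        "\<And>c Z. c \<in> carrier K \<Longrightarrow> Z \<in> carrier (quot_alg ?B ?a) \<Longrightarrow> \<beta> (c \<odot>\<^bsub>quot_alg ?B ?a\<^esub> Z) = c \<odot>\<^bsub>\<Gamma>\<^esub> \<beta> Z"
      show thesis by (rule that[OF *])
    qed
    have ringC: "ring (quot_alg ?B ?a)" by (rule kB.ring_quot_alg[OF aid])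
    obtain \<alpha> where \<alpha>: "\<alpha> \<in> ring_iso \<Gamma> (quot_alg ?B ?a)" "\<And>Z. Z \<in> carrier (quot_alg ?B ?a) \<Longrightarrow> \<alpha> (\<beta> Z) = Z"
      "\<And>x. x \<in> carrier \<Gamma> \<Longrightarrow> \<beta> (\<alpha> x) = x"
      using ring_iso_inverse[OF ringC \<beta>(1)] by blast
    have kC: "k_algebra K (quot_alg ?B ?a)"
      by (rule k_algebra_surj_image[OF kB.k_algebra_axioms ringC kB.quot_hom[OF aid]])
         (use kB.quot_carrier[OF aid] kB.quot_smult[OF aid] in \<open>auto simp del: quot_alg_simps\<close>)
    interpret kC: k_algebra K "quot_alg ?B ?a" by (rule kC)
    have "\<alpha> (c \<odot>\<^bsub>\<Gamma>\<^esub> x) = c \<odot>\<^bsub>quot_alg ?B ?a\<^esub> \<alpha> x" if c: "c \<in> carrier K" "x \<in> carrier \<Gamma>" for c x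
    proof -
      have ax: "\<alpha> x \<in> carrier (quot_alg ?B ?a)" using \<alpha>(1) c(2) by (auto simp: ring_iso_def ring_hom_closed simp del: quot_alg_simps)
      have "\<alpha> (c \<odot>\<^bsub>\<Gamma>\<^esub> x) = \<alpha> (\<beta> (c \<odot>\<^bsub>quot_alg ?B ?a\<^esub> \<alpha> x))" using \<beta>(2)[OF c(1) ax] \<alpha>(3)[OF c(2)] by simp
      then show ?thesis using \<alpha>(2)[OF kC.smult_closed[OF c(1) ax]] by simp
    qed
    then show ?thesis using \<alpha>(1) unfolding alg_isomorphic_def by blast
  qed
  moreover have "alg_isomorphic K ?B \<Lambda>" using \<phi>(1,3) unfolding alg_isomorphic_def by blast
  ultimately show ?thesis using bq remA unfolding generalized_arrow_removal_def by blast
qed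

section \<open>Split extensions\<close>

text \<open>As the list is distinct, the coefficient function of the tail can be changed at the head
  without affecting the other terms.\<close>

lemma (in k_algebra) list_span_finsum:
  assumes "distinct ss" "set ss \<subseteq> carrier A" "x \<in> list_span ss"
  shows "\<exists>c \<in> set ss \<rightarrow> carrier K. x = (\<Oplus>\<^bsub>A\<^esub>s\<in>set ss. c s \<odot>\<^bsub>A\<^esub> s)"
  using assms
proof (induction ss arbitrary: x)
  case Nil
  then show ?case by simp
next
  case (Cons s ss)
  then obtain b v where b: "b \<in> carrier K" "v \<in> list_span ss" "x = b \<odot>\<^bsub>A\<^esub> s \<oplus>\<^bsub>A\<^esub> v" by auto
  have "distinct ss" "set ss \<subseteq> carrier A" using Cons.prems by auto
  from Cons.IH[OF this b(2)] obtain c where c: "c \<in> set ss \<rightarrow> carrier K"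
    "v = (\<Oplus>\<^bsub>A\<^esub>t\<in>set ss. c t \<odot>\<^bsub>A\<^esub> t)" by blast
  let ?c = "c(s := b)"
  have "(\<Oplus>\<^bsub>A\<^esub>t\<in>set ss. ?c t \<odot>\<^bsub>A\<^esub> t) = v"
    unfolding c(2) using Cons.prems c(1) by (intro M.finsum_cong') (auto simp: Pi_iff subset_iff)
  moreover have "(\<Oplus>\<^bsub>A\<^esub>t\<in>insert s (set ss). ?c t \<odot>\<^bsub>A\<^esub> t) = ?c s \<odot>\<^bsub>A\<^esub> s \<oplus>\<^bsub>A\<^esub> (\<Oplus>\<^bsub>A\<^esub>t\<in>set ss. ?c t \<odot>\<^bsub>A\<^esub> t)"
    using Cons.prems c(1) b(1) by (intro M.finsum_insert) (auto simp: Pi_iff subset_iff)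
  ultimately have "x = (\<Oplus>\<^bsub>A\<^esub>t\<in>set (s # ss). ?c t \<odot>\<^bsub>A\<^esub> t)" using b(3) by simp
  moreover have "?c \<in> set (s # ss) \<rightarrow> carrier K" using b(1) c(1) by auto
  ultimately show ?case by blast
qed

text \<open>The injection h moves N into the type \<open>nat \<Rightarrow> 'k\<close> in which the
  bimodule has to live; below, elements of N are encoded by h and decoded by
  \<open>d\<close>.\<close>

locale split_model = G: k_algebra K \<Gamma> + L: fin_dim_algebra K \<Lambda>
  for K :: "('k, 'x) ring_scheme" and \<Gamma> :: "('k, 'a, 'y) module_scheme"
    and \<Lambda> :: "('k, 'b, 'z) module_scheme" +
  fixes \<sigma> :: "'a \<Rightarrow> 'b" and N :: "'b set" and \<pi> :: "'b \<Rightarrow> 'a" and h :: "'b \<Rightarrow> nat \<Rightarrow> 'k"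
  assumes \<sigma>: "\<sigma> \<in> ring_hom \<Gamma> \<Lambda>"
    and \<sigma>_smult: "c \<in> carrier K \<Longrightarrow> g \<in> carrier \<Gamma> \<Longrightarrow> \<sigma> (c \<odot>\<^bsub>\<Gamma>\<^esub> g) = c \<odot>\<^bsub>\<Lambda>\<^esub> \<sigma> g"
    and N_ideal: "ideal N \<Lambda>"
    and N_nilpotent: "nilpotent_set \<Lambda> N"
    and \<pi>: "\<pi> \<in> ring_hom \<Lambda> \<Gamma>"
    and \<pi>_eq: "g \<in> carrier \<Gamma> \<Longrightarrow> n \<in> N \<Longrightarrow> \<pi> (\<sigma> g \<oplus>\<^bsub>\<Lambda>\<^esub> n) = g"
    and \<pi>_smult: "c \<in> carrier K \<Longrightarrow> x \<in> carrier \<Lambda> \<Longrightarrow> \<pi> (c \<odot>\<^bsub>\<Lambda>\<^esub> x) = c \<odot>\<^bsub>\<Gamma>\<^esub> \<pi> x"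
    and decomp: "x \<in> carrier \<Lambda> \<Longrightarrow> \<exists>n\<in>N. x = \<sigma> (\<pi> x) \<oplus>\<^bsub>\<Lambda>\<^esub> n"
    and h_inj: "inj_on h (carrier \<Lambda>)"
begin

sublocale \<sigma>: ring_hom_ring \<Gamma> \<Lambda> \<sigma>
  by (rule ring_hom_ringI2[OF G.A.ring_axioms L.A.ring_axioms \<sigma>])

sublocale \<pi>: ring_hom_ring \<Lambda> \<Gamma> \<pi>
  by (rule ring_hom_ringI2[OF L.A.ring_axioms G.A.ring_axioms \<pi>])

lemmas N_subspace = L.ideal_subspace[OF N_ideal]

lemma N_carr [simp]: "n \<in> N \<Longrightarrow> n \<in> carrier \<Lambda>"
  using L.subspace_carr[OF N_subspace] .

lemma N_closed [simp]:
  "\<zero>\<^bsub>\<Lambda>\<^esub> \<in> N" "m \<in> N \<Longrightarrow> n \<in> N \<Longrightarrow> m \<oplus>\<^bsub>\<Lambda>\<^esub> n \<in> N" "n \<in> N \<Longrightarrow> \<ominus>\<^bsub>\<Lambda>\<^esub> n \<in> N"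
  "x \<in> carrier \<Lambda> \<Longrightarrow> n \<in> N \<Longrightarrow> x \<otimes>\<^bsub>\<Lambda>\<^esub> n \<in> N" "x \<in> carrier \<Lambda> \<Longrightarrow> n \<in> N \<Longrightarrow> n \<otimes>\<^bsub>\<Lambda>\<^esub> x \<in> N"
  "c \<in> carrier K \<Longrightarrow> n \<in> N \<Longrightarrow> c \<odot>\<^bsub>\<Lambda>\<^esub> n \<in> N"
  using L.subspace_zero[OF N_subspace] L.subspace_add[OF N_subspace] L.subspace_neg[OF N_subspace]
    ideal.I_l_closed[OF N_ideal] ideal.I_r_closed[OF N_ideal] L.subspace_smult[OF N_subspace]
  by auto

definition d :: "(nat \<Rightarrow> 'k) \<Rightarrow> 'b" where
  "d = inv_into N h"

lemma d_h [simp]: "n \<in> N \<Longrightarrow> d (h n) = n"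
  unfolding d_def by (rule inv_into_f_f) (auto intro: inj_on_subset[OF h_inj])

lemma h_eq [simp]: "m \<in> N \<Longrightarrow> n \<in> N \<Longrightarrow> h m = h n \<longleftrightarrow> m = n"
  using inj_on_eq_iff[OF h_inj] by simp

text \<open>N with \<Gamma> acting through \<sigma> on both sides, moved along h. The product inside
  N does not appear here; it becomes \<theta>.\<close>

definition NM :: "('a, nat \<Rightarrow> 'k) bimodule" where
  "NM = \<lparr>carrier = h ` N, monoid.mult = undefined, one = undefined, ring.zero = h \<zero>\<^bsub>\<Lambda>\<^esub>,
     add = (\<lambda>u v. h (d u \<oplus>\<^bsub>\<Lambda>\<^esub> d v)), smult = (\<lambda>g u. h (\<sigma> g \<otimes>\<^bsub>\<Lambda>\<^esub> d u)),
     rsmult = (\<lambda>u g. h (d u \<otimes>\<^bsub>\<Lambda>\<^esub> \<sigma> g))\<rparr>"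

lemma NM_carrier: "carrier NM = h ` N" and NM_zero: "\<zero>\<^bsub>NM\<^esub> = h \<zero>\<^bsub>\<Lambda>\<^esub>"
  by (simp_all add: NM_def)

lemma NM_add: "m \<in> N \<Longrightarrow> n \<in> N \<Longrightarrow> h m \<oplus>\<^bsub>NM\<^esub> h n = h (m \<oplus>\<^bsub>\<Lambda>\<^esub> n)"
  and NM_smult: "n \<in> N \<Longrightarrow> g \<odot>\<^bsub>NM\<^esub> h n = h (\<sigma> g \<otimes>\<^bsub>\<Lambda>\<^esub> n)"
  and NM_rsmult: "n \<in> N \<Longrightarrow> h n \<triangleleft>\<^bsub>NM\<^esub> g = h (n \<otimes>\<^bsub>\<Lambda>\<^esub> \<sigma> g)"
  by (simp_all add: NM_def)

lemmas NM_simps = NM_carrier NM_zero NM_add NM_smult NM_rsmult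

lemma NM_abelian_group: "abelian_group NM"
proof (rule abelian_groupI)
  fix u assume "u \<in> carrier NM"
  then obtain n where "n \<in> N" "u = h n" by (auto simp: NM_carrier)
  then show "\<exists>v\<in>carrier NM. v \<oplus>\<^bsub>NM\<^esub> u = \<zero>\<^bsub>NM\<^esub>"
    by (intro bexI[of _ "h (\<ominus>\<^bsub>\<Lambda>\<^esub> n)"]) (auto simp: NM_simps L.M.l_neg)
qed (auto simp: NM_simps L.M.a_ac)

lemma NM_lmodule: "lmodule \<Gamma> NM"
  by (intro lmodule.intro lmodule_axioms.intro G.A.ring_axioms NM_abelian_group)
     (auto simp: NM_simps L.A.l_distr L.A.r_distr L.A.m_assoc)

lemma NM_rmodule: "lmodule (op_alg \<Gamma>) (right_module NM)"
proof (intro lmodule.intro lmodule_axioms.intro ring_op_alg G.A.ring_axioms)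
  show "abelian_group (right_module NM)"
    by (rule abelian_group_cong[OF NM_abelian_group]) (auto simp: right_module_def)
qed (auto simp: right_module_def op_alg_def NM_simps L.A.l_distr L.A.r_distr L.A.m_assoc)

lemma \<sigma>_scalar: "c \<in> carrier K \<Longrightarrow> \<sigma> (c \<odot>\<^bsub>\<Gamma>\<^esub> \<one>\<^bsub>\<Gamma>\<^esub>) = c \<odot>\<^bsub>\<Lambda>\<^esub> \<one>\<^bsub>\<Lambda>\<^esub>"
  by (simp add: \<sigma>_smult)

lemma NM_bimodule: "algebra_bimodule K \<Gamma> NM"
  by (intro algebra_bimodule.intro algebra_bimodule_axioms.intro G.k_algebra_axioms NM_lmodule NM_rmodule)
     (auto simp: NM_simps L.A.m_assoc \<sigma>_scalar L.scalar_mult_eq)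

section \<open>The product of N as a map on the tensor product\<close>

abbreviation F where "F \<equiv> free_Abelian_group (carrier NM \<times> carrier NM)"
abbreviation Ker where "Ker \<equiv> tensor_kernel \<Gamma> NM NM"

text \<open>By the universal property of the free abelian group on pairs, the product of N extends
  additively; \<theta> is obtained from this map by passing to the quotient.\<close>

lemma ex_mult_map:
  "\<exists>\<mu>. \<mu> \<in> hom F (add_monoid NM) \<and>
     (\<forall>m\<in>N. \<forall>n\<in>N. \<mu> (frag_of (h m, h n)) = h (m \<otimes>\<^bsub>\<Lambda>\<^esub> n))"
proof -
  interpret ab: comm_group "add_monoid NM"
    using NM_abelian_group by (rule abelian_group.a_comm_group)
  have im: "(\<lambda>(u, v). h (d u \<otimes>\<^bsub>\<Lambda>\<^esub> d v)) ` (carrier NM \<times> carrier NM) \<subseteq> carrier (add_monoid NM)"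
    by (auto simp: NM_carrier)
  obtain \<mu> where "\<mu> \<in> hom F (add_monoid NM)"
    "\<And>x. x \<in> carrier NM \<times> carrier NM \<Longrightarrow> \<mu> (frag_of x) = (\<lambda>(u, v). h (d u \<otimes>\<^bsub>\<Lambda>\<^esub> d v)) x"
    using ab.free_Abelian_group_universal[OF im] by metis
  then show ?thesis by (intro exI[of _ \<mu>]) (auto simp: NM_carrier)
qed

definition \<mu> :: "((nat \<Rightarrow> 'k) \<times> (nat \<Rightarrow> 'k) \<Rightarrow>\<^sub>0 int) \<Rightarrow> nat \<Rightarrow> 'k" where
  "\<mu> = (SOME \<mu>. \<mu> \<in> hom F (add_monoid NM) \<and>
     (\<forall>m\<in>N. \<forall>n\<in>N. \<mu> (frag_of (h m, h n)) = h (m \<otimes>\<^bsub>\<Lambda>\<^esub> n)))"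

lemma \<mu>_hom: "\<mu> \<in> hom F (add_monoid NM)"
  and \<mu>_frag: "m \<in> N \<Longrightarrow> n \<in> N \<Longrightarrow> \<mu> (frag_of (h m, h n)) = h (m \<otimes>\<^bsub>\<Lambda>\<^esub> n)"
  using someI_ex[OF ex_mult_map, folded \<mu>_def] by auto

sublocale \<mu>: group_hom F "add_monoid NM" \<mu>
  by (rule group_hom.intro[OF group_free_Abelian_group abelian_group.a_group[OF NM_abelian_group]])
     (rule group_hom_axioms.intro[OF \<mu>_hom])

lemma \<mu>_closed: "x \<in> carrier F \<Longrightarrow> \<mu> x \<in> h ` N"
  using \<mu>.hom_closed by (simp add: NM_carrier)

lemma \<mu>_add: "x \<in> carrier F \<Longrightarrow> y \<in> carrier F \<Longrightarrow> \<mu> (x + y) = \<mu> x \<oplus>\<^bsub>NM\<^esub> \<mu> y"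
  using \<mu>.hom_mult[of x y] by simp

text \<open>Both the relations of the tensor product and the induction principle of a free abelian
  group are written with differences.\<close>

lemma \<mu>_diff:
  assumes "x \<in> carrier F" "y \<in> carrier F" "\<mu> x = h m" "\<mu> y = h n" "m \<in> N" "n \<in> N"
  shows "\<mu> (x - y) = h (m \<ominus>\<^bsub>\<Lambda>\<^esub> n)"
proof -
  have xy: "x - y \<in> carrier F" using assms(1,2) keys_diff[of x y] by auto
  then obtain l where l: "l \<in> N" "\<mu> (x - y) = h l" using \<mu>_closed by blast
  have "h m = \<mu> ((x - y) + y)" using assms by simp
  also have "\<dots> = h (l \<oplus>\<^bsub>\<Lambda>\<^esub> n)" using \<mu>_add[OF xy assms(2)] l assms by (simp add: NM_add)
  finally have "m = l \<oplus>\<^bsub>\<Lambda>\<^esub> n" using l assms by simp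
  moreover have "(l \<oplus>\<^bsub>\<Lambda>\<^esub> n) \<ominus>\<^bsub>\<Lambda>\<^esub> n = l"
    using N_carr[OF l(1)] N_carr[OF assms(6)] by algebra
  ultimately show ?thesis using l by simp
qed

text \<open>Distributivity in \<Lambda> handles the two families of biadditivity relations, and
  associativity, applied to m \<sigma>(r) n, the balancing relations.\<close>

lemma relations_carrier: "tensor_relations \<Gamma> NM NM \<subseteq> carrier F"
  and relations_kernel: "x \<in> tensor_relations \<Gamma> NM NM \<Longrightarrow> \<mu> x = h \<zero>\<^bsub>\<Lambda>\<^esub>"
proof -
  have fr: "frag_of (h m, h n) \<in> carrier F" if "m \<in> N" "n \<in> N" for m n
    using that by (simp add: NM_carrier)
  have df: "x - y \<in> carrier F" if "x \<in> carrier F" "y \<in> carrier F" for x y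
    using that keys_diff[of x y] by auto
  have cancel: "(a \<oplus>\<^bsub>\<Lambda>\<^esub> b) \<ominus>\<^bsub>\<Lambda>\<^esub> a \<ominus>\<^bsub>\<Lambda>\<^esub> b = \<zero>\<^bsub>\<Lambda>\<^esub>" if "a \<in> carrier \<Lambda>" "b \<in> carrier \<Lambda>" for a b
    using that by algebra
  have *: "x \<in> carrier F \<and> \<mu> x = h \<zero>\<^bsub>\<Lambda>\<^esub>" if "x \<in> tensor_relations \<Gamma> NM NM" for x
    using that unfolding tensor_relations_def
  proof (elim UnE CollectE exE conjE)
    fix u u' v assume x: "x = frag_of (u \<oplus>\<^bsub>NM\<^esub> u', v) - frag_of (u, v) - frag_of (u', v)"
      "u \<in> carrier NM" "u' \<in> carrier NM" "v \<in> carrier NM"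
    then obtain m m' n where mn: "m \<in> N" "m' \<in> N" "n \<in> N" "u = h m" "u' = h m'" "v = h n" by (auto simp: NM_carrier)
    have x': "x = frag_of (h (m \<oplus>\<^bsub>\<Lambda>\<^esub> m'), h n) - frag_of (h m, h n) - frag_of (h m', h n)"
      using x(1) mn by (simp add: NM_add)
    have "\<mu> x = h ((m \<oplus>\<^bsub>\<Lambda>\<^esub> m') \<otimes>\<^bsub>\<Lambda>\<^esub> n \<ominus>\<^bsub>\<Lambda>\<^esub> m \<otimes>\<^bsub>\<Lambda>\<^esub> n \<ominus>\<^bsub>\<Lambda>\<^esub> m' \<otimes>\<^bsub>\<Lambda>\<^esub> n)"
      unfolding x' using mn by (intro \<mu>_diff df fr \<mu>_frag) (auto simp: a_minus_def)
    also have "\<dots> = h \<zero>\<^bsub>\<Lambda>\<^esub>" using mn by (simp add: L.A.l_distr cancel)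
    finally show ?thesis using x' mn by (auto intro!: df fr simp del: carrier_free_Abelian_group_iff)
  next
    fix u v v' assume x: "x = frag_of (u, v \<oplus>\<^bsub>NM\<^esub> v') - frag_of (u, v) - frag_of (u, v')"
      "u \<in> carrier NM" "v \<in> carrier NM" "v' \<in> carrier NM"
    then obtain m n n' where mn: "m \<in> N" "n \<in> N" "n' \<in> N" "u = h m" "v = h n" "v' = h n'" by (auto simp: NM_carrier)
    have x': "x = frag_of (h m, h (n \<oplus>\<^bsub>\<Lambda>\<^esub> n')) - frag_of (h m, h n) - frag_of (h m, h n')"
      using x(1) mn by (simp add: NM_add)
    have "\<mu> x = h (m \<otimes>\<^bsub>\<Lambda>\<^esub> (n \<oplus>\<^bsub>\<Lambda>\<^esub> n') \<ominus>\<^bsub>\<Lambda>\<^esub> m \<otimes>\<^bsub>\<Lambda>\<^esub> n \<ominus>\<^bsub>\<Lambda>\<^esub> m \<otimes>\<^bsub>\<Lambda>\<^esub> n')"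
      unfolding x' using mn by (intro \<mu>_diff df fr \<mu>_frag) (auto simp: a_minus_def)
    also have "\<dots> = h \<zero>\<^bsub>\<Lambda>\<^esub>" using mn by (simp add: L.A.r_distr cancel)
    finally show ?thesis using x' mn by (auto intro!: df fr simp del: carrier_free_Abelian_group_iff)
  next
    fix u r v assume x: "x = frag_of (u \<triangleleft>\<^bsub>NM\<^esub> r, v) - frag_of (u, r \<odot>\<^bsub>NM\<^esub> v)"
      "u \<in> carrier NM" "r \<in> carrier \<Gamma>" "v \<in> carrier NM"
    then obtain m n where mn: "m \<in> N" "n \<in> N" "u = h m" "v = h n" by (auto simp: NM_carrier)
    have x': "x = frag_of (h (m \<otimes>\<^bsub>\<Lambda>\<^esub> \<sigma> r), h n) - frag_of (h m, h (\<sigma> r \<otimes>\<^bsub>\<Lambda>\<^esub> n))"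
      using x(1) mn by (simp add: NM_smult NM_rsmult)
    have "\<mu> x = h ((m \<otimes>\<^bsub>\<Lambda>\<^esub> \<sigma> r) \<otimes>\<^bsub>\<Lambda>\<^esub> n \<ominus>\<^bsub>\<Lambda>\<^esub> m \<otimes>\<^bsub>\<Lambda>\<^esub> (\<sigma> r \<otimes>\<^bsub>\<Lambda>\<^esub> n))"
      unfolding x' using mn x(3) by (intro \<mu>_diff df fr \<mu>_frag) auto
    also have "\<dots> = h \<zero>\<^bsub>\<Lambda>\<^esub>" using mn x(3) by (simp add: L.A.m_assoc L.minus_self)
    finally show ?thesis using x' mn x(3) by (auto intro!: df fr simp del: carrier_free_Abelian_group_iff)
  qed
  show "tensor_relations \<Gamma> NM NM \<subseteq> carrier F" using * by blast
  show "x \<in> tensor_relations \<Gamma> NM NM \<Longrightarrow> \<mu> x = h \<zero>\<^bsub>\<Lambda>\<^esub>" using * by blast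
qed

lemma Ker_subgroup: "subgroup Ker F"
  unfolding tensor_kernel_def
  by (rule group.generate_is_subgroup[OF group_free_Abelian_group relations_carrier])

lemma Ker_kernel: "x \<in> Ker \<Longrightarrow> \<mu> x = h \<zero>\<^bsub>\<Lambda>\<^esub>"
proof -
  have "tensor_relations \<Gamma> NM NM \<subseteq> kernel F (add_monoid NM) \<mu>"
    unfolding kernel_def NM_zero[symmetric] using relations_carrier relations_kernel
    by (auto simp: NM_zero simp del: carrier_free_Abelian_group_iff)
  then have "Ker \<subseteq> kernel F (add_monoid NM) \<mu>"
    unfolding tensor_kernel_def
    by (rule group.generate_subgroup_incl[OF group_free_Abelian_group _ \<mu>.subgroup_kernel])
  then show "x \<in> Ker \<Longrightarrow> \<mu> x = h \<zero>\<^bsub>\<Lambda>\<^esub>" by (auto simp: kernel_def NM_zero)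
qed

abbreviation cls where "cls \<equiv> tensor_class \<Gamma> NM NM"

lemma cls_\<mu>:
  assumes x: "x \<in> carrier F" and y: "y \<in> cls x" shows "y \<in> carrier F" "\<mu> y = \<mu> x"
proof -
  obtain k where k: "k \<in> Ker" "y = k + x" using y by (auto simp: tensor_class_def r_coset_def)
  have kF: "k \<in> carrier F" using subgroup.mem_carrier[OF Ker_subgroup k(1)] .
  show "y \<in> carrier F" using group.is_monoid[OF group_free_Abelian_group] monoid.m_closed[of F k x] kF x k(2) by simp
  obtain n where n: "n \<in> N" "\<mu> x = h n" using \<mu>_closed[OF x] by blast
  show "\<mu> y = \<mu> x" unfolding k(2) \<mu>_add[OF kF x] Ker_kernel[OF k(1)] n(2) using n(1) by (simp add: NM_add)
qed

lemma cls_self: "x \<in> carrier F \<Longrightarrow> x \<in> cls x"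
  unfolding tensor_class_def
  by (rule group.rcos_self[OF group_free_Abelian_group _ Ker_subgroup])

text \<open>Any element of the coset may be used, because \<mu> vanishes on the subgroup of
  relations and so is constant on its cosets.\<close>

definition \<theta> :: "((nat \<Rightarrow> 'k) \<times> (nat \<Rightarrow> 'k) \<Rightarrow>\<^sub>0 int) set \<Rightarrow> nat \<Rightarrow> 'k" where
  "\<theta> Z = \<mu> (SOME x. x \<in> Z)"

lemma \<theta>_const:
  assumes "z \<in> Z" "\<And>x. x \<in> Z \<Longrightarrow> \<mu> x = u" shows "\<theta> Z = u"
  unfolding \<theta>_def by (rule assms(2)) (rule someI[of "\<lambda>x. x \<in> Z", OF assms(1)])

lemma \<theta>_cls: "x \<in> carrier F \<Longrightarrow> \<theta> (cls x) = \<mu> x"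
  by (rule \<theta>_const[OF cls_self cls_\<mu>(2)])

lemma \<theta>_elem: "m \<in> N \<Longrightarrow> n \<in> N \<Longrightarrow> \<theta> (tensor_elem \<Gamma> NM NM (h m) (h n)) = h (m \<otimes>\<^bsub>\<Lambda>\<^esub> n)"
  unfolding tensor_elem_def by (subst \<theta>_cls) (auto simp: NM_carrier \<mu>_frag)

lemma tensor_carrier: "carrier (tensor_product \<Gamma> NM NM) = cls ` carrier F"
  unfolding tensor_product_def Let_def FactGroup_def RCOSETS_def tensor_class_def by auto

lemma tensor_add:
  assumes "x \<in> carrier F" "y \<in> carrier F"
  shows "cls x \<oplus>\<^bsub>tensor_product \<Gamma> NM NM\<^esub> cls y = cls (x + y)"
proof -
  have "normal Ker F"
    by (rule comm_group.subgroup_imp_normal[OF abelian_free_Abelian_group Ker_subgroup])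
  from normal.rcos_sum[OF this assms] show ?thesis
    by (simp add: tensor_product_def Let_def FactGroup_def tensor_class_def)
qed

text \<open>Serves both scalar actions on the tensor product: f acts on one component of a pair, and
  \<tau> is multiplication of the product by \<sigma>(r) on the corresponding side. Compatibility
  with differences carries the formula from pairs to the whole group.\<close>

lemma \<mu>_frag_extend:
  assumes f: "\<And>p. p \<in> carrier NM \<times> carrier NM \<Longrightarrow> f p \<in> carrier NM \<times> carrier NM"
    and \<tau>: "\<And>m n. m \<in> N \<Longrightarrow> n \<in> N \<Longrightarrow> \<mu> (frag_of (f (h m, h n))) = h (\<tau> (m \<otimes>\<^bsub>\<Lambda>\<^esub> n))"
    and \<tau>_closed: "\<And>n. n \<in> N \<Longrightarrow> \<tau> n \<in> N"
    and \<tau>_diff: "\<And>m n. m \<in> N \<Longrightarrow> n \<in> N \<Longrightarrow> \<tau> (m \<ominus>\<^bsub>\<Lambda>\<^esub> n) = \<tau> m \<ominus>\<^bsub>\<Lambda>\<^esub> \<tau> n"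
    and x: "x \<in> carrier F"
  shows "frag_extend (\<lambda>p. frag_of (f p)) x \<in> carrier F \<and>
    \<mu> (frag_extend (\<lambda>p. frag_of (f p)) x) = h (\<tau> (d (\<mu> x)))"
proof -
  let ?f = "frag_extend (\<lambda>p. frag_of (f p))"
  show ?thesis
  proof (rule free_Abelian_group_induct[where S = "carrier NM \<times> carrier NM" and x = x])
    show "Poly_Mapping.keys x \<subseteq> carrier NM \<times> carrier NM" using x by simp
    have z: "\<mu> 0 = h \<zero>\<^bsub>\<Lambda>\<^esub>" using \<mu>.hom_one by (simp add: NM_zero)
    have "\<tau> \<zero>\<^bsub>\<Lambda>\<^esub> = \<zero>\<^bsub>\<Lambda>\<^esub>" using \<tau>_diff[of "\<zero>\<^bsub>\<Lambda>\<^esub>" "\<zero>\<^bsub>\<Lambda>\<^esub>"] \<tau>_closed[of "\<zero>\<^bsub>\<Lambda>\<^esub>"] by (simp add: L.minus_self)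
    then show "?f 0 \<in> carrier F \<and> \<mu> (?f 0) = h (\<tau> (d (\<mu> 0)))" using z by simp
  next
    fix x y assume k: "Poly_Mapping.keys x \<subseteq> carrier NM \<times> carrier NM" "Poly_Mapping.keys y \<subseteq> carrier NM \<times> carrier NM"
      and IH: "?f x \<in> carrier F \<and> \<mu> (?f x) = h (\<tau> (d (\<mu> x)))" "?f y \<in> carrier F \<and> \<mu> (?f y) = h (\<tau> (d (\<mu> y)))"
    have xy: "x \<in> carrier F" "y \<in> carrier F" using k by simp_all
    obtain m where m: "m \<in> N" "\<mu> x = h m" using \<mu>_closed[OF xy(1)] by blast
    obtain n where n: "n \<in> N" "\<mu> y = h n" using \<mu>_closed[OF xy(2)] by blast
    note mn = m n
    have e: "?f (x - y) = ?f x - ?f y" by (rule frag_extend_diff)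
    have c: "?f x \<in> carrier F" "?f y \<in> carrier F" using IH by blast+
    have "\<mu> (?f x - ?f y) = h (\<tau> m \<ominus>\<^bsub>\<Lambda>\<^esub> \<tau> n)"
      using IH mn \<tau>_closed by (intro \<mu>_diff c) auto
    moreover have "\<mu> (x - y) = h (m \<ominus>\<^bsub>\<Lambda>\<^esub> n)" using mn by (intro \<mu>_diff xy)
    moreover have "m \<ominus>\<^bsub>\<Lambda>\<^esub> n \<in> N" using mn by (simp add: a_minus_def)
    moreover have "?f x - ?f y \<in> carrier F" using c keys_diff[of "?f x" "?f y"] by auto
    ultimately show "?f (x - y) \<in> carrier F \<and> \<mu> (?f (x - y)) = h (\<tau> (d (\<mu> (x - y))))"
      unfolding e using \<tau>_diff mn by (simp del: carrier_free_Abelian_group_iff)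
  next
    fix p assume p: "p \<in> carrier NM \<times> carrier NM"
    then obtain m n where mn: "m \<in> N" "n \<in> N" "p = (h m, h n)" by (auto simp: NM_carrier)
    then show "?f (frag_of p) \<in> carrier F \<and> \<mu> (?f (frag_of p)) = h (\<tau> (d (\<mu> (frag_of p))))"
      using f[OF p] \<tau> \<mu>_frag by simp
  qed
qed

lemma \<theta>_hom: "\<theta> \<in> bimodule_hom \<Gamma> (tensor_product \<Gamma> NM NM) NM"
proof -
  let ?T = "tensor_product \<Gamma> NM NM"
  have ball: "(\<And>x. x \<in> carrier F \<Longrightarrow> P (cls x)) \<Longrightarrow> Z \<in> carrier ?T \<Longrightarrow> P Z" for P Z
    unfolding tensor_carrier by blast
  have dist: "\<sigma> r \<otimes>\<^bsub>\<Lambda>\<^esub> (m \<ominus>\<^bsub>\<Lambda>\<^esub> n) = \<sigma> r \<otimes>\<^bsub>\<Lambda>\<^esub> m \<ominus>\<^bsub>\<Lambda>\<^esub> \<sigma> r \<otimes>\<^bsub>\<Lambda>\<^esub> n"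
    "(m \<ominus>\<^bsub>\<Lambda>\<^esub> n) \<otimes>\<^bsub>\<Lambda>\<^esub> \<sigma> r = m \<otimes>\<^bsub>\<Lambda>\<^esub> \<sigma> r \<ominus>\<^bsub>\<Lambda>\<^esub> n \<otimes>\<^bsub>\<Lambda>\<^esub> \<sigma> r"
    if "r \<in> carrier \<Gamma>" "m \<in> N" "n \<in> N" for r m n
    using that by (simp_all add: a_minus_def L.A.r_distr L.A.r_minus L.A.l_distr L.A.l_minus)
  have left: "\<theta> (r \<odot>\<^bsub>?T\<^esub> cls x) = r \<odot>\<^bsub>NM\<^esub> \<mu> x" if r: "r \<in> carrier \<Gamma>" and x: "x \<in> carrier F" for r x
  proof -
    let ?f = "\<lambda>(m, n). (r \<odot>\<^bsub>NM\<^esub> m, n)"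
    let ?E = "frag_extend (\<lambda>p. frag_of (?f p))"
    have E: "?E y \<in> carrier F \<and> \<mu> (?E y) = h (\<sigma> r \<otimes>\<^bsub>\<Lambda>\<^esub> d (\<mu> y))" if y: "y \<in> carrier F" for y
      by (rule \<mu>_frag_extend[OF _ _ _ _ y])
         (use r dist in \<open>auto simp: NM_simps \<mu>_frag L.A.m_assoc\<close>)
    have f: "(\<lambda>(m, n). frag_of (r \<odot>\<^bsub>NM\<^esub> m, n)) = (\<lambda>p. frag_of (?f p))" by auto
    \<comment> \<open>The action is a union over the representatives y of the coset; \<mu> takes one
      and the same value on all classes in the union, so \<open>\<theta>_const\<close>
      applies.\<close>
    have sm: "r \<odot>\<^bsub>?T\<^esub> cls x = (\<Union>y\<in>cls x. cls (?E y))"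
      by (simp add: tensor_product_def Let_def f)
    obtain n where n: "n \<in> N" "\<mu> x = h n" using \<mu>_closed[OF x] by blast
    have "\<theta> (r \<odot>\<^bsub>?T\<^esub> cls x) = h (\<sigma> r \<otimes>\<^bsub>\<Lambda>\<^esub> n)"
    proof (rule \<theta>_const[of "?E x"])
      show "?E x \<in> r \<odot>\<^bsub>?T\<^esub> cls x" unfolding sm using cls_self[OF x] cls_self[of "?E x"] E[OF x] by blast
      fix w assume "w \<in> r \<odot>\<^bsub>?T\<^esub> cls x"
      then obtain y where y: "y \<in> cls x" "w \<in> cls (?E y)" unfolding sm by blast
      have yF: "y \<in> carrier F" "\<mu> y = \<mu> x" using cls_\<mu>[OF x y(1)] by auto
      show "\<mu> w = h (\<sigma> r \<otimes>\<^bsub>\<Lambda>\<^esub> n)" using cls_\<mu>(2)[OF _ y(2)] E[OF yF(1)] yF(2) n by simp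
    qed
    then show ?thesis using n by (simp add: NM_smult)
  qed
  have right: "\<theta> (cls x \<triangleleft>\<^bsub>?T\<^esub> r) = \<mu> x \<triangleleft>\<^bsub>NM\<^esub> r" if r: "r \<in> carrier \<Gamma>" and x: "x \<in> carrier F" for r x
  proof -
    let ?f = "\<lambda>(m, n). (m, n \<triangleleft>\<^bsub>NM\<^esub> r)"
    let ?E = "frag_extend (\<lambda>p. frag_of (?f p))"
    have E: "?E y \<in> carrier F \<and> \<mu> (?E y) = h (d (\<mu> y) \<otimes>\<^bsub>\<Lambda>\<^esub> \<sigma> r)" if y: "y \<in> carrier F" for y
      by (rule \<mu>_frag_extend[OF _ _ _ _ y])
         (use r dist in \<open>auto simp: NM_simps \<mu>_frag L.A.m_assoc\<close>)
    have f: "(\<lambda>(m, n). frag_of (m, n \<triangleleft>\<^bsub>NM\<^esub> r)) = (\<lambda>p. frag_of (?f p))" by auto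
    have sm: "cls x \<triangleleft>\<^bsub>?T\<^esub> r = (\<Union>y\<in>cls x. cls (?E y))"
      by (simp add: tensor_product_def Let_def f)
    obtain n where n: "n \<in> N" "\<mu> x = h n" using \<mu>_closed[OF x] by blast
    have "\<theta> (cls x \<triangleleft>\<^bsub>?T\<^esub> r) = h (n \<otimes>\<^bsub>\<Lambda>\<^esub> \<sigma> r)"
    proof (rule \<theta>_const[of "?E x"])
      show "?E x \<in> cls x \<triangleleft>\<^bsub>?T\<^esub> r" unfolding sm using cls_self[OF x] cls_self[of "?E x"] E[OF x] by blast
      fix w assume "w \<in> cls x \<triangleleft>\<^bsub>?T\<^esub> r"
      then obtain y where y: "y \<in> cls x" "w \<in> cls (?E y)" unfolding sm by blast
      have yF: "y \<in> carrier F" "\<mu> y = \<mu> x" using cls_\<mu>[OF x y(1)] by auto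
      show "\<mu> w = h (n \<otimes>\<^bsub>\<Lambda>\<^esub> \<sigma> r)" using cls_\<mu>(2)[OF _ y(2)] E[OF yF(1)] yF(2) n by simp
    qed
    then show ?thesis using n by (simp add: NM_rsmult)
  qed
  have "\<theta> Z \<in> carrier NM" if Z: "Z \<in> carrier ?T" for Z
  proof -
    obtain x where x: "x \<in> carrier F" "Z = cls x" using Z unfolding tensor_carrier by blast
    show ?thesis unfolding x(2) \<theta>_cls[OF x(1)] NM_carrier by (rule \<mu>_closed[OF x(1)])
  qed
  moreover have "\<theta> (Z \<oplus>\<^bsub>?T\<^esub> Z') = \<theta> Z \<oplus>\<^bsub>NM\<^esub> \<theta> Z'" if Z: "Z \<in> carrier ?T" "Z' \<in> carrier ?T" for Z Z'
  proof -
    obtain x where x: "x \<in> carrier F" "Z = cls x" using Z(1) unfolding tensor_carrier by blast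
    obtain y where y: "y \<in> carrier F" "Z' = cls y" using Z(2) unfolding tensor_carrier by blast
    note xy = x y
    have "x + y \<in> carrier F"
      using monoid.m_closed[OF group.is_monoid[OF group_free_Abelian_group] xy(1,3)] by simp
    then show ?thesis using xy by (simp add: tensor_add \<theta>_cls \<mu>_add del: carrier_free_Abelian_group_iff)
  qed
  moreover have "\<theta> (r \<odot>\<^bsub>?T\<^esub> Z) = r \<odot>\<^bsub>NM\<^esub> \<theta> Z" "\<theta> (Z \<triangleleft>\<^bsub>?T\<^esub> r) = \<theta> Z \<triangleleft>\<^bsub>NM\<^esub> r"
    if rZ: "r \<in> carrier \<Gamma>" "Z \<in> carrier ?T" for r Z
  proof -
    obtain x where x: "x \<in> carrier F" "Z = cls x" using rZ(2) unfolding tensor_carrier by blast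
    show "\<theta> (r \<odot>\<^bsub>?T\<^esub> Z) = r \<odot>\<^bsub>NM\<^esub> \<theta> Z" "\<theta> (Z \<triangleleft>\<^bsub>?T\<^esub> r) = \<theta> Z \<triangleleft>\<^bsub>NM\<^esub> r"
      unfolding x(2) \<theta>_cls[OF x(1)] using left[OF rZ(1) x(1)] right[OF rZ(1) x(1)] by auto
  qed
  ultimately show ?thesis unfolding bimodule_hom_def lmod_hom_def by blast
qed

text \<open>The map p, the identity minus \<sigma> after \<pi>, is a linear projection of \<Lambda>
  onto N, so it takes a finite spanning set of \<Lambda> to one of N.\<close>

lemma NM_fin_dim: "fin_dim K (k_space \<Gamma> NM)"
proof -
  obtain S where S: "S \<subseteq> carrier \<Lambda>" "finite S"
    "\<And>x. x \<in> carrier \<Lambda> \<Longrightarrow> \<exists>c \<in> S \<rightarrow> carrier K. x = (\<Oplus>\<^bsub>\<Lambda>\<^esub>s\<in>S. c s \<odot>\<^bsub>\<Lambda>\<^esub> s)"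
    using L.fin_dim unfolding fin_dim_def by blast
  define p where "p x = x \<ominus>\<^bsub>\<Lambda>\<^esub> \<sigma> (\<pi> x)" for x
  have pN: "p x \<in> N" if x: "x \<in> carrier \<Lambda>" for x
  proof -
    obtain n where n: "n \<in> N" "x = \<sigma> (\<pi> x) \<oplus>\<^bsub>\<Lambda>\<^esub> n" using decomp[OF x] by blast
    have "(a \<oplus>\<^bsub>\<Lambda>\<^esub> b) \<ominus>\<^bsub>\<Lambda>\<^esub> a = b" if "a \<in> carrier \<Lambda>" "b \<in> carrier \<Lambda>" for a b using that by algebra
    then have "p x = n" unfolding p_def using n x by (metis N_carr \<pi>.hom_closed \<sigma>.hom_closed)
    then show ?thesis using n by simp
  qed
  have p_add: "p (x \<oplus>\<^bsub>\<Lambda>\<^esub> y) = p x \<oplus>\<^bsub>\<Lambda>\<^esub> p y" if "x \<in> carrier \<Lambda>" "y \<in> carrier \<Lambda>" for x y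
  proof -
    have "(x \<oplus>\<^bsub>\<Lambda>\<^esub> y) \<ominus>\<^bsub>\<Lambda>\<^esub> (a \<oplus>\<^bsub>\<Lambda>\<^esub> b) = (x \<ominus>\<^bsub>\<Lambda>\<^esub> a) \<oplus>\<^bsub>\<Lambda>\<^esub> (y \<ominus>\<^bsub>\<Lambda>\<^esub> b)"
      if "a \<in> carrier \<Lambda>" "b \<in> carrier \<Lambda>" for a b
      using that \<open>x \<in> carrier \<Lambda>\<close> \<open>y \<in> carrier \<Lambda>\<close> by algebra
    then show ?thesis using that by (simp add: p_def)
  qed
  have p_smult: "p (c \<odot>\<^bsub>\<Lambda>\<^esub> x) = c \<odot>\<^bsub>\<Lambda>\<^esub> p x" if "c \<in> carrier K" "x \<in> carrier \<Lambda>" for c x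
    using that by (simp add: p_def a_minus_def \<pi>_smult \<sigma>_smult L.smult_r_distr L.smult_r_minus)
  have p_id: "p x = x" if x: "x \<in> N" for x
  proof -
    have "\<pi> x = \<zero>\<^bsub>\<Gamma>\<^esub>" using \<pi>_eq[OF G.M.zero_closed x] x by simp
    then show ?thesis using x by (simp add: p_def a_minus_def)
  qed
  obtain ss where ss: "distinct ss" "set ss = p ` S" using finite_distinct_list[of "p ` S"] S(2) by auto
  have ssN: "set ss \<subseteq> N" using ss(2) pN S(1) by auto
  then have ssL: "set ss \<subseteq> carrier \<Lambda>" by auto
  have span: "x \<in> L.list_span ss" if x: "x \<in> N" for x
  proof -
    obtain c where c: "c \<in> S \<rightarrow> carrier K" "x = (\<Oplus>\<^bsub>\<Lambda>\<^esub>s\<in>S. c s \<odot>\<^bsub>\<Lambda>\<^esub> s)" using S(3) x by (meson N_carr)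
    note sub = L.subspace_list_span[OF ssL]
    have "p (\<Oplus>\<^bsub>\<Lambda>\<^esub>s\<in>S. c s \<odot>\<^bsub>\<Lambda>\<^esub> s) = (\<Oplus>\<^bsub>\<Lambda>\<^esub>s\<in>S. p (c s \<odot>\<^bsub>\<Lambda>\<^esub> s))"
      using S c(1) p_add pN p_id[OF N_closed(1)]
      by (intro additive_map_finsum[OF L.M.abelian_monoid_axioms L.M.abelian_monoid_axioms]) auto
    also have "\<dots> \<in> L.list_span ss"
    proof (rule L.subspace_finsum[OF sub S(2)])
      fix s assume s: "s \<in> S"
      have "p s \<in> L.list_span ss"
      proof -
        have psc: "p s \<in> carrier \<Lambda>" using pN s S(1) by auto
        have "p s \<in> set ss" using ss s by simp
        then have "p s = (\<Oplus>\<^bsub>\<Lambda>\<^esub>t\<in>set ss. if p s = t then p s else \<zero>\<^bsub>\<Lambda>\<^esub>)"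
          using L.M.finsum_singleton[of "p s" "set ss" "\<lambda>_. p s"] psc by simp
        also have "\<dots> = (\<Oplus>\<^bsub>\<Lambda>\<^esub>t\<in>set ss. (if p s = t then \<one>\<^bsub>K\<^esub> else \<zero>\<^bsub>K\<^esub>) \<odot>\<^bsub>\<Lambda>\<^esub> t)"
          using ssL by (intro L.M.finsum_cong') (auto simp: L.smult_l_null)
        also have "\<dots> \<in> L.list_span ss" by (rule L.finsum_in_list_span[OF ss(1) ssL]) auto
        finally show ?thesis .
      qed
      then show "p (c s \<odot>\<^bsub>\<Lambda>\<^esub> s) \<in> L.list_span ss"
        using s S(1) funcset_mem[OF c(1) s] p_smult[of "c s" s] L.subspace_smult[OF sub, of "c s" "p s"] by auto
    qed
    finally show ?thesis using c(2) p_id[OF x] by simp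
  qed
  let ?V = "k_space \<Gamma> NM"
  have V: "abelian_group ?V"
    by (rule abelian_group_cong[OF NM_abelian_group]) (simp_all add: k_space_def)
  have Vs: "carrier ?V = h ` N" "ring.zero ?V = h \<zero>\<^bsub>\<Lambda>\<^esub>" "\<And>m n. m \<in> N \<Longrightarrow> n \<in> N \<Longrightarrow> h m \<oplus>\<^bsub>?V\<^esub> h n = h (m \<oplus>\<^bsub>\<Lambda>\<^esub> n)"
    "\<And>c n. c \<in> carrier K \<Longrightarrow> n \<in> N \<Longrightarrow> c \<odot>\<^bsub>?V\<^esub> h n = h (c \<odot>\<^bsub>\<Lambda>\<^esub> n)"
    by (simp_all add: k_space_def NM_simps \<sigma>_scalar L.scalar_mult_eq)
  have hsum: "h (\<Oplus>\<^bsub>\<Lambda>\<^esub>i\<in>I. f i) = (\<Oplus>\<^bsub>?V\<^esub>i\<in>I. h (f i))" if "finite I" "\<And>i. i \<in> I \<Longrightarrow> f i \<in> N" for I and f :: "'b \<Rightarrow> 'b"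
    using that
  proof (induction I rule: finite_induct)
    case empty
    interpret V: abelian_group ?V by (rule V)
    show ?case by (simp add: Vs)
  next
    case (insert i I)
    interpret V: abelian_group ?V by (rule V)
    have "f \<in> I \<rightarrow> carrier \<Lambda>" "(\<lambda>i. h (f i)) \<in> I \<rightarrow> carrier ?V" using insert.prems Vs(1) by auto
    moreover have "(\<Oplus>\<^bsub>\<Lambda>\<^esub>i\<in>I. f i) \<in> N" using insert by (intro L.subspace_finsum[OF N_subspace]) auto
    ultimately show ?case using insert Vs(1) by (simp add: Vs(3)[symmetric])
  qed
  show ?thesis
    unfolding fin_dim_def
  proof (intro exI[of _ "h ` set ss"] conjI ballI)
    show "h ` set ss \<subseteq> carrier ?V" using ssN Vs(1) by auto
    show "finite (h ` set ss)" by simp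
    fix u assume "u \<in> carrier ?V"
    then obtain x where x: "x \<in> N" "u = h x" using Vs(1) by auto
    obtain c where c: "c \<in> set ss \<rightarrow> carrier K" "x = (\<Oplus>\<^bsub>\<Lambda>\<^esub>s\<in>set ss. c s \<odot>\<^bsub>\<Lambda>\<^esub> s)"
      using L.list_span_finsum[OF ss(1) ssL span[OF x(1)]] by blast
    interpret V: abelian_group ?V by (rule V)
    have "u = (\<Oplus>\<^bsub>?V\<^esub>s\<in>set ss. h (c s \<odot>\<^bsub>\<Lambda>\<^esub> s))"
      unfolding x(2) c(2) using c(1) ssN by (intro hsum) (auto simp: Pi_iff subset_iff)
    \<comment> \<open>The coefficients are indexed by elements of N, whereas the new spanning set
      consists of their codes; \<open>d\<close> translates back.\<close>
    also have "\<dots> = (\<Oplus>\<^bsub>?V\<^esub>s\<in>set ss. c (d (h s)) \<odot>\<^bsub>?V\<^esub> h s)"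
      using c(1) ssN Vs(1) by (intro V.finsum_cong') (auto simp: Vs(4) subset_iff Pi_iff)
    also have "\<dots> = (\<Oplus>\<^bsub>?V\<^esub>t\<in>h ` set ss. c (d t) \<odot>\<^bsub>?V\<^esub> t)"
    proof (rule V.finsum_reindex[symmetric])
      show "(\<lambda>t. c (d t) \<odot>\<^bsub>?V\<^esub> t) \<in> h ` set ss \<rightarrow> carrier ?V"
        using c(1) ssN Vs(1) by (auto simp: Vs(4) subset_iff Pi_iff)
      show "inj_on h (set ss)" using h_inj ssL by (rule inj_on_subset)
    qed
    finally have "u = (\<Oplus>\<^bsub>?V\<^esub>t\<in>h ` set ss. c (d t) \<odot>\<^bsub>?V\<^esub> t)" .
    moreover have "(\<lambda>t. c (d t)) \<in> h ` set ss \<rightarrow> carrier K" using c(1) ssN by (auto simp: subset_iff Pi_iff)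
    ultimately show "\<exists>c\<in>h ` set ss \<rightarrow> carrier K. u = (\<Oplus>\<^bsub>?V\<^esub>t\<in>h ` set ss. c t \<odot>\<^bsub>?V\<^esub> t)"
      by (intro bexI[of _ "\<lambda>t. c (d t)"])
  qed
qed

lemma multiplicative:
  assumes "N \<noteq> {\<zero>\<^bsub>\<Lambda>\<^esub>}" shows "multiplicative_bimodule K \<Gamma> NM \<theta>"
proof (intro multiplicative_bimodule.intro multiplicative_bimodule_axioms.intro NM_bimodule NM_fin_dim \<theta>_hom)
  obtain n where n: "n \<in> N" "n \<noteq> \<zero>\<^bsub>\<Lambda>\<^esub>" using assms N_closed(1) by auto
  then have "h n \<in> carrier NM" "h n \<noteq> \<zero>\<^bsub>NM\<^esub>" by (auto simp: NM_simps)
  then show "carrier NM \<noteq> {\<zero>\<^bsub>NM\<^esub>}" by auto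
qed (auto simp: NM_carrier \<theta>_elem L.A.m_assoc)

text \<open>The power \<theta>^r multiplies the r + 1 elements m 0, ..., m r; hence the list up to
  \<open>Suc r\<close>.\<close>

lemma theta_power_eq:
  assumes "\<forall>i\<le>r. m i \<in> N"
  shows "theta_power \<Gamma> NM \<theta> r (\<lambda>i. h (m i)) = h (L.mprod (map m [0..<Suc r])) \<and> L.mprod (map m [0..<Suc r]) \<in> N"
  using assms
proof (induction r)
  case 0
  then show ?case by simp
next
  case (Suc r)
  have c: "set (map m [0..<Suc r]) \<subseteq> carrier \<Lambda>" "m (Suc r) \<in> N" using Suc.prems by auto
  have "L.mprod (map m [0..<Suc r] @ [m (Suc r)]) = L.mprod (map m [0..<Suc r]) \<otimes>\<^bsub>\<Lambda>\<^esub> m (Suc r)"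
    using c by (subst L.mprod_append) auto
  moreover have "map m [0..<Suc (Suc r)] = map m [0..<Suc r] @ [m (Suc r)]" by simp
  moreover have "theta_power \<Gamma> NM \<theta> r (\<lambda>i. h (m i)) = h (L.mprod (map m [0..<Suc r]))" "L.mprod (map m [0..<Suc r]) \<in> N"
    using Suc by auto
  ultimately show ?case using c by (simp only: theta_power.simps \<theta>_elem) simp
qed

lemma nilpotent_theta: "nilpotent_theta \<Gamma> NM \<theta>"
proof -
  obtain l where l: "0 < l" "\<And>xs. set xs \<subseteq> N \<Longrightarrow> length xs = l \<Longrightarrow> L.mprod xs = \<zero>\<^bsub>\<Lambda>\<^esub>"
    using N_nilpotent unfolding nilpotent_set_def L.mprod_def by blast
  have "theta_power \<Gamma> NM \<theta> l u = \<zero>\<^bsub>NM\<^esub>" if u: "\<forall>i\<le>l. u i \<in> carrier NM" for u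
  proof -
    \<comment> \<open>Zero beyond l is a default value; only the indices up to l occur.\<close>
    define m where "m i = (if i \<le> l then d (u i) else \<zero>\<^bsub>\<Lambda>\<^esub>)" for i
    have m: "m i \<in> N \<and> h (m i) = u i" if "i \<le> l" for i using u that by (auto simp: NM_carrier m_def)
    have cong: "theta_power \<Gamma> NM \<theta> r u = theta_power \<Gamma> NM \<theta> r (\<lambda>i. h (m i))" if "r \<le> l" for r
      using that by (induction r) (use m in auto)
    have *: "set (map m [0..<l]) \<subseteq> N" using m by auto
    then have z: "L.mprod (map m [0..<l]) = \<zero>\<^bsub>\<Lambda>\<^esub>" using l(2) by simp
    \<comment> \<open>The first l of the l + 1 factors already have product zero.\<close>
    have "L.mprod (map m [0..<l] @ [m l]) = L.mprod (map m [0..<l]) \<otimes>\<^bsub>\<Lambda>\<^esub> m l"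
      using * m[of l] by (subst L.mprod_append) auto
    then have "L.mprod (map m [0..<Suc l]) = \<zero>\<^bsub>\<Lambda>\<^esub>" using z m[of l] by simp
    then show ?thesis using cong[of l] theta_power_eq[of l m] m by (simp add: NM_zero)
  qed
  then show ?thesis using l(1) unfolding nilpotent_theta_def by (intro exI[of _ l]) auto
qed

text \<open>Vanishing on pairs passes to the whole free abelian group by induction, since \<mu>
  respects differences.\<close>

lemma \<theta>_zero:
  assumes "\<forall>m\<in>N. \<forall>n\<in>N. m \<otimes>\<^bsub>\<Lambda>\<^esub> n = \<zero>\<^bsub>\<Lambda>\<^esub>" and t: "t \<in> carrier (tensor_product \<Gamma> NM NM)"
  shows "\<theta> t = \<zero>\<^bsub>NM\<^esub>"
proof -
  obtain x where x: "x \<in> carrier F" "t = cls x" using t unfolding tensor_carrier by blast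
  have "\<mu> x = h \<zero>\<^bsub>\<Lambda>\<^esub>"
  proof (rule free_Abelian_group_induct[where S = "carrier NM \<times> carrier NM" and x = x])
    show "Poly_Mapping.keys x \<subseteq> carrier NM \<times> carrier NM" using x by simp
    show "\<mu> 0 = h \<zero>\<^bsub>\<Lambda>\<^esub>" using \<mu>.hom_one by (simp add: NM_zero)
  next
    fix x y assume "Poly_Mapping.keys x \<subseteq> carrier NM \<times> carrier NM" "Poly_Mapping.keys y \<subseteq> carrier NM \<times> carrier NM"
      "\<mu> x = h \<zero>\<^bsub>\<Lambda>\<^esub>" "\<mu> y = h \<zero>\<^bsub>\<Lambda>\<^esub>"
    then have "\<mu> (x - y) = h (\<zero>\<^bsub>\<Lambda>\<^esub> \<ominus>\<^bsub>\<Lambda>\<^esub> \<zero>\<^bsub>\<Lambda>\<^esub>)" by (intro \<mu>_diff) simp_all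
    then show "\<mu> (x - y) = h \<zero>\<^bsub>\<Lambda>\<^esub>" by (simp add: L.minus_self)
  next
    fix p assume "p \<in> carrier NM \<times> carrier NM"
    then obtain m n where "m \<in> N" "n \<in> N" "p = (h m, h n)" by (auto simp: NM_carrier)
    then show "\<mu> (frag_of p) = h \<zero>\<^bsub>\<Lambda>\<^esub>" using \<mu>_frag assms(1) by simp
  qed
  then show ?thesis unfolding x(2) \<theta>_cls[OF x(1)] NM_zero .
qed

section \<open>The isomorphism with the split extension\<close>

abbreviation E where "E \<equiv> split_extension \<Gamma> NM \<theta>"

definition toE :: "'b \<Rightarrow> 'a \<times> (nat \<Rightarrow> 'k)" where
  "toE x = (\<pi> x, h (x \<ominus>\<^bsub>\<Lambda>\<^esub> \<sigma> (\<pi> x)))"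

lemma toE_eq:
  assumes "g \<in> carrier \<Gamma>" "n \<in> N" shows "toE (\<sigma> g \<oplus>\<^bsub>\<Lambda>\<^esub> n) = (g, h n)"
proof -
  have "(a \<oplus>\<^bsub>\<Lambda>\<^esub> b) \<ominus>\<^bsub>\<Lambda>\<^esub> a = b" if "a \<in> carrier \<Lambda>" "b \<in> carrier \<Lambda>" for a b using that by algebra
  then show ?thesis using assms \<pi>_eq[OF assms] by (simp add: toE_def)
qed

lemma ex_decomp:
  assumes "x \<in> carrier \<Lambda>"
  obtains g n where "g \<in> carrier \<Gamma>" "n \<in> N" "x = \<sigma> g \<oplus>\<^bsub>\<Lambda>\<^esub> n"
  using decomp[OF assms] \<pi>.hom_closed[OF assms] by blast

text \<open>In the product of \<sigma>(g) + n and \<sigma>(g') + n' the N-part consists of the three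
  terms that define multiplication in a split extension, with \<theta> supplying n n'.\<close>

lemma toE_iso: "toE \<in> ring_iso \<Lambda> E"
proof (rule ring_iso_memI)
  fix x assume "x \<in> carrier \<Lambda>"
  then obtain g n where "g \<in> carrier \<Gamma>" "n \<in> N" "x = \<sigma> g \<oplus>\<^bsub>\<Lambda>\<^esub> n" by (rule ex_decomp)
  then show "toE x \<in> carrier E" by (simp add: toE_eq split_extension_def NM_carrier)
next
  fix x y assume x: "x \<in> carrier \<Lambda>" and y: "y \<in> carrier \<Lambda>"
  obtain g n where g: "g \<in> carrier \<Gamma>" "n \<in> N" "x = \<sigma> g \<oplus>\<^bsub>\<Lambda>\<^esub> n" using x by (rule ex_decomp)
  obtain g' n' where g': "g' \<in> carrier \<Gamma>" "n' \<in> N" "y = \<sigma> g' \<oplus>\<^bsub>\<Lambda>\<^esub> n'" using y by (rule ex_decomp)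
  have "x \<otimes>\<^bsub>\<Lambda>\<^esub> y = \<sigma> (g \<otimes>\<^bsub>\<Gamma>\<^esub> g') \<oplus>\<^bsub>\<Lambda>\<^esub> (\<sigma> g \<otimes>\<^bsub>\<Lambda>\<^esub> n' \<oplus>\<^bsub>\<Lambda>\<^esub> n \<otimes>\<^bsub>\<Lambda>\<^esub> \<sigma> g' \<oplus>\<^bsub>\<Lambda>\<^esub> n \<otimes>\<^bsub>\<Lambda>\<^esub> n')"
    unfolding g(3) g'(3) using g(1,2) g'(1,2) by (simp add: L.A.l_distr L.A.r_distr L.M.a_ac)
  then have "toE (x \<otimes>\<^bsub>\<Lambda>\<^esub> y) = (g \<otimes>\<^bsub>\<Gamma>\<^esub> g', h (\<sigma> g \<otimes>\<^bsub>\<Lambda>\<^esub> n' \<oplus>\<^bsub>\<Lambda>\<^esub> n \<otimes>\<^bsub>\<Lambda>\<^esub> \<sigma> g' \<oplus>\<^bsub>\<Lambda>\<^esub> n \<otimes>\<^bsub>\<Lambda>\<^esub> n'))"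
    using toE_eq[OF G.A.m_closed[OF g(1) g'(1)]] g g' by (simp only: N_closed \<sigma>.hom_closed N_carr)
  also have "\<dots> = (g, h n) \<otimes>\<^bsub>E\<^esub> (g', h n')"
    using g(1,2) g'(1,2) by (simp add: split_extension_def NM_simps \<theta>_elem)
  finally show "toE (x \<otimes>\<^bsub>\<Lambda>\<^esub> y) = toE x \<otimes>\<^bsub>E\<^esub> toE y"
    using toE_eq[OF g(1,2)] toE_eq[OF g'(1,2)] g(3) g'(3) by simp
  have "x \<oplus>\<^bsub>\<Lambda>\<^esub> y = \<sigma> (g \<oplus>\<^bsub>\<Gamma>\<^esub> g') \<oplus>\<^bsub>\<Lambda>\<^esub> (n \<oplus>\<^bsub>\<Lambda>\<^esub> n')"
    unfolding g(3) g'(3) using g(1,2) g'(1,2) by (simp add: L.M.a_ac)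
  then have "toE (x \<oplus>\<^bsub>\<Lambda>\<^esub> y) = (g \<oplus>\<^bsub>\<Gamma>\<^esub> g', h (n \<oplus>\<^bsub>\<Lambda>\<^esub> n'))"
    using toE_eq[OF G.M.a_closed[OF g(1) g'(1)]] g g' by (simp only: N_closed)
  also have "\<dots> = (g, h n) \<oplus>\<^bsub>E\<^esub> (g', h n')"
    using g(1,2) g'(1,2) by (simp add: split_extension_def NM_simps)
  finally show "toE (x \<oplus>\<^bsub>\<Lambda>\<^esub> y) = toE x \<oplus>\<^bsub>E\<^esub> toE y"
    using toE_eq[OF g(1,2)] toE_eq[OF g'(1,2)] g(3) g'(3) by simp
next
  show "toE \<one>\<^bsub>\<Lambda>\<^esub> = \<one>\<^bsub>E\<^esub>" using toE_eq[OF G.A.one_closed N_closed(1)] by (simp add: split_extension_def NM_zero)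
  show "bij_betw toE (carrier \<Lambda>) (carrier E)"
    unfolding bij_betw_def
  proof
    show "inj_on toE (carrier \<Lambda>)"
    proof (rule inj_onI)
      fix x y assume x: "x \<in> carrier \<Lambda>" and y: "y \<in> carrier \<Lambda>" and xy: "toE x = toE y"
      obtain g n where g: "g \<in> carrier \<Gamma>" "n \<in> N" "x = \<sigma> g \<oplus>\<^bsub>\<Lambda>\<^esub> n" using x by (rule ex_decomp)
      obtain g' n' where g': "g' \<in> carrier \<Gamma>" "n' \<in> N" "y = \<sigma> g' \<oplus>\<^bsub>\<Lambda>\<^esub> n'" using y by (rule ex_decomp)
      show "x = y" using xy toE_eq[OF g(1,2)] toE_eq[OF g'(1,2)] g g' by simp
    qed
    show "toE ` carrier \<Lambda> = carrier E"
    proof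
      show "toE ` carrier \<Lambda> \<subseteq> carrier E"
      proof (rule image_subsetI)
        fix x assume "x \<in> carrier \<Lambda>"
        then obtain g n where "g \<in> carrier \<Gamma>" "n \<in> N" "x = \<sigma> g \<oplus>\<^bsub>\<Lambda>\<^esub> n" by (rule ex_decomp)
        then show "toE x \<in> carrier E" by (simp add: toE_eq split_extension_def NM_carrier)
      qed
      show "carrier E \<subseteq> toE ` carrier \<Lambda>"
      proof
        fix z assume "z \<in> carrier E"
        then obtain g n where gn: "g \<in> carrier \<Gamma>" "n \<in> N" "z = (g, h n)" by (auto simp: split_extension_def NM_carrier)
        then show "z \<in> toE ` carrier \<Lambda>" by (intro image_eqI[of _ _ "\<sigma> g \<oplus>\<^bsub>\<Lambda>\<^esub> n"]) (simp_all add: toE_eq)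
      qed
    qed
  qed
qed

lemma toE_smult:
  assumes c: "c \<in> carrier K" and x: "x \<in> carrier \<Lambda>" shows "toE (c \<odot>\<^bsub>\<Lambda>\<^esub> x) = c \<odot>\<^bsub>E\<^esub> toE x"
proof -
  obtain g n where g: "g \<in> carrier \<Gamma>" "n \<in> N" "x = \<sigma> g \<oplus>\<^bsub>\<Lambda>\<^esub> n" using x by (rule ex_decomp)
  have "c \<odot>\<^bsub>\<Lambda>\<^esub> x = \<sigma> (c \<odot>\<^bsub>\<Gamma>\<^esub> g) \<oplus>\<^bsub>\<Lambda>\<^esub> c \<odot>\<^bsub>\<Lambda>\<^esub> n" unfolding g(3) using c g(1,2) by (simp add: \<sigma>_smult L.smult_r_distr)
  then have "toE (c \<odot>\<^bsub>\<Lambda>\<^esub> x) = (c \<odot>\<^bsub>\<Gamma>\<^esub> g, h (c \<odot>\<^bsub>\<Lambda>\<^esub> n))"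
    using toE_eq[OF G.smult_closed[OF c g(1)] N_closed(6)[OF c g(2)]] by simp
  also have "\<dots> = c \<odot>\<^bsub>E\<^esub> (g, h n)"
    using c g(1,2) by (simp add: split_extension_def NM_simps \<sigma>_scalar L.scalar_mult_eq)
  finally show ?thesis using toE_eq[OF g(1,2)] g(3) by simp
qed

lemma toE_ideal: "toE ` N = extension_ideal \<Gamma> NM"
proof -
  have "toE n = (\<zero>\<^bsub>\<Gamma>\<^esub>, h n)" if "n \<in> N" for n using toE_eq[OF G.M.zero_closed that] that by simp
  then show ?thesis by (auto simp: extension_ideal_def NM_carrier image_iff)
qed

text \<open>The ring laws are transported from \<Lambda> along the isomorphism. The transported zero
  is the image of zero, which has to be recognised as the zero of the extension.\<close>

lemma ring_E: "ring E"
proof -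
  have "ring (E \<lparr>ring.zero := toE \<zero>\<^bsub>\<Lambda>\<^esub>\<rparr>)" by (rule L.A.ring_iso_imp_img_ring[OF toE_iso])
  moreover have "toE \<zero>\<^bsub>\<Lambda>\<^esub> = \<zero>\<^bsub>E\<^esub>" using toE_eq[OF G.M.zero_closed N_closed(1)] by (simp add: split_extension_def NM_zero)
  ultimately show ?thesis by simp
qed

lemma removable_bimodule:
  assumes rem: "removable_ideal \<Lambda> N"
  shows "removable_bimodule K \<Gamma> NM \<theta>"
proof -
  have NL: "N \<subseteq> carrier \<Lambda>" by auto
  have pd: "right_pd E (extension_ideal \<Gamma> NM) = right_pd \<Lambda> N" "left_pd E (extension_ideal \<Gamma> NM) = left_pd \<Lambda> N"
    using right_pd_ring_iso[OF L.A.ring_axioms ring_E toE_iso NL] left_pd_ring_iso[OF L.A.ring_axioms ring_E toE_iso NL]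
    unfolding toE_ideal by auto
  \<comment> \<open>The zero ideal has right dimension -\<infinity>, so finiteness provides the
    non-zero bimodule that a multiplicative bimodule requires.\<close>
  have "N \<noteq> {\<zero>\<^bsub>\<Lambda>\<^esub>}" using rem right_pd_zero[OF L.A.ring_axioms] by (auto simp: removable_ideal_def)
  note mb = multiplicative[OF this]
  show ?thesis
  proof (cases "pd_finite (left_pd \<Lambda> N)")
    case True
    then have "two_sided_removable_bimodule K \<Gamma> NM \<theta>"
      unfolding two_sided_removable_bimodule_def pd
      using rem mb nilpotent_theta by (simp add: removable_ideal_def)
    then show ?thesis by (simp add: removable_bimodule_def)
  next
    case False
    then have z: "\<forall>m\<in>N. \<forall>n\<in>N. m \<otimes>\<^bsub>\<Lambda>\<^esub> n = \<zero>\<^bsub>\<Lambda>\<^esub>" and l: "left_pd \<Lambda> N = \<infinity>" and r: "pd_finite (right_pd \<Lambda> N)"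
      using rem unfolding removable_ideal_def by (elim conjE disjE; simp)+
    then have "only_left_removable_bimodule K \<Gamma> NM \<theta>"
      unfolding only_left_removable_bimodule_def pd
      using mb nilpotent_theta \<theta>_zero[OF z] by blast
    then show ?thesis by (simp add: removable_bimodule_def)
  qed
qed

end

lemma splitting_imp_split_extension:
  fixes K :: "('k, 'x) ring_scheme" and \<Gamma> :: "('k, 'a, 'y) module_scheme" and \<Lambda> :: "('k, 'b, 'z) module_scheme"
  assumes \<Gamma>: "k_algebra K \<Gamma>" and \<Lambda>: "fin_dim_algebra K \<Lambda>"
    and sp: "nilpotent_splitting K \<Gamma> \<Lambda> \<sigma> N" and rem: "removable_ideal \<Lambda> N"
  shows "\<exists>(M :: ('a, nat \<Rightarrow> 'k) bimodule) \<theta>.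
       removable_bimodule K \<Gamma> M \<theta> \<and> alg_isomorphic K \<Lambda> (split_extension \<Gamma> M \<theta>)"
proof -
  interpret L: fin_dim_algebra K \<Lambda> by fact
  obtain \<pi> where \<pi>: "\<pi> \<in> ring_hom \<Lambda> \<Gamma>"
    "\<And>g n. g \<in> carrier \<Gamma> \<Longrightarrow> n \<in> N \<Longrightarrow> \<pi> (\<sigma> g \<oplus>\<^bsub>\<Lambda>\<^esub> n) = g"
    "\<And>c x. c \<in> carrier K \<Longrightarrow> x \<in> carrier \<Lambda> \<Longrightarrow> \<pi> (c \<odot>\<^bsub>\<Lambda>\<^esub> x) = c \<odot>\<^bsub>\<Gamma>\<^esub> \<pi> x"
    "\<And>x. x \<in> carrier \<Lambda> \<Longrightarrow> \<exists>n\<in>N. x = \<sigma> (\<pi> x) \<oplus>\<^bsub>\<Lambda>\<^esub> n"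
    "\<And>x. x \<in> carrier \<Lambda> \<Longrightarrow> \<pi> x = \<zero>\<^bsub>\<Gamma>\<^esub> \<longleftrightarrow> x \<in> N"
    by (fact splitting_projection[OF \<Gamma> L.k_algebra_axioms sp])
  obtain h :: "'b \<Rightarrow> nat \<Rightarrow> 'k" where h: "inj_on h (carrier \<Lambda>)" using L.ex_inj_nat_fun by blast
  interpret S: split_model K \<Gamma> \<Lambda> \<sigma> N \<pi> h
    by (intro split_model.intro \<Gamma> \<Lambda> split_model_axioms.intro)
       (use sp \<pi> h in \<open>auto simp: nilpotent_splitting_def\<close>)
  have "alg_isomorphic K \<Lambda> (split_extension \<Gamma> S.NM S.\<theta>)"
    unfolding alg_isomorphic_def using S.toE_iso S.toE_smult by blast
  then show ?thesis using S.removable_bimodule[OF rem] by blast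
qed

text \<open>The splitting is read off the extension: \<sigma> sends a to (a, 0), and N is 0 \<oplus>
  M, both carried to \<Lambda> by the inverse isomorphism.\<close>

lemma split_extension_imp_splitting:
  fixes K :: "('k, 'x) ring_scheme" and \<Gamma> :: "('k, 'a, 'y) module_scheme"
    and \<Lambda> :: "('k, 'b, 'z) module_scheme" and M :: "('a, 'm, 'w) bimodule_scheme"
  assumes \<Gamma>: "k_algebra K \<Gamma>" and \<Lambda>: "k_algebra K \<Lambda>"
    and rem: "removable_bimodule K \<Gamma> M \<theta>" and iso: "alg_isomorphic K \<Lambda> (split_extension \<Gamma> M \<theta>)"
  shows "\<exists>\<sigma> N. nilpotent_splitting K \<Gamma> \<Lambda> \<sigma> N \<and> removable_ideal \<Lambda> N"
proof -
  interpret G: k_algebra K \<Gamma> by fact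
  interpret L: k_algebra K \<Lambda> by fact
  have mb: "multiplicative_bimodule K \<Gamma> M \<theta>" and nt: "nilpotent_theta \<Gamma> M \<theta>"
    using rem unfolding removable_bimodule_def two_sided_removable_bimodule_def only_left_removable_bimodule_def by blast+
  have ab: "algebra_bimodule K \<Gamma> M" using mb by (simp add: multiplicative_bimodule_def)
  interpret M: lmodule \<Gamma> M by (rule algebra_bimodule.left_module[OF ab])
  interpret RM: lmodule "op_alg \<Gamma>" "right_module M" by (rule algebra_bimodule.right_module[OF ab])
  have r_closed: "m \<triangleleft>\<^bsub>M\<^esub> a \<in> carrier M" if "m \<in> carrier M" "a \<in> carrier \<Gamma>" for m a
    using RM.smult_closed[of a m] that by (simp add: right_module_def op_alg_def)
  have r_zero: "m \<triangleleft>\<^bsub>M\<^esub> \<zero>\<^bsub>\<Gamma>\<^esub> = \<zero>\<^bsub>M\<^esub>" if m: "m \<in> carrier M" for m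
  proof -
    have "m \<triangleleft>\<^bsub>M\<^esub> (\<zero>\<^bsub>\<Gamma>\<^esub> \<oplus>\<^bsub>\<Gamma>\<^esub> \<zero>\<^bsub>\<Gamma>\<^esub>) = m \<triangleleft>\<^bsub>M\<^esub> \<zero>\<^bsub>\<Gamma>\<^esub> \<oplus>\<^bsub>M\<^esub> m \<triangleleft>\<^bsub>M\<^esub> \<zero>\<^bsub>\<Gamma>\<^esub>"
      using RM.smult_l_distr[of "\<zero>\<^bsub>\<Gamma>\<^esub>" "\<zero>\<^bsub>\<Gamma>\<^esub>" m] m by (simp add: right_module_def op_alg_def)
    then show ?thesis using r_closed[OF m G.M.zero_closed] by simp
  qed
  have l_zero: "\<zero>\<^bsub>\<Gamma>\<^esub> \<odot>\<^bsub>M\<^esub> m = \<zero>\<^bsub>M\<^esub>" if m: "m \<in> carrier M" for m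
    using M.smult_l_distr[of "\<zero>\<^bsub>\<Gamma>\<^esub>" "\<zero>\<^bsub>\<Gamma>\<^esub>" m] M.smult_closed[of "\<zero>\<^bsub>\<Gamma>\<^esub>" m] m by simp
  have l_zero': "a \<odot>\<^bsub>M\<^esub> \<zero>\<^bsub>M\<^esub> = \<zero>\<^bsub>M\<^esub>" if a: "a \<in> carrier \<Gamma>" for a
    using M.smult_r_distr[of a "\<zero>\<^bsub>M\<^esub>" "\<zero>\<^bsub>M\<^esub>"] M.smult_closed[of a "\<zero>\<^bsub>M\<^esub>"] a by simp
  have r_zero': "\<zero>\<^bsub>M\<^esub> \<triangleleft>\<^bsub>M\<^esub> a = \<zero>\<^bsub>M\<^esub>" if a: "a \<in> carrier \<Gamma>" for a
  proof -
    have "(\<zero>\<^bsub>M\<^esub> \<oplus>\<^bsub>M\<^esub> \<zero>\<^bsub>M\<^esub>) \<triangleleft>\<^bsub>M\<^esub> a = \<zero>\<^bsub>M\<^esub> \<triangleleft>\<^bsub>M\<^esub> a \<oplus>\<^bsub>M\<^esub> \<zero>\<^bsub>M\<^esub> \<triangleleft>\<^bsub>M\<^esub> a"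
      using RM.smult_r_distr[of a "\<zero>\<^bsub>M\<^esub>" "\<zero>\<^bsub>M\<^esub>"] a by (simp add: right_module_def op_alg_def)
    then show ?thesis using r_closed[OF M.M.zero_closed a] by simp
  qed
  have tensor_closed: "tensor_elem \<Gamma> M M m n \<in> carrier (tensor_product \<Gamma> M M)" if "m \<in> carrier M" "n \<in> carrier M" for m n
    using that unfolding tensor_product_def Let_def FactGroup_def RCOSETS_def tensor_elem_def tensor_class_def
    by auto
  define mu where "mu m n = \<theta> (tensor_elem \<Gamma> M M m n)" for m n
  have mu_closed: "mu m n \<in> carrier M" if "m \<in> carrier M" "n \<in> carrier M" for m n
    using multiplicative_bimodule.theta_hom[OF mb] tensor_closed[OF that]
    by (auto simp: mu_def bimodule_hom_def lmod_hom_def)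
  let ?E = "split_extension \<Gamma> M \<theta>"
  have Es: "carrier ?E = carrier \<Gamma> \<times> carrier M" "\<zero>\<^bsub>?E\<^esub> = (\<zero>\<^bsub>\<Gamma>\<^esub>, \<zero>\<^bsub>M\<^esub>)" "\<one>\<^bsub>?E\<^esub> = (\<one>\<^bsub>\<Gamma>\<^esub>, \<zero>\<^bsub>M\<^esub>)"
    "\<And>a b m n. (a, m) \<oplus>\<^bsub>?E\<^esub> (b, n) = (a \<oplus>\<^bsub>\<Gamma>\<^esub> b, m \<oplus>\<^bsub>M\<^esub> n)"
    "\<And>a b m n. (a, m) \<otimes>\<^bsub>?E\<^esub> (b, n) = (a \<otimes>\<^bsub>\<Gamma>\<^esub> b, a \<odot>\<^bsub>M\<^esub> n \<oplus>\<^bsub>M\<^esub> m \<triangleleft>\<^bsub>M\<^esub> b \<oplus>\<^bsub>M\<^esub> mu m n)"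
    "\<And>c a m. c \<odot>\<^bsub>?E\<^esub> (a, m) = (c \<odot>\<^bsub>\<Gamma>\<^esub> a, (c \<odot>\<^bsub>\<Gamma>\<^esub> \<one>\<^bsub>\<Gamma>\<^esub>) \<odot>\<^bsub>M\<^esub> m)"
    by (simp_all add: split_extension_def mu_def)
  obtain f where f: "f \<in> ring_iso \<Lambda> ?E"
    and fl: "\<And>c x. c \<in> carrier K \<Longrightarrow> x \<in> carrier \<Lambda> \<Longrightarrow> f (c \<odot>\<^bsub>\<Lambda>\<^esub> x) = c \<odot>\<^bsub>?E\<^esub> f x"
    using iso unfolding alg_isomorphic_def by blast
  have fh: "f \<in> ring_hom \<Lambda> ?E" using f by (simp add: ring_iso_def)
  \<comment> \<open>The extension is not yet known to be a ring. But f(0) + f(0) = f(0), and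
    cancelling in the groups \<Gamma> and M gives f(0) = 0; the ring structure can then be inherited
    from \<Lambda>.\<close>
  have f0: "f \<zero>\<^bsub>\<Lambda>\<^esub> = \<zero>\<^bsub>?E\<^esub>"
  proof -
    obtain a m where am: "f \<zero>\<^bsub>\<Lambda>\<^esub> = (a, m)" "a \<in> carrier \<Gamma>" "m \<in> carrier M"
      using ring_hom_closed[OF fh L.M.zero_closed] Es(1) by (metis mem_Sigma_iff surj_pair)
    have "f \<zero>\<^bsub>\<Lambda>\<^esub> \<oplus>\<^bsub>?E\<^esub> f \<zero>\<^bsub>\<Lambda>\<^esub> = f \<zero>\<^bsub>\<Lambda>\<^esub>" using ring_hom_add[OF fh L.M.zero_closed L.M.zero_closed] by simp
    then show ?thesis using am by (simp add: Es)
  qed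
  have ringE: "ring ?E"
    using L.A.ring_iso_imp_img_ring[OF f] unfolding f0 by simp
  interpret E: ring ?E by (rule ringE)
  \<comment> \<open>This is read off from the product of zero with itself in the ring just obtained,
    without entering the tensor product.\<close>
  have mu_zero: "mu \<zero>\<^bsub>M\<^esub> \<zero>\<^bsub>M\<^esub> = \<zero>\<^bsub>M\<^esub>"
  proof -
    have "(\<zero>\<^bsub>\<Gamma>\<^esub>, \<zero>\<^bsub>M\<^esub>) \<otimes>\<^bsub>?E\<^esub> (\<zero>\<^bsub>\<Gamma>\<^esub>, \<zero>\<^bsub>M\<^esub>) = (\<zero>\<^bsub>\<Gamma>\<^esub>, \<zero>\<^bsub>M\<^esub>)" using E.l_null[OF E.zero_closed] Es(2) by simp
    then show ?thesis using mu_closed[of "\<zero>\<^bsub>M\<^esub>" "\<zero>\<^bsub>M\<^esub>"] by (simp add: Es(5) l_zero r_zero)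
  qed
  obtain g where g: "g \<in> ring_iso ?E \<Lambda>" "\<And>x. x \<in> carrier \<Lambda> \<Longrightarrow> g (f x) = x"
    "\<And>y. y \<in> carrier ?E \<Longrightarrow> f (g y) = y"
    by (fact ring_iso_inverse[OF L.A.ring_axioms f])
  have gh: "g \<in> ring_hom ?E \<Lambda>" and gs: "g ` carrier ?E = carrier \<Lambda>" using g(1) by (auto simp: ring_iso_def bij_betw_def)
  have g_inj: "inj_on g (carrier ?E)" using g(1) by (auto simp: ring_iso_def bij_betw_def)
  have gl: "g (c \<odot>\<^bsub>?E\<^esub> y) = c \<odot>\<^bsub>\<Lambda>\<^esub> g y" if c: "c \<in> carrier K" "y \<in> carrier ?E" for c y
  proof -
    have gy: "g y \<in> carrier \<Lambda>" using ring_hom_closed[OF gh c(2)] .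
    have "g (c \<odot>\<^bsub>?E\<^esub> y) = g (f (c \<odot>\<^bsub>\<Lambda>\<^esub> g y))" using fl[OF c(1) gy] g(3)[OF c(2)] by simp
    then show ?thesis using g(2)[OF L.smult_closed[OF c(1) gy]] by simp
  qed
  define \<sigma> where "\<sigma> a = g (a, \<zero>\<^bsub>M\<^esub>)" for a
  define I where "I = extension_ideal \<Gamma> M"
  have I: "I = {\<zero>\<^bsub>\<Gamma>\<^esub>} \<times> carrier M" by (simp add: I_def extension_ideal_def)
  have I_ideal: "ideal I ?E"
  proof (rule idealI[OF ringE])
    show "subgroup I (add_monoid ?E)"
    proof (rule group.subgroupI[OF E.a_group])
      show "I \<subseteq> carrier (add_monoid ?E)" by (auto simp: I Es)
      show "I \<noteq> {}" by (auto simp: I)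
    next
      fix x assume "x \<in> I"
      then obtain m where m: "m \<in> carrier M" "x = (\<zero>\<^bsub>\<Gamma>\<^esub>, m)" by (auto simp: I)
      have "(\<zero>\<^bsub>\<Gamma>\<^esub>, \<ominus>\<^bsub>M\<^esub> m) \<oplus>\<^bsub>?E\<^esub> x = \<zero>\<^bsub>?E\<^esub>" using m by (simp add: Es M.M.l_neg)
      then have "\<ominus>\<^bsub>?E\<^esub> x = (\<zero>\<^bsub>\<Gamma>\<^esub>, \<ominus>\<^bsub>M\<^esub> m)" using m by (intro E.minus_equality) (auto simp: Es)
      then show "inv\<^bsub>add_monoid ?E\<^esub> x \<in> I" using m by (simp add: I a_inv_def)
    qed (auto simp: I Es)
  next
    fix a x assume "a \<in> I" "x \<in> carrier ?E"
    then obtain m b n where "m \<in> carrier M" "a = (\<zero>\<^bsub>\<Gamma>\<^esub>, m)" "b \<in> carrier \<Gamma>" "n \<in> carrier M" "x = (b, n)"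
      by (auto simp: I Es)
    then show "x \<otimes>\<^bsub>?E\<^esub> a \<in> I" "a \<otimes>\<^bsub>?E\<^esub> x \<in> I"
      by (auto simp: I Es mu_closed r_closed M.smult_closed)
  qed
  have I_mult: "(\<zero>\<^bsub>\<Gamma>\<^esub>, m) \<otimes>\<^bsub>?E\<^esub> (\<zero>\<^bsub>\<Gamma>\<^esub>, n) = (\<zero>\<^bsub>\<Gamma>\<^esub>, mu m n)" if "m \<in> carrier M" "n \<in> carrier M" for m n
    using that mu_closed by (simp add: Es l_zero r_zero)
  have Ic: "I \<subseteq> carrier ?E" by (auto simp: I Es)
  define N where "N = g ` I"
  have \<sigma>_hom: "\<sigma> \<in> ring_hom \<Gamma> \<Lambda>"
  proof (rule ring_hom_memI)
    show "\<sigma> x \<in> carrier \<Lambda>" if "x \<in> carrier \<Gamma>" for x unfolding \<sigma>_def using that by (intro ring_hom_closed[OF gh]) (simp add: Es)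
  next
    fix x y assume xy: "x \<in> carrier \<Gamma>" "y \<in> carrier \<Gamma>"
    have c: "(x, \<zero>\<^bsub>M\<^esub>) \<in> carrier ?E" "(y, \<zero>\<^bsub>M\<^esub>) \<in> carrier ?E" using xy by (auto simp: Es)
    show "\<sigma> (x \<otimes>\<^bsub>\<Gamma>\<^esub> y) = \<sigma> x \<otimes>\<^bsub>\<Lambda>\<^esub> \<sigma> y"
      unfolding \<sigma>_def ring_hom_mult[OF gh c, symmetric] using xy by (simp add: Es l_zero' r_zero' mu_zero)
    show "\<sigma> (x \<oplus>\<^bsub>\<Gamma>\<^esub> y) = \<sigma> x \<oplus>\<^bsub>\<Lambda>\<^esub> \<sigma> y"
      unfolding \<sigma>_def ring_hom_add[OF gh c, symmetric] using xy by (simp add: Es)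
  next
    show "\<sigma> \<one>\<^bsub>\<Gamma>\<^esub> = \<one>\<^bsub>\<Lambda>\<^esub>" using ring_hom_one[OF gh] by (simp add: \<sigma>_def Es)
  qed
  have "nilpotent_splitting K \<Gamma> \<Lambda> \<sigma> N"
    unfolding nilpotent_splitting_def
  proof (intro conjI ballI impI \<sigma>_hom)
    fix c x assume cx: "c \<in> carrier K" "x \<in> carrier \<Gamma>"
    show "\<sigma> (c \<odot>\<^bsub>\<Gamma>\<^esub> x) = c \<odot>\<^bsub>\<Lambda>\<^esub> \<sigma> x"
      using gl[OF cx(1), of "(x, \<zero>\<^bsub>M\<^esub>)"] cx by (simp add: \<sigma>_def Es l_zero')
  next
    show "ideal N \<Lambda>" unfolding N_def by (rule surj_image_ideal[OF ringE L.A.ring_axioms gh gs I_ideal])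
  next
    obtain r where r: "1 \<le> r" "\<And>m. (\<forall>i\<le>r. m i \<in> carrier M) \<Longrightarrow> theta_power \<Gamma> M \<theta> r m = \<zero>\<^bsub>M\<^esub>"
      using nt unfolding nilpotent_theta_def by blast
    have tp: "L.mprod (map (\<lambda>i. g (\<zero>\<^bsub>\<Gamma>\<^esub>, m i)) [0..<Suc l]) = g (\<zero>\<^bsub>\<Gamma>\<^esub>, theta_power \<Gamma> M \<theta> l m) \<and>
        theta_power \<Gamma> M \<theta> l m \<in> carrier M" if "\<forall>i\<le>l. m i \<in> carrier M" for l m
      using that
    proof (induction l)
      case 0
      then show ?case using ring_hom_closed[OF gh, of "(\<zero>\<^bsub>\<Gamma>\<^esub>, m 0)"] by (simp add: Es)
    next
      case (Suc l)
      let ?x = "\<lambda>i. g (\<zero>\<^bsub>\<Gamma>\<^esub>, m i)"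
      have IH: "L.mprod (map ?x [0..<Suc l]) = g (\<zero>\<^bsub>\<Gamma>\<^esub>, theta_power \<Gamma> M \<theta> l m)" "theta_power \<Gamma> M \<theta> l m \<in> carrier M"
        using Suc by auto
      have xc: "?x i \<in> carrier \<Lambda>" if "i \<le> Suc l" for i
        using Suc.prems that by (intro ring_hom_closed[OF gh]) (simp add: Es)
      have c: "set (map ?x [0..<Suc l]) \<subseteq> carrier \<Lambda>" "?x (Suc l) \<in> carrier \<Lambda>" using xc by auto
      have mS: "m (Suc l) \<in> carrier M" using Suc.prems by auto
      have "L.mprod (map ?x [0..<Suc l] @ [?x (Suc l)]) = L.mprod (map ?x [0..<Suc l]) \<otimes>\<^bsub>\<Lambda>\<^esub> ?x (Suc l)"
        using L.mprod_append[OF c(1), of "[?x (Suc l)]"] c(2) by simp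
      also have "\<dots> = g ((\<zero>\<^bsub>\<Gamma>\<^esub>, theta_power \<Gamma> M \<theta> l m) \<otimes>\<^bsub>?E\<^esub> (\<zero>\<^bsub>\<Gamma>\<^esub>, m (Suc l)))"
        unfolding IH(1) using IH(2) mS by (intro ring_hom_mult[OF gh, symmetric]) (simp_all add: Es)
      also have "\<dots> = g (\<zero>\<^bsub>\<Gamma>\<^esub>, theta_power \<Gamma> M \<theta> (Suc l) m)"
        unfolding I_mult[OF IH(2) mS] by (simp add: mu_def)
      finally have "L.mprod (map ?x [0..<Suc l] @ [?x (Suc l)]) = g (\<zero>\<^bsub>\<Gamma>\<^esub>, theta_power \<Gamma> M \<theta> (Suc l) m)" .
      moreover have "map ?x [0..<Suc (Suc l)] = map ?x [0..<Suc l] @ [?x (Suc l)]" by simp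
      moreover have "theta_power \<Gamma> M \<theta> (Suc l) m \<in> carrier M" using mu_closed[OF IH(2) mS] by (simp add: mu_def)
      ultimately show ?case by metis
    qed
    \<comment> \<open>The exponent is \<open>Suc r\<close>, because \<theta>^r has r + 1
      arguments.\<close>
    have "L.mprod xs = \<zero>\<^bsub>\<Lambda>\<^esub>" if xs: "set xs \<subseteq> N" "length xs = Suc r" for xs
    proof -
      define m where "m i = snd (f (xs ! i))" for i
      have m: "m i \<in> carrier M \<and> xs ! i = g (\<zero>\<^bsub>\<Gamma>\<^esub>, m i)" if i: "i < Suc r" for i
      proof -
        have "xs ! i \<in> N" using xs i by auto
        then obtain n where n: "n \<in> carrier M" "xs ! i = g (\<zero>\<^bsub>\<Gamma>\<^esub>, n)" by (auto simp: N_def I)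
        then show ?thesis using g(3)[of "(\<zero>\<^bsub>\<Gamma>\<^esub>, n)"] by (simp add: m_def Es)
      qed
      have "xs = map (\<lambda>i. g (\<zero>\<^bsub>\<Gamma>\<^esub>, m i)) [0..<Suc r]"
        by (rule nth_equalityI) (use xs(2) m in \<open>auto simp del: upt_Suc\<close>)
      then have "L.mprod xs = g (\<zero>\<^bsub>\<Gamma>\<^esub>, theta_power \<Gamma> M \<theta> r m)" using tp[of r m] m by auto
      also have "\<dots> = g \<zero>\<^bsub>?E\<^esub>" using r(2)[of m] m by (simp add: Es)
      also have "\<dots> = \<zero>\<^bsub>\<Lambda>\<^esub>" by (rule ring_hom_zero[OF gh ringE L.A.ring_axioms])
      finally show ?thesis .
    qed
    then show "nilpotent_set \<Lambda> N" unfolding nilpotent_set_def L.mprod_def by blast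
  next
    fix x assume "x \<in> carrier \<Lambda>"
    then obtain y where y: "y \<in> carrier ?E" "x = g y" using gs by blast
    then obtain a m where am: "a \<in> carrier \<Gamma>" "m \<in> carrier M" "x = g (a, m)"
      by (cases y) (auto simp: Es)
    have "(a, m) = (a, \<zero>\<^bsub>M\<^esub>) \<oplus>\<^bsub>?E\<^esub> (\<zero>\<^bsub>\<Gamma>\<^esub>, m)" using am by (simp add: Es)
    then have "x = \<sigma> a \<oplus>\<^bsub>\<Lambda>\<^esub> g (\<zero>\<^bsub>\<Gamma>\<^esub>, m)"
      using ring_hom_add[OF gh, of "(a, \<zero>\<^bsub>M\<^esub>)" "(\<zero>\<^bsub>\<Gamma>\<^esub>, m)"] am by (simp add: \<sigma>_def Es)
    moreover have "g (\<zero>\<^bsub>\<Gamma>\<^esub>, m) \<in> N" using am by (simp add: N_def I)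
    ultimately show "\<exists>b\<in>carrier \<Gamma>. \<exists>n\<in>N. x = \<sigma> b \<oplus>\<^bsub>\<Lambda>\<^esub> n" using am(1) by blast
  next
    fix a assume a: "a \<in> carrier \<Gamma>" "\<sigma> a \<in> N"
    then obtain m where m: "m \<in> carrier M" "g (a, \<zero>\<^bsub>M\<^esub>) = g (\<zero>\<^bsub>\<Gamma>\<^esub>, m)" by (auto simp: N_def I \<sigma>_def)
    then have "(a, \<zero>\<^bsub>M\<^esub>) = (\<zero>\<^bsub>\<Gamma>\<^esub>, m)" using a by (intro inj_onD[OF g_inj]) (auto simp: Es)
    then show "a = \<zero>\<^bsub>\<Gamma>\<^esub>" by simp
  qed
  moreover have "removable_ideal \<Lambda> N"
  proof -
    have "removable_ideal ?E I"
    proof -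
      have "x \<otimes>\<^bsub>?E\<^esub> y = \<zero>\<^bsub>?E\<^esub>" if "\<forall>t\<in>carrier (tensor_product \<Gamma> M M). \<theta> t = \<zero>\<^bsub>M\<^esub>" "x \<in> I" "y \<in> I" for x y
      proof -
        obtain m n where "m \<in> carrier M" "n \<in> carrier M" "x = (\<zero>\<^bsub>\<Gamma>\<^esub>, m)" "y = (\<zero>\<^bsub>\<Gamma>\<^esub>, n)"
          using \<open>x \<in> I\<close> \<open>y \<in> I\<close> by (auto simp: I)
        then show ?thesis using I_mult tensor_closed that(1) by (simp add: mu_def Es(2))
      qed
      then have sq: "(\<forall>t\<in>carrier (tensor_product \<Gamma> M M). \<theta> t = \<zero>\<^bsub>M\<^esub>) \<longrightarrow>
          (\<forall>x\<in>I. \<forall>y\<in>I. x \<otimes>\<^bsub>?E\<^esub> y = \<zero>\<^bsub>?E\<^esub>)" by blast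
      from rem show ?thesis
        unfolding removable_bimodule_def two_sided_removable_bimodule_def
          only_left_removable_bimodule_def removable_ideal_def I_def[symmetric]
        using sq by (elim conjE disjE) simp_all
    qed
    then show ?thesis unfolding N_def using removable_ideal_iso[OF ringE L.A.ring_axioms g(1) Ic] by blast
  qed
  ultimately show ?thesis by blast
qed

theorem theorem5p9:
  fixes K :: "('k, 'x) ring_scheme"
    and \<Gamma> :: "('k, 'a, 'y) module_scheme"
    and \<Lambda> :: "('k, 'b, 'z) module_scheme"
  assumes "field K"
    and "fin_dim_algebra K \<Gamma>" and "basic \<Gamma>" and "one_dim_simples K \<Gamma>"
    and "fin_dim_algebra K \<Lambda>" and "basic \<Lambda>" and "one_dim_simples K \<Lambda>"
  shows "generalized_arrow_removal K \<Gamma> \<Lambda> \<longleftrightarrow>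
    (\<exists>(M :: ('a, nat \<Rightarrow> 'k) bimodule) \<theta>.
       removable_bimodule K \<Gamma> M \<theta> \<and> alg_isomorphic K \<Lambda> (split_extension \<Gamma> M \<theta>))"
proof -
  have k: "k_algebra K \<Gamma>" "k_algebra K \<Lambda>" using assms by (simp_all add: fin_dim_algebra_def)
  show ?thesis
  proof
    assume "generalized_arrow_removal K \<Gamma> \<Lambda>"
    from generalized_arrow_removal_imp_splitting[OF k this] show "\<exists>(M :: ('a, nat \<Rightarrow> 'k) bimodule) \<theta>.
       removable_bimodule K \<Gamma> M \<theta> \<and> alg_isomorphic K \<Lambda> (split_extension \<Gamma> M \<theta>)"
      using splitting_imp_split_extension[OF k(1) assms(5)] by blast
  next
    assume "\<exists>(M :: ('a, nat \<Rightarrow> 'k) bimodule) \<theta>.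
       removable_bimodule K \<Gamma> M \<theta> \<and> alg_isomorphic K \<Lambda> (split_extension \<Gamma> M \<theta>)"
    then show "generalized_arrow_removal K \<Gamma> \<Lambda>"
      using split_extension_imp_splitting[OF k]
        splitting_imp_generalized_arrow_removal[OF assms(2-5)] by blast
  qed
qed

end
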